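(* For positive integers $m,n$ let $\kappa=m+2n+1$. Then \[ \sum_{\substack{\lambda\\ \lambda_1\le m}}q^{|\lambda|/2}P_\lambda\big(1,q,q^2,\dots;q^{2n}\big) =\frac{(q^{\kappa};q^{\kappa})_\infty^{n-1}(q^{\kappa/2};q^{\kappa/2})_\infty}{(q;q)_\infty^{n-1}(q^{1/2};q^{1/2})_\infty}\prod_{i=1}^n\theta(q^i;q^{\kappa/2})\prod_{1\le i<j\le n}\theta(q^{j-i};q^\kappa)\theta(q^{i+j};q^\kappa). \]
   Context: $(z;q)_\infty=\prod_{k\ge0}(1-zq^k)$ and $\theta(z;q)=(z;q)_\infty(q/z;q)_\infty$. $P_\lambda(x;t)$ denotes the Hall–Littlewood symmetric function: for finitely many variables $P_\lambda(x_1,\dots,x_n;t)=\frac{1}{v_\lambda(t)}\sum_{w\in S_n}w\big(x^\lambda\prod_{i<j}\frac{x_i-tx_j}{x_i-x_j}\big)$, $v_\lambda(t)=\prod_{i\ge0}(t;t)_{m_i(\lambda)}/(1-t)^{m_i(\lambda)}$ ($m_i(\lambda)$ the multiplicity of $i$, $m_0=n-\ell(\lambda)$), extended by stability to symmetric functions; $P_\lambda(1,q,q^2,\dots;t)$ is its evaluation at the infinite alphabet $\{q^k\}_{k\ge0}$, a formal power series in $q$. Identities are identities of formal power series in $q^{1/2}$. *)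

theory Defs
  imports "HOL-Analysis.Analysis" "HOL-Computational_Algebra.Formal_Laurent_Series"
begin

definition qpoch :: "'a::comm_ring_1 \<Rightarrow> 'a \<Rightarrow> nat \<Rightarrow> 'a" where
  "qpoch z q n = (\<Prod>k<n. 1 - z * q ^ k)"

definition qpoch_inf :: "'a::{comm_ring_1, t2_space} \<Rightarrow> 'a \<Rightarrow> 'a" where
  "qpoch_inf z q = (\<Prod>k. 1 - z * q ^ k)"

definition theta :: "'a::{field, t2_space} \<Rightarrow> 'a \<Rightarrow> 'a" where
  "theta z q = qpoch_inf z q * qpoch_inf (q / z) q"

text \<open>A partition is the weakly decreasing list of its positive parts, so that its length is
  \<open>length \<mu>\<close> and its size is \<open>sum_list \<mu>\<close>.\<close>

definition is_partition :: "nat list \<Rightarrow> bool" where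
  "is_partition \<mu> \<longleftrightarrow> sorted_wrt (\<ge>) \<mu> \<and> 0 \<notin> set \<mu>"

text \<open>Parts are indexed from \<open>0\<close>: the usual \<open>\<mu>\<^sub>1\<close> is \<open>part \<mu> 0\<close>.\<close>

definition part :: "nat list \<Rightarrow> nat \<Rightarrow> nat" where
  "part \<mu> i = (if i < length \<mu> then \<mu> ! i else 0)"

text \<open>The multiplicity of \<open>i\<close> in \<open>\<mu>\<close> padded with zeros to \<open>n \<ge> length \<mu>\<close> entries; in particular
  \<open>mult n \<mu> 0 = n - length \<mu>\<close>.\<close>

definition mult :: "nat \<Rightarrow> nat list \<Rightarrow> nat \<Rightarrow> nat" where
  "mult n \<mu> i = card {j. j < n \<and> part \<mu> j = i}"

text \<open>The factors with \<open>i\<close> larger than the first part are \<open>1\<close>, so the product over all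
  \<open>i \<ge> 0\<close> may be cut off there.\<close>

definition hl_v :: "nat \<Rightarrow> nat list \<Rightarrow> 'a::field \<Rightarrow> 'a" where
  "hl_v n \<mu> t = (\<Prod>i\<le>part \<mu> 0. qpoch t t (mult n \<mu> i) / (1 - t) ^ mult n \<mu> i)"

text \<open>The Hall--Littlewood polynomial in the \<open>n\<close> variables \<open>x 0, \<dots>, x (n - 1)\<close>, evaluated in a field.
  The formula is meaningful when these are pairwise distinct, \<open>t \<noteq> 1\<close> and \<open>hl_v n \<mu> t \<noteq> 0\<close>.
  As usual, it is \<open>0\<close> when there are fewer variables than parts.\<close>

definition hall_littlewood :: "nat \<Rightarrow> nat list \<Rightarrow> (nat \<Rightarrow> 'a::field) \<Rightarrow> 'a \<Rightarrow> 'a" where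
  "hall_littlewood n \<mu> x t =
     (if length \<mu> \<le> n then
        1 / hl_v n \<mu> t *
        (\<Sum>w | w permutes {..<n}.
           (\<Prod>i<n. x (w i) ^ part \<mu> i) *
           (\<Prod>(i, j)\<in>{(i, j). i < j \<and> j < n}. (x (w i) - t * x (w j)) / (x (w i) - x (w j))))
      else 0)"

text \<open>By stability (setting the last variable to \<open>0\<close> in \<open>n + 1\<close> variables gives the polynomial in
  \<open>n\<close> variables), the value of the symmetric function at the alphabet \<open>x 0, x 1, x 2, \<dots>\<close> is the
  limit of its values at the truncations \<open>x 0, \<dots>, x (n - 1), 0, 0, \<dots>\<close>. For formal
  Laurent series, which serve as the ambient field because of the denominators above, \<open>lim\<close>
  refers to the \<open>X\<close>-adic metric; so do the infinite products and sums of such series.\<close>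

definition hall_littlewood_inf ::
  "nat list \<Rightarrow> (nat \<Rightarrow> 'a::{field, t2_space}) \<Rightarrow> 'a \<Rightarrow> 'a" where
  "hall_littlewood_inf \<mu> x t = lim (\<lambda>n. hall_littlewood n \<mu> x t)"

end

theory Submission
  imports Defs "Jordan_Normal_Form.Determinant" "HOL-Combinatorics.Multiset_Permutations"
begin

text \<open>
  Absorbing \<open>q\<^bsup>|\<lambda>|/2\<^esup>\<close> into the variables turns the left-hand side into the sum of
  \<open>P\<^sub>\<lambda>(x; t)\<close> over \<open>\<lambda>\<^sub>1 \<le> m\<close> at \<open>x\<^sub>i = s\<^bsup>2 i + 1\<^esup>\<close> and \<open>t = s\<^bsup>4 n\<^esup>\<close>, where \<open>s\<close> is the square root
  of \<open>q\<close>. For finitely many variables this sum equals \<open>\<Sum>\<^sub>J \<Phi>(y\<^sub>J) \<Prod>\<^bsub>j \<in> J\<^esub> x\<^sub>j\<^sup>m\<close> with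
  \<open>\<Phi>(y) = \<Prod>\<^sub>i 1 / (1 - y\<^sub>i) \<Prod>\<^bsub>i < j\<^esub> (1 - t y\<^sub>i y\<^sub>j) / (1 - y\<^sub>i y\<^sub>j)\<close>, where \<open>y\<^sub>J\<close> arises from \<open>x\<close> by inverting
  the variables in \<open>J\<close>: both sides satisfy the same recursion in \<open>m\<close>, obtained by splitting off the
  first column of \<open>\<lambda>\<close> on one side and by partial fractions on the other. At the given \<open>x\<close> and \<open>t\<close>, in
  the limit of infinitely many variables, only sets \<open>J\<close> indexed by \<open>r \<in> \<int>\<^sup>n\<close> survive, and the sum
  becomes a constant times \<open>\<Sum>\<^sub>r s\<^bsup>\<kappa> Q(r)\<^esup> \<Delta>(r)\<close> with a quadratic form \<open>Q\<close> and the type C Weyl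
  denominator \<open>\<Delta>(r)\<close> at the points \<open>s\<^bsup>4 n r\<^sub>i - 2 i - 1\<^esup>\<close>.

  Expanding \<open>\<Delta>(r)\<close> as a determinant identifies the last sum with \<open>det (f\<^sub>i(\<xi>\<^sub>j))\<close> at
  \<open>\<xi>\<^sub>j = s\<^bsup>j + 1\<^esup>\<close>, where \<open>f\<^sub>0, \<dots>, f\<^bsub>n - 1\<^esub>\<close> is a basis of a space of theta functions with
  nome \<open>P = s\<^sup>\<kappa>\<close>. In each variable the product of theta functions on the right-hand side lies in the
  same space and has the same zeros, so the two are proportional, with a factor depending on \<open>P\<close>
  only. The case \<open>m = 0\<close>, in which the left-hand side is \<open>1\<close>, gives this factor for
  \<open>P = s\<^bsup>2 n + 1\<^esup>\<close>; taking \<open>s = X\<^sup>\<kappa>\<close> there, it becomes known for \<open>P = X\<^bsup>\<kappa> (2 n + 1)\<^esup>\<close>, and the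
  injective substitution \<open>X \<mapsto> X\<^bsup>2 n + 1\<^esup>\<close> brings it down to \<open>P = X\<^sup>\<kappa>\<close>.
\<close>

section \<open>Convergence of formal Laurent series\<close>

text \<open>The choice t = q^(2 n) acts twice. A factor 1 - t y_i y_j vanishes as soon as t y_i y_j
  = 1, and this kills almost all sets J. Moreover, for y = s^(2 z + 1), multiplying by t amounts to
  adding 2 n to z, so the products over a residue class of z telescope; the few factors that survive
  build up the Weyl denominator.

  The limit attached to r is never computed outright. It is compared with its neighbour under r_i ->
  r_i + 1, where a single variable changes, and r = 0 has a closed product.

  The last obstacle is that the case m = 0 ties the nome to the points: it gives the factor at P =
  s^(2 n + 1) only for points that are powers of the same s. Because the factor depends on P alone,
  two systems of points over one nome are enough to separate the two roles of s. Therefore s is a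
  parameter and not simply X.

  All limits are X-adic, so convergence is a question about valuations: a family is summable as soon
  as its terms tend to 0, and products of summable families and exchanges of limits need no further
  estimates.\<close>

definition vge :: "int \<Rightarrow> 'a::zero fls \<Rightarrow> bool" where
  "vge k f \<longleftrightarrow> (\<forall>i<k. fls_nth f i = 0)"

text \<open>The subdegree of 0 is 0 by convention although its valuation is infinite, hence the
  separate case; a definition by coefficients avoids it.\<close>

lemma vge_iff_subdegree: "vge k f \<longleftrightarrow> f = 0 \<or> k \<le> fls_subdegree f"
proof (cases "f = 0")
  case False
  then show ?thesis
    unfolding vge_def using nth_fls_subdegree_nonzero[OF False] fls_eq0_below_subdegree[of _ f]
    by (metis linorder_not_le order_less_le_trans)
qed (simp add: vge_def)

lemma vge_0 [simp]: "vge k 0"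
  by (simp add: vge_def)

lemma vge_one: "k \<le> 0 \<Longrightarrow> vge k (1 :: 'a::zero_neq_one fls)"
  by (auto simp: vge_iff_subdegree)

lemma vge_mono: "vge k f \<Longrightarrow> j \<le> k \<Longrightarrow> vge j f"
  by (auto simp: vge_def)

lemma vge_add: "vge k f \<Longrightarrow> vge k g \<Longrightarrow> vge k (f + g :: 'a::monoid_add fls)"
  by (auto simp: vge_def)

lemma vge_diff: "vge k f \<Longrightarrow> vge k g \<Longrightarrow> vge k (f - g :: 'a::group_add fls)"
  by (auto simp: vge_def)

lemma vge_uminus [simp]: "vge k (- f) \<longleftrightarrow> vge k (f :: 'a::group_add fls)"
  by (auto simp: vge_def)

lemma vge_minus_commute: "vge k (f - g) \<longleftrightarrow> vge k (g - f :: 'a::ab_group_add fls)"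
  by (metis minus_diff_eq vge_uminus)

lemma vge_sum: "(\<And>x. x \<in> A \<Longrightarrow> vge k (f x)) \<Longrightarrow> vge k (\<Sum>x\<in>A. f x :: 'a::ab_group_add fls)"
  by (induction A rule: infinite_finite_induct) (auto intro: vge_add)

lemma vge_mult: "vge j f \<Longrightarrow> vge k g \<Longrightarrow> vge (j + k) (f * g :: 'a::field fls)"
  by (cases "f = 0 \<or> g = 0") (auto simp: vge_iff_subdegree)

lemma vge_prod:
  "(\<And>x. x \<in> A \<Longrightarrow> vge (k x) (f x)) \<Longrightarrow> vge (\<Sum>x\<in>A. k x) (\<Prod>x\<in>A. f x :: 'a::field fls)"
  by (induction A rule: infinite_finite_induct) (auto intro: vge_mult vge_one)

lemma vge_prod_0:
  "(\<And>x. x \<in> A \<Longrightarrow> vge 0 (f x)) \<Longrightarrow> vge 0 (\<Prod>x\<in>A. f x :: 'a::field fls)"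
  using vge_prod[of A "\<lambda>_. 0" f] by simp

lemma vge_power: "vge k f \<Longrightarrow> vge (int n * k) (f ^ n :: 'a::field fls)"
  by (induction n) (auto simp: algebra_simps intro: vge_one dest: vge_mult[of k f])

lemma dist_fls_lt_if_vge:
  fixes a b :: "'a::group_add fls"
  assumes "vge (int n) (a - b)"
  shows "dist a b < 2 * inverse (2 ^ n)"
proof (cases "a = b")
  case False
  then have s: "int n \<le> fls_subdegree (a - b)"
    using assms by (auto simp: vge_iff_subdegree)
  then have "dist a b = inverse (2 ^ nat (fls_subdegree (a - b)))"
    using False by (simp add: dist_fls_def)
  also have "\<dots> \<le> inverse (2 ^ n)"
    using s by (intro le_imp_inverse_le power_increasing) (auto simp: nat_le_iff le_nat_iff)
  also have "\<dots> < 2 * inverse (2 ^ n)"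
    by simp
  finally show ?thesis .
qed simp

lemma vge_if_dist_fls_lt:
  fixes a b :: "'a::group_add fls"
  assumes "dist a b < inverse (2 ^ n)"
  shows "vge (int n) (a - b)"
proof (rule ccontr)
  assume *: "\<not> ?thesis"
  then have ne: "a - b \<noteq> 0" and s: "fls_subdegree (a - b) < int n"
    by (auto simp: vge_iff_subdegree)
  have "inverse (2 ^ n :: real) \<le> 1"
    by (simp add: inverse_le_1_iff)
  moreover have "\<not> 2 ^ nat (- fls_subdegree (a - b)) < (1 :: real)"
    by (simp add: not_less)
  moreover have "inverse (2 ^ n) \<le> inverse (2 ^ nat (fls_subdegree (a - b)) :: real)"
    using s by (intro le_imp_inverse_le power_increasing) auto
  ultimately show False
    using assms ne by (cases "fls_subdegree (a - b) \<ge> 0") (simp_all only: dist_fls_def if_True if_False, (auto split: if_splits)[1], smt (verit) right_minus_eq)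
qed

text \<open>Up to a factor 2 in the radius, balls are the sets of series that agree below a given
  exponent. Limits can therefore be computed with valuations instead of the metric.\<close>

lemma tendsto_fls_iff:
  fixes f :: "'b \<Rightarrow> 'a::group_add fls"
  shows "(f \<longlongrightarrow> l) F \<longleftrightarrow> (\<forall>k. eventually (\<lambda>x. vge k (f x - l)) F)"
proof
  assume *: "(f \<longlongrightarrow> l) F"
  show "\<forall>k. eventually (\<lambda>x. vge k (f x - l)) F"
  proof
    fix k :: int
    have "eventually (\<lambda>x. dist (f x) l < inverse (2 ^ nat k)) F"
      using * by (rule tendstoD) simp
    then show "eventually (\<lambda>x. vge k (f x - l)) F"
      by eventually_elim (rule vge_mono[OF vge_if_dist_fls_lt], auto)
  qed
next
  assume *: "\<forall>k. eventually (\<lambda>x. vge k (f x - l)) F"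
  show "(f \<longlongrightarrow> l) F"
  proof (rule tendstoI)
    fix e :: real assume "e > 0"
    then obtain n where n: "inverse (2 ^ n) < e / 2"
      using real_arch_pow_inv[of "e / 2" "1 / 2"] by (auto simp: power_one_over inverse_eq_divide)
    have "eventually (\<lambda>x. vge (int n) (f x - l)) F"
      using * by blast
    then show "eventually (\<lambda>x. dist (f x) l < e) F"
    proof eventually_elim
      case (elim x)
      then have "dist (f x) l < 2 * inverse (2 ^ n)"
        by (rule dist_fls_lt_if_vge)
      then show ?case using n by linarith
    qed
  qed
qed

section \<open>Continuity of the field operations in the X-adic topology\<close>

instance fls :: (group_add) topological_monoid_add
proof
  fix a b :: "'a fls"
  show "((\<lambda>x. fst x + snd x) \<longlongrightarrow> a + b) (nhds a \<times>\<^sub>F nhds b)"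
    unfolding tendsto_fls_iff
  proof
    fix k
    have 1: "eventually (\<lambda>x. vge k (x - a)) (nhds a)" for a :: "'a fls"
      using tendsto_fls_iff[of "\<lambda>x. x" a "nhds a"] by (simp add: filterlim_ident)
    show "\<forall>\<^sub>F x in nhds a \<times>\<^sub>F nhds b. vge k (fst x + snd x - (a + b))"
      using eventually_prodI[OF 1[of a] 1[of b]]
      by eventually_elim (auto simp: vge_def algebra_simps)
  qed
qed

instance fls :: (ab_group_add) topological_comm_monoid_add ..

instance fls :: (ab_group_add) topological_ab_group_add
proof
  fix a :: "'a fls"
  show "(uminus \<longlongrightarrow> - a) (nhds a)"
    unfolding tendsto_fls_iff
  proof
    fix k
    have "eventually (\<lambda>x. vge k (x - a)) (nhds a)"
      using tendsto_fls_iff[of "\<lambda>x. x" a "nhds a"] by (simp add: filterlim_ident)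
    then show "\<forall>\<^sub>F x in nhds a. vge k (- x - - a)"
      by eventually_elim (auto simp: vge_def)
  qed
qed

lemma fls_vge_ex: "\<exists>j. vge j (f :: 'a::zero fls)"
  by (metis order_refl vge_iff_subdegree)

instance fls :: (field) topological_semigroup_mult
proof
  fix a b :: "'a fls"
  show "((\<lambda>x. fst x * snd x) \<longlongrightarrow> a * b) (nhds a \<times>\<^sub>F nhds b)"
    unfolding tendsto_fls_iff
  proof
    fix k
    obtain i j where ij: "vge i a" "vge j b"
      using fls_vge_ex by metis
    have 1: "eventually (\<lambda>x. vge m (x - a)) (nhds a)" for m and a :: "'a fls"
      using tendsto_fls_iff[of "\<lambda>x. x" a "nhds a"] by (simp add: filterlim_ident)
    \<comment> \<open>The bounds \<open>0\<close> and \<open>k\<close> inside the maxima control the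
      product of the two differences; \<open>k - j\<close> and \<open>k - i\<close> compensate the
      valuations of \<open>b\<close> and \<open>a\<close>.\<close>
    have "eventually (\<lambda>x. (vge (max (k - j) 0) (fst x - a)) \<and> (vge (max (k - i) k) (snd x - b)))
        (nhds a \<times>\<^sub>F nhds b)"
      by (intro eventually_prodI 1)
    then show "\<forall>\<^sub>F x in nhds a \<times>\<^sub>F nhds b. vge k (fst x * snd x - a * b)"
    proof eventually_elim
      case (elim x)
      have "fst x * snd x - a * b = (fst x - a) * (snd x - b) + a * (snd x - b) + (fst x - a) * b"
        by (simp add: algebra_simps)
      moreover have "vge k ((fst x - a) * (snd x - b))"
        using vge_mult[of 0 "fst x - a" k "snd x - b"] elim vge_mono by fastforce
      moreover have "vge k (a * (snd x - b))"
        using vge_mult[OF ij(1), of "k - i" "snd x - b"] elim vge_mono by fastforce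
      moreover have "vge k ((fst x - a) * b)"
        using vge_mult[OF _ ij(2), of "k - j" "fst x - a"] elim vge_mono by fastforce
      ultimately show ?case
        by (simp add: vge_add)
    qed
  qed
qed

text \<open>Once the error lies beyond the leading term of \<open>l\<close>, the valuation of
  \<open>f x\<close> equals that of \<open>l\<close>; then 1 / f - 1 / l = (l - f) / (f l) loses
  only twice this valuation.\<close>

lemma tendsto_inverse_fls:
  fixes f :: "'b \<Rightarrow> 'a::field fls"
  assumes "(f \<longlongrightarrow> l) F" "l \<noteq> 0"
  shows "((\<lambda>x. inverse (f x)) \<longlongrightarrow> inverse l) F"
  unfolding tendsto_fls_iff
proof
  fix k
  define d where "d = fls_subdegree l"
  have "eventually (\<lambda>x. vge (max (d + 1) (k + 2 * d)) (f x - l)) F"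
    using assms(1) by (auto simp: tendsto_fls_iff)
  then show "eventually (\<lambda>x. vge k (inverse (f x) - inverse l)) F"
  proof eventually_elim
    case (elim x)
    have "fls_nth (f x - l) d = 0"
      using elim by (auto simp: vge_def)
    then have "fls_nth (f x) d \<noteq> 0"
      using assms(2) by (simp add: d_def)
    moreover have "fls_nth (f x) i = 0" if "i < d" for i
    proof -
      have "fls_nth (f x - l) i = 0"
        using elim that by (auto simp: vge_def)
      then show ?thesis
        using that by (simp add: d_def)
    qed
    ultimately have s: "fls_subdegree (f x) = d" and nz: "f x \<noteq> 0"
      by (auto intro: fls_subdegree_eqI)
    have "inverse (f x) - inverse l = inverse (f x) * inverse l * (l - f x)"
      using nz assms(2) by (simp add: field_simps)
    moreover have "vge (- d + - d + (k + 2 * d)) (inverse (f x) * inverse l * (l - f x))"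
    proof (intro vge_mult)
      show "vge (- d) (inverse (f x))" "vge (- d) (inverse l)"
        using s nz assms(2) by (auto simp: vge_iff_subdegree fls_inverse_subdegree d_def)
      show "vge (k + 2 * d) (l - f x)"
        using elim vge_mono vge_minus_commute by (metis max.cobounded2)
    qed
    ultimately show ?case by simp
  qed
qed

lemma tendsto_divide_fls:
  fixes f g :: "'b \<Rightarrow> 'a::field fls"
  assumes "(f \<longlongrightarrow> l) F" "(g \<longlongrightarrow> m) F" "m \<noteq> 0"
  shows "((\<lambda>x. f x / g x) \<longlongrightarrow> l / m) F"
  unfolding divide_inverse by (intro tendsto_mult tendsto_inverse_fls assms)

lemma vge_tendsto:
  fixes f :: "'b \<Rightarrow> 'a::group_add fls"
  assumes "(f \<longlongrightarrow> l) F" "F \<noteq> bot" "eventually (\<lambda>x. vge k (f x)) F"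
  shows "vge k l"
proof -
  have "eventually (\<lambda>x. vge k (f x - l)) F"
    using assms(1) by (auto simp: tendsto_fls_iff)
  with assms(3) have "eventually (\<lambda>x. vge k l) F"
    by eventually_elim (auto simp: vge_def)
  then show ?thesis using assms(2) by simp
qed

text \<open>Each coefficient of the sum involves only finitely many terms. \<open>B 0\<close>
  collects the finitely many terms with negative exponents, so that the rest is a power
  series.\<close>

lemma has_sum_fls_ex:
  fixes f :: "'b \<Rightarrow> 'a::ab_group_add fls"
  assumes "\<And>k. finite {x\<in>A. \<not> vge k (f x)}"
  shows "\<exists>S. (f has_sum S) A"
proof -
  define B where "B k = {x\<in>A. \<not> vge k (f x)}" for k
  have fin: "finite (B k)" for k
    using assms by (simp add: B_def)
  define S where "S = (\<Sum>x\<in>B 0. f x) + fps_to_fls (Abs_fps (\<lambda>n. \<Sum>x\<in>B (int n + 1) - B 0. fls_nth (f x) (int n)))"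
  have zero: "fls_nth (f x) i = 0" if "x \<in> A" "x \<notin> B k" "i < k" for x i k
    using that by (auto simp: B_def vge_def)
  have sub: "B k \<subseteq> A" for k
    by (auto simp: B_def)
  have "(f has_sum S) A"
    unfolding has_sum_def tendsto_fls_iff
  proof
    fix k :: int
    show "\<forall>\<^sub>F F in finite_subsets_at_top A. vge k (sum f F - S)"
      unfolding eventually_finite_subsets_at_top
    proof (intro exI[of _ "B 0 \<union> B k"] conjI allI impI)
      show "finite (B 0 \<union> B k)" "B 0 \<union> B k \<subseteq> A"
        using fin sub by auto
      fix F assume F: "finite F \<and> B 0 \<union> B k \<subseteq> F \<and> F \<subseteq> A"
      have *: "(\<Sum>x\<in>F. fls_nth (f x) i) = fls_nth S i" if "i < k" for i
      proof -
        have "(\<Sum>x\<in>F. fls_nth (f x) i) = (\<Sum>x\<in>B 0. fls_nth (f x) i) + (\<Sum>x\<in>F - B 0. fls_nth (f x) i)"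
          using F by (metis Un_subset_iff add.commute sum.subset_diff)
        also have "(\<Sum>x\<in>F - B 0. fls_nth (f x) i)
            = (if i < 0 then 0 else \<Sum>x\<in>B (i + 1) - B 0. fls_nth (f x) i)"
        proof (cases "i < 0")
          case True
          then show ?thesis using F zero by (auto intro!: sum.neutral)
        next
          case False
          have "B (i + 1) \<subseteq> B k"
            using that vge_mono[of k _ "i + 1"] by (auto simp: B_def)
          then have "(\<Sum>x\<in>F - B 0. fls_nth (f x) i) = (\<Sum>x\<in>B (i + 1) - B 0. fls_nth (f x) i)"
            using F zero[of _ "i + 1" i] sub by (intro sum.mono_neutral_right) force+
          then show ?thesis using False by simp
        qed
        also have "(\<Sum>x\<in>B 0. fls_nth (f x) i) + \<dots> = fls_nth S i"
          by (simp add: S_def fls_nth_sum)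
        finally show ?thesis .
      qed
      show "vge k (sum f F - S)"
        using * by (auto simp: vge_def fls_nth_sum)
    qed
  qed
  then show ?thesis by blast
qed

text \<open>Converse of the previous criterion: two partial sums close to \<open>S\<close> may
  differ by a single term, which is then small.\<close>

lemma has_sum_fls_finite:
  fixes f :: "'b \<Rightarrow> 'a::ab_group_add fls"
  assumes "(f has_sum S) A"
  shows "finite {x\<in>A. \<not> vge k (f x)}"
proof -
  obtain B where B: "finite B" "B \<subseteq> A" "\<And>F. finite F \<Longrightarrow> B \<subseteq> F \<Longrightarrow> F \<subseteq> A \<Longrightarrow> vge k (sum f F - S)"
    using assms unfolding has_sum_def tendsto_fls_iff eventually_finite_subsets_at_top by metis
  have "vge k (f x)" if "x \<in> A" "x \<notin> B" for x
  proof -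
    have "vge k (sum f (insert x B) - S)" "vge k (sum f B - S)"
      by (rule B(3); use B(1,2) that in blast)+
    then have "vge k ((sum f (insert x B) - S) - (sum f B - S))"
      by (rule vge_diff)
    then show ?thesis
      using that B(1) by simp
  qed
  then have "{x\<in>A. \<not> vge k (f x)} \<subseteq> B" by blast
  then show ?thesis using B(1) finite_subset by blast
qed

lemma has_sum_vge:
  fixes f :: "'b \<Rightarrow> 'a::ab_group_add fls"
  assumes "(f has_sum S) A" "\<And>x. x \<in> A \<Longrightarrow> vge k (f x)"
  shows "vge k S"
  using assms(1) unfolding has_sum_def
proof (rule vge_tendsto)
  show "eventually (\<lambda>F. vge k (sum f F)) (finite_subsets_at_top A)"
    using assms(2) by (intro eventually_finite_subsets_at_top_weakI) (auto intro!: vge_sum)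
qed simp

lemma has_sum_fls_lower:
  fixes f :: "'b \<Rightarrow> 'a::ab_group_add fls"
  assumes "(f has_sum S) A"
  obtains j where "\<And>x. x \<in> A \<Longrightarrow> vge j (f x)"
proof -
  define B where "B = {x\<in>A. \<not> vge 0 (f x)}"
  have fin: "finite B"
    using has_sum_fls_finite[OF assms] by (simp add: B_def)
  have "\<forall>x. \<exists>j. vge j (f x)"
    using fls_vge_ex by blast
  then obtain h where h: "\<And>x. vge (h x) (f x)"
    by metis
  show ?thesis
  proof (rule that[of "Min (insert 0 (h ` B))"])
    fix x assume x: "x \<in> A"
    show "vge (Min (insert 0 (h ` B))) (f x)"
    proof (cases "x \<in> B")
      case True
      then show ?thesis using fin h[of x] by (intro vge_mono[OF h]) auto
    next
      case False
      then have "vge 0 (f x)" using x by (simp add: B_def)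
      then show ?thesis by (rule vge_mono) (use fin in auto)
    qed
  qed
qed

text \<open>Tannery's theorem: a lower bound \<open>v\<close> on the valuations that is uniform in
  \<open>n\<close> and small only finitely often lets the limit pass under the sum. It serves every
  exchange of a limit with an infinite sum below.\<close>

lemma has_sum_dominated:
  fixes a :: "'n \<Rightarrow> 'b \<Rightarrow> 'a::ab_group_add fls" and v :: "'b \<Rightarrow> int"
  assumes lim: "\<And>x. x \<in> A \<Longrightarrow> ((\<lambda>n. a n x) \<longlongrightarrow> b x) F" and F: "F \<noteq> bot"
    and v: "\<And>n x. x \<in> A \<Longrightarrow> vge (v x) (a n x)"
    and fin: "\<And>k. finite {x\<in>A. v x < k}"
    and sum: "\<And>n. (a n has_sum c n) A"
  shows "\<exists>S. (b has_sum S) A \<and> (c \<longlongrightarrow> S) F"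
proof -
  have vb: "vge (v x) (b x)" if "x \<in> A" for x
    using lim[OF that] F by (rule vge_tendsto) (simp add: v[OF that])
  have "\<exists>S. (b has_sum S) A"
  proof (rule has_sum_fls_ex)
    fix k show "finite {x \<in> A. \<not> vge k (b x)}"
      by (rule finite_subset[OF _ fin[of k]]) (auto intro: vge_mono[OF vb] simp: not_less[symmetric])
  qed
  then obtain S where S: "(b has_sum S) A" by blast
  have "(c \<longlongrightarrow> S) F"
    unfolding tendsto_fls_iff
  proof
    fix k :: int
    define B where "B = {x\<in>A. v x < k}"
    have B: "finite B" "B \<subseteq> A" using fin by (auto simp: B_def)
    have "eventually (\<lambda>n. \<forall>x\<in>B. vge k (a n x - b x)) F"
      using lim B by (intro eventually_ball_finite) (auto simp: tendsto_fls_iff)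
    then show "eventually (\<lambda>n. vge k (c n - S)) F"
    proof eventually_elim
      case (elim n)
      have "((a n) has_sum (c n - sum (a n) B)) (A - B)"
        using B by (intro has_sum_Diff sum) auto
      then have 1: "vge k (c n - sum (a n) B)"
        by (rule has_sum_vge) (auto simp: B_def intro: vge_mono[OF v])
      have "(b has_sum (S - sum b B)) (A - B)"
        using B by (intro has_sum_Diff S) auto
      then have 2: "vge k (S - sum b B)"
        by (rule has_sum_vge) (auto simp: B_def intro: vge_mono[OF vb])
      have 3: "vge k (sum (a n) B - sum b B)"
        using elim by (auto simp: sum_subtractf[symmetric] intro!: vge_sum)
      have "vge k ((c n - sum (a n) B) - (S - sum b B) + (sum (a n) B - sum b B))"
        by (intro vge_add vge_diff 1 2 3)
      then show ?case by simp
    qed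
  qed
  with S show ?thesis by blast
qed

text \<open>Existence and value are separated: valuations give summability over pairs, after which
  summing over one coordinate first identifies the sum.\<close>

lemma has_sum_product_fls:
  fixes f :: "'b \<Rightarrow> 'a::field fls" and g :: "'c \<Rightarrow> 'a fls"
  assumes f: "(f has_sum a) A" and g: "(g has_sum b) B"
  shows "((\<lambda>(x, y). f x * g y) has_sum a * b) (A \<times> B)"
proof -
  obtain i where i: "\<And>x. x \<in> A \<Longrightarrow> vge i (f x)"
    using has_sum_fls_lower[OF f] by blast
  obtain j where j: "\<And>x. x \<in> B \<Longrightarrow> vge j (g x)"
    using has_sum_fls_lower[OF g] by blast
  have "\<exists>S. ((\<lambda>(x, y). f x * g y) has_sum S) (A \<times> B)"
  proof (rule has_sum_fls_ex)
    fix k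
    have "\<not> vge (k - j) (f x) \<and> \<not> vge (k - i) (g y)"
      if "x \<in> A" "y \<in> B" "\<not> vge k (f x * g y)" for x y
      using that vge_mult[OF i, of x "k - i" "g y"] vge_mult[OF _ j, of "k - j" "f x" y] by auto
    then have "{z \<in> A \<times> B. \<not> vge k (case z of (x, y) \<Rightarrow> f x * g y)}
        \<subseteq> {x\<in>A. \<not> vge (k - j) (f x)} \<times> {y\<in>B. \<not> vge (k - i) (g y)}"
      by auto
    then show "finite {z \<in> A \<times> B. \<not> vge k (case z of (x, y) \<Rightarrow> f x * g y)}"
      using finite_subset has_sum_fls_finite[OF f] has_sum_fls_finite[OF g] by blast
  qed
  then obtain S where S: "((\<lambda>(x, y). f x * g y) has_sum S) (A \<times> B)" by blast
  have "((\<lambda>x. f x * b) has_sum S) A"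
    using S by (rule has_sum_SigmaD) (auto intro: has_sum_cmult_right g)
  moreover have "((\<lambda>x. f x * b) has_sum a * b) A"
    using f by (rule has_sum_cmult_left)
  ultimately have "S = a * b" by (rule has_sum_unique)
  with S show ?thesis by simp
qed

lemma has_sum_prod_PiE_fls:
  fixes f :: "'i \<Rightarrow> 'b \<Rightarrow> 'a::field fls"
  assumes "finite I" "\<And>i. i \<in> I \<Longrightarrow> (f i has_sum s i) (A i)"
  shows "((\<lambda>r. \<Prod>i\<in>I. f i (r i)) has_sum (\<Prod>i\<in>I. s i)) (PiE I A)"
  using assms
proof (induction I rule: finite_induct)
  case empty
  then show ?case by (simp add: has_sum_finiteI)
next
  case (insert i I)
  have "((\<lambda>(x, r). f i x * (\<Prod>i\<in>I. f i (r i))) has_sum (s i * (\<Prod>i\<in>I. s i))) (A i \<times> PiE I A)"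
    using insert by (intro has_sum_product_fls) auto
  moreover have "(\<lambda>(x, r). f i x * (\<Prod>i\<in>I. f i (r i)))
      = (\<lambda>r. \<Prod>i\<in>insert i I. f i (r i)) \<circ> (\<lambda>(y, g). g(i := y))"
  proof (intro ext, unfold split_paired_all comp_apply prod.case prod.insert[OF insert(1,2)])
    fix x r
    have "(\<Prod>j\<in>I. f j (r j)) = (\<Prod>j\<in>I. f j ((r(i := x)) j))"
      using insert by (intro prod.cong) auto
    then show "f i x * (\<Prod>j\<in>I. f j (r j)) = f i ((r(i := x)) i) * (\<Prod>j\<in>I. f j ((r(i := x)) j))"
      by simp
  qed
  ultimately show ?case
    by (simp only: PiE_insert_eq has_sum_reindex[OF inj_combinator[OF insert(2)]] prod.insert[OF insert(1,2)])
qed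

text \<open>Ultrametric Cauchy criterion: the increments tend to 0, hence are summable, and their
  partial sums telescope.\<close>

lemma fls_convergentI:
  fixes X :: "nat \<Rightarrow> 'a::ab_group_add fls"
  assumes "\<And>k. eventually (\<lambda>n. vge k (X (Suc n) - X n)) sequentially"
  shows "convergent X"
proof -
  have "\<exists>S. ((\<lambda>n. X (Suc n) - X n) has_sum S) UNIV"
  proof (rule has_sum_fls_ex)
    fix k
    obtain N where "\<And>n. n \<ge> N \<Longrightarrow> vge k (X (Suc n) - X n)"
      using assms[of k] by (auto simp: eventually_sequentially)
    then have "{n \<in> UNIV. \<not> vge k (X (Suc n) - X n)} \<subseteq> {..<N}"
      by (auto simp: not_le[symmetric])
    then show "finite {n \<in> UNIV. \<not> vge k (X (Suc n) - X n)}"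
      using finite_subset by blast
  qed
  then obtain S where "(\<lambda>n. X (Suc n) - X n) sums S"
    using has_sum_imp_sums by blast
  then have "(\<lambda>n. (\<Sum>i<n. X (Suc i) - X i) + X 0) \<longlonglongrightarrow> S + X 0"
    unfolding sums_def by (intro tendsto_add tendsto_const)
  then show ?thesis
    unfolding sum_lessThan_telescope convergent_def by auto
qed

section \<open>Infinite q-Pochhammer products\<close>

lemma vge_mult_power:
  fixes z q :: "'a::field fls"
  assumes "vge 1 q" "vge j z"
  shows "vge (j + int n) (z * q ^ n)"
  using vge_mult[OF assms(2) vge_power[OF assms(1), of n]] by simp

text \<open>\<open>raw_has_prod\<close> speaks of a tail with nonzero limit, \<open>has_prod\<close>
  also admits vanishing initial factors. The missing factors are restored one at a time from the
  tail downwards, and the first zero met ends the descent.\<close>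

lemma raw_has_prod_imp_has_prod:
  fixes f :: "nat \<Rightarrow> 'a::field fls"
  assumes "raw_has_prod f M p"
  shows "\<exists>p. f has_prod p"
  using assms
proof (induction M arbitrary: p)
  case 0
  then show ?case by (auto simp: has_prod_def)
next
  case (Suc M)
  show ?case
  proof (cases "f M = 0")
    case True
    then show ?thesis using Suc.prems by (auto simp: has_prod_def)
  next
    case False
    have "(\<lambda>n. f M * (\<Prod>i\<le>n. f (i + Suc M))) \<longlonglongrightarrow> f M * p"
      using Suc.prems by (intro tendsto_mult tendsto_const) (simp add: raw_has_prod_def)
    moreover have "f M * (\<Prod>i\<le>n. f (i + Suc M)) = (\<Prod>i\<le>Suc n. f (i + M))" for n
      by (subst prod.atMost_Suc_shift) simp
    ultimately have "(\<lambda>n. \<Prod>i\<le>Suc n. f (i + M)) \<longlonglongrightarrow> f M * p"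
      by simp
    then have "raw_has_prod f M (f M * p)"
      using False Suc.prems unfolding raw_has_prod_def by (subst (asm) filterlim_sequentially_Suc) auto
    then show ?thesis by (rule Suc.IH)
  qed
qed

lemma has_prod_qpoch:
  fixes z q :: "'a::field fls"
  assumes "vge 1 q"
  shows "(\<lambda>k. 1 - z * q ^ k) has_prod qpoch_inf z q"
proof -
  obtain j where j: "vge j z" using fls_vge_ex by blast
  \<comment> \<open>\<open>z\<close> may have a pole; after the first \<open>M\<close> factors all
    factors are 1 modulo X.\<close>
  define M where "M = nat (1 - j)"
  define P where "P n = (\<Prod>i\<le>n. 1 - z * q ^ (i + M))" for n
  have v: "vge (int i + 1) (z * q ^ (i + M))" for i
    by (rule vge_mono[OF vge_mult_power[OF assms j]]) (simp add: M_def)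
  have P0: "vge 0 (P n)" for n
    unfolding P_def by (intro vge_prod_0 vge_diff vge_one vge_mono[OF v]) auto
  have P1: "vge (int n + 2) (P (Suc n) - P n)" for n
  proof -
    have "P (Suc n) - P n = - (P n * (z * q ^ (Suc n + M)))"
      by (simp add: P_def algebra_simps)
    then show ?thesis
      using vge_mult[OF P0 v[of "Suc n"], of n] by (simp add: add.commute)
  qed
  have "convergent P"
  proof (rule fls_convergentI)
    fix k
    show "eventually (\<lambda>n. vge k (P (Suc n) - P n)) sequentially"
      using eventually_ge_at_top[of "nat k"] by eventually_elim (rule vge_mono[OF P1], simp)
  qed
  then obtain L where L: "P \<longlonglongrightarrow> L" by (auto simp: convergent_def)
  \<comment> \<open>The limit is 1 modulo X and therefore nonzero, as \<open>raw_has_prod\<close>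
    demands.\<close>
  have P2: "vge 1 (P n - 1)" for n
  proof (induction n)
    case 0
    then show ?case using v[of 0] by (simp add: P_def)
  next
    case (Suc n)
    have "vge 1 (P (Suc n) - P n + (P n - 1))"
      by (intro vge_add Suc vge_mono[OF P1]) simp
    then show ?case by simp
  qed
  have "(\<lambda>n. P n - 1) \<longlonglongrightarrow> L - 1" by (intro tendsto_intros L)
  then have "vge 1 (L - 1)" by (rule vge_tendsto) (use P2 in auto)
  then have "fls_nth (L - 1) 0 = 0" by (simp add: vge_def)
  then have "L \<noteq> 0" by auto
  then have "raw_has_prod (\<lambda>k. 1 - z * q ^ k) M L"
    using L by (simp add: raw_has_prod_def P_def[abs_def])
  then obtain p where "(\<lambda>k. 1 - z * q ^ k) has_prod p"
    using raw_has_prod_imp_has_prod by blast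
  then show ?thesis
    using has_prod_unique by (fastforce simp: qpoch_inf_def)
qed

lemma qpoch_tendsto:
  fixes z q :: "'a::field fls"
  assumes "vge 1 q"
  shows "(\<lambda>N. qpoch z q N) \<longlonglongrightarrow> qpoch_inf z q"
  unfolding qpoch_def
  by (rule has_prod_imp_tendsto'[OF has_prod_qpoch[OF assms]])

lemma qpoch_inf_eq_0_iff:
  fixes z q :: "'a::field fls"
  assumes "vge 1 q"
  shows "qpoch_inf z q = 0 \<longleftrightarrow> (\<exists>k. z * q ^ k = 1)"
proof -
  have "qpoch_inf z q = 0 \<longleftrightarrow> 0 \<in> range (\<lambda>k. 1 - z * q ^ k)"
    by (rule has_prod_eq_0_iff[OF has_prod_qpoch[OF assms]])
  then show ?thesis by (auto simp: image_iff)
qed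

lemma qpoch_inf_nonzero:
  fixes z q :: "'a::field fls"
  assumes "vge 1 q" "vge 1 z"
  shows "qpoch_inf z q \<noteq> 0"
proof -
  have "vge 1 (z * q ^ k)" for k
    by (rule vge_mono[OF vge_mult_power[OF assms]]) simp
  then have "z * q ^ k \<noteq> 1" for k
    by (metis fls_one_nth int_one_le_iff_zero_less less_numeral_extra(1) vge_def zero_neq_one)
  then show ?thesis
    using qpoch_inf_eq_0_iff[OF assms(1)] by blast
qed

section \<open>Partial fractions and bounded sums\<close>

lemma sum_Pow_insert:
  assumes "finite X" "a \<notin> X"
  shows "(\<Sum>J\<in>Pow (insert a X). f J) = (\<Sum>J\<in>Pow X. f J + f (insert a J) :: 'b::comm_monoid_add)"
proof -
  have "(\<Sum>J\<in>Pow (insert a X). f J) = (\<Sum>J\<in>Pow X. f J) + (\<Sum>J\<in>insert a ` Pow X. f J)"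
    unfolding Pow_insert using assms by (intro sum.union_disjoint) auto
  also have "(\<Sum>J\<in>insert a ` Pow X. f J) = (\<Sum>J\<in>Pow X. f (insert a J))"
    using assms by (subst sum.reindex) (auto intro!: inj_onI dest: insert_ident[THEN iffD1, rotated 2])
  finally show ?thesis by (simp add: sum.distrib)
qed

lemma poly_eq_0_if_card_roots:
  fixes p :: "'a::idom poly"
  assumes "finite S" "degree p < card S" "\<And>x. x \<in> S \<Longrightarrow> poly p x = 0"
  shows "p = 0"
proof (rule ccontr)
  assume "p \<noteq> 0"
  then have "card S \<le> card {x. poly p x = 0}"
    using assms(3) by (intro card_mono poly_roots_finite) auto
  also have "\<dots> \<le> degree p"
    using \<open>p \<noteq> 0\<close> by (rule card_poly_roots_bound)
  finally show False using assms(2) by simp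
qed

lemma degree_prod_linear_le: "degree (\<Prod>k\<in>Y. [:1, f k:] :: 'a::comm_ring_1 poly) \<le> card Y"
proof (induction Y rule: infinite_finite_induct)
  case (insert x F)
  have "degree ([:1, f x:] * (\<Prod>k\<in>F. [:1, f k:])) \<le> 1 + card F"
    by (rule order.trans[OF degree_mult_le add_mono]) (use insert in auto)
  then show ?case using insert by simp
qed auto

text \<open>Lagrange interpolation: over the common denominator, the numerator of the right-hand
  side has degree below \<open>card Y\<close> and agrees with \<open>p\<close> at the
  \<open>card Y\<close> poles \<open>1 / v j\<close>.\<close>

lemma partial_fraction:
  fixes v :: "'i \<Rightarrow> 'a::field"
  assumes Y: "finite Y" "inj_on v Y" "\<And>j. j \<in> Y \<Longrightarrow> v j \<noteq> 0" and p: "degree p < card Y"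
    and z: "\<And>j. j \<in> Y \<Longrightarrow> z * v j \<noteq> 1"
  shows "poly p z / (\<Prod>j\<in>Y. 1 - z * v j)
    = (\<Sum>j\<in>Y. poly p (1 / v j) / (\<Prod>k\<in>Y - {j}. 1 - v k / v j) / (1 - z * v j))"
proof -
  define c where "c j = poly p (1 / v j) / (\<Prod>k\<in>Y - {j}. 1 - v k / v j)" for j
  define r where "r = (\<Sum>j\<in>Y. Polynomial.smult (c j) (\<Prod>k\<in>Y - {j}. [:1, - v k:]))"
  have deg: "degree r \<le> card Y - 1"
    unfolding r_def using Y(1)
    by (intro degree_sum_le order.trans[OF degree_smult_le] order.trans[OF degree_prod_linear_le]) auto
  have eval: "poly r y = (\<Sum>j\<in>Y. c j * (\<Prod>k\<in>Y - {j}. 1 - y * v k))" for y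
    by (simp add: r_def poly_sum poly_prod)
  have "p - r = 0"
  proof (rule poly_eq_0_if_card_roots)
    show "finite ((\<lambda>j. 1 / v j) ` Y)" using Y by simp
    have "card ((\<lambda>j. 1 / v j) ` Y) = card Y"
      using Y by (intro card_image) (auto simp: inj_on_def field_simps)
    then show "degree (p - r) < card ((\<lambda>j. 1 / v j) ` Y)"
      using deg p by (intro le_less_trans[OF degree_diff_le_max]) auto
    fix y assume "y \<in> (\<lambda>j. 1 / v j) ` Y"
    then obtain i where i: "i \<in> Y" "y = 1 / v i" by auto
    have "poly r y = c i * (\<Prod>k\<in>Y - {i}. 1 - y * v k)
        + (\<Sum>j\<in>Y - {i}. c j * (\<Prod>k\<in>Y - {j}. 1 - y * v k))"
      unfolding eval using i Y(1) by (simp add: sum.remove)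
    also have "(\<Sum>j\<in>Y - {i}. c j * (\<Prod>k\<in>Y - {j}. 1 - y * v k)) = 0"
      using i Y by (intro sum.neutral) (auto intro!: disjI2 bexI[of _ i])
    also have "c i * (\<Prod>k\<in>Y - {i}. 1 - y * v k) = poly p y"
    proof -
      have "v k / v i \<noteq> 1" if "k \<in> Y - {i}" for k
        using that i Y by (auto simp: inj_on_def)
      then have "(\<Prod>k\<in>Y - {i}. 1 - v k / v i) \<noteq> 0"
        using Y(1) by auto
      then show ?thesis by (simp add: c_def i)
    qed
    finally show "poly (p - r) y = 0" by simp
  qed
  then have "p = r" by simp
  then have "poly p z = (\<Sum>j\<in>Y. c j * (\<Prod>k\<in>Y - {j}. 1 - z * v k))"
    using eval by simp
  then have "poly p z / (\<Prod>j\<in>Y. 1 - z * v j)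
      = (\<Sum>j\<in>Y. c j * (\<Prod>k\<in>Y - {j}. 1 - z * v k) / (\<Prod>j\<in>Y. 1 - z * v j))"
    by (simp add: sum_divide_distrib)
  also have "\<dots> = (\<Sum>j\<in>Y. c j / (1 - z * v j))"
  proof (rule sum.cong[OF refl])
    fix j assume j: "j \<in> Y"
    have "(\<Prod>k\<in>Y - {j}. 1 - z * v k) \<noteq> 0"
      using Y(1) z by force
    then show "c j * (\<Prod>k\<in>Y - {j}. 1 - z * v k) / (\<Prod>j\<in>Y. 1 - z * v j) = c j / (1 - z * v j)"
      using j Y(1) by (simp add: prod.remove[of Y j])
  qed
  finally show ?thesis by (simp add: c_def)
qed

text \<open>At u = x_j / x_i this is the factor (x_i - t x_j) / (x_i - x_j) of the Hall-Littlewood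
  polynomials, at u = y_i y_j the pair factor of \<open>hlPhi\<close>.\<close>

definition hlB :: "'a::field \<Rightarrow> 'a \<Rightarrow> 'a" where
  "hlB t u = (1 - t * u) / (1 - u)"

definition hlA :: "'a::field \<Rightarrow> (nat \<Rightarrow> 'a) \<Rightarrow> nat set \<Rightarrow> nat set \<Rightarrow> 'a" where
  "hlA t x I K = (\<Prod>i\<in>I. \<Prod>k\<in>K. hlB t (x k / x i))"

text \<open>The product side of Littlewood's identity for the sum of P_\<lambda>(y; t) over all
  partitions, without a bound on the first part.\<close>

definition hlPhi :: "'a::field \<Rightarrow> nat set \<Rightarrow> (nat \<Rightarrow> 'a) \<Rightarrow> 'a" where
  "hlPhi t X y = (\<Prod>i\<in>X. 1 / (1 - y i)) * (\<Prod>(i, j)\<in>{(i, j). i \<in> X \<and> j \<in> X \<and> i < j}. hlB t (y i * y j))"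

definition flip :: "(nat \<Rightarrow> 'a::field) \<Rightarrow> nat set \<Rightarrow> nat \<Rightarrow> 'a" where
  "flip x J i = (if i \<in> J then 1 / x i else x i)"

text \<open>Invariant under inverting variables, so the denominators of \<open>hlB\<close> and
  \<open>hlPhi\<close> stay nonzero at every flipped point.\<close>

definition generic :: "(nat \<Rightarrow> 'a::field) \<Rightarrow> nat set \<Rightarrow> bool" where
  "generic x X \<longleftrightarrow> (\<forall>i\<in>X. x i \<noteq> 0 \<and> x i \<noteq> 1) \<and> (\<forall>i\<in>X. \<forall>j\<in>X. i \<noteq> j \<longrightarrow> x i \<noteq> x j \<and> x i * x j \<noteq> 1)"

lemma generic_subset: "generic x X \<Longrightarrow> Y \<subseteq> X \<Longrightarrow> generic x Y"
  by (auto simp: generic_def)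

lemma generic_flip: "generic x X \<Longrightarrow> generic (flip x J) X"
  by (auto simp: generic_def flip_def field_simps)

lemma hlPhi_empty [simp]: "hlPhi t {} y = 1"
  by (simp add: hlPhi_def)

lemma hlPhi_cong: "(\<And>i. i \<in> X \<Longrightarrow> y i = y' i) \<Longrightarrow> hlPhi t X y = hlPhi t X y'"
  unfolding hlPhi_def by (intro arg_cong2[where f = "(*)"] prod.cong) auto

lemma hlPhi_insert:
  assumes "finite X" "a \<notin> X"
  shows "hlPhi t (insert a X) y = hlPhi t X y * (1 / (1 - y a) * (\<Prod>j\<in>X. hlB t (y a * y j)))"
proof -
  let ?P = "\<lambda>X. {(i, j). i \<in> X \<and> j \<in> X \<and> i < j}"
  let ?f = "\<lambda>(i, j). hlB t (y i * y j)"
  have "?P (insert a X) = ?P X \<union> (\<lambda>j. if a < j then (a, j) else (j, a)) ` X"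
    using assms by (auto simp: image_iff not_less le_less split: if_splits)
  then have "prod ?f (?P (insert a X)) = prod ?f (?P X) * prod ?f ((\<lambda>j. if a < j then (a, j) else (j, a)) ` X)"
    using assms finite_subset[of "?P X" "X \<times> X"]
    by (simp only:, intro prod.union_disjoint) (auto split: if_splits)
  also have "prod ?f ((\<lambda>j. if a < j then (a, j) else (j, a)) ` X) = (\<Prod>j\<in>X. hlB t (y a * y j))"
    using assms by (subst prod.reindex) (auto simp: inj_on_def mult.commute intro!: prod.cong split: if_splits)
  finally show ?thesis
    using assms by (simp add: hlPhi_def)
qed

lemma hlPhi_remove:
  assumes "finite X" "a \<in> X"
  shows "hlPhi t X y = hlPhi t (X - {a}) y * (1 / (1 - y a) * (\<Prod>j\<in>X - {a}. hlB t (y a * y j)))"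
  using hlPhi_insert[of "X - {a}" a t y] assms by (simp add: insert_absorb)

lemma hlPhi_Un:
  assumes "finite J" "finite Y" "J \<inter> Y = {}"
  shows "hlPhi t (J \<union> Y) y = hlPhi t J y * hlPhi t Y y * (\<Prod>i\<in>J. \<Prod>j\<in>Y. hlB t (y i * y j))"
  using assms(1,3)
proof (induction J rule: finite_induct)
  case (insert a J)
  have "hlPhi t (insert a (J \<union> Y)) y
      = hlPhi t (J \<union> Y) y * (1 / (1 - y a) * ((\<Prod>j\<in>J. hlB t (y a * y j)) * (\<Prod>j\<in>Y. hlB t (y a * y j))))"
    using insert assms(2) by (subst hlPhi_insert) (auto simp: prod.union_disjoint)
  then show ?case
    using insert by (simp add: hlPhi_insert)
qed simp

text \<open>The left-hand side is what a new variable \<open>z\<close> contributes to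
  \<open>hlPhi\<close>, by \<open>hlPhi_insert\<close>. As a function of \<open>z\<close> its
  numerator has degree at most \<open>card X\<close> and its denominator has
  \<open>card X + 1\<close> linear factors, so there is no polynomial part. \<open>None\<close>
  encodes the pole z = 1 and \<open>Some j\<close> the pole z = 1 / y_j.\<close>

lemma Phi_partial_fraction:
  fixes y :: "nat \<Rightarrow> 'a::field"
  assumes X: "finite X" "generic y X" and z: "z \<noteq> 1" "\<And>j. j \<in> X \<Longrightarrow> z * y j \<noteq> 1"
  shows "1 / (1 - z) * (\<Prod>j\<in>X. hlB t (z * y j))
    = (\<Prod>j\<in>X. hlB t (y j)) / (1 - z)
      + (\<Sum>j\<in>X. (1 - t) / (1 - 1 / y j) * (\<Prod>k\<in>X - {j}. hlB t (y k / y j)) / (1 - z * y j))"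
proof -
  define v where "v k = (case k of None \<Rightarrow> 1 | Some j \<Rightarrow> y j)" for k
  define Y where "Y = insert None (Some ` X)"
  define p where "p = (\<Prod>j\<in>X. [:1, - (t * y j):])"
  have fin: "finite Y" using X by (simp add: Y_def)
  have "inj_on v Y"
    using X(2) by (auto simp: inj_on_def v_def Y_def generic_def)
  moreover have "v k \<noteq> 0" "z * v k \<noteq> 1" if "k \<in> Y" for k
    using that X z by (auto simp: v_def Y_def generic_def)
  moreover have "degree p < card Y"
  proof -
    have "degree p \<le> card X" unfolding p_def by (rule degree_prod_linear_le)
    moreover have "card Y = Suc (card X)"
      using X by (simp add: Y_def card_image)
    ultimately show ?thesis by simp
  qed
  ultimately have pf: "poly p z / (\<Prod>j\<in>Y. 1 - z * v j)
    = (\<Sum>j\<in>Y. poly p (1 / v j) / (\<Prod>k\<in>Y - {j}. 1 - v k / v j) / (1 - z * v j))"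
    using fin by (intro partial_fraction) auto
  have pp: "poly p u = (\<Prod>j\<in>X. 1 - t * (u * y j))" for u
    by (simp add: p_def poly_prod mult_ac)
  have "(\<Prod>j\<in>Y. 1 - z * v j) = (1 - z) * (\<Prod>j\<in>X. 1 - z * y j)"
    using X by (simp add: Y_def v_def prod.reindex)
  then have L: "poly p z / (\<Prod>j\<in>Y. 1 - z * v j) = 1 / (1 - z) * (\<Prod>j\<in>X. hlB t (z * y j))"
    by (simp add: pp hlB_def prod_dividef)
  have Y1: "Y - {None} = Some ` X" by (auto simp: Y_def)
  have "(\<Sum>j\<in>Y. poly p (1 / v j) / (\<Prod>k\<in>Y - {j}. 1 - v k / v j) / (1 - z * v j))
    = poly p 1 / (\<Prod>k\<in>X. 1 - y k) / (1 - z)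
     + (\<Sum>j\<in>X. poly p (1 / y j) / (\<Prod>k\<in>Y - {Some j}. 1 - v k / y j) / (1 - z * y j))"
    using X by (subst sum.remove[of _ None])
      (auto simp: fin Y1 v_def sum.reindex prod.reindex, auto simp: Y_def)
  also have "poly p 1 / (\<Prod>k\<in>X. 1 - y k) = (\<Prod>j\<in>X. hlB t (y j))"
    by (simp add: pp hlB_def prod_dividef)
  also have "(\<Sum>j\<in>X. poly p (1 / y j) / (\<Prod>k\<in>Y - {Some j}. 1 - v k / y j) / (1 - z * y j))
    = (\<Sum>j\<in>X. (1 - t) / (1 - 1 / y j) * (\<Prod>k\<in>X - {j}. hlB t (y k / y j)) / (1 - z * y j))"
  proof (rule sum.cong[OF refl])
    fix j assume j: "j \<in> X"
    then have yj: "y j \<noteq> 0" using X by (auto simp: generic_def)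
    have "Y - {Some j} = insert None (Some ` (X - {j}))"
      by (auto simp: Y_def)
    then have "(\<Prod>k\<in>Y - {Some j}. 1 - v k / y j) = (1 - 1 / y j) * (\<Prod>k\<in>X - {j}. 1 - y k / y j)"
      using X by (simp add: v_def prod.reindex)
    moreover have "poly p (1 / y j) = (1 - t) * (\<Prod>k\<in>X - {j}. 1 - t * (y k / y j))"
      using j yj X by (simp add: pp prod.remove[of X j])
    ultimately show "poly p (1 / y j) / (\<Prod>k\<in>Y - {Some j}. 1 - v k / y j) / (1 - z * y j)
      = (1 - t) / (1 - 1 / y j) * (\<Prod>k\<in>X - {j}. hlB t (y k / y j)) / (1 - z * y j)"
      by (simp add: hlB_def prod_dividef)
  qed
  finally show ?thesis using pf L by simp
qed

text \<open>The weight stays general because the weights 1 and 1 / x_i are needed besides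
  x_i^m.\<close>

definition PhiSum :: "'a::field \<Rightarrow> (nat \<Rightarrow> 'a) \<Rightarrow> (nat \<Rightarrow> 'a) \<Rightarrow> nat set \<Rightarrow> 'a" where
  "PhiSum t x \<omega> X = (\<Sum>J\<in>Pow X. hlPhi t X (flip x J) * (\<Prod>i\<in>J. \<omega> i))"

text \<open>The flip \<open>y\<^sub>j \<mapsto> 1 / y\<^sub>j\<close> reverses the sign of the partial-fraction terms.\<close>

lemma Phi_flip_cancel:
  fixes x :: "nat \<Rightarrow> 'a::field"
  assumes X: "finite X" "generic x X" and j: "j \<in> X"
    and u: "\<omega> j * u (1 / x j) = - u (x j)"
  shows "(\<Sum>J\<in>Pow X. hlPhi t X (flip x J) * (\<Prod>i\<in>J. \<omega> i)
     * ((1 - t) / (1 - 1 / flip x J j) * (\<Prod>k\<in>X - {j}. hlB t (flip x J k / flip x J j)) * u (flip x J j))) = 0"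
    (is "(\<Sum>J\<in>Pow X. ?F J) = 0")
proof -
  have Xj: "X = insert j (X - {j})" using j by auto
  have "(\<Sum>J\<in>Pow X. ?F J) = (\<Sum>J\<in>Pow (insert j (X - {j})). ?F J)"
    using Xj by simp
  also have "\<dots> = (\<Sum>J\<in>Pow (X - {j}). ?F J + ?F (insert j J))"
    using X(1) by (subst sum_Pow_insert) auto
  also have "\<dots> = 0"
  proof (intro sum.neutral ballI)
    fix J assume J: "J \<in> Pow (X - {j})"
    define y where "y = flip x J"
    have jJ: "j \<notin> J" and fJ: "finite J" using J X(1) finite_subset by auto
    have xj: "x j \<noteq> 0" "x j \<noteq> 1" using X(2) j by (auto simp: generic_def)
    have y1: "flip x J j = x j" "flip x (insert j J) j = 1 / x j" using jJ by (auto simp: flip_def)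
    have y2: "flip x (insert j J) k = flip x J k" if "k \<in> X - {j}" for k
      using that by (auto simp: flip_def)
    have P1: "hlPhi t X (flip x J) = hlPhi t (X - {j}) y * (1 / (1 - x j) * (\<Prod>k\<in>X - {j}. hlB t (x j * y k)))"
      using hlPhi_remove[OF X(1) j, of t "flip x J"] by (simp add: y1 y_def)
    have "hlPhi t (X - {j}) (flip x (insert j J)) = hlPhi t (X - {j}) y"
      using y2 by (intro hlPhi_cong) (auto simp: y_def)
    then have P2: "hlPhi t X (flip x (insert j J)) = hlPhi t (X - {j}) y * (1 / (1 - 1 / x j) * (\<Prod>k\<in>X - {j}. hlB t (y k / x j)))"
      using hlPhi_remove[OF X(1) j, of t "flip x (insert j J)"] y2 by (simp add: y1 y_def)
    have P3: "(\<Prod>k\<in>X - {j}. hlB t (flip x (insert j J) k / flip x (insert j J) j)) = (\<Prod>k\<in>X - {j}. hlB t (x j * y k))"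
      using y2 by (intro prod.cong) (auto simp: y1 y_def mult.commute)
    have P4: "(\<Prod>k\<in>X - {j}. hlB t (flip x J k / flip x J j)) = (\<Prod>k\<in>X - {j}. hlB t (y k / x j))"
      by (simp add: y1 y_def)
    define c where "c = hlPhi t (X - {j}) y * (1 / (1 - x j)) * (1 / (1 - 1 / x j)) * (1 - t)
      * (\<Prod>k\<in>X - {j}. hlB t (x j * y k)) * (\<Prod>k\<in>X - {j}. hlB t (y k / x j)) * (\<Prod>i\<in>J. \<omega> i)"
    have F1: "?F J = c * u (x j)"
      unfolding P1 P4 by (simp add: y1 c_def mult_ac)
    have "?F (insert j J) = c * (\<omega> j * u (1 / x j))"
      unfolding P2 P3 using fJ jJ by (simp add: y1 c_def mult_ac)
    with F1 show "?F J + ?F (insert j J) = 0" by (simp add: u)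
  qed
  finally show ?thesis .
qed

lemma PhiSum_insert:
  assumes "finite X" "a \<notin> X"
  shows "PhiSum t x \<omega> (insert a X) = (\<Sum>J\<in>Pow X. hlPhi t X (flip x J) * (\<Prod>i\<in>J. \<omega> i) *
     (1 / (1 - x a) * (\<Prod>j\<in>X. hlB t (x a * flip x J j))
      + \<omega> a * (1 / (1 - 1 / x a) * (\<Prod>j\<in>X. hlB t (1 / x a * flip x J j)))))"
  unfolding PhiSum_def sum_Pow_insert[OF assms]
proof (rule sum.cong[OF refl])
  fix J assume J: "J \<in> Pow X"
  then have aJ: "a \<notin> J" and fJ: "finite J" using assms finite_subset by auto
  have y: "flip x (insert a J) k = flip x J k" if "k \<in> X" for k
    using that assms by (auto simp: flip_def)
  have [simp]: "flip x J a = x a" "flip x (insert a J) a = 1 / x a" using aJ by (auto simp: flip_def)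
  have "hlPhi t X (flip x (insert a J)) = hlPhi t X (flip x J)"
    by (intro hlPhi_cong y)
  moreover have "(\<Prod>j\<in>X. hlB t (1 / x a * flip x (insert a J) j)) = (\<Prod>j\<in>X. hlB t (1 / x a * flip x J j))"
    using y by (intro prod.cong) auto
  ultimately show "hlPhi t (insert a X) (flip x J) * prod \<omega> J + hlPhi t (insert a X) (flip x (insert a J)) * prod \<omega> (insert a J)
    = hlPhi t X (flip x J) * prod \<omega> J * (1 / (1 - x a) * (\<Prod>j\<in>X. hlB t (x a * flip x J j))
      + \<omega> a * (1 / (1 - 1 / x a) * (\<Prod>j\<in>X. hlB t (1 / x a * flip x J j))))"
    unfolding hlPhi_insert[OF assms] using aJ fJ by (simp add: algebra_simps)
qed

text \<open>Induction on the variables. The contributions of x_a = z and of its flip 1 / z are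
  decomposed together: the two terms with pole z = 1 add up to a constant in z, and the others
  combine to values of \<open>u\<close> at the y_j. Since u(1 / w) = - u(w),
  \<open>Phi_flip_cancel\<close> removes them and leaves the sum for \<open>X\<close>.\<close>

lemma PhiSum_one:
  assumes "finite X" "generic x X"
  shows "PhiSum t x (\<lambda>_. 1) X = 1"
  using assms
proof (induction X rule: finite_induct)
  case empty
  then show ?case by (simp add: PhiSum_def)
next
  case (insert a X)
  define z where "z = x a"
  define \<alpha> where "\<alpha> y j = (1 - t) / (1 - 1 / y j) * (\<Prod>k\<in>X - {j}. hlB t (y k / y j))" for y :: "nat \<Rightarrow> 'a" and j
  define u where "u w = 1 / (1 - z * w) + 1 / (1 - 1 / z * w) - 1" for w
  have g: "generic x X" using insert.prems by (rule generic_subset) auto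
  have z: "z \<noteq> 0" "z \<noteq> 1" using insert.prems by (auto simp: generic_def z_def)
  have zx: "z * x j \<noteq> 1" "z \<noteq> x j" if "j \<in> X" for j
    using insert.prems insert.hyps that by (auto simp: generic_def z_def)
  have "1 / (1 - z) * (\<Prod>j\<in>X. hlB t (z * flip x J j)) + 1 * (1 / (1 - 1 / z) * (\<Prod>j\<in>X. hlB t (1 / z * flip x J j)))
     = 1 + (\<Sum>j\<in>X. \<alpha> (flip x J) j * u (flip x J j))" for J
  proof -
    define y where "y = flip x J"
    have gy: "generic y X" unfolding y_def by (rule generic_flip[OF g])
    have zy: "z * y j \<noteq> 1" "1 / z * y j \<noteq> 1" if "j \<in> X" for j
      using zx[OF that] z g that by (auto simp: y_def flip_def generic_def field_simps)
    let ?c = "\<Prod>j\<in>X. hlB t (y j)"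
    have 1: "1 / (1 - z) * (\<Prod>j\<in>X. hlB t (z * y j)) = ?c / (1 - z) + (\<Sum>j\<in>X. \<alpha> y j / (1 - z * y j))"
      unfolding \<alpha>_def using insert.hyps gy z zy by (intro Phi_partial_fraction) auto
    have 2: "1 / (1 - 1 / z) * (\<Prod>j\<in>X. hlB t (1 / z * y j)) = ?c / (1 - 1 / z) + (\<Sum>j\<in>X. \<alpha> y j / (1 - 1 / z * y j))"
      unfolding \<alpha>_def using insert.hyps gy z zy by (intro Phi_partial_fraction) auto
    \<comment> \<open>The same decomposition at z = 0 expresses \<open>?c\<close> through the
      residues; this accounts for the - 1 in \<open>u\<close>.\<close>
    have 3: "1 = ?c + (\<Sum>j\<in>X. \<alpha> y j)"
      using Phi_partial_fraction[OF insert.hyps(1) gy, of 0 t] by (simp add: \<alpha>_def hlB_def)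
    have "1 - z \<noteq> 0" "z - 1 \<noteq> 0" using z by auto
    then have 4: "?c / (1 - z) + ?c / (1 - 1 / z) = ?c"
      using z by (simp add: divide_simps) (simp add: algebra_simps)
    have "(\<Sum>j\<in>X. \<alpha> y j * u (y j)) = (\<Sum>j\<in>X. \<alpha> y j / (1 - z * y j)) + (\<Sum>j\<in>X. \<alpha> y j / (1 - 1 / z * y j)) - (\<Sum>j\<in>X. \<alpha> y j)"
      by (simp add: u_def algebra_simps sum.distrib sum_subtractf)
    moreover have "?c = 1 - (\<Sum>j\<in>X. \<alpha> y j)"
      using 3 by (metis add_diff_cancel_right')
    moreover have "1 / (1 - z) * (\<Prod>j\<in>X. hlB t (z * y j)) + 1 * (1 / (1 - 1 / z) * (\<Prod>j\<in>X. hlB t (1 / z * y j)))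
      = (?c / (1 - z) + ?c / (1 - 1 / z)) + ((\<Sum>j\<in>X. \<alpha> y j / (1 - z * y j)) + (\<Sum>j\<in>X. \<alpha> y j / (1 - 1 / z * y j)))"
      unfolding 1 2 by (simp only: add_ac mult_1)
    ultimately show ?thesis unfolding y_def[symmetric] 4 by simp
  qed
  then have "PhiSum t x (\<lambda>_. 1) (insert a X) = (\<Sum>J\<in>Pow X. hlPhi t X (flip x J) * (\<Prod>i\<in>J. 1) *
      (1 + (\<Sum>j\<in>X. \<alpha> (flip x J) j * u (flip x J j))))"
    unfolding PhiSum_insert[OF insert.hyps] by (simp add: z_def)
  also have "\<dots> = PhiSum t x (\<lambda>_. 1) X + (\<Sum>J\<in>Pow X. \<Sum>j\<in>X. hlPhi t X (flip x J) * (\<Prod>i\<in>J. 1) * (\<alpha> (flip x J) j * u (flip x J j)))"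
    by (simp add: PhiSum_def algebra_simps sum.distrib sum_distrib_left)
  also have "(\<Sum>J\<in>Pow X. \<Sum>j\<in>X. hlPhi t X (flip x J) * (\<Prod>i\<in>J. 1) * (\<alpha> (flip x J) j * u (flip x J j))) = 0"
  proof (subst sum.swap, rule sum.neutral, rule ballI)
    fix j assume j: "j \<in> X"
    have xj: "x j \<noteq> 0" using g j by (auto simp: generic_def)
    have "1 * u (1 / x j) = - u (x j)"
    proof -
      have "1 - z * x j \<noteq> 0" "x j - z \<noteq> 0" "z - x j \<noteq> 0" "z * x j - 1 \<noteq> 0"
        using zx[OF j] by auto
      moreover have "u (1 / x j) = x j / (x j - z) + z * x j / (z * x j - 1) - 1"
        using xj z by (simp add: u_def divide_simps)
      moreover have "u (x j) = 1 / (1 - z * x j) + z / (z - x j) - 1"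
        using z by (simp add: u_def divide_simps)
      moreover have "x j / (x j - z) = 1 + z / (x j - z)" "z * x j / (z * x j - 1) = 1 + 1 / (z * x j - 1)"
        using zx[OF j] by (simp_all add: divide_simps)
      moreover have "z / (x j - z) = - (z / (z - x j))" "1 / (z * x j - 1) = - (1 / (1 - z * x j))"
        by (metis minus_diff_eq minus_divide_right)+
      ultimately show ?thesis
        by simp
    qed
    then show "(\<Sum>J\<in>Pow X. hlPhi t X (flip x J) * (\<Prod>i\<in>J. 1) * (\<alpha> (flip x J) j * u (flip x J j))) = 0"
      unfolding \<alpha>_def using Phi_flip_cancel[OF insert.hyps(1) g j, of "\<lambda>_. 1" u t] by simp
  qed
  finally show ?case using insert.IH[OF g] by simp
qed

text \<open>With the weight 1 / z on the flip of x_a = z, the two terms with pole z = 1 cancel each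
  other. No constant survives, and \<open>Phi_flip_cancel\<close> removes everything else.\<close>

lemma PhiSum_inverse:
  fixes x :: "nat \<Rightarrow> 'a::field"
  assumes "finite X" "generic x X" "X \<noteq> {}"
  shows "PhiSum t x (\<lambda>i. 1 / x i) X = 0"
proof -
  obtain a Y where X: "X = insert a Y" "a \<notin> Y" using assms(3) by (metis mk_disjoint_insert equals0I)
  define z where "z = x a"
  define \<omega> where "\<omega> = (\<lambda>i. 1 / x i)"
  define \<alpha> where "\<alpha> y j = (1 - t) / (1 - 1 / y j) * (\<Prod>k\<in>Y - {j}. hlB t (y k / y j))" for y :: "nat \<Rightarrow> 'a" and j
  define u where "u w = 1 / (1 - z * w) + 1 / z * (1 / (1 - 1 / z * w))" for w
  have Y: "finite Y" using assms X by simp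
  have g: "generic x Y" using assms X by (auto intro: generic_subset)
  have z: "z \<noteq> 0" "z \<noteq> 1" using assms X by (auto simp: generic_def z_def)
  have zx: "z * x j \<noteq> 1" "z \<noteq> x j" if "j \<in> Y" for j
    using assms X that by (auto simp: generic_def z_def)
  have "1 / (1 - z) * (\<Prod>j\<in>Y. hlB t (z * flip x J j)) + \<omega> a * (1 / (1 - 1 / z) * (\<Prod>j\<in>Y. hlB t (1 / z * flip x J j)))
     = (\<Sum>j\<in>Y. \<alpha> (flip x J) j * u (flip x J j))" for J
  proof -
    define y where "y = flip x J"
    have gy: "generic y Y" unfolding y_def by (rule generic_flip[OF g])
    have zy: "z * y j \<noteq> 1" "1 / z * y j \<noteq> 1" if "j \<in> Y" for j
      using zx[OF that] z g that by (auto simp: y_def flip_def generic_def field_simps)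
    let ?c = "\<Prod>j\<in>Y. hlB t (y j)"
    have 1: "1 / (1 - z) * (\<Prod>j\<in>Y. hlB t (z * y j)) = ?c / (1 - z) + (\<Sum>j\<in>Y. \<alpha> y j / (1 - z * y j))"
      unfolding \<alpha>_def using Y gy z zy by (intro Phi_partial_fraction) auto
    have 2: "1 / (1 - 1 / z) * (\<Prod>j\<in>Y. hlB t (1 / z * y j)) = ?c / (1 - 1 / z) + (\<Sum>j\<in>Y. \<alpha> y j / (1 - 1 / z * y j))"
      unfolding \<alpha>_def using Y gy z zy by (intro Phi_partial_fraction) auto
    have "1 - z \<noteq> 0" "z - 1 \<noteq> 0" using z by auto
    then have 4: "?c / (1 - z) + 1 / z * (?c / (1 - 1 / z)) = 0"
      using z by (simp add: divide_simps) (simp add: algebra_simps)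
    have w: "\<omega> a = 1 / z" by (simp add: \<omega>_def z_def)
    have "(\<Sum>j\<in>Y. \<alpha> y j * u (y j)) = (\<Sum>j\<in>Y. \<alpha> y j / (1 - z * y j)) + 1 / z * (\<Sum>j\<in>Y. \<alpha> y j / (1 - 1 / z * y j))"
      by (simp add: u_def algebra_simps sum.distrib sum_distrib_left)
    with 1 2 4 show ?thesis unfolding y_def[symmetric] w by (simp add: algebra_simps)
  qed
  then have "PhiSum t x \<omega> X = (\<Sum>J\<in>Pow Y. hlPhi t Y (flip x J) * prod \<omega> J *
      (\<Sum>j\<in>Y. \<alpha> (flip x J) j * u (flip x J j)))"
    unfolding X PhiSum_insert[OF Y X(2)] by (simp add: z_def)
  also have "\<dots> = (\<Sum>J\<in>Pow Y. \<Sum>j\<in>Y. hlPhi t Y (flip x J) * prod \<omega> J * (\<alpha> (flip x J) j * u (flip x J j)))"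
    by (simp add: sum_distrib_left)
  also have "\<dots> = 0"
  proof (subst sum.swap, rule sum.neutral, rule ballI)
    fix j assume j: "j \<in> Y"
    have xj: "x j \<noteq> 0" using g j by (auto simp: generic_def)
    have "\<omega> j * u (1 / x j) = - u (x j)"
    proof -
      have "1 - z * x j \<noteq> 0" "x j - z \<noteq> 0" "z - x j \<noteq> 0" "z * x j - 1 \<noteq> 0"
        using zx[OF j] by auto
      moreover have "u (1 / x j) = x j / (x j - z) + x j / (z * x j - 1)"
        using xj z by (simp add: u_def divide_simps)
      moreover have "u (x j) = 1 / (1 - z * x j) + 1 / (z - x j)"
        using z by (simp add: u_def divide_simps)
      moreover have "1 / (x j - z) = - (1 / (z - x j))" "1 / (z * x j - 1) = - (1 / (1 - z * x j))"
        by (metis minus_diff_eq minus_divide_right)+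
      ultimately show ?thesis using xj unfolding \<omega>_def
        by (simp add: add_divide_distrib)
    qed
    then show "(\<Sum>J\<in>Pow Y. hlPhi t Y (flip x J) * prod \<omega> J * (\<alpha> (flip x J) j * u (flip x J j))) = 0"
      unfolding \<alpha>_def using Phi_flip_cancel[OF Y g j, of \<omega> u t] by simp
  qed
  finally show ?thesis by (simp add: \<omega>_def)
qed

text \<open>After the flip of \<open>J\<close>, the pair factor of a flipped x_i and an unflipped
  x_k has argument x_k / x_i, which is exactly a factor of \<open>hlA\<close>. So \<open>J\<close>
  ends up coupled to all of \<open>X - J\<close>, whatever \<open>I\<close> is.\<close>

lemma hlA_hlPhi_flip:
  assumes "finite X" "J \<subseteq> I" "I \<subseteq> X"
  shows "hlA t x I (X - I) * hlPhi t I (flip x J)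
    = hlPhi t J (\<lambda>i. 1 / x i) * hlA t x J (X - J) * (hlA t x (I - J) (X - I) * hlPhi t (I - J) x)"
proof -
  have "finite I" using assms(3,1) by (rule finite_subset)
  moreover have "finite J" using assms(2) \<open>finite I\<close> by (rule finite_subset)
  ultimately have fin: "finite I" "finite J" by auto
  have I: "I = J \<union> (I - J)" using assms by auto
  have XJ: "X - J = (I - J) \<union> (X - I)" using assms by auto
  have "hlA t x I (X - I) = hlA t x J (X - I) * hlA t x (I - J) (X - I)"
    unfolding hlA_def using prod.subset_diff[OF assms(2) fin(1), of "\<lambda>i. \<Prod>k\<in>X - I. hlB t (x k / x i)"]
    by (simp only: mult.commute)
  moreover have "hlPhi t I (flip x J) = hlPhi t J (\<lambda>i. 1 / x i) * hlPhi t (I - J) x * hlA t x J (I - J)"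
  proof -
    have "hlPhi t I (flip x J) = hlPhi t J (flip x J) * hlPhi t (I - J) (flip x J) *
        (\<Prod>i\<in>J. \<Prod>j\<in>I - J. hlB t (flip x J i * flip x J j))"
      using I hlPhi_Un[of J "I - J" t "flip x J"] fin by auto
    also have "hlPhi t J (flip x J) = hlPhi t J (\<lambda>i. 1 / x i)"
      by (intro hlPhi_cong) (simp add: flip_def)
    also have "hlPhi t (I - J) (flip x J) = hlPhi t (I - J) x"
      by (intro hlPhi_cong) (simp add: flip_def)
    also have "(\<Prod>i\<in>J. \<Prod>j\<in>I - J. hlB t (flip x J i * flip x J j)) = hlA t x J (I - J)"
      unfolding hlA_def by (intro prod.cong refl) (simp add: flip_def)
    finally show ?thesis .
  qed
  moreover have "hlA t x J (X - J) = hlA t x J (I - J) * hlA t x J (X - I)"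
    unfolding XJ hlA_def using fin assms(1)
    by (subst prod.union_disjoint) (auto simp: prod.distrib)
  ultimately show ?thesis by simp
qed

text \<open>Summing over pairs J \<subseteq> I \<subseteq> X with \<open>J\<close> outermost
  separates the variables: the weight depends on \<open>J\<close> alone, and the inner sum over I -
  J does not contain it.\<close>

lemma PhiSum_rec:
  fixes x \<omega> :: "nat \<Rightarrow> 'a::field"
  assumes "finite X"
  shows "(\<Sum>I\<in>Pow X. hlA t x I (X - I) * (\<Prod>i\<in>I. x i) * PhiSum t x \<omega> I)
    = (\<Sum>J\<in>Pow X. (\<Prod>i\<in>J. x i * \<omega> i) * (hlPhi t J (\<lambda>i. 1 / x i) * hlA t x J (X - J)) *
        (\<Sum>I\<in>Pow (X - J). hlA t x I (X - J - I) * (\<Prod>i\<in>I. x i) * hlPhi t I x))"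
proof -
  have fin: "finite I" if "I \<in> Pow X" for I using that assms finite_subset by blast
  have "(\<Sum>I\<in>Pow X. hlA t x I (X - I) * (\<Prod>i\<in>I. x i) * PhiSum t x \<omega> I)
    = (\<Sum>I\<in>Pow X. \<Sum>J\<in>Pow I. (hlA t x I (X - I) * hlPhi t I (flip x J)) * (\<Prod>i\<in>I. x i) * (\<Prod>i\<in>J. \<omega> i))"
    by (simp add: PhiSum_def sum_distrib_left mult_ac)
  also have "\<dots> = (\<Sum>(I, J)\<in>Sigma (Pow X) Pow. (hlA t x I (X - I) * hlPhi t I (flip x J)) * (\<Prod>i\<in>I. x i) * (\<Prod>i\<in>J. \<omega> i))"
    using assms fin by (subst sum.Sigma) auto
  also have "\<dots> = (\<Sum>(J, I)\<in>(SIGMA J:Pow X. Pow (X - J)). (\<Prod>i\<in>J. x i * \<omega> i) * (hlPhi t J (\<lambda>i. 1 / x i) * hlA t x J (X - J)) *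
        (hlA t x I (X - J - I) * (\<Prod>i\<in>I. x i) * hlPhi t I x))"
  proof (rule sum.reindex_bij_witness[of _ "\<lambda>(J, I). (J \<union> I, J)" "\<lambda>(I, J). (J, I - J)"]; clarsimp)
    fix I J assume IJ: "I \<subseteq> X" "J \<subseteq> I"
    have "(\<Prod>i\<in>I. x i) = (\<Prod>i\<in>J. x i) * (\<Prod>i\<in>I - J. x i)"
      using prod.subset_diff[of J I x] IJ fin[of I] by (simp add: mult.commute)
    moreover have "X - J - (I - J) = X - I" using IJ by auto
    ultimately show "(\<Prod>i\<in>J. x i * \<omega> i) * (hlPhi t J (\<lambda>i. 1 / x i) * hlA t x J (X - J)) *
        (hlA t x (I - J) (X - J - (I - J)) * prod x (I - J) * hlPhi t (I - J) x)
      = hlA t x I (X - I) * hlPhi t I (flip x J) * prod x I * prod \<omega> J"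
      using hlA_hlPhi_flip[OF assms IJ(2,1), of t x] by (simp add: prod.distrib mult_ac)
  qed auto
  also have "\<dots> = (\<Sum>J\<in>Pow X. \<Sum>I\<in>Pow (X - J). (\<Prod>i\<in>J. x i * \<omega> i) * (hlPhi t J (\<lambda>i. 1 / x i) * hlA t x J (X - J)) *
        (hlA t x I (X - J - I) * (\<Prod>i\<in>I. x i) * hlPhi t I x))"
    using assms by (subst sum.Sigma) auto
  finally show ?thesis by (simp add: sum_distrib_left)
qed

lemma hlPhi_split:
  assumes "finite X" "J \<subseteq> X"
  shows "hlPhi t J (\<lambda>i. 1 / x i) * hlA t x J (X - J) * hlPhi t (X - J) x = hlPhi t X (flip x J)"
  using hlA_hlPhi_flip[OF assms order_refl, of t x] by (simp add: hlA_def)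

text \<open>Both PhiSum_one and PhiSum_inverse enter: they are the cases \<open>m = 0\<close> and \<open>m = -1\<close> of the
  bounded sum, and the recursion from \<open>-1\<close> to \<open>0\<close> leaves only the term \<open>J = {}\<close>.\<close>

lemma hlPhi_rec:
  fixes x :: "nat \<Rightarrow> 'a::field"
  assumes "finite X" "generic x X"
  shows "(\<Sum>I\<in>Pow X. hlA t x I (X - I) * (\<Prod>i\<in>I. x i) * hlPhi t I x) = hlPhi t X x"
  using assms
proof (induction "card X" arbitrary: X rule: less_induct)
  case less
  define E where "E Y = (\<Sum>I\<in>Pow Y. hlA t x I (Y - I) * (\<Prod>i\<in>I. x i) * hlPhi t I x)" for Y
  define C where "C J = hlPhi t J (\<lambda>i. 1 / x i) * hlA t x J (X - J)" for J
  have E: "E (X - J) = hlPhi t (X - J) x" if "J \<in> Pow X - {{}}" for J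
    unfolding E_def using that less.prems
    by (intro less.hyps generic_subset[OF less.prems(2)]) (auto intro: psubset_card_mono)
  have "(\<Sum>I\<in>Pow X. hlA t x I (X - I) * (\<Prod>i\<in>I. x i) * PhiSum t x (\<lambda>i. 1 / x i) I)
      = (\<Sum>I\<in>Pow X. if I = {} then 1 else 0)"
  proof (intro sum.cong refl)
    fix I assume I: "I \<in> Pow X"
    show "hlA t x I (X - I) * (\<Prod>i\<in>I. x i) * PhiSum t x (\<lambda>i. 1 / x i) I = (if I = {} then 1 else 0)"
    proof (cases "I = {}")
      case False
      then show ?thesis using PhiSum_inverse[of I x t] I less.prems
        by (auto dest: finite_subset simp: generic_subset[OF less.prems(2)])
    qed (simp add: hlA_def PhiSum_def)
  qed
  also have "\<dots> = 1" using less.prems by simp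
  also have "\<dots> = PhiSum t x (\<lambda>_. 1) X" using less.prems by (simp add: PhiSum_one)
  also have "\<dots> = (\<Sum>J\<in>Pow X. C J * hlPhi t (X - J) x)"
    unfolding PhiSum_def C_def using less.prems by (intro sum.cong refl) (simp add: hlPhi_split)
  finally have "(\<Sum>J\<in>Pow X. (\<Prod>i\<in>J. x i * (1 / x i)) * C J * E (X - J)) = (\<Sum>J\<in>Pow X. C J * hlPhi t (X - J) x)"
    using PhiSum_rec[OF less.prems(1), of t x "\<lambda>i. 1 / x i"] by (simp add: C_def E_def)
  moreover have "(\<Prod>i\<in>J. x i * (1 / x i)) = 1" if "J \<in> Pow X" for J
    using that less.prems by (intro prod.neutral) (auto simp: generic_def)
  then have "(\<Sum>J\<in>Pow X. (\<Prod>i\<in>J. x i * (1 / x i)) * C J * E (X - J)) = (\<Sum>J\<in>Pow X. C J * E (X - J))"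
    by (intro sum.cong refl) (simp only: mult_1)
  ultimately have "(\<Sum>J\<in>Pow X. C J * E (X - J)) = (\<Sum>J\<in>Pow X. C J * hlPhi t (X - J) x)"
    by simp
  moreover have "(\<Sum>J\<in>Pow X - {{}}. C J * E (X - J)) = (\<Sum>J\<in>Pow X - {{}}. C J * hlPhi t (X - J) x)"
    by (intro sum.cong refl) (simp add: E)
  ultimately have "C {} * E (X - {}) = C {} * hlPhi t (X - {}) x"
    using less.prems by (simp add: sum.remove[of "Pow X" "{}"])
  then show ?case by (simp add: C_def E_def hlA_def)
qed

text \<open>\<open>I\<close> is the set of variables that occupy the rows of the first column;
  \<open>sum_HLX_Parts\<close> identifies the result with a sum of Hall-Littlewood
  polynomials.\<close>

fun boundedSum :: "'a::field \<Rightarrow> (nat \<Rightarrow> 'a) \<Rightarrow> nat \<Rightarrow> nat set \<Rightarrow> 'a" where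
  "boundedSum t x 0 X = 1"
| "boundedSum t x (Suc m) X = (\<Sum>I\<in>Pow X. hlA t x I (X - I) * (\<Prod>i\<in>I. x i) * boundedSum t x m I)"

text \<open>The two recursions agree: in \<open>PhiSum_rec\<close> the inner sum closes up by
  \<open>hlPhi_rec\<close>, the factors recombine by \<open>hlPhi_split\<close>, and every flipped
  variable has gained one power of x_i.\<close>

lemma boundedSum_eq_PhiSum:
  assumes "finite X" "generic x X"
  shows "boundedSum t x m X = PhiSum t x (\<lambda>i. x i ^ m) X"
  using assms
proof (induction m arbitrary: X)
  case 0
  then show ?case by (simp add: PhiSum_one)
next
  case (Suc m)
  have "boundedSum t x (Suc m) X = (\<Sum>I\<in>Pow X. hlA t x I (X - I) * (\<Prod>i\<in>I. x i) * PhiSum t x (\<lambda>i. x i ^ m) I)"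
    using Suc.IH finite_subset[OF _ Suc.prems(1)] generic_subset[OF Suc.prems(2)]
    by (auto intro!: sum.cong)
  also have "\<dots> = (\<Sum>J\<in>Pow X. (\<Prod>i\<in>J. x i * x i ^ m) * (hlPhi t J (\<lambda>i. 1 / x i) * hlA t x J (X - J)) * hlPhi t (X - J) x)"
    unfolding PhiSum_rec[OF Suc.prems(1)]
    using Suc.prems(1) by (intro sum.cong refl arg_cong2[where f = "(*)"] hlPhi_rec generic_subset[OF Suc.prems(2)]) auto
  also have "\<dots> = PhiSum t x (\<lambda>i. x i ^ Suc m) X"
    unfolding PhiSum_def using Suc.prems
    by (intro sum.cong refl) (auto simp: hlPhi_split[symmetric] mult_ac)
  finally show ?case .
qed

section \<open>Removing the first column of a partition\<close>

text \<open>List form of a product over pairs i < j, chosen because splitting a permutation into two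
  blocks becomes concatenation.\<close>

fun crossl :: "('i \<Rightarrow> 'i \<Rightarrow> 'a::comm_monoid_mult) \<Rightarrow> 'i list \<Rightarrow> 'a" where
  "crossl c [] = 1"
| "crossl c (a # xs) = (\<Prod>b\<in>set xs. c a b) * crossl c xs"

lemma crossl_append:
  assumes "distinct (ys @ zs)"
  shows "crossl c (ys @ zs) = crossl c ys * crossl c zs * (\<Prod>a\<in>set ys. \<Prod>b\<in>set zs. c a b)"
  using assms by (induction ys) (auto simp: prod.union_disjoint mult_ac)

lemma crossl_nth:
  assumes "distinct xs"
  shows "crossl c xs = (\<Prod>(i, j)\<in>{(i, j). i < j \<and> j < length xs}. c (xs ! i) (xs ! j))"
proof -
  have "crossl c xs = (\<Prod>i<length xs. \<Prod>j\<in>{i<..<length xs}. c (xs ! i) (xs ! j))"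
    using assms
  proof (induction xs)
    case (Cons a xs)
    have "(\<Prod>j\<in>{0<..<Suc (length xs)}. c a ((a # xs) ! j)) = (\<Prod>j<length xs. c a (xs ! j))"
      by (rule prod.reindex_bij_witness[of _ Suc "\<lambda>j. j - 1"]) auto
    also have "\<dots> = (\<Prod>b\<in>set xs. c a b)"
      using Cons.prems by (intro prod.reindex_bij_betw bij_betw_nth) auto
    finally have 1: "(\<Prod>j\<in>{0<..<Suc (length xs)}. c a ((a # xs) ! j)) = (\<Prod>b\<in>set xs. c a b)" .
    have 2: "(\<Prod>j\<in>{Suc i<..<Suc (length xs)}. c ((a # xs) ! Suc i) ((a # xs) ! j))
        = (\<Prod>j\<in>{i<..<length xs}. c (xs ! i) (xs ! j))" for i
      by (rule prod.reindex_bij_witness[of _ Suc "\<lambda>j. j - 1"]) auto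
    show ?case
      unfolding length_Cons prod.lessThan_Suc_shift 2 comp_apply nth_Cons_0 1
      using Cons by simp
  qed simp
  also have "\<dots> = (\<Prod>(i, j)\<in>(SIGMA i:{..<length xs}. {i<..<length xs}). c (xs ! i) (xs ! j))"
    by (subst prod.Sigma) auto
  also have "(SIGMA i:{..<length xs}. {i<..<length xs}) = {(i, j). i < j \<and> j < length xs}"
    by auto
  finally show ?thesis .
qed

lemma sum_permutes_eq_lists:
  "(\<Sum>w | w permutes {..<n}. F (map w [0..<n])) = (\<Sum>xs\<in>permutations_of_set {..<n}. F xs :: 'b::comm_monoid_add)"
proof (rule sum.reindex_bij_witness[of _ "\<lambda>xs i. if i < n then xs ! i else i" "\<lambda>w. map w [0..<n]"])
  fix w assume w: "w \<in> {w. w permutes {..<n}}"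
  then show "(\<lambda>i. if i < n then map w [0..<n] ! i else i) = w"
    by (intro ext) (auto dest: permutes_not_in)
  have "inj_on w {..<n}" "w ` {..<n} = {..<n}"
    using w permutes_inj_on[of w "{..<n}" "{..<n}"] permutes_image[of w "{..<n}"] by simp_all
  then show "map w [0..<n] \<in> permutations_of_set {..<n}"
    by (simp add: permutations_of_set_def distinct_map atLeast0LessThan)
next
  fix xs assume xs: "xs \<in> permutations_of_set {..<n}"
  then have d: "distinct xs" and s: "set xs = {..<n}"
    by (auto simp: permutations_of_set_def)
  then have len: "length xs = n" by (metis card_lessThan distinct_card)
  show "map (\<lambda>i. if i < n then xs ! i else i) [0..<n] = xs"
    using len by (intro nth_equalityI) auto
  have "bij_betw (\<lambda>i. if i < n then xs ! i else i) {..<n} {..<n}"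
  proof (rule bij_betw_cong[THEN iffD2])
    show "bij_betw ((!) xs) {..<n} {..<n}"
      using d by (rule bij_betw_nth) (simp_all add: len s)
  qed simp
  then show "(\<lambda>i. if i < n then xs ! i else i) \<in> {w. w permutes {..<n}}"
    by (intro CollectI bij_imp_permutes) simp_all
qed auto

lemma sum_permutations_split:
  assumes "finite X" "l \<le> card X"
  shows "(\<Sum>xs\<in>permutations_of_set X. F xs) =
    (\<Sum>J | J \<subseteq> X \<and> card J = l. \<Sum>ys\<in>permutations_of_set J. \<Sum>zs\<in>permutations_of_set (X - J). F (ys @ zs) :: 'b::comm_monoid_add)"
proof -
  let ?S = "SIGMA J:{J. J \<subseteq> X \<and> card J = l}. permutations_of_set J \<times> permutations_of_set (X - J)"
  have fin: "finite {J. J \<subseteq> X \<and> card J = l}" using assms by auto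
  have "(\<Sum>xs\<in>permutations_of_set X. F xs) = (\<Sum>(J, ys, zs)\<in>?S. F (ys @ zs))"
  proof (rule sum.reindex_bij_witness[of _ "\<lambda>(J, ys, zs). ys @ zs" "\<lambda>xs. (set (take l xs), take l xs, drop l xs)"])
    fix xs assume "xs \<in> permutations_of_set X"
    then have xs: "distinct xs" "set xs = X" by (auto simp: permutations_of_set_def)
    then have len: "length xs = card X" by (metis distinct_card)
    have u: "X = set (take l xs) \<union> set (drop l xs)" using xs by (metis append_take_drop_id set_append)
    have d: "set (take l xs) \<inter> set (drop l xs) = {}" using xs(1) by (rule set_take_disj_set_drop_if_distinct) simp
    have "card (set (take l xs)) = l"
      using xs(1) len assms(2) by (simp add: distinct_card)
    moreover have "X - set (take l xs) = set (drop l xs)" using u d by blast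
    ultimately show "(set (take l xs), take l xs, drop l xs) \<in> ?S"
      using xs u by (simp add: permutations_of_set_def)
  next
    fix a assume "a \<in> ?S"
    then obtain J ys zs where a: "a = (J, ys, zs)" "J \<subseteq> X" "card J = l" "set ys = J" "distinct ys"
        "set zs = X - J" "distinct zs"
      by (auto simp: permutations_of_set_def)
    then have "length ys = l" using distinct_card[of ys] by simp
    then show "(case a of (J, ys, zs) \<Rightarrow> ys @ zs) \<in> permutations_of_set X"
      "(set (take l (case a of (J, ys, zs) \<Rightarrow> ys @ zs)), take l (case a of (J, ys, zs) \<Rightarrow> ys @ zs), drop l (case a of (J, ys, zs) \<Rightarrow> ys @ zs)) = a"
      using a by (auto simp: permutations_of_set_def)
  qed auto
  also have "\<dots> = (\<Sum>J | J \<subseteq> X \<and> card J = l. \<Sum>(ys, zs)\<in>permutations_of_set J \<times> permutations_of_set (X - J). F (ys @ zs))"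
    using fin by (subst sum.Sigma) auto
  finally show ?thesis by (simp add: sum.cartesian_product)
qed

text \<open>The unnormalised Hall-Littlewood polynomial. Its variables are indexed by an arbitrary
  set, because splitting off a column leads to subsets of the variables.\<close>

definition hsum :: "'a::field \<Rightarrow> (nat \<Rightarrow> 'a) \<Rightarrow> nat set \<Rightarrow> nat list \<Rightarrow> 'a" where
  "hsum t x X \<mu> = (\<Sum>xs\<in>permutations_of_set X.
     (\<Prod>i<length xs. x (xs ! i) ^ part \<mu> i) * crossl (\<lambda>a b. hlB t (x b / x a)) xs)"

text \<open>The t-analogue of the factorial of \<open>k\<close>: the factor of \<open>hl_v\<close>
  that belongs to a part of multiplicity \<open>k\<close>.\<close>

definition hlV :: "'a::field \<Rightarrow> nat \<Rightarrow> 'a" where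
  "hlV t k = qpoch t t k / (1 - t) ^ k"

lemma hlV_nonzero:
  assumes "\<And>k. t ^ Suc k \<noteq> (1 :: 'a::field)"
  shows "hlV t k \<noteq> 0"
  using assms assms[of 0] by (auto simp: hlV_def qpoch_def)

lemma coeff_prod_linear:
  assumes "finite Y"
  shows "poly.coeff (\<Prod>k\<in>Y. [:1, f k:]) (card Y) = (\<Prod>k\<in>Y. f k :: 'a::comm_ring_1)"
  using assms
proof (induction Y rule: finite_induct)
  case (insert a Y)
  have "degree (\<Prod>k\<in>Y. [:1, f k:]) \<le> card Y" by (rule degree_prod_linear_le)
  then have "poly.coeff (\<Prod>k\<in>Y. [:1, f k:]) (Suc (card Y)) = 0" by (intro coeff_eq_0) simp
  then show ?case using insert by simp
qed simp

text \<open>Partial fractions for the product of 1 - t z x_j over that of 1 - z x_j, evaluated at z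
  = 0. Subtracting t^N times the denominator brings the degree of the numerator below N without
  changing its values at the poles.\<close>

lemma sum_hlA_singletons:
  fixes x :: "'i \<Rightarrow> 'a::field"
  assumes K: "finite K" "inj_on x K" "\<And>a. a \<in> K \<Longrightarrow> x a \<noteq> 0" and t: "t \<noteq> 1"
  shows "(\<Sum>a\<in>K. \<Prod>b\<in>K - {a}. hlB t (x b / x a)) = (1 - t ^ card K) / (1 - t)"
proof (cases "K = {}")
  case False
  define N where "N = card K"
  define p where "p = (\<Prod>j\<in>K. [:1, t * - x j:]) - Polynomial.smult (t ^ N) (\<Prod>j\<in>K. [:1, - x j:])"
  have N: "N > 0" using False K(1) by (auto simp: N_def card_gt_0_iff)
  have "degree p \<le> N"
    unfolding p_def N_def
    by (intro degree_diff_le order.trans[OF degree_smult_le] degree_prod_linear_le)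
  moreover have "poly.coeff p N = 0"
    unfolding p_def N_def coeff_diff coeff_smult coeff_prod_linear[OF K(1)] prod.distrib by simp
  ultimately have "degree p < N"
    using N by (metis coeff_0 degree_0 eq_zero_or_degree_less leading_coeff_0_iff le_neq_implies_less)
  then have "poly p 0 / (\<Prod>j\<in>K. 1 - 0 * x j)
    = (\<Sum>j\<in>K. poly p (1 / x j) / (\<Prod>k\<in>K - {j}. 1 - x k / x j) / (1 - 0 * x j))"
    using K unfolding N_def by (intro partial_fraction) auto
  also have "\<dots> = (\<Sum>a\<in>K. (1 - t) * (\<Prod>b\<in>K - {a}. hlB t (x b / x a)))"
  proof (intro sum.cong refl)
    fix a assume a: "a \<in> K"
    have "(\<Prod>j\<in>K. 1 - x j / x a) = 0" using a K by (auto intro!: bexI[of _ a])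
    then have "poly p (1 / x a) = (\<Prod>j\<in>K. 1 - t * (x j / x a))"
      by (simp add: p_def poly_prod)
    also have "\<dots> = (1 - t) * (\<Prod>b\<in>K - {a}. 1 - t * (x b / x a))"
      using a K by (subst prod.remove[of K a]) auto
    finally show "poly p (1 / x a) / (\<Prod>k\<in>K - {a}. 1 - x k / x a) / (1 - 0 * x a) = (1 - t) * (\<Prod>b\<in>K - {a}. hlB t (x b / x a))"
      by (simp add: hlB_def prod_dividef)
  qed
  also have "poly p 0 = 1 - t ^ N" by (simp add: p_def poly_prod)
  finally have "1 - t ^ N = (1 - t) * (\<Sum>a\<in>K. \<Prod>b\<in>K - {a}. hlB t (x b / x a))"
    by (simp add: sum_distrib_left)
  then show ?thesis using t by (simp add: N_def)
qed simp

text \<open>Sorting the permutations by their first entry produces the sum of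
  \<open>sum_hlA_singletons\<close>. The resulting t-factorial is the normalisation of the block of
  zero parts.\<close>

lemma hsum_Nil:
  fixes x :: "nat \<Rightarrow> 'a::field"
  assumes "finite K" "inj_on x K" "\<And>a. a \<in> K \<Longrightarrow> x a \<noteq> 0" and t: "t \<noteq> 1"
  shows "hsum t x K [] = hlV t (card K)"
  using assms(1-3)
proof (induction "card K" arbitrary: K)
  case 0
  then show ?case by (simp add: hsum_def hlV_def qpoch_def)
next
  case (Suc N)
  let ?c = "\<lambda>a b. hlB t (x b / x a)"
  have IH: "(\<Sum>xs\<in>permutations_of_set (K - {a}). crossl ?c xs) = hlV t N" if "a \<in> K" for a
  proof -
    have "hsum t x (K - {a}) [] = hlV t (card (K - {a}))"
      using Suc.hyps(2) Suc.prems that by (intro Suc.hyps(1)) (auto intro: inj_on_subset)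
    moreover have "card (K - {a}) = N" using Suc.hyps(2) Suc.prems(1) that by simp
    ultimately show ?thesis by (simp add: hsum_def part_def)
  qed
  have ne: "K \<noteq> {}" using Suc.hyps(2) by auto
  have "hsum t x K [] = (\<Sum>xs\<in>(\<Union>a\<in>K. (#) a ` permutations_of_set (K - {a})). crossl ?c xs)"
    using permutations_of_set_nonempty[OF ne] by (simp add: hsum_def part_def)
  also have "\<dots> = (\<Sum>a\<in>K. \<Sum>xs\<in>(#) a ` permutations_of_set (K - {a}). crossl ?c xs)"
    using Suc.prems(1) by (subst sum.UNION_disjoint) auto
  also have "\<dots> = (\<Sum>a\<in>K. (\<Prod>b\<in>K - {a}. ?c a b) * hlV t N)"
  proof (intro sum.cong refl)
    fix a assume a: "a \<in> K"
    have "(\<Sum>xs\<in>(#) a ` permutations_of_set (K - {a}). crossl ?c xs)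
      = (\<Sum>xs\<in>permutations_of_set (K - {a}). (\<Prod>b\<in>K - {a}. ?c a b) * crossl ?c xs)"
      by (subst sum.reindex) (auto simp: permutations_of_set_def)
    then show "(\<Sum>xs\<in>(#) a ` permutations_of_set (K - {a}). crossl ?c xs) = (\<Prod>b\<in>K - {a}. ?c a b) * hlV t N"
      using IH[OF a] by (simp add: sum_distrib_left[symmetric])
  qed
  also have "\<dots> = (1 - t ^ card K) / (1 - t) * hlV t N"
    using sum_hlA_singletons[OF Suc.prems t] by (simp add: sum_distrib_right[symmetric])
  also have "\<dots> = hlV t (card K)"
    unfolding Suc.hyps(2)[symmetric] by (simp add: hlV_def qpoch_def mult_ac)
  finally show ?case .
qed

text \<open>Puts a column of height \<open>l\<close> in front of the Young diagram.\<close>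

definition incr :: "nat \<Rightarrow> nat list \<Rightarrow> nat list" where
  "incr l \<nu> = map Suc \<nu> @ replicate (l - length \<nu>) 1"

lemma length_incr: "length \<nu> \<le> l \<Longrightarrow> length (incr l \<nu>) = l"
  by (simp add: incr_def)

lemma part_incr: "length \<nu> \<le> l \<Longrightarrow> part (incr l \<nu>) i = (if i < l then Suc (part \<nu> i) else 0)"
  by (auto simp: incr_def part_def nth_append)

lemma is_partition_Cons: "is_partition (a # \<mu>) \<longleftrightarrow> 0 < a \<and> (\<forall>b\<in>set \<mu>. b \<le> a) \<and> is_partition \<mu>"
  by (auto simp: is_partition_def)

lemma is_partition_incr:
  "is_partition \<nu> \<Longrightarrow> is_partition (incr l \<nu>)"
proof -
  have "sorted_wrt (\<ge>) (replicate k (1 :: nat))" for k by (induction k) auto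
  then show "is_partition \<nu> \<Longrightarrow> is_partition (incr l \<nu>)"
    by (auto simp: is_partition_def incr_def sorted_wrt_append sorted_wrt_map)
qed

definition Parts :: "nat \<Rightarrow> nat \<Rightarrow> nat list set" where
  "Parts m N = {\<mu>. is_partition \<mu> \<and> part \<mu> 0 \<le> m \<and> length \<mu> \<le> N}"

lemma partition_as_incr:
  "is_partition \<mu> \<Longrightarrow> \<exists>\<nu>. is_partition \<nu> \<and> length \<nu> \<le> length \<mu> \<and> incr (length \<mu>) \<nu> = \<mu>"
proof (induction \<mu>)
  case Nil
  then show ?case by (auto simp: incr_def)
next
  case (Cons a \<mu>)
  have a: "0 < a" "\<And>b. b \<in> set \<mu> \<Longrightarrow> b \<le> a" "is_partition \<mu>"
    using Cons.prems by (auto simp: is_partition_Cons)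
  obtain \<nu> where \<nu>: "is_partition \<nu>" "length \<nu> \<le> length \<mu>" "incr (length \<mu>) \<nu> = \<mu>"
    using Cons.IH[OF a(3)] by blast
  show ?case
  \<comment> \<open>If the largest part is 1, the first column is the whole diagram and nothing
    remains.\<close>
  proof (cases "a = 1")
    case True
    have "b = 1" if "b \<in> set \<mu>" for b
    proof -
      have "b \<noteq> 0" using a(3) that by (metis is_partition_def)
      then show ?thesis using a(2)[OF that] True by simp
    qed
    then have "replicate (length (a # \<mu>)) 1 = a # \<mu>"
      using True by (intro replicate_eqI[symmetric]) auto
    moreover have "incr (length (a # \<mu>)) [] = replicate (length (a # \<mu>)) 1" by (simp add: incr_def)
    ultimately have "incr (length (a # \<mu>)) [] = a # \<mu>" by (simp only:)
    then show ?thesis by (intro exI[of _ "[]"]) (simp add: is_partition_def)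
  next
    case False
    have mem: "Suc b \<in> set \<mu>" if "b \<in> set \<nu>" for b
    proof -
      have "Suc b \<in> set (incr (length \<mu>) \<nu>)" using that by (auto simp: incr_def)
      then show ?thesis by (simp only: \<nu>(3))
    qed
    have "a - 1 > 0" using False a by simp
    moreover have "b \<le> a - 1" if "b \<in> set \<nu>" for b
      using a(2)[OF mem[OF that]] by simp
    ultimately have "is_partition ((a - 1) # \<nu>)"
      using \<nu>(1) by (auto simp: is_partition_Cons)
    moreover have "incr (length (a # \<mu>)) ((a - 1) # \<nu>) = a # incr (length \<mu>) \<nu>"
      using \<open>a - 1 > 0\<close> by (simp add: incr_def)
    ultimately show ?thesis using \<nu>(2,3) by (intro exI[of _ "(a - 1) # \<nu>"]) simp
  qed
qed

lemma inj_on_incr: "inj_on (incr l) {\<nu>. is_partition \<nu> \<and> length \<nu> \<le> l}"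
proof (rule inj_onI; clarsimp)
  fix \<mu> \<nu> assume *: "is_partition \<mu>" "length \<mu> \<le> l" "is_partition \<nu>" "length \<nu> \<le> l" "incr l \<mu> = incr l \<nu>"
  \<comment> \<open>The inner partition is recovered by dropping the parts 1 and lowering the
    others.\<close>
  have f: "map (\<lambda>k. k - 1) (filter (\<lambda>k. 1 < k) (incr l \<mu>)) = \<mu>" if "is_partition \<mu>" for \<mu>
  proof -
    have "0 < b" if "b \<in> set \<mu>" for b using \<open>is_partition \<mu>\<close> that by (auto simp: is_partition_def intro: gr0I)
    then have "filter (\<lambda>k. 1 < k) (map Suc \<mu>) = map Suc \<mu>" by (intro filter_True) auto
    moreover have "filter (\<lambda>k. 1 < k) (replicate (l - length \<mu>) (1 :: nat)) = []" by simp
    ultimately show ?thesis by (simp add: incr_def o_def)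
  qed
  show "\<mu> = \<nu>" using f[OF *(1)] f[OF *(3)] *(5) by simp
qed

lemma Parts_Suc: "Parts (Suc m) N = (\<Union>l\<in>{..N}. incr l ` Parts m l)"
proof (intro equalityI subsetI)
  fix \<mu> assume \<mu>: "\<mu> \<in> Parts (Suc m) N"
  then have "is_partition \<mu>" by (simp add: Parts_def)
  from partition_as_incr[OF this] obtain \<nu>
    where \<nu>: "is_partition \<nu>" "length \<nu> \<le> length \<mu>" "incr (length \<mu>) \<nu> = \<mu>" by blast
  have "part \<mu> 0 = (if 0 < length \<mu> then Suc (part \<nu> 0) else 0)"
    using part_incr[OF \<nu>(2), of 0] by (simp add: \<nu>(3))
  then have "part \<nu> 0 \<le> m"
    using \<mu> \<nu>(2) by (auto simp: Parts_def part_def split: if_splits)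
  then have "\<nu> \<in> Parts m (length \<mu>)" using \<nu> by (simp add: Parts_def)
  moreover have "length \<mu> \<le> N" using \<mu> by (simp add: Parts_def)
  ultimately show "\<mu> \<in> (\<Union>l\<in>{..N}. incr l ` Parts m l)"
    unfolding UN_iff image_iff using \<nu>(3) by (intro bexI[of _ "length \<mu>"] bexI[of _ \<nu>]) auto
qed (auto simp: Parts_def length_incr part_incr is_partition_incr)

lemma Parts_0: "Parts 0 N = {[]}"
proof (intro equalityI subsetI)
  fix \<mu> assume "\<mu> \<in> Parts 0 N"
  then show "\<mu> \<in> {[]}" by (cases \<mu>) (auto simp: Parts_def is_partition_Cons part_def)
qed (auto simp: Parts_def is_partition_def part_def)

lemma finite_Parts: "finite (Parts m N)"
  by (induction m arbitrary: N) (auto simp: Parts_0 Parts_Suc)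

lemma mult_incr_0: "length \<nu> \<le> l \<Longrightarrow> l \<le> N \<Longrightarrow> Defs.mult N (incr l \<nu>) 0 = N - l"
proof -
  assume *: "length \<nu> \<le> l" "l \<le> N"
  have "{j. j < N \<and> part (incr l \<nu>) j = 0} = {l..<N}"
    using * by (auto simp: part_incr split: if_splits)
  then show ?thesis by (simp add: Defs.mult_def)
qed

lemma mult_incr_Suc: "length \<nu> \<le> l \<Longrightarrow> l \<le> N \<Longrightarrow> Defs.mult N (incr l \<nu>) (Suc i) = Defs.mult l \<nu> i"
  unfolding Defs.mult_def by (intro arg_cong[where f = card]) (auto simp: part_incr split: if_splits)

text \<open>A column of height \<open>l\<close> shifts all multiplicities by one level and leaves
  \<open>N - l\<close> zeros. For \<open>l = 0\<close> the first part does not grow, hence the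
  separate case.\<close>

lemma hl_v_incr:
  assumes "length \<nu> \<le> l" "l \<le> N"
  shows "hl_v N (incr l \<nu>) t = hlV t (N - l) * hl_v l \<nu> t"
proof (cases "l = 0")
  case True
  then show ?thesis using assms
    by (simp add: hl_v_def hlV_def incr_def part_def Defs.mult_def qpoch_def)
next
  case False
  then have "part (incr l \<nu>) 0 = Suc (part \<nu> 0)" using assms by (simp add: part_incr)
  then show ?thesis using assms
    unfolding hl_v_def hlV_def by (simp only: prod.atMost_Suc_shift mult_incr_0 mult_incr_Suc comp_apply)
qed

definition HLX :: "'a::field \<Rightarrow> (nat \<Rightarrow> 'a) \<Rightarrow> nat set \<Rightarrow> nat list \<Rightarrow> 'a" where
  "HLX t x X \<mu> = hsum t x X \<mu> / hl_v (card X) \<mu> t"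

lemma hsum_incr:
  assumes "finite J" "length \<nu> \<le> card J"
  shows "hsum t x J (incr (card J) \<nu>) = (\<Prod>i\<in>J. x i) * hsum t x J \<nu>"
  unfolding hsum_def sum_distrib_left
proof (intro sum.cong refl)
  fix xs assume xs: "xs \<in> permutations_of_set J"
  then have "distinct xs" "set xs = J" by (auto simp: permutations_of_set_def)
  then have len: "length xs = card J" "distinct xs" "set xs = J"
    using distinct_card[of xs] by auto
  have "(\<Prod>i\<in>J. x i) = (\<Prod>i<length xs. x (xs ! i))"
    using len by (intro prod.reindex_bij_betw[symmetric] bij_betw_nth) auto
  then have "(\<Prod>i<length xs. x (xs ! i) ^ part (incr (card J) \<nu>) i) = (\<Prod>i\<in>J. x i) * (\<Prod>i<length xs. x (xs ! i) ^ part \<nu> i)"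
    using len assms by (simp add: part_incr prod.distrib)
  then show "(\<Prod>i<length xs. x (xs ! i) ^ part (incr (card J) \<nu>) i) * crossl (\<lambda>a b. hlB t (x b / x a)) xs
    = (\<Prod>i\<in>J. x i) * ((\<Prod>i<length xs. x (xs ! i) ^ part \<nu> i) * crossl (\<lambda>a b. hlB t (x b / x a)) xs)"
    by simp
qed

text \<open>\<open>J\<close> holds the variables in the first \<open>length \<mu>\<close> positions
  of a permutation. The remaining ones have exponent 0, and the pairs across the two blocks form
  \<open>hlA\<close>.\<close>

lemma hsum_split:
  assumes "finite X" "length \<mu> \<le> card X"
  shows "hsum t x X \<mu> = (\<Sum>J | J \<subseteq> X \<and> card J = length \<mu>. hlA t x J (X - J) * hsum t x J \<mu> * hsum t x (X - J) [])"
  unfolding hsum_def sum_permutations_split[OF assms]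
proof (intro sum.cong refl; clarify)
  fix J assume J: "J \<subseteq> X" "card J = length \<mu>"
  let ?c = "\<lambda>a b. hlB t (x b / x a)"
  let ?m = "\<lambda>\<mu> xs. \<Prod>i<length xs. x (xs ! i) ^ part \<mu> i"
  have "?m \<mu> (ys @ zs) * crossl ?c (ys @ zs) = hlA t x J (X - J) * (?m \<mu> ys * crossl ?c ys) * (?m [] zs * crossl ?c zs)"
    if "ys \<in> permutations_of_set J" "zs \<in> permutations_of_set (X - J)" for ys zs
  proof -
    have *: "distinct ys" "set ys = J" "distinct zs" "set zs = X - J"
      using that by (auto simp: permutations_of_set_def)
    then have len: "length ys = length \<mu>" using J distinct_card[of ys] by simp
    have "?m \<mu> (ys @ zs) = (\<Prod>i<length ys + length zs. x ((ys @ zs) ! i) ^ part \<mu> i)"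
      by simp
    also have "\<dots> = (\<Prod>i<length ys. x ((ys @ zs) ! i) ^ part \<mu> i)"
      using len by (intro prod.mono_neutral_right) (auto simp: part_def)
    also have "\<dots> = ?m \<mu> ys"
      by (intro prod.cong) (auto simp: nth_append)
    finally have "?m \<mu> (ys @ zs) = ?m \<mu> ys" .
    moreover have "?m [] zs = 1" by (simp add: part_def)
    moreover have "crossl ?c (ys @ zs) = crossl ?c ys * crossl ?c zs * hlA t x J (X - J)"
      using * by (subst crossl_append) (auto simp: hlA_def)
    ultimately show ?thesis by simp
  qed
  then have "(\<Sum>ys\<in>permutations_of_set J. \<Sum>zs\<in>permutations_of_set (X - J). ?m \<mu> (ys @ zs) * crossl ?c (ys @ zs))
    = (\<Sum>ys\<in>permutations_of_set J. \<Sum>zs\<in>permutations_of_set (X - J). hlA t x J (X - J) * (?m \<mu> ys * crossl ?c ys) * (?m [] zs * crossl ?c zs))"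
    by (intro sum.cong) auto
  then show "(\<Sum>ys\<in>permutations_of_set J. \<Sum>zs\<in>permutations_of_set (X - J). ?m \<mu> (ys @ zs) * crossl ?c (ys @ zs))
    = hlA t x J (X - J) * (\<Sum>xs\<in>permutations_of_set J. ?m \<mu> xs * crossl ?c xs) * (\<Sum>xs\<in>permutations_of_set (X - J). ?m [] xs * crossl ?c xs)"
    by (simp only: sum_distrib_left sum_distrib_right) (subst sum.swap, rule refl)
qed

text \<open>Summing over the orders of the variables outside \<open>J\<close> gives the t-factorial
  of \<open>card X - l\<close> by \<open>hsum_Nil\<close>, which cancels the zero-part factor of
  \<open>hl_v\<close>. What remains is the recursion of \<open>boundedSum\<close> for a single
  partition.\<close>

lemma HLX_incr:
  fixes x :: "nat \<Rightarrow> 'a::field"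
  assumes X: "finite X" "generic x X" and t: "\<And>k. t ^ Suc k \<noteq> 1"
    and l: "length \<nu> \<le> l" "l \<le> card X"
  shows "HLX t x X (incr l \<nu>) = (\<Sum>J | J \<subseteq> X \<and> card J = l. hlA t x J (X - J) * (\<Prod>i\<in>J. x i) * HLX t x J \<nu>)"
proof -
  have t1: "t \<noteq> 1" using t[of 0] by simp
  have "hsum t x X (incr l \<nu>) = (\<Sum>J | J \<subseteq> X \<and> card J = l. hlA t x J (X - J) * hsum t x J (incr l \<nu>) * hsum t x (X - J) [])"
    using hsum_split[OF X(1), of "incr l \<nu>" t x] l by (simp add: length_incr)
  also have "\<dots> = (\<Sum>J | J \<subseteq> X \<and> card J = l. hlA t x J (X - J) * ((\<Prod>i\<in>J. x i) * hsum t x J \<nu>) * hlV t (card X - l))"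
  proof (intro sum.cong refl; clarify)
    fix J assume J: "J \<subseteq> X" "l = card J"
    have "finite J" using J(1) X(1) by (rule finite_subset)
    moreover have "hsum t x (X - J) [] = hlV t (card (X - J))"
      using X t1 by (intro hsum_Nil) (auto simp: generic_def inj_on_def)
    ultimately show "hlA t x J (X - J) * hsum t x J (incr (card J) \<nu>) * hsum t x (X - J) []
      = hlA t x J (X - J) * ((\<Prod>i\<in>J. x i) * hsum t x J \<nu>) * hlV t (card X - card J)"
      using J l X by (simp add: hsum_incr card_Diff_subset)
  qed
  finally have "HLX t x X (incr l \<nu>) = (\<Sum>J | J \<subseteq> X \<and> card J = l. hlA t x J (X - J) * ((\<Prod>i\<in>J. x i) * hsum t x J \<nu>) / hl_v l \<nu> t)"
    using hlV_nonzero[OF t, of "card X - l"] l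
    by (simp add: HLX_def hl_v_incr sum_divide_distrib mult_ac)
  also have "\<dots> = (\<Sum>J | J \<subseteq> X \<and> card J = l. hlA t x J (X - J) * (\<Prod>i\<in>J. x i) * HLX t x J \<nu>)"
    by (intro sum.cong refl) (auto simp: HLX_def)
  finally show ?thesis .
qed

text \<open>The partitions are sorted by the height \<open>l\<close> of their first column; together
  with the sum over \<open>J\<close> of size \<open>l\<close> this becomes one sum over all
  subsets.\<close>

lemma sum_HLX_Parts:
  fixes x :: "nat \<Rightarrow> 'a::field"
  assumes "finite X" "generic x X" and t: "\<And>k. t ^ Suc k \<noteq> 1"
  shows "(\<Sum>\<mu>\<in>Parts m (card X). HLX t x X \<mu>) = boundedSum t x m X"
  using assms(1,2)
proof (induction m arbitrary: X)
  case 0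
  have "t \<noteq> 1" using t[of 0] by simp
  then have "hsum t x X [] = hlV t (card X)"
    using 0 by (intro hsum_Nil) (auto simp: generic_def inj_on_def)
  moreover have "hl_v (card X) [] t = hlV t (card X)"
    by (simp add: hl_v_def hlV_def part_def Defs.mult_def)
  ultimately show ?case
    using hlV_nonzero[OF t] by (simp add: Parts_0 HLX_def)
next
  case (Suc m)
  have len: "length \<mu> = l" if "\<mu> \<in> incr l ` Parts m l" for \<mu> l
    using that by (auto simp: Parts_def length_incr)
  have inj: "inj_on (incr l) (Parts m l)" for l
    by (rule inj_on_subset[OF inj_on_incr]) (auto simp: Parts_def)
  have "(\<Sum>\<mu>\<in>Parts (Suc m) (card X). HLX t x X \<mu>) = (\<Sum>l\<le>card X. \<Sum>\<mu>\<in>incr l ` Parts m l. HLX t x X \<mu>)"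
    unfolding Parts_Suc
  proof (rule sum.UNION_disjoint)
    show "\<forall>i\<in>{..card X}. \<forall>j\<in>{..card X}. i \<noteq> j \<longrightarrow> incr i ` Parts m i \<inter> incr j ` Parts m j = {}"
    proof (intro ballI impI equals0I)
      fix i j \<mu> assume "i \<noteq> j" "\<mu> \<in> incr i ` Parts m i \<inter> incr j ` Parts m j"
      then show False using len[of \<mu> i] len[of \<mu> j] by simp
    qed
  qed (simp_all add: finite_Parts)
  also have "\<dots> = (\<Sum>l\<le>card X. \<Sum>\<nu>\<in>Parts m l. HLX t x X (incr l \<nu>))"
    by (simp add: sum.reindex[OF inj])
  also have "\<dots> = (\<Sum>l\<le>card X. \<Sum>\<nu>\<in>Parts m l. \<Sum>J | J \<subseteq> X \<and> card J = l. hlA t x J (X - J) * (\<Prod>i\<in>J. x i) * HLX t x J \<nu>)"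
    using Suc.prems t by (intro sum.cong refl HLX_incr) (auto simp: Parts_def)
  also have "\<dots> = (\<Sum>l\<le>card X. \<Sum>J | J \<subseteq> X \<and> card J = l. hlA t x J (X - J) * (\<Prod>i\<in>J. x i) * boundedSum t x m J)"
  proof (intro sum.cong refl)
    fix l
    have "(\<Sum>\<nu>\<in>Parts m (card J). HLX t x J \<nu>) = boundedSum t x m J" if "J \<subseteq> X" for J
      by (rule Suc.IH[OF finite_subset[OF that Suc.prems(1)] generic_subset[OF Suc.prems(2) that]])
    then show "(\<Sum>\<nu>\<in>Parts m l. \<Sum>J | J \<subseteq> X \<and> card J = l. hlA t x J (X - J) * (\<Prod>i\<in>J. x i) * HLX t x J \<nu>)
       = (\<Sum>J | J \<subseteq> X \<and> card J = l. hlA t x J (X - J) * (\<Prod>i\<in>J. x i) * boundedSum t x m J)"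
      by (subst sum.swap) (auto simp: sum_distrib_left[symmetric] intro!: sum.cong)
  qed
  also have "\<dots> = (\<Sum>J\<in>Pow X. hlA t x J (X - J) * (\<Prod>i\<in>J. x i) * boundedSum t x m J)"
  proof -
    have "(\<Sum>l\<in>{..card X}. sum G {J \<in> Pow X. card J = l}) = sum G (Pow X)" for G :: "nat set \<Rightarrow> 'a"
      using Suc.prems by (intro sum.group) (auto intro: card_mono)
    then show ?thesis by (simp add: Pow_def)
  qed
  finally show ?case by simp
qed

section \<open>Comparison with the Hall-Littlewood polynomials as originally defined\<close>

lemma hall_littlewood_eq_HLX:
  fixes x :: "nat \<Rightarrow> 'a::field"
  assumes "generic x {..<n}"
  shows "hall_littlewood n \<mu> x t = (if length \<mu> \<le> n then HLX t x {..<n} \<mu> else 0)"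
proof -
  let ?c = "\<lambda>a b. hlB t (x b / x a)"
  have "hsum t x {..<n} \<mu> = (\<Sum>w | w permutes {..<n}. (\<Prod>i<length (map w [0..<n]). x (map w [0..<n] ! i) ^ part \<mu> i) * crossl ?c (map w [0..<n]))"
    unfolding hsum_def by (subst sum_permutes_eq_lists) (rule refl)
  also have "\<dots> = (\<Sum>w | w permutes {..<n}. (\<Prod>i<n. x (w i) ^ part \<mu> i) *
           (\<Prod>(i, j)\<in>{(i, j). i < j \<and> j < n}. (x (w i) - t * x (w j)) / (x (w i) - x (w j))))"
  proof (intro sum.cong refl arg_cong2[where f = "(*)"]; clarify?)
    fix w assume w: "w permutes {..<n}"
    show "(\<Prod>i<length (map w [0..<n]). x (map w [0..<n] ! i) ^ part \<mu> i) = (\<Prod>i<n. x (w i) ^ part \<mu> i)"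
      by simp
    have "distinct (map w [0..<n])"
      using permutes_inj_on[OF w] by (simp add: distinct_map lessThan_atLeast0)
    then have "crossl ?c (map w [0..<n]) = (\<Prod>(i, j)\<in>{(i, j). i < j \<and> j < n}. ?c (map w [0..<n] ! i) (map w [0..<n] ! j))"
      by (subst crossl_nth) auto
    also have "\<dots> = (\<Prod>(i, j)\<in>{(i, j). i < j \<and> j < n}. (x (w i) - t * x (w j)) / (x (w i) - x (w j)))"
    proof (intro prod.cong refl; clarsimp)
      fix i j assume ij: "i < j" "j < n"
      have "w i < n" "w j < n" using permutes_in_image[OF w] ij by auto
      then have "x (w i) \<noteq> 0" using assms by (auto simp: generic_def)
      then show "hlB t (x (w j) / x (w i)) = (x (w i) - t * x (w j)) / (x (w i) - x (w j))"
        by (simp add: hlB_def divide_simps)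
    qed
    finally show "crossl ?c (map w [0..<n]) = (\<Prod>(i, j)\<in>{(i, j). i < j \<and> j < n}. (x (w i) - t * x (w j)) / (x (w i) - x (w j)))" .
  qed
  finally show ?thesis
    by (simp add: hall_littlewood_def HLX_def)
qed

lemma hall_littlewood_scale:
  assumes "length \<mu> \<le> n" "c \<noteq> 0"
  shows "hall_littlewood n \<mu> (\<lambda>i. c * x i) t = c ^ sum_list \<mu> * hall_littlewood n \<mu> x t"
proof -
  have "sum_list \<mu> = (\<Sum>i<n. part \<mu> i)"
  proof -
    have "sum_list \<mu> = (\<Sum>i<length \<mu>. part \<mu> i)"
      by (simp add: sum_list_sum_nth atLeast0LessThan part_def)
    also have "\<dots> = (\<Sum>i<n. part \<mu> i)"
      using assms by (intro sum.mono_neutral_left) (auto simp: part_def)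
    finally show ?thesis .
  qed
  then have c: "c ^ sum_list \<mu> = (\<Prod>i<n. c ^ part \<mu> i)"
    by (simp add: power_sum)
  have *: "(c * x (w i) - t * (c * x (w j))) / (c * x (w i) - c * x (w j)) = (x (w i) - t * x (w j)) / (x (w i) - x (w j))" for w i j
  proof -
    have "c * x (w i) - t * (c * x (w j)) = c * (x (w i) - t * x (w j))" "c * x (w i) - c * x (w j) = c * (x (w i) - x (w j))"
      by (simp_all add: algebra_simps)
    then show ?thesis using assms(2) by simp
  qed
  show ?thesis
    unfolding hall_littlewood_def * by (simp add: c power_mult_distrib prod.distrib sum_distrib_left mult_ac)
qed

lemma vge_inverse_one_minus:
  fixes u :: "'a::field fls"
  assumes "vge 1 u"
  shows "1 - u \<noteq> 0" "vge 0 (1 / (1 - u))"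
proof -
  have *: "fls_nth (1 - u) 0 \<noteq> 0" "\<forall>i<0. fls_nth (1 - u) i = 0"
    using assms by (auto simp: vge_def)
  then show "1 - u \<noteq> 0" by auto
  have "fls_subdegree (1 - u) = 0"
    using * by (intro fls_subdegree_eqI) auto
  then show "vge 0 (1 / (1 - u))"
    using \<open>1 - u \<noteq> 0\<close> by (auto simp: vge_iff_subdegree divide_inverse fls_inverse_subdegree)
qed

lemma vge_prod_minus_one:
  fixes f :: "'i \<Rightarrow> 'a::field fls"
  assumes "\<And>i. i \<in> I \<Longrightarrow> vge k (f i - 1)" "k \<ge> 0"
  shows "vge k (prod f I - 1)"
  using assms(1)
proof (induction I rule: infinite_finite_induct)
  case (insert i I)
  have "vge k (f i - 1)" "vge k (prod f I - 1)" using insert by auto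
  then have "vge k ((f i - 1) * (prod f I - 1) + (f i - 1) + (prod f I - 1))"
    by (intro vge_add) (auto intro: vge_mono[OF vge_mult] simp: assms(2))
  also have "(f i - 1) * (prod f I - 1) + (f i - 1) + (prod f I - 1) = prod f (insert i I) - 1"
    using insert by (simp add: algebra_simps)
  finally show ?case .
qed auto

lemma fls_subdegree_power_int:
  fixes s :: "'a::field fls"
  assumes "s \<noteq> 0"
  shows "fls_subdegree (s powi k) = k * fls_subdegree s"
proof (cases "k \<ge> 0")
  case True
  then show ?thesis using assms by (simp add: power_int_def fls_subdegree_pow)
next
  case False
  then show ?thesis using assms
    by (simp add: power_int_def fls_subdegree_pow fls_inverse_subdegree)
qed

section \<open>The principal specialisation\<close>

text \<open>\<open>s\<close> is not fixed to X because the results are needed for s = X, s = X^(2 n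
  + 1) and s = X^\<kappa>.\<close>

locale nome =
  fixes s :: "rat fls"
  assumes s_nonzero: "s \<noteq> 0" and vge_s: "vge 1 s"
begin

lemma deg_s: "fls_subdegree s \<ge> 1"
  using s_nonzero vge_s by (simp add: vge_iff_subdegree)

lemma powi_eq_1_iff [simp]: "s powi k = 1 \<longleftrightarrow> k = 0"
proof
  assume "s powi k = 1"
  then have "k * fls_subdegree s = 0"
    using fls_subdegree_power_int[OF s_nonzero, of k] by simp
  then show "k = 0" using deg_s by simp
qed simp

lemma powi_eq_iff [simp]: "s powi j = s powi k \<longleftrightarrow> j = k"
proof
  assume *: "s powi j = s powi k"
  have "s powi (j - k) = s powi j / s powi k"
    using s_nonzero by (intro power_int_diff) auto
  also have "\<dots> = 1" using * s_nonzero by (simp add: power_int_eq_0_iff)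
  finally show "j = k" by simp
qed simp

lemma power_eq_1_iff [simp]: "s ^ k = 1 \<longleftrightarrow> k = 0"
  using powi_eq_1_iff[of "int k"] by simp

lemma power_eq_iff [simp]: "s ^ j = s ^ k \<longleftrightarrow> j = k"
  using powi_eq_iff[of "int j" "int k"] by simp

lemma vge_powi: "vge (k * fls_subdegree s) (s powi k)"
  using fls_subdegree_power_int[OF s_nonzero, of k] by (simp add: vge_iff_subdegree)

lemma vge_powi': "0 \<le> j \<Longrightarrow> j \<le> k \<Longrightarrow> vge j (s powi k)"
proof (rule vge_mono[OF vge_powi])
  assume "0 \<le> j" "j \<le> k"
  then have "k * 1 \<le> k * fls_subdegree s" using deg_s by (intro mult_left_mono) auto
  then show "j \<le> k * fls_subdegree s" using \<open>j \<le> k\<close> by simp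
qed

lemma vge_spow: "j \<le> int k \<Longrightarrow> vge j (s ^ k)"
  using vge_powi'[of "max 0 j" "int k"] vge_mono[of "max 0 j" "s ^ k" j] by simp

lemma hlB_inverse:
  assumes "u \<noteq> 0" "u \<noteq> (1 :: 'a::field)"
  shows "hlB t u = (t - 1 / u) / (1 - 1 / u)"
  using assms by (simp add: hlB_def divide_simps) (simp add: algebra_simps)

text \<open>For negative \<open>k\<close> the argument u has a pole, but then (1 - t u) / (1 - u) =
  (t - 1 / u) / (1 - 1 / u) is a quotient of integral series with unit denominator.\<close>

lemma vge_hlB: "k \<noteq> 0 \<Longrightarrow> vge 0 (hlB (s ^ j) (s powi k))"
proof (cases "k > 0")
  case True
  then have "vge 0 (1 / (1 - s powi k))" "vge 0 (1 - s ^ j * s powi k)"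
    using vge_mult[OF vge_spow[of 0 j] vge_powi'[of 0 k]]
    by (auto intro!: vge_inverse_one_minus vge_powi' vge_diff vge_one)
  from vge_mult[OF this(2,1)] show ?thesis by (simp add: hlB_def)
next
  case False
  assume "k \<noteq> 0"
  then have k: "- k > 0" using False by simp
  have u: "1 / s powi k = s powi (- k)" by (simp add: power_int_minus divide_inverse)
  have "vge 0 (1 / (1 - s powi (- k)))" "vge 0 (s ^ j - s powi (- k))"
    using k by (auto intro!: vge_inverse_one_minus vge_powi' vge_diff vge_spow)
  from vge_mult[OF this(2,1)] show ?thesis
    using \<open>k \<noteq> 0\<close> s_nonzero by (subst hlB_inverse) (auto simp: u power_int_eq_0_iff)
qed

lemma vge_hlB_minus_one:
  assumes "k > 0"
  shows "vge k (hlB (s ^ j) (s powi k) - 1)"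
proof -
  have ne: "1 - s powi k \<noteq> 0" and i: "vge 0 (1 / (1 - s powi k))"
    using assms by (auto intro!: vge_inverse_one_minus vge_powi')
  have "vge (k + 0 + 0) (s powi k * (1 - s ^ j) * (1 / (1 - s powi k)))"
    using assms i by (intro vge_mult) (auto intro!: vge_powi' vge_diff vge_one vge_spow)
  also have "s powi k * (1 - s ^ j) * (1 / (1 - s powi k)) = hlB (s ^ j) (s powi k) - 1"
    using ne by (simp add: hlB_def field_simps)
  finally show ?thesis by simp
qed

definition xs :: "nat \<Rightarrow> rat fls" where
  "xs i = s ^ (2 * i + 1)"

lemma xs_powi: "xs i = s powi (2 * int i + 1)"
  by (simp add: xs_def power_int_add s_nonzero power_int_mult power_add power_mult)

lemma xs_nonzero [simp]: "xs i \<noteq> 0"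
  by (simp add: xs_def s_nonzero)

lemma xs_divide: "xs k / xs i = s powi (2 * (int k - int i))"
  using power_int_diff[of s "2 * int k + 1" "2 * int i + 1"] s_nonzero by (simp add: xs_powi algebra_simps)

lemma generic_xs: "generic xs X"
proof -
  have "xs i \<noteq> 1" for i unfolding xs_def power_eq_1_iff by simp
  moreover have "xs i = xs j \<longleftrightarrow> i = j" for i j unfolding xs_def power_eq_iff by simp
  moreover have "xs i * xs j \<noteq> 1" for i j unfolding xs_def power_add[symmetric] power_eq_1_iff by simp
  ultimately show ?thesis by (simp add: generic_def)
qed

lemma vge_xs: "vge (2 * int i + 1) (xs i)"
  unfolding xs_def by (rule vge_spow) simp

lemma vge_hlA:
  assumes "J \<inter> Y = {}"
  shows "vge 0 (hlA (s ^ j) xs J Y)"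
  unfolding hlA_def xs_divide using assms by (intro vge_prod_0 vge_hlB) auto

lemma t_power_neq: "n \<ge> 1 \<Longrightarrow> (s ^ (4 * n)) ^ Suc k \<noteq> 1"
  unfolding power_mult[symmetric] by simp

lemma sum_list_incr: "length \<nu> \<le> l \<Longrightarrow> sum_list (incr l \<nu>) = sum_list \<nu> + l"
proof -
  have "sum_list (map Suc \<nu>) = sum_list \<nu> + length \<nu>" by (induction \<nu>) auto
  then show "length \<nu> \<le> l \<Longrightarrow> sum_list (incr l \<nu>) = sum_list \<nu> + l"
    by (simp add: incr_def sum_list_replicate)
qed

lemma vge_prod_xs: "finite J \<Longrightarrow> vge (int (\<Sum>i\<in>J. 2 * i + 1)) (\<Prod>i\<in>J. xs i)"
  using vge_prod[of J "\<lambda>i. 2 * int i + 1" xs] vge_xs by (simp add: algebra_simps)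

text \<open>Each column of height \<open>l\<close> contributes a product of \<open>l\<close>
  distinct variables, of valuation at least \<open>l\<close>, times integral factors. The bound is
  uniform in the number of variables and so dominates the sum over partitions.\<close>

lemma vge_HLX:
  assumes n: "n \<ge> 1"
  shows "is_partition \<mu> \<Longrightarrow> finite X \<Longrightarrow> length \<mu> \<le> card X \<Longrightarrow> vge (int (sum_list \<mu>)) (HLX (s ^ (4 * n)) xs X \<mu>)"
proof (induction "sum_list \<mu>" arbitrary: \<mu> X rule: less_induct)
  case less
  obtain \<nu> where \<nu>: "is_partition \<nu>" "length \<nu> \<le> length \<mu>" "incr (length \<mu>) \<nu> = \<mu>"
    using partition_as_incr[OF less.prems(1)] by blast
  show ?case
  proof (cases "\<mu> = []")
    case True
    have t1: "s ^ (4 * n) \<noteq> 1" using n by simp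
    have "hsum (s ^ (4 * n)) xs X [] = hlV (s ^ (4 * n)) (card X)"
      using less.prems t1 generic_xs[of X] by (intro hsum_Nil) (auto simp: generic_def inj_on_def)
    moreover have "hl_v (card X) [] (s ^ (4 * n)) = hlV (s ^ (4 * n)) (card X)"
      by (simp add: hl_v_def hlV_def part_def Defs.mult_def)
    ultimately show ?thesis
      using hlV_nonzero[of "s ^ (4 * n)" "card X"] t_power_neq[OF n] True by (simp add: HLX_def vge_one)
  next
    case False
    have sl: "sum_list \<mu> = sum_list \<nu> + length \<mu>" using sum_list_incr[OF \<nu>(2)] \<nu>(3) by simp
    have "HLX (s ^ (4 * n)) xs X (incr (length \<mu>) \<nu>)
      = (\<Sum>J | J \<subseteq> X \<and> card J = length \<mu>. hlA (s ^ (4 * n)) xs J (X - J) * (\<Prod>i\<in>J. xs i) * HLX (s ^ (4 * n)) xs J \<nu>)"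
      using less.prems \<nu>(2) generic_xs t_power_neq[OF n] by (intro HLX_incr) auto
    moreover have "vge (int (sum_list \<mu>)) \<dots>"
    proof (rule vge_sum; clarify)
      fix J assume J: "J \<subseteq> X" "card J = length \<mu>"
      have fJ: "finite J" using J(1) less.prems(2) by (rule finite_subset)
      have "vge (int (sum_list \<nu>)) (HLX (s ^ (4 * n)) xs J \<nu>)"
        using \<nu> J False fJ sl by (intro less.hyps) auto
      moreover have "int (card J) \<le> int (\<Sum>i\<in>J. 2 * i + 1)"
        unfolding of_nat_le_iff using sum_mono[of J "\<lambda>_. 1" "\<lambda>i. 2 * i + 1"] by simp
      then have "vge (int (card J)) (\<Prod>i\<in>J. xs i)"
        by (rule vge_mono[OF vge_prod_xs[OF fJ]])
      moreover have "vge 0 (hlA (s ^ (4 * n)) xs J (X - J))"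
        by (rule vge_hlA) auto
      ultimately have "vge (0 + int (card J) + int (sum_list \<nu>)) (hlA (s ^ (4 * n)) xs J (X - J) * (\<Prod>i\<in>J. xs i) * HLX (s ^ (4 * n)) xs J \<nu>)"
        by (intro vge_mult)
      then show "vge (int (sum_list \<mu>)) (hlA (s ^ (4 * n)) xs J (X - J) * (\<Prod>i\<in>J. xs i) * HLX (s ^ (4 * n)) xs J \<nu>)"
        by (simp add: sl J add.commute)
    qed
    ultimately show ?thesis using \<nu>(3) by simp
  qed
qed

text \<open>A new variable x_N changes the product only by the factors \<open>hlB\<close> at x_N /
  x_i, which tend to 1 as N grows.\<close>

lemma convergent_hlA:
  assumes "finite J"
  shows "convergent (\<lambda>N. hlA (s ^ j) xs J ({..<N} - J))"
proof (rule fls_convergentI)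
  fix k :: int
  obtain M where M: "\<And>i. i \<in> J \<Longrightarrow> i < M"
    using assms finite_nat_set_iff_bounded by auto
  have "vge k (hlA (s ^ j) xs J ({..<Suc N} - J) - hlA (s ^ j) xs J ({..<N} - J))" if "N \<ge> M + nat k" for N
  proof -
    have "{..<Suc N} - J = insert N ({..<N} - J)" using M[of N] that by (auto simp: less_Suc_eq)
    then have "hlA (s ^ j) xs J ({..<Suc N} - J) = (\<Prod>i\<in>J. hlB (s ^ j) (xs N / xs i)) * hlA (s ^ j) xs J ({..<N} - J)"
      by (simp add: hlA_def prod.distrib)
    then have "hlA (s ^ j) xs J ({..<Suc N} - J) - hlA (s ^ j) xs J ({..<N} - J)
      = ((\<Prod>i\<in>J. hlB (s ^ j) (xs N / xs i)) - 1) * hlA (s ^ j) xs J ({..<N} - J)"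
      by (simp add: algebra_simps)
    moreover have "vge (max 0 k) ((\<Prod>i\<in>J. hlB (s ^ j) (xs N / xs i)) - 1)"
    proof (rule vge_prod_minus_one)
      fix i assume i: "i \<in> J"
      show "vge (max 0 k) (hlB (s ^ j) (xs N / xs i) - 1)"
        unfolding xs_divide using M[OF i] that by (intro vge_mono[OF vge_hlB_minus_one]) auto
    qed simp
    moreover have "vge 0 (hlA (s ^ j) xs J ({..<N} - J))" by (rule vge_hlA) auto
    ultimately show ?thesis
      using vge_mult[of "max 0 k" _ 0] vge_mono[of "max 0 k + 0" _ k] by fastforce
  qed
  then show "\<forall>\<^sub>F N in sequentially. vge k (hlA (s ^ j) xs J ({..<Suc N} - J) - hlA (s ^ j) xs J ({..<N} - J))"
    by (auto simp: eventually_sequentially)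
qed

lemma finite_sum_less: "finite {J. finite J \<and> int (\<Sum>i\<in>J. 2 * i + 1) < k}"
proof (rule finite_subset)
  show "{J. finite J \<and> int (\<Sum>i\<in>J. 2 * i + 1) < k} \<subseteq> Pow {..<nat k}"
  proof clarify
    fix J i assume J: "finite J" "int (\<Sum>i\<in>J. 2 * i + 1) < k" "i \<in> J"
    have "2 * i + 1 \<le> (\<Sum>i\<in>J. 2 * i + 1)" using J by (intro member_le_sum) auto
    then show "i < nat k" using J(2) by linarith
  qed
qed simp

text \<open>\<open>hall_littlewood_inf\<close> is a \<open>lim\<close> and carries information only
  if the limit exists. Splitting off the first column gives a sum over sets \<open>J\<close> in
  which every term converges, and the valuation of the product over \<open>J\<close>
  dominates.\<close>

lemma convergent_hall_littlewood:
  assumes n: "n \<ge> 1" and \<mu>: "is_partition \<mu>"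
  shows "convergent (\<lambda>N. hall_littlewood N \<mu> xs (s ^ (4 * n)))"
proof -
  define t where "t = s ^ (4 * n)"
  obtain \<nu> where \<nu>: "is_partition \<nu>" "length \<nu> \<le> length \<mu>" "incr (length \<mu>) \<nu> = \<mu>"
    using partition_as_incr[OF \<mu>] by blast
  define A where "A = {J :: nat set. finite J \<and> card J = length \<mu>}"
  \<comment> \<open>Sets that need variables beyond the first \<open>N\<close> count as 0, so that
    the index set does not depend on \<open>N\<close>.\<close>
  define a where "a N J = (if J \<subseteq> {..<N} then hlA t xs J ({..<N} - J) * (\<Prod>i\<in>J. xs i) * HLX t xs J \<nu> else 0)" for N J
  define b where "b J = lim (\<lambda>N. hlA t xs J ({..<N} - J)) * (\<Prod>i\<in>J. xs i) * HLX t xs J \<nu>" for J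
  have "\<exists>S. (b has_sum S) A \<and> (\<lambda>N. hall_littlewood N \<mu> xs t) \<longlonglongrightarrow> S"
  proof (rule has_sum_dominated[where v = "\<lambda>J. int (\<Sum>i\<in>J. 2 * i + 1)"])
    fix J assume J: "J \<in> A"
    then have fJ: "finite J" by (simp add: A_def)
    obtain M where M: "\<And>i. i \<in> J \<Longrightarrow> i < M"
      using fJ finite_nat_set_iff_bounded by auto
    have "(\<lambda>N. hlA t xs J ({..<N} - J)) \<longlonglongrightarrow> lim (\<lambda>N. hlA t xs J ({..<N} - J))"
      using convergent_hlA[OF fJ] unfolding t_def by (simp add: convergent_LIMSEQ_iff)
    then have "(\<lambda>N. hlA t xs J ({..<N} - J) * (\<Prod>i\<in>J. xs i) * HLX t xs J \<nu>) \<longlonglongrightarrow> b J"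
      unfolding b_def by (intro tendsto_mult tendsto_const)
    moreover have "\<forall>\<^sub>F N in sequentially. hlA t xs J ({..<N} - J) * (\<Prod>i\<in>J. xs i) * HLX t xs J \<nu> = a N J"
      using eventually_ge_at_top[of M]
    proof eventually_elim
      case (elim N)
      then have "J \<subseteq> {..<N}" using M by fastforce
      then show ?case by (simp add: a_def)
    qed
    ultimately show "(\<lambda>N. a N J) \<longlonglongrightarrow> b J" by (rule Lim_transform_eventually)
    fix N
    have "vge (0 + int (\<Sum>i\<in>J. 2 * i + 1) + 0) (hlA t xs J ({..<N} - J) * (\<Prod>i\<in>J. xs i) * HLX t xs J \<nu>)"
    proof (intro vge_mult vge_prod_xs fJ)
      show "vge 0 (hlA t xs J ({..<N} - J))" unfolding t_def by (rule vge_hlA) auto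
      show "vge 0 (HLX t xs J \<nu>)"
        unfolding t_def using vge_HLX[OF n \<nu>(1) fJ] \<nu>(2) J by (intro vge_mono[OF vge_HLX[OF n \<nu>(1) fJ]]) (auto simp: A_def)
    qed
    then show "vge (int (\<Sum>i\<in>J. 2 * i + 1)) (a N J)" by (simp add: a_def)
  next
    fix k show "finite {J \<in> A. int (\<Sum>i\<in>J. 2 * i + 1) < k}"
      by (rule finite_subset[OF _ finite_sum_less[of k]]) (auto simp: A_def)
  next
    fix N
    show "(a N has_sum hall_littlewood N \<mu> xs t) A"
    proof (rule has_sum_finite_neutralI)
      show "finite {J. J \<subseteq> {..<N} \<and> card J = length \<mu>}" by simp
      show "{J. J \<subseteq> {..<N} \<and> card J = length \<mu>} \<subseteq> A"
        by (auto simp: A_def dest: finite_subset)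
      show "a N J = 0" if "J \<in> A - {J. J \<subseteq> {..<N} \<and> card J = length \<mu>}" for J
        using that by (auto simp: A_def a_def)
      have e: "hall_littlewood N \<mu> xs t = (if length \<mu> \<le> N then HLX t xs {..<N} \<mu> else 0)"
        by (rule hall_littlewood_eq_HLX[OF generic_xs])
      show "hall_littlewood N \<mu> xs t = sum (a N) {J. J \<subseteq> {..<N} \<and> card J = length \<mu>}"
      proof (cases "length \<mu> \<le> N")
        case True
        have "HLX t xs {..<N} (incr (length \<mu>) \<nu>) = (\<Sum>J | J \<subseteq> {..<N} \<and> card J = length \<mu>. hlA t xs J ({..<N} - J) * (\<Prod>i\<in>J. xs i) * HLX t xs J \<nu>)"
          unfolding t_def using True \<nu>(2) generic_xs t_power_neq[OF n] by (intro HLX_incr) auto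
        then show ?thesis using e True \<nu>(3) by (simp add: a_def)
      next
        case False
        have "{J. J \<subseteq> {..<N} \<and> card J = length \<mu>} = {}"
        proof (rule equals0I)
          fix J assume "J \<in> {J. J \<subseteq> {..<N} \<and> card J = length \<mu>}"
          then have "length \<mu> \<le> card {..<N}" using card_mono[of "{..<N}" J] by auto
          then show False using False by simp
        qed
        then show ?thesis using e False by (simp only: sum.empty if_False)
      qed
    qed
  qed simp
  then show ?thesis unfolding t_def by (auto simp: convergent_def)
qed

text \<open>x_i = s q^i is the principal alphabet scaled by s, so homogeneity turns the scaling into
  the factor q^(|\<mu>| / 2).\<close>

lemma hall_littlewood_xs_tendsto:
  assumes n: "n \<ge> 1" and \<mu>: "is_partition \<mu>"
  shows "(\<lambda>N. hall_littlewood N \<mu> xs (s ^ (4 * n)))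
    \<longlonglongrightarrow> s ^ sum_list \<mu> * hall_littlewood_inf \<mu> (\<lambda>k. (s ^ 2) ^ k) ((s ^ 2) ^ (2 * n))"
proof -
  define t where "t = s ^ (4 * n)"
  have t: "(s ^ 2) ^ (2 * n) = t" by (simp add: t_def power_mult[symmetric])
  obtain L where L: "(\<lambda>N. hall_littlewood N \<mu> xs t) \<longlonglongrightarrow> L"
    using convergent_hall_littlewood[OF assms] by (auto simp: convergent_def t_def)
  have xs: "xs = (\<lambda>i. s * (s ^ 2) ^ i)"
    by (auto simp: xs_def power_mult)
  have "(\<lambda>N. inverse (s ^ sum_list \<mu>) * hall_littlewood N \<mu> xs t) \<longlonglongrightarrow> inverse (s ^ sum_list \<mu>) * L"
    by (intro tendsto_mult tendsto_const L)
  moreover have "\<forall>\<^sub>F N in sequentially. inverse (s ^ sum_list \<mu>) * hall_littlewood N \<mu> xs t = hall_littlewood N \<mu> (\<lambda>k. (s ^ 2) ^ k) t"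
    using eventually_ge_at_top[of "length \<mu>"]
  proof eventually_elim
    case (elim N)
    then show ?case unfolding xs using hall_littlewood_scale[of \<mu> N s "\<lambda>i. (s ^ 2) ^ i" t] s_nonzero by simp
  qed
  ultimately have "(\<lambda>N. hall_littlewood N \<mu> (\<lambda>k. (s ^ 2) ^ k) t) \<longlonglongrightarrow> inverse (s ^ sum_list \<mu>) * L"
    by (rule Lim_transform_eventually)
  then have "hall_littlewood_inf \<mu> (\<lambda>k. (s ^ 2) ^ k) t = inverse (s ^ sum_list \<mu>) * L"
    unfolding hall_littlewood_inf_def by (rule limI)
  then show ?thesis using L s_nonzero unfolding t_def[symmetric] t by (simp add: mult.assoc[symmetric])
qed

text \<open>The sum over partitions is exchanged with the limit of infinitely many variables; for
  \<open>N\<close> variables it is a finite sum over \<open>Parts m N\<close>.\<close>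

theorem sum_hall_littlewood_eq_limit:
  assumes n: "n \<ge> 1"
  shows "\<exists>S. ((\<lambda>\<mu>. s ^ sum_list \<mu> * hall_littlewood_inf \<mu> (\<lambda>k. (s ^ 2) ^ k) ((s ^ 2) ^ (2 * n))) has_sum S)
      {\<mu>. is_partition \<mu> \<and> part \<mu> 0 \<le> m}
    \<and> (\<lambda>N. PhiSum (s ^ (4 * n)) xs (\<lambda>i. xs i ^ m) {..<N}) \<longlonglongrightarrow> S"
proof (rule has_sum_dominated[where v = "\<lambda>\<mu>. int (sum_list \<mu>)"])
  let ?A = "{\<mu>. is_partition \<mu> \<and> part \<mu> 0 \<le> m}"
  have e: "hall_littlewood N \<mu> xs (s ^ (4 * n)) = (if length \<mu> \<le> N then HLX (s ^ (4 * n)) xs {..<N} \<mu> else 0)" for N \<mu>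
    by (rule hall_littlewood_eq_HLX[OF generic_xs])
  show "(\<lambda>N. hall_littlewood N \<mu> xs (s ^ (4 * n)))
    \<longlonglongrightarrow> s ^ sum_list \<mu> * hall_littlewood_inf \<mu> (\<lambda>k. (s ^ 2) ^ k) ((s ^ 2) ^ (2 * n))" if "\<mu> \<in> ?A" for \<mu>
    using hall_littlewood_xs_tendsto[OF n] that by simp
  show "vge (int (sum_list \<mu>)) (hall_littlewood N \<mu> xs (s ^ (4 * n)))" if "\<mu> \<in> ?A" for N \<mu>
    unfolding e using that by (auto intro!: vge_HLX[OF n])
  show "finite {\<mu> \<in> ?A. int (sum_list \<mu>) < k}" for k
  proof (rule finite_subset)
    show "{\<mu> \<in> ?A. int (sum_list \<mu>) < k} \<subseteq> Parts m (nat k)"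
    proof clarify
      fix \<mu> assume \<mu>: "is_partition \<mu>" "part \<mu> 0 \<le> m" "int (sum_list \<mu>) < k"
      have "length \<mu> \<le> sum_list \<mu>" using \<mu>(1)
        by (induction \<mu>) (auto simp: is_partition_Cons)
      then show "\<mu> \<in> Parts m (nat k)" using \<mu> by (simp add: Parts_def)
    qed
  qed (rule finite_Parts)
  show "((\<lambda>\<mu>. hall_littlewood N \<mu> xs (s ^ (4 * n))) has_sum PhiSum (s ^ (4 * n)) xs (\<lambda>i. xs i ^ m) {..<N}) ?A" for N
  proof (rule has_sum_finite_neutralI[OF finite_Parts[of m N]])
    show "Parts m N \<subseteq> ?A" by (auto simp: Parts_def)
    show "hall_littlewood N \<mu> xs (s ^ (4 * n)) = 0" if "\<mu> \<in> ?A - Parts m N" for \<mu>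
      using that by (auto simp: e Parts_def)
    have "(\<Sum>\<mu>\<in>Parts m N. hall_littlewood N \<mu> xs (s ^ (4 * n))) = (\<Sum>\<mu>\<in>Parts m (card {..<N}). HLX (s ^ (4 * n)) xs {..<N} \<mu>)"
      by (intro sum.cong) (auto simp: e Parts_def)
    also have "\<dots> = PhiSum (s ^ (4 * n)) xs (\<lambda>i. xs i ^ m) {..<N}"
      using t_power_neq[OF n] generic_xs by (subst sum_HLX_Parts) (auto simp: boundedSum_eq_PhiSum)
    finally show "PhiSum (s ^ (4 * n)) xs (\<lambda>i. xs i ^ m) {..<N} = (\<Sum>\<mu>\<in>Parts m N. hall_littlewood N \<mu> xs (s ^ (4 * n)))"
      by simp
  qed
qed simp

end

lemma tendsto_prod_fls:
  fixes f :: "'b \<Rightarrow> 'c \<Rightarrow> 'a::field fls"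
  assumes "\<And>i. i \<in> I \<Longrightarrow> (f i \<longlongrightarrow> l i) F"
  shows "((\<lambda>x. \<Prod>i\<in>I. f i x) \<longlongrightarrow> (\<Prod>i\<in>I. l i)) F"
  using assms by (induction I rule: infinite_finite_induct) (auto intro: tendsto_mult)

lemma neg_div_mod:
  fixes M z :: int
  assumes "M > 0"
  shows "(- z - 1) div M = - (z div M) - 1" "(- z - 1) mod M = M - 1 - z mod M"
proof -
  have z: "- z - 1 = M * (- (z div M) - 1) + (M - 1 - z mod M)"
    using mult_div_mod_eq[of M z] by (simp add: algebra_simps)
  have b: "0 \<le> M - 1 - z mod M" "M - 1 - z mod M < M"
    using assms pos_mod_bound[of M z] pos_mod_sign[of M z] by linarith+
  show "(- z - 1) div M = - (z div M) - 1" by (rule int_div_pos_eq[OF z b])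
  show "(- z - 1) mod M = M - 1 - z mod M" by (rule int_mod_pos_eq[OF z b])
qed

text \<open>The change of a Vandermonde product when one entry is replaced, cross-multiplied to
  avoid division by differences.\<close>

lemma prod_pairs_update:
  fixes w :: "nat \<Rightarrow> 'a::comm_ring_1"
  assumes i: "i < n"
  shows "(\<Prod>(a, b)\<in>{(a, b). a < b \<and> b < n}. (w(i := v)) b - (w(i := v)) a) * (\<Prod>j\<in>{..<n} - {i}. w i - w j)
    = (\<Prod>(a, b)\<in>{(a, b). a < b \<and> b < n}. w b - w a) * (\<Prod>j\<in>{..<n} - {i}. v - w j)"
proof -
  define R where "R = {(a, b). a < b \<and> b < n \<and> a \<noteq> i \<and> b \<noteq> i}"
  have fin: "finite R" unfolding R_def by (rule finite_subset[of _ "{..<n} \<times> {..<n}"]) auto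
  have set_eq: "{(a, b). a < b \<and> b < n} = R \<union> ((\<lambda>a. (a, i)) ` {..<i} \<union> (\<lambda>b. (i, b)) ` {i<..<n})"
    using i by (auto simp: R_def)
  have split: "(\<Prod>(a, b)\<in>{(a, b). a < b \<and> b < n}. f b - f a)
      = (\<Prod>(a, b)\<in>R. f b - f a) * ((\<Prod>a<i. f i - f a) * (\<Prod>b\<in>{i<..<n}. f b - f i))" for f :: "nat \<Rightarrow> 'a"
    unfolding set_eq using fin
    by (subst prod.union_disjoint, simp, simp, force simp: R_def, subst prod.union_disjoint)
       (auto simp: prod.reindex inj_on_def)
  have set2: "{..<n} - {i} = {..<i} \<union> {i<..<n}" using i by auto
  have split2: "(\<Prod>j\<in>{..<n} - {i}. g j) = (\<Prod>j<i. g j) * (\<Prod>j\<in>{i<..<n}. g j)" for g :: "nat \<Rightarrow> 'a"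
    unfolding set2 by (intro prod.union_disjoint) auto
  have 1: "(\<Prod>(a, b)\<in>R. (w(i := v)) b - (w(i := v)) a) = (\<Prod>(a, b)\<in>R. w b - w a)"
    by (intro prod.cong) (auto simp: R_def)
  have 2: "(\<Prod>a<i. (w(i := v)) i - (w(i := v)) a) = (\<Prod>a<i. v - w a)"
    by (intro prod.cong) auto
  have 3: "(\<Prod>b\<in>{i<..<n}. (w(i := v)) b - (w(i := v)) i) = (\<Prod>b\<in>{i<..<n}. - (v - w b))"
    by (intro prod.cong) auto
  have 4: "(\<Prod>b\<in>{i<..<n}. w b - w i) = (\<Prod>b\<in>{i<..<n}. - (w i - w b))"
    by (intro prod.cong) auto
  show ?thesis
    unfolding split split2 1 2 3 4 prod_uminus by (simp add: mult_ac)
qed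

section \<open>Reduction to a lattice sum\<close>

locale nome_n = nome +
  fixes n :: nat
  assumes n_pos: "n \<ge> 1"
begin

abbreviation M :: int where "M \<equiv> 2 * int n"

abbreviation t :: "rat fls" where "t \<equiv> s ^ (4 * n)"

text \<open>The variables are written as \<open>s\<^bsup>2 z + 1\<^esup>\<close> with \<open>z \<in> \<int>\<close>, so that inverting \<open>x\<^sub>a\<close> replaces \<open>z = a\<close> by
  \<open>z = - a - 1\<close>. Since \<open>1 - t y\<^sub>i y\<^sub>j\<close> must not vanish, the set of exponents \<open>z\<close> in use is closed under
  adding \<open>2 n\<close>, hence given by a threshold in each residue class. The thresholds of \<open>z\<close> and \<open>- z - 1\<close>
  are opposite because exactly one of the two exponents is in use.\<close>

definition thr :: "(nat \<Rightarrow> int) \<Rightarrow> int \<Rightarrow> int" where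
  "thr r \<rho> = (if \<rho> < int n then r (nat (int n - 1 - \<rho>)) else - r (nat (\<rho> - int n)))"

definition inT :: "(nat \<Rightarrow> int) \<Rightarrow> int \<Rightarrow> bool" where
  "inT r z \<longleftrightarrow> thr r (z mod M) \<le> z div M"

definition flipset :: "(nat \<Rightarrow> int) \<Rightarrow> nat set" where
  "flipset r = {a. \<not> inT r (int a)}"

definition expo :: "(nat \<Rightarrow> int) \<Rightarrow> nat \<Rightarrow> int" where
  "expo r a = (if inT r (int a) then int a else - int a - 1)"

text \<open>Exponent of s at the i-th point of the Weyl denominator. By \<open>two_minz\<close> it
  is, up to the shift 2 n, the exponent of a boundary variable of the configuration
  \<open>r\<close>.\<close>

definition gexp :: "(nat \<Rightarrow> int) \<Rightarrow> nat \<Rightarrow> int" where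
  "gexp r i = 4 * int n * r i - (2 * int i + 1)"

definition bounded :: "(nat \<Rightarrow> int) \<Rightarrow> nat \<Rightarrow> bool" where
  "bounded r L \<longleftrightarrow> (\<forall>i<n. \<bar>r i\<bar> \<le> int L)"

section \<open>Exponents in use and their thresholds\<close>

lemma M_pos: "M > 0"
  using n_pos by simp

lemma mod_range: "0 \<le> z mod M" "z mod M < M"
  using M_pos by auto

lemma thr_anti: "0 \<le> \<rho> \<Longrightarrow> \<rho> < M \<Longrightarrow> thr r (M - 1 - \<rho>) = - thr r \<rho>"
  by (auto simp: thr_def intro!: arg_cong[where f = r])

lemma thr_lower: "j < n \<Longrightarrow> thr r (int n - 1 - int j) = r j"
  by (simp add: thr_def)

lemma thr_upper: "thr r (int n + int j) = - r j"
  by (simp add: thr_def)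

lemma inT_neg: "inT r (- z - 1) \<longleftrightarrow> \<not> inT r z"
  unfolding inT_def neg_div_mod[OF M_pos] thr_anti[OF mod_range] by linarith

lemma inT_repr: "0 \<le> \<rho> \<Longrightarrow> \<rho> < M \<Longrightarrow> inT r (\<rho> + M * d) \<longleftrightarrow> thr r \<rho> \<le> d"
  by (simp add: inT_def)

lemma thr_bound:
  assumes "bounded r L" "0 \<le> \<rho>" "\<rho> < M"
  shows "\<bar>thr r \<rho>\<bar> \<le> int L"
proof (cases "\<rho> < int n")
  case True
  then have "nat (int n - 1 - \<rho>) < n" using assms by simp
  then show ?thesis using assms(1) True by (simp add: thr_def bounded_def)
next
  case False
  then have "nat (\<rho> - int n) < n" using assms by simp
  then show ?thesis using assms(1) False by (simp add: thr_def bounded_def)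
qed

lemma inT_ge: "bounded r L \<Longrightarrow> int L \<le> z div M \<Longrightarrow> inT r z"
  using thr_bound[OF _ mod_range, of r L z] by (auto simp: inT_def)

lemma div_M_ge: "M * k \<le> z \<Longrightarrow> k \<le> z div M"
  using M_pos by (metis nonzero_mult_div_cancel_left less_irrefl zdiv_mono1)

lemma div_M_less: "z < M * k \<Longrightarrow> z div M < k"
proof (rule ccontr)
  assume z: "z < M * k" and "\<not> z div M < k"
  then have "M * k \<le> M * (z div M)" using M_pos by (intro mult_left_mono) auto
  also have "\<dots> \<le> z" using mult_div_mod_eq[of M z] mod_range[of z] by linarith
  finally show False using z by simp
qed

lemma flipset_subset: "bounded r L \<Longrightarrow> flipset r \<subseteq> {..<2 * n * L}"
proof
  fix a assume b: "bounded r L" and a: "a \<in> flipset r"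
  show "a \<in> {..<2 * n * L}"
  proof (rule ccontr)
    assume "a \<notin> {..<2 * n * L}"
    then have "int (2 * n * L) \<le> int a" by (simp only: of_nat_le_iff) simp
    then have "M * int L \<le> int a" by simp
    then have "inT r (int a)" using inT_ge[OF b] div_M_ge by blast
    then show False using a by (simp add: flipset_def)
  qed
qed

lemma bounded_ex: "\<exists>L. bounded r L"
proof -
  have "bounded r (nat (\<Sum>i<n. \<bar>r i\<bar>))"
    unfolding bounded_def
  proof (intro allI impI)
    fix i assume "i < n"
    then have "\<bar>r i\<bar> \<le> (\<Sum>i<n. \<bar>r i\<bar>)" by (intro member_le_sum) auto
    then show "\<bar>r i\<bar> \<le> int (nat (\<Sum>i<n. \<bar>r i\<bar>))" by simp
  qed
  then show ?thesis by blast
qed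

lemma bounded_mono: "bounded r L \<Longrightarrow> L \<le> L' \<Longrightarrow> bounded r L'"
  by (fastforce simp: bounded_def)

lemma finite_flipset: "finite (flipset r)"
  using bounded_ex flipset_subset by (meson finite_lessThan finite_subset)

lemma inT_eq_if_flipset_eq:
  assumes "flipset r = flipset r'"
  shows "inT r z = inT r' z"
proof (cases "z \<ge> 0")
  case True
  have "nat z \<in> flipset r \<longleftrightarrow> nat z \<in> flipset r'" using assms by simp
  then show ?thesis using True by (simp add: flipset_def)
next
  case False
  have "nat (- z - 1) \<in> flipset r \<longleftrightarrow> nat (- z - 1) \<in> flipset r'" using assms by simp
  then show ?thesis using False inT_neg[of r z] inT_neg[of r' z] by (simp add: flipset_def)
qed

lemma inj_on_flipset: "inj_on flipset (PiE {..<n} (\<lambda>_. UNIV))"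
proof (rule inj_onI)
  fix r r' assume r: "r \<in> PiE {..<n} (\<lambda>_. UNIV)" "r' \<in> PiE {..<n} (\<lambda>_. UNIV)" "flipset r = flipset r'"
  show "r = r'"
  proof (rule PiE_ext[OF r(1,2)])
    fix j assume j: "j \<in> {..<n}"
    define \<rho> where "\<rho> = int n - 1 - int j"
    have \<rho>: "0 \<le> \<rho>" "\<rho> < M" using j by (auto simp: \<rho>_def)
    have "r j \<le> d \<longleftrightarrow> r' j \<le> d" for d
      using inT_eq_if_flipset_eq[OF r(3), of "\<rho> + M * d"] j
      unfolding inT_repr[OF \<rho>] by (simp add: \<rho>_def thr_lower)
    from this[of "r j"] this[of "r' j"] show "r j = r' j" by simp
  qed
qed

lemma flip_flipset: "flip xs (flipset r) a = s powi (2 * expo r a + 1)"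
proof (cases "inT r (int a)")
  case True
  then show ?thesis by (simp add: flip_def flipset_def expo_def xs_powi)
next
  case False
  have "1 / xs a = s powi (- (2 * int a + 1))"
    unfolding xs_powi power_int_minus by (simp add: divide_inverse)
  moreover have "- (2 * int a + 1) = 2 * (- int a - 1) + 1" by simp
  ultimately show ?thesis using False by (simp add: flip_def flipset_def expo_def)
qed

lemma inT_expo: "inT r (expo r a)"
  using inT_neg[of r "int a"] by (simp add: expo_def)

text \<open>For each index a exactly one of a and - a - 1 is in use, and for a < 2 n L these are all
  exponents in use below 2 n L. Sorted by residue modulo 2 n they form intervals from the threshold
  up to L - 1.\<close>

lemma expo_bij:
  assumes "bounded r L"
  shows "bij_betw (expo r) {..<2 * n * L} ((\<lambda>(\<rho>, d). \<rho> + M * d) ` (SIGMA \<rho>:{0..<M}. {thr r \<rho>..<int L}))"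
  unfolding bij_betw_def
proof
  show "inj_on (expo r) {..<2 * n * L}"
  proof (rule inj_onI)
    fix a b assume ab: "expo r a = expo r b"
    have "int a \<noteq> - int b - 1" "int b \<noteq> - int a - 1" by linarith+
    then show "a = b" using ab by (auto simp: expo_def split: if_splits)
  qed
  show "expo r ` {..<2 * n * L} = (\<lambda>(\<rho>, d). \<rho> + M * d) ` (SIGMA \<rho>:{0..<M}. {thr r \<rho>..<int L})"
  proof (intro equalityI subsetI)
    fix z assume "z \<in> expo r ` {..<2 * n * L}"
    then obtain a where a: "a < 2 * n * L" "z = expo r a" by auto
    have "int a < int (2 * n * L)" using a(1) by (simp only: of_nat_less_iff)
    then have "z < M * int L" using a(2) by (auto simp: expo_def)
    then have "z div M < int L" by (rule div_M_less)
    moreover have "thr r (z mod M) \<le> z div M" using inT_expo[of r a] a(2) by (simp add: inT_def)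
    ultimately show "z \<in> (\<lambda>(\<rho>, d). \<rho> + M * d) ` (SIGMA \<rho>:{0..<M}. {thr r \<rho>..<int L})"
      using mod_range[of z] by (intro image_eqI[of _ _ "(z mod M, z div M)"]) auto
  next
    fix z assume "z \<in> (\<lambda>(\<rho>, d). \<rho> + M * d) ` (SIGMA \<rho>:{0..<M}. {thr r \<rho>..<int L})"
    then obtain \<rho> d where z: "z = \<rho> + M * d" "0 \<le> \<rho>" "\<rho> < M" "thr r \<rho> \<le> d" "d < int L" by auto
    have iT: "inT r z" using z by (simp add: inT_repr)
    have d: "- int L \<le> d" using thr_bound[OF assms z(2,3)] z(4) by linarith
    have "M * (d + 1) \<le> M * int L" using z(5) M_pos by (intro mult_left_mono) auto
    then have up: "z < M * int L" using z by (simp add: algebra_simps)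
    have "M * (- int L) \<le> M * d" using d M_pos by (intro mult_left_mono) auto
    then have low: "- z - 1 < M * int L" using z(1,2) unfolding mult_minus_right by linarith
    show "z \<in> expo r ` {..<2 * n * L}"
    proof (cases "z \<ge> 0")
      case True
      have "int (nat z) < int (2 * n * L)" using up True by simp
      then have "nat z < 2 * n * L" by (simp only: of_nat_less_iff)
      then show ?thesis using True iT by (intro image_eqI[of _ _ "nat z"]) (auto simp: expo_def)
    next
      case False
      have "int (nat (- z - 1)) < int (2 * n * L)" using low False by simp
      then have "nat (- z - 1) < 2 * n * L" by (simp only: of_nat_less_iff)
      moreover have "z = expo r (nat (- z - 1))" using False iT inT_neg[of r z] by (simp add: expo_def)
      ultimately show ?thesis by (intro image_eqI[of _ _ "nat (- z - 1)"]) auto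
    qed
  qed
qed

lemma prod_expo:
  fixes F :: "int \<Rightarrow> 'b::comm_monoid_mult"
  assumes "bounded r L"
  shows "(\<Prod>a<2 * n * L. F (expo r a)) = (\<Prod>\<rho>\<in>{0..<M}. \<Prod>d\<in>{thr r \<rho>..<int L}. F (\<rho> + M * d))"
proof -
  have inj: "inj_on (\<lambda>(\<rho>, d). \<rho> + M * d) (SIGMA \<rho>:{0..<M}. {thr r \<rho>..<int L})"
  proof (rule inj_onI; clarsimp)
    fix \<rho> d \<rho>' d' assume *: "0 \<le> \<rho>" "\<rho> < M" "0 \<le> \<rho>'" "\<rho>' < M" "\<rho> + M * d = \<rho>' + M * d'"
    have "(\<rho> + M * d) mod M = \<rho>" "(\<rho>' + M * d') mod M = \<rho>'" using *(1-4) by auto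
    then have "\<rho> = \<rho>'" using *(5) by metis
    then show "\<rho> = \<rho>' \<and> d = d'" using *(5) M_pos by simp
  qed
  have "(\<Prod>a<2 * n * L. F (expo r a)) = (\<Prod>z\<in>(\<lambda>(\<rho>, d). \<rho> + M * d) ` (SIGMA \<rho>:{0..<M}. {thr r \<rho>..<int L}). F z)"
    by (rule prod.reindex_bij_betw[OF expo_bij[OF assms]])
  also have "\<dots> = (\<Prod>(\<rho>, d)\<in>(SIGMA \<rho>:{0..<M}. {thr r \<rho>..<int L}). F (\<rho> + M * d))"
    using prod.reindex[OF inj, of F] by (simp add: o_def case_prod_unfold)
  also have "\<dots> = (\<Prod>\<rho>\<in>{0..<M}. \<Prod>d\<in>{thr r \<rho>..<int L}. F (\<rho> + M * d))"
    by (subst prod.Sigma) auto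
  finally show ?thesis .
qed

lemma prod_residues:
  fixes F :: "int \<Rightarrow> 'b::comm_monoid_mult"
  shows "(\<Prod>\<rho>\<in>{0..<M}. F \<rho>) = (\<Prod>j<n. F (int n - 1 - int j) * F (int n + int j))"
proof -
  have "{0..<M} = {0..<int n} \<union> {int n..<M}" by auto
  then have "(\<Prod>\<rho>\<in>{0..<M}. F \<rho>) = (\<Prod>\<rho>\<in>{0..<int n}. F \<rho>) * (\<Prod>\<rho>\<in>{int n..<M}. F \<rho>)"
    by (simp add: prod.union_disjoint)
  also have "(\<Prod>\<rho>\<in>{0..<int n}. F \<rho>) = (\<Prod>j<n. F (int n - 1 - int j))"
    by (rule prod.reindex_bij_witness[of _ "\<lambda>j. int n - 1 - int j" "\<lambda>\<rho>. nat (int n - 1 - \<rho>)"]) auto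
  also have "(\<Prod>\<rho>\<in>{int n..<M}. F \<rho>) = (\<Prod>j<n. F (int n + int j))"
    by (rule prod.reindex_bij_witness[of _ "\<lambda>j. int n + int j" "\<lambda>\<rho>. nat (\<rho> - int n)"]) auto
  finally show ?thesis by (simp add: prod.distrib)
qed

text \<open>The least exponent in use in the residue class of n - 1 - i modulo 2 n, whose threshold
  is r_i. Raising r_i by 1 exchanges it for its mirror image - minz - 1 and changes nothing
  else.\<close>

definition minz :: "(nat \<Rightarrow> int) \<Rightarrow> nat \<Rightarrow> int" where
  "minz r i = int n - 1 - int i + M * r i"

lemma two_minz: "2 * minz r i + 1 = M + gexp r i"
  by (simp add: minz_def gexp_def algebra_simps)

lemma inT_minz: "i < n \<Longrightarrow> inT r (minz r i)"
  unfolding minz_def by (subst inT_repr) (auto simp: thr_lower)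

lemma inT_update:
  assumes i: "i < n"
  shows "inT (r(i := r i + 1)) z \<longleftrightarrow> z = - minz r i - 1 \<or> (inT r z \<and> z \<noteq> minz r i)"
proof -
  define \<rho> d where "\<rho> = z mod M" and "d = z div M"
  have z: "z = \<rho> + M * d" and \<rho>: "0 \<le> \<rho>" "\<rho> < M"
    using mod_range[of z] by (auto simp: \<rho>_def d_def)
  have uniq: "\<rho> + M * d = \<rho>' + M * d' \<longleftrightarrow> \<rho> = \<rho>' \<and> d = d'" if "0 \<le> \<rho>'" "\<rho>' < M" for \<rho>' d'
  proof
    assume *: "\<rho> + M * d = \<rho>' + M * d'"
    have "(\<rho> + M * d) mod M = \<rho>" "(\<rho>' + M * d') mod M = \<rho>'" using \<rho> that by auto
    then have "\<rho> = \<rho>'" using * by metis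
    then show "\<rho> = \<rho>' \<and> d = d'" using * M_pos by simp
  qed simp
  have e1: "z = minz r i \<longleftrightarrow> \<rho> = int n - 1 - int i \<and> d = r i"
    unfolding z minz_def using i by (intro uniq) auto
  have "- minz r i - 1 = (int n + int i) + M * (- r i - 1)" by (simp add: minz_def algebra_simps)
  then have e2: "z = - minz r i - 1 \<longleftrightarrow> \<rho> = int n + int i \<and> d = - r i - 1"
    unfolding z using i by (simp only:) (intro uniq, auto)
  have T: "inT r z \<longleftrightarrow> thr r \<rho> \<le> d" for r unfolding z by (rule inT_repr[OF \<rho>])
  consider "\<rho> = int n - 1 - int i" | "\<rho> = int n + int i" | "\<rho> \<noteq> int n - 1 - int i" "\<rho> \<noteq> int n + int i" by blast
  then show ?thesis
  proof cases
    case 1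
    then have "\<rho> \<noteq> int n + int i" by simp
    then show ?thesis unfolding e1 e2 T using 1 i by (auto simp: thr_lower)
  next
    case 2
    then have "\<rho> \<noteq> int n - 1 - int i" by simp
    then show ?thesis unfolding e1 e2 T using 2 by (auto simp: thr_upper)
  next
    case 3
    have "thr (r(i := r i + 1)) \<rho> = thr r \<rho>"
    proof (cases "\<rho> < int n")
      case True
      then have "nat (int n - 1 - \<rho>) \<noteq> i" using 3(1) by linarith
      then show ?thesis using True by (simp add: thr_def)
    next
      case False
      then have "nat (\<rho> - int n) \<noteq> i" using 3(2) by linarith
      then show ?thesis using False by (simp add: thr_def)
    qed
    then show ?thesis unfolding e1 e2 T using 3 by simp
  qed
qed

lemma odd_gexp: "odd (gexp r i)"
  by (simp add: gexp_def)

text \<open>Modulo 4 n the exponents are -(2 i + 1), and for distinct i, j < n neither i - j nor i +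
  j + 1 is divisible by 2 n. This keeps the denominators of the limits away from 0.\<close>

lemma gexp_neq:
  assumes "i < n" "j < n" "i \<noteq> j"
  shows "gexp r i - gexp r' j + 4 * int n * k \<noteq> 0" "gexp r i + gexp r' j + 4 * int n * k \<noteq> 0"
proof -
  have *: "2 * l \<noteq> 4 * int n * k'" if "\<bar>l\<bar> < M" "l \<noteq> 0" for l k' :: int
  proof
    assume "2 * l = 4 * int n * k'"
    then have "l = M * k'" by simp
    then have "M dvd l" by simp
    then have "M \<le> \<bar>l\<bar>" using that(2) dvd_imp_le_int[of l M] by simp
    then show False using that by simp
  qed
  have "gexp r i - gexp r' j + 4 * int n * k = 4 * int n * (r i - r' j + k) - 2 * (int i - int j)"
    "gexp r i + gexp r' j + 4 * int n * k = 4 * int n * (r i + r' j + k) - 2 * (int i + int j + 1)"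
    by (simp_all add: gexp_def algebra_simps)
  moreover have "2 * (int i - int j) \<noteq> 4 * int n * (r i - r' j + k)" using assms by (intro *) auto
  moreover have "2 * (int i + int j + 1) \<noteq> 4 * int n * (r i + r' j + k)" using assms by (intro *) auto
  ultimately show "gexp r i - gexp r' j + 4 * int n * k \<noteq> 0" "gexp r i + gexp r' j + 4 * int n * k \<noteq> 0"
    by linarith+
qed

text \<open>As t = s^(4 n), the numerator 1 - t u of one factor is the denominator of the next: the
  exponent of t matches the period 2 n.\<close>

lemma hlB_telescope:
  fixes c h l :: int
  assumes "h \<le> l" "\<And>d. h \<le> d \<Longrightarrow> d < l \<Longrightarrow> c + 4 * int n * d \<noteq> 0" "c + 4 * int n * h \<noteq> 0"
  shows "(\<Prod>d\<in>{h..<l}. hlB t (s powi (c + 4 * int n * d)))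
    = (1 - s powi (c + 4 * int n * l)) / (1 - s powi (c + 4 * int n * h))"
  using assms(1,2)
proof (induction l rule: int_ge_induct)
  case base
  then show ?case using assms(3) by simp
next
  case (step l)
  have set: "{h..<l + 1} = insert l {h..<l}" using step.hyps by auto
  have "s powi (c + 4 * int n * (l + 1)) = t * s powi (c + 4 * int n * l)"
  proof -
    have "c + 4 * int n * (l + 1) = int (4 * n) + (c + 4 * int n * l)" by (simp add: algebra_simps)
    then show ?thesis by (simp only: power_int_add[OF disjI1[OF s_nonzero]] power_int_of_nat)
  qed
  then have "hlB t (s powi (c + 4 * int n * l)) = (1 - s powi (c + 4 * int n * (l + 1))) / (1 - s powi (c + 4 * int n * l))"
    by (simp add: hlB_def)
  moreover have "1 - s powi (c + 4 * int n * l) \<noteq> 0" using step.prems[of l] step.hyps by simp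
  ultimately show ?case using step by (simp add: set)
qed

lemma powi_tendsto_0: "(\<lambda>L. s powi (c + 4 * int n * int L)) \<longlonglongrightarrow> 0"
  unfolding tendsto_fls_iff
proof
  fix k
  show "\<forall>\<^sub>F L in sequentially. vge k (s powi (c + 4 * int n * int L) - 0)"
    using eventually_ge_at_top[of "nat (\<bar>k\<bar> + \<bar>c\<bar>)"]
  proof eventually_elim
    case (elim L)
    have "1 * int L \<le> 4 * int n * int L" using n_pos by (intro mult_right_mono) auto
    then have "\<bar>k\<bar> \<le> c + 4 * int n * int L" using elim by linarith
    then have "vge \<bar>k\<bar> (s powi (c + 4 * int n * int L))" by (intro vge_powi') auto
    then show ?case by (auto intro: vge_mono)
  qed
qed

section \<open>The effect of raising one coordinate of r\<close>

definition PhiL :: "(nat \<Rightarrow> int) \<Rightarrow> nat \<Rightarrow> rat fls" where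
  "PhiL r L = hlPhi t {..<2 * n * L} (flip xs (flipset r))"

definition minpos :: "(nat \<Rightarrow> int) \<Rightarrow> nat \<Rightarrow> nat" where
  "minpos r i = (if minz r i \<ge> 0 then nat (minz r i) else nat (- minz r i - 1))"

lemma expo_minpos: "i < n \<Longrightarrow> expo r (minpos r i) = minz r i"
  using inT_minz[of i r] inT_neg[of r "minz r i"] by (auto simp: expo_def minpos_def)

lemma expo_update_minpos: "i < n \<Longrightarrow> expo (r(i := r i + 1)) (minpos r i) = - minz r i - 1"
  using inT_update[of i r "minz r i"] inT_update[of i r "- minz r i - 1"]
  by (auto simp: expo_def minpos_def simp del: fun_upd_apply)

lemma inT_update_other:
  assumes "i < n" "a \<noteq> minpos r i"
  shows "inT (r(i := r i + 1)) (int a) \<longleftrightarrow> inT r (int a)"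
proof -
  have "int a \<noteq> minz r i" "int a \<noteq> - minz r i - 1"
    using assms(2) by (auto simp: minpos_def split: if_splits)
  then show ?thesis using inT_update[OF assms(1), of r "int a"] by simp
qed

lemma minpos_less: "bounded r L \<Longrightarrow> i < n \<Longrightarrow> int L > \<bar>r i\<bar> \<Longrightarrow> minpos r i < 2 * n * L"
proof -
  assume *: "bounded r L" "i < n" "int L > \<bar>r i\<bar>"
  have "minz r i \<in> (\<lambda>(\<rho>, d). \<rho> + M * d) ` (SIGMA \<rho>:{0..<M}. {thr r \<rho>..<int L})"
    unfolding minz_def using * by (intro image_eqI[of _ _ "(int n - 1 - int i, r i)"]) (auto simp: thr_lower)
  then obtain a where a: "a < 2 * n * L" "expo r a = minz r i"
    using expo_bij[OF *(1)] unfolding bij_betw_def by (metis (no_types, lifting) imageE lessThan_iff)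
  then have "a = minpos r i"
    by (auto simp: expo_def minpos_def split: if_splits)
  then show ?thesis using a(1) by simp
qed

text \<open>The two configurations differ only in the variable at \<open>minpos r i\<close>, so both
  sides are the \<open>hlPhi\<close> of the other variables times the contribution of this one,
  cross-multiplied.\<close>

lemma PhiL_update:
  assumes i: "i < n" and b: "bounded r L" "int L > \<bar>r i\<bar>"
  defines "X \<equiv> {..<2 * n * L} - {minpos r i}" and "y0 \<equiv> s powi (M + gexp r i)"
  shows "PhiL (r(i := r i + 1)) L * (1 - 1 / y0) * (\<Prod>a\<in>X. hlB t (s powi (2 * (minz r i + expo r a + 1))))
    = PhiL r L * (1 - y0) * (\<Prod>a\<in>X. hlB t (s powi (2 * (expo r a - minz r i))))"
proof -
  let ?r' = "r(i := r i + 1)"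
  let ?a = "minpos r i"
  have a: "?a \<in> {..<2 * n * L}" using minpos_less[OF b(1) i b(2)] by simp
  have y0: "y0 = s powi (2 * minz r i + 1)" by (simp add: y0_def two_minz)
  have y0nz: "y0 \<noteq> 0" using s_nonzero by (simp add: y0_def power_int_eq_0_iff)
  have "odd (M + gexp r i)" using odd_gexp[of r i] by simp
  then have "M + gexp r i \<noteq> 0" by (metis even_zero)
  then have "y0 \<noteq> 1" by (simp add: y0_def)
  then have y1: "1 - y0 \<noteq> 0" "1 - 1 / y0 \<noteq> 0" using y0nz by auto
  have e: "expo ?r' a = expo r a" if "a \<in> X" for a
    using inT_update_other[OF i, of a r] that by (simp add: expo_def X_def del: fun_upd_apply)
  have "1 / y0 = s powi (- (2 * minz r i + 1))" unfolding y0 power_int_minus by (simp add: divide_inverse)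
  moreover have "- (2 * minz r i + 1) = 2 * (- minz r i - 1) + 1" by simp
  ultimately have y0': "1 / y0 = s powi (2 * (- minz r i - 1) + 1)" by simp
  have eq: "hlPhi t X (flip xs (flipset ?r')) = hlPhi t X (flip xs (flipset r))"
    by (intro hlPhi_cong) (simp add: flip_flipset e del: fun_upd_apply)
  have P1: "PhiL r L = hlPhi t X (flip xs (flipset r)) * (1 / (1 - y0) * (\<Prod>a\<in>X. hlB t (s powi (2 * (minz r i + expo r a + 1)))))"
    unfolding PhiL_def X_def hlPhi_remove[OF finite_lessThan a] flip_flipset expo_minpos[OF i] y0[symmetric]
    unfolding y0 power_int_add[OF disjI1[OF s_nonzero], symmetric]
    by (simp add: algebra_simps)
  have P2: "PhiL ?r' L = hlPhi t X (flip xs (flipset r)) * (1 / (1 - 1 / y0) * (\<Prod>a\<in>X. hlB t (s powi (2 * (expo r a - minz r i)))))"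
  proof -
    have "PhiL ?r' L = hlPhi t X (flip xs (flipset r)) * (1 / (1 - 1 / y0) * (\<Prod>a\<in>X. hlB t (1 / y0 * s powi (2 * expo ?r' a + 1))))"
      unfolding PhiL_def X_def hlPhi_remove[OF finite_lessThan a] eq[unfolded X_def] flip_flipset[of ?r'] expo_update_minpos[OF i] y0' ..
    also have "(\<Prod>a\<in>X. hlB t (1 / y0 * s powi (2 * expo ?r' a + 1))) = (\<Prod>a\<in>X. hlB t (s powi (2 * (expo r a - minz r i))))"
      unfolding y0' power_int_add[OF disjI1[OF s_nonzero], symmetric]
    proof (intro prod.cong refl)
      fix a assume "a \<in> X"
      then have ea: "expo ?r' a = expo r a" by (rule e)
      have "2 * (- minz r i - 1) + 1 + (2 * expo ?r' a + 1) = 2 * (expo r a - minz r i)"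
        unfolding ea by simp
      then show "hlB t (s powi (2 * (- minz r i - 1) + 1 + (2 * expo ?r' a + 1))) = hlB t (s powi (2 * (expo r a - minz r i)))"
        by (simp only:)
    qed
    finally show ?thesis .
  qed
  show ?thesis unfolding P1 P2 using y1 by simp
qed

text \<open>In every residue class the product telescopes; its upper end tends to 1 and only the
  lowest denominator survives. The classes n - 1 - j and n + j give the two factors attached to j,
  and for j = i the factor 1 - t and the one with 2 gexp.\<close>

lemma prod_hlB_limits:
  assumes i: "i < n"
  shows "(\<lambda>L. \<Prod>a\<in>{..<2 * n * L} - {minpos r i}. hlB t (s powi (2 * (minz r i + expo r a + 1))))
      \<longlonglongrightarrow> 1 / ((1 - t) * (1 - s powi (8 * int n + 2 * gexp r i)) *
           (\<Prod>j\<in>{..<n} - {i}. (1 - s powi (4 * int n + gexp r i + gexp r j)) * (1 - s powi (4 * int n + gexp r i - gexp r j))))"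
    (is "?A \<longlonglongrightarrow> ?a")
    and "(\<lambda>L. \<Prod>a\<in>{..<2 * n * L} - {minpos r i}. hlB t (s powi (2 * (expo r a - minz r i))))
      \<longlonglongrightarrow> 1 / ((1 - t) * (1 - s powi (- 2 * gexp r i)) *
           (\<Prod>j\<in>{..<n} - {i}. (1 - s powi (gexp r j - gexp r i)) * (1 - s powi (- gexp r j - gexp r i))))"
    (is "?B \<longlonglongrightarrow> ?b")
proof -
  obtain L0 where L0: "bounded r L0" using bounded_ex by blast
  \<comment> \<open>The variable at \<open>minpos r i\<close> is itself left out, which raises the
    lower end of its class by one.\<close>
  define h where "h \<rho> = thr r \<rho> + (if \<rho> = int n - 1 - int i then 1 else 0)" for \<rho>
  have general: "(\<lambda>L. \<Prod>a\<in>{..<2 * n * L} - {minpos r i}. hlB t (s powi (c + 2 * expo r a)))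
      \<longlonglongrightarrow> (\<Prod>\<rho>\<in>{0..<M}. 1 / (1 - s powi (c + 2 * \<rho> + 4 * int n * h \<rho>)))"
    if c: "\<And>z. inT r z \<Longrightarrow> z \<noteq> minz r i \<Longrightarrow> c + 2 * z \<noteq> 0" for c
  proof -
    have ne: "c + 2 * \<rho> + 4 * int n * d \<noteq> 0" if "0 \<le> \<rho>" "\<rho> < M" "h \<rho> \<le> d" for \<rho> d
    proof -
      have "inT r (\<rho> + M * d)" using that by (auto simp: inT_repr h_def split: if_splits)
      moreover have "\<rho> + M * d \<noteq> minz r i"
      proof
        assume eq: "\<rho> + M * d = minz r i"
        have "(\<rho> + M * d) mod M = \<rho>" "minz r i mod M = int n - 1 - int i" using that i by (auto simp: minz_def)
        then have "\<rho> = int n - 1 - int i" using eq by metis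
        then have "d = r i" using eq M_pos by (simp add: minz_def)
        then show False using that(3) \<open>\<rho> = int n - 1 - int i\<close> i by (simp add: h_def thr_lower)
      qed
      ultimately have "c + 2 * (\<rho> + M * d) \<noteq> 0" by (rule c)
      then show ?thesis by (simp add: algebra_simps)
    qed
    have ev: "\<forall>\<^sub>F L in sequentially. (\<Prod>\<rho>\<in>{0..<M}. (1 - s powi (c + 2 * \<rho> + 4 * int n * int L)) / (1 - s powi (c + 2 * \<rho> + 4 * int n * h \<rho>)))
       = (\<Prod>a\<in>{..<2 * n * L} - {minpos r i}. hlB t (s powi (c + 2 * expo r a)))"
      using eventually_ge_at_top[of "L0 + 1"]
    proof eventually_elim
      case (elim L)
      have bL: "bounded r L" using bounded_mono[OF L0] elim by simp
      have "\<bar>r i\<bar> \<le> int L0" using L0 i by (simp add: bounded_def)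
      then have ri: "\<bar>r i\<bar> < int L" using elim by linarith
      \<comment> \<open>Setting the omitted factor to 1 extends the product to all indices, so that
        \<open>prod_expo\<close> applies.\<close>
      define F where "F z = (if z = minz r i then 1 else hlB t (s powi (c + 2 * z)))" for z
      have "expo r a \<noteq> minz r i" if "a \<noteq> minpos r i" for a
        using that by (auto simp: expo_def minpos_def split: if_splits)
      then have "(\<Prod>a\<in>{..<2 * n * L} - {minpos r i}. hlB t (s powi (c + 2 * expo r a))) = (\<Prod>a\<in>{..<2 * n * L} - {minpos r i}. F (expo r a))"
        by (intro prod.cong refl) (auto simp: F_def)
      also have "\<dots> = (\<Prod>a<2 * n * L. F (expo r a))"
        using minpos_less[OF bL i ri] expo_minpos[OF i, of r] by (subst (2) prod.remove[of _ "minpos r i"]) (auto simp: F_def)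
      also have "\<dots> = (\<Prod>\<rho>\<in>{0..<M}. \<Prod>d\<in>{thr r \<rho>..<int L}. F (\<rho> + M * d))"
        by (rule prod_expo[OF bL])
      also have "\<dots> = (\<Prod>\<rho>\<in>{0..<M}. (1 - s powi (c + 2 * \<rho> + 4 * int n * int L)) / (1 - s powi (c + 2 * \<rho> + 4 * int n * h \<rho>)))"
      proof (intro prod.cong refl)
        fix \<rho> assume "\<rho> \<in> {0..<M}"
        then have \<rho>: "0 \<le> \<rho>" "\<rho> < M" by auto
        have hL: "h \<rho> \<le> int L"
        proof (cases "\<rho> = int n - 1 - int i")
          case True
          then show ?thesis using ri i by (simp add: h_def thr_lower)
        next
          case False
          then show ?thesis using thr_bound[OF bL \<rho>] by (simp add: h_def)
        qed
        have "(\<Prod>d\<in>{thr r \<rho>..<int L}. F (\<rho> + M * d)) = (\<Prod>d\<in>{h \<rho>..<int L}. F (\<rho> + M * d))"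
        proof (cases "\<rho> = int n - 1 - int i")
          case True
          have "{thr r \<rho>..<int L} = insert (r i) {h \<rho>..<int L}"
            using True i ri by (auto simp: h_def thr_lower)
          moreover have "F (\<rho> + M * r i) = 1" using True by (simp add: F_def minz_def)
          moreover have "r i \<notin> {h \<rho>..<int L}" using True i by (simp add: h_def thr_lower)
          ultimately show ?thesis by simp
        qed (simp add: h_def)
        also have "\<dots> = (\<Prod>d\<in>{h \<rho>..<int L}. hlB t (s powi (c + 2 * \<rho> + 4 * int n * d)))"
        proof (intro prod.cong refl)
          fix d assume "d \<in> {h \<rho>..<int L}"
          then have d: "h \<rho> \<le> d" by simp
          have "\<rho> + M * d \<noteq> minz r i"
          proof
            assume eq: "\<rho> + M * d = minz r i"
            have "(\<rho> + M * d) mod M = \<rho>" "minz r i mod M = int n - 1 - int i" using \<rho> i by (auto simp: minz_def)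
            then have "\<rho> = int n - 1 - int i" using eq by metis
            then have "d = r i" using eq M_pos by (simp add: minz_def)
            then show False using d \<open>\<rho> = int n - 1 - int i\<close> i by (simp add: h_def thr_lower)
          qed
          then show "F (\<rho> + M * d) = hlB t (s powi (c + 2 * \<rho> + 4 * int n * d))"
            by (simp add: F_def algebra_simps)
        qed
        also have "\<dots> = (1 - s powi (c + 2 * \<rho> + 4 * int n * int L)) / (1 - s powi (c + 2 * \<rho> + 4 * int n * h \<rho>))"
          using hL ne[OF \<rho>] by (intro hlB_telescope) auto
        finally show "(\<Prod>d\<in>{thr r \<rho>..<int L}. F (\<rho> + M * d))
          = (1 - s powi (c + 2 * \<rho> + 4 * int n * int L)) / (1 - s powi (c + 2 * \<rho> + 4 * int n * h \<rho>))" .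
      qed
      finally show ?case by simp
    qed
    have "(\<lambda>L. \<Prod>\<rho>\<in>{0..<M}. (1 - s powi (c + 2 * \<rho> + 4 * int n * int L)) / (1 - s powi (c + 2 * \<rho> + 4 * int n * h \<rho>)))
      \<longlonglongrightarrow> (\<Prod>\<rho>\<in>{0..<M}. (1 - 0) / (1 - s powi (c + 2 * \<rho> + 4 * int n * h \<rho>)))"
      using ne[OF _ _ order_refl]
      by (intro tendsto_prod_fls tendsto_divide_fls tendsto_diff tendsto_const powi_tendsto_0) auto
    then show ?thesis using ev by (auto intro: Lim_transform_eventually)
  qed
  have hj: "h (int n - 1 - int j) = r j" "h (int n + int j) = - r j" if "j < n" "j \<noteq> i" for j
    using that by (auto simp: h_def thr_lower thr_upper)
  have hi: "h (int n - 1 - int i) = r i + 1" "h (int n + int i) = - r i"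
    using i by (auto simp: h_def thr_lower thr_upper)
  have split: "(\<Prod>\<rho>\<in>{0..<M}. F \<rho>) = F (int n - 1 - int i) * F (int n + int i) *
      (\<Prod>j\<in>{..<n} - {i}. F (int n - 1 - int j) * F (int n + int j))" for F :: "int \<Rightarrow> rat fls"
    unfolding prod_residues using i by (subst prod.remove[of _ i]) auto
  have t: "t = s powi (4 * int n)" using power_int_of_nat[of s "4 * n"] by simp
  have c1: "2 * minz r i + 2 + 2 * z \<noteq> 0" if "inT r z" for z
  proof
    assume "2 * minz r i + 2 + 2 * z = 0"
    then have "z = - minz r i - 1" by simp
    then show False using that inT_neg[of r "minz r i"] inT_minz[OF i] by simp
  qed
  have "(\<lambda>L. \<Prod>a\<in>{..<2 * n * L} - {minpos r i}. hlB t (s powi (2 * minz r i + 2 + 2 * expo r a)))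
    \<longlonglongrightarrow> (\<Prod>\<rho>\<in>{0..<M}. 1 / (1 - s powi (2 * minz r i + 2 + 2 * \<rho> + 4 * int n * h \<rho>)))"
    using c1 by (rule general)
  also have "(\<Prod>\<rho>\<in>{0..<M}. 1 / (1 - s powi (2 * minz r i + 2 + 2 * \<rho> + 4 * int n * h \<rho>))) = ?a"
  proof -
    have E: "2 * minz r i + 2 + 2 * (int n - 1 - int i) + 4 * int n * h (int n - 1 - int i) = 8 * int n + 2 * gexp r i"
      "2 * minz r i + 2 + 2 * (int n + int i) + 4 * int n * h (int n + int i) = 4 * int n"
      unfolding hi by (simp_all add: minz_def gexp_def algebra_simps)
    have E': "2 * minz r i + 2 + 2 * (int n - 1 - int j) + 4 * int n * h (int n - 1 - int j) = 4 * int n + gexp r i + gexp r j"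
      "2 * minz r i + 2 + 2 * (int n + int j) + 4 * int n * h (int n + int j) = 4 * int n + gexp r i - gexp r j"
      if "j < n" "j \<noteq> i" for j
      unfolding hj[OF that] by (simp_all add: minz_def gexp_def algebra_simps)
    have P: "(\<Prod>j\<in>{..<n} - {i}. 1 / (1 - s powi (2 * minz r i + 2 + 2 * (int n - 1 - int j) + 4 * int n * h (int n - 1 - int j))) *
          (1 / (1 - s powi (2 * minz r i + 2 + 2 * (int n + int j) + 4 * int n * h (int n + int j)))))
        = (\<Prod>j\<in>{..<n} - {i}. 1 / (1 - s powi (4 * int n + gexp r i + gexp r j)) * (1 / (1 - s powi (4 * int n + gexp r i - gexp r j))))"
    proof (intro prod.cong refl)
      fix j assume "j \<in> {..<n} - {i}"
      then have j: "j < n" "j \<noteq> i" by auto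
      show "1 / (1 - s powi (2 * minz r i + 2 + 2 * (int n - 1 - int j) + 4 * int n * h (int n - 1 - int j))) *
          (1 / (1 - s powi (2 * minz r i + 2 + 2 * (int n + int j) + 4 * int n * h (int n + int j)))) = 1 / (1 - s powi (4 * int n + gexp r i + gexp r j)) * (1 / (1 - s powi (4 * int n + gexp r i - gexp r j)))"
        by (simp only: E'[OF j])
    qed
    show ?thesis
      unfolding split P E t by (simp add: prod_dividef prod.distrib mult_ac)
  qed
  also have "(\<lambda>L. \<Prod>a\<in>{..<2 * n * L} - {minpos r i}. hlB t (s powi (2 * minz r i + 2 + 2 * expo r a))) = ?A"
    by (simp add: algebra_simps)
  finally show "?A \<longlonglongrightarrow> ?a" .
  have "(\<lambda>L. \<Prod>a\<in>{..<2 * n * L} - {minpos r i}. hlB t (s powi (- 2 * minz r i + 2 * expo r a)))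
    \<longlonglongrightarrow> (\<Prod>\<rho>\<in>{0..<M}. 1 / (1 - s powi (- 2 * minz r i + 2 * \<rho> + 4 * int n * h \<rho>)))"
    by (rule general) simp
  also have "(\<Prod>\<rho>\<in>{0..<M}. 1 / (1 - s powi (- 2 * minz r i + 2 * \<rho> + 4 * int n * h \<rho>))) = ?b"
  proof -
    have E: "- 2 * minz r i + 2 * (int n - 1 - int i) + 4 * int n * h (int n - 1 - int i) = 4 * int n"
      "- 2 * minz r i + 2 * (int n + int i) + 4 * int n * h (int n + int i) = - 2 * gexp r i"
      unfolding hi by (simp_all add: minz_def gexp_def algebra_simps)
    have E': "- 2 * minz r i + 2 * (int n - 1 - int j) + 4 * int n * h (int n - 1 - int j) = gexp r j - gexp r i"
      "- 2 * minz r i + 2 * (int n + int j) + 4 * int n * h (int n + int j) = - gexp r j - gexp r i"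
      if "j < n" "j \<noteq> i" for j
      unfolding hj[OF that] by (simp_all add: minz_def gexp_def algebra_simps)
    have P: "(\<Prod>j\<in>{..<n} - {i}. 1 / (1 - s powi (- 2 * minz r i + 2 * (int n - 1 - int j) + 4 * int n * h (int n - 1 - int j))) *
          (1 / (1 - s powi (- 2 * minz r i + 2 * (int n + int j) + 4 * int n * h (int n + int j)))))
        = (\<Prod>j\<in>{..<n} - {i}. 1 / (1 - s powi (gexp r j - gexp r i)) * (1 / (1 - s powi (- gexp r j - gexp r i))))"
    proof (intro prod.cong refl)
      fix j assume "j \<in> {..<n} - {i}"
      then have j: "j < n" "j \<noteq> i" by auto
      show "1 / (1 - s powi (- 2 * minz r i + 2 * (int n - 1 - int j) + 4 * int n * h (int n - 1 - int j))) *
          (1 / (1 - s powi (- 2 * minz r i + 2 * (int n + int j) + 4 * int n * h (int n + int j)))) = 1 / (1 - s powi (gexp r j - gexp r i)) * (1 / (1 - s powi (- gexp r j - gexp r i)))"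
        by (simp only: E'[OF j])
    qed
    show ?thesis
      unfolding split P E t by (simp add: prod_dividef prod.distrib mult_ac)
  qed
  also have "(\<lambda>L. \<Prod>a\<in>{..<2 * n * L} - {minpos r i}. hlB t (s powi (- 2 * minz r i + 2 * expo r a))) = ?B"
    by (simp add: algebra_simps)
  finally show "?B \<longlonglongrightarrow> ?b" .
qed

end

text \<open>As the step is an equivalence, it moves a coordinate both up and down, and the
  coordinates are adjusted one after the other. The origin is extensional because elements of
  \<open>PiE\<close> are \<open>undefined\<close> outside \<open>{..<n}\<close>.\<close>

lemma PiE_grid_induct:
  fixes P :: "(nat \<Rightarrow> int) \<Rightarrow> bool"
  assumes base: "P (\<lambda>i. if i < n then 0 else undefined)"
    and step: "\<And>r i. i < n \<Longrightarrow> P r \<longleftrightarrow> P (r(i := r i + 1))"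
    and r: "r \<in> PiE {..<n} (\<lambda>_. UNIV)"
  shows "P r"
proof -
  let ?r0 = "\<lambda>i. if i < n then 0 else undefined :: int"
  have "\<forall>r. (\<forall>i\<ge>k. r i = ?r0 i) \<longrightarrow> P r" if "k \<le> n" for k
    using that
  proof (induction k)
    case 0
    show ?case
    proof (intro allI impI)
      fix r assume "\<forall>i\<ge>0. r i = ?r0 i"
      then have "r = ?r0" by auto
      then show "P r" using base by simp
    qed
  next
    case (Suc k)
    show ?case
    proof (intro allI impI)
      fix r assume r: "\<forall>i\<ge>Suc k. r i = ?r0 i"
      have k: "k < n" using Suc.prems by simp
      have "P (r(k := v))" for v
      proof (induction v rule: int_induct[where k = 0])
        case base
        have "\<forall>i\<ge>k. (r(k := 0)) i = ?r0 i" using r k by auto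
        then show ?case using Suc by simp
      next
        case (step1 v)
        then show ?case using step[OF k, of "r(k := v)"] by (simp add: fun_upd_same del: fun_upd_apply)
      next
        case (step2 v)
        then show ?case using step[OF k, of "r(k := v - 1)"] by (simp add: fun_upd_same del: fun_upd_apply)
      qed
      from this[of "r k"] show "P r" by simp
    qed
  qed
  from this[of n] show ?thesis using r by (auto simp: PiE_def extensional_def)
qed

context nome
begin

abbreviation q :: "rat fls" where "q \<equiv> s ^ 2"

lemma vge_q: "vge 1 q"
  by (rule vge_spow) simp

lemma qpoch_q_nonzero: "qpoch q q k \<noteq> 0"
proof -
  have "s ^ (2 * (k + 1)) \<noteq> 1" for k unfolding power_eq_1_iff by simp
  then show ?thesis by (auto simp: qpoch_def power_mult[symmetric] power_add[symmetric])
qed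

lemma qpoch_inf_split:
  "qpoch_inf s q * qpoch_inf q q = qpoch_inf s s"
proof -
  have "qpoch s q N * qpoch q q N = qpoch s s (2 * N)" for N
  proof (induction N)
    case (Suc N)
    have "qpoch s q (Suc N) * qpoch q q (Suc N) = (qpoch s q N * qpoch q q N) * ((1 - s * q ^ N) * (1 - q * q ^ N))"
      by (simp add: qpoch_def mult_ac)
    also have "\<dots> = qpoch s s (2 * N) * ((1 - s * s ^ (2 * N)) * (1 - s * s ^ (2 * N + 1)))"
      unfolding Suc.IH power_mult[symmetric] by (simp add: power2_eq_square mult.assoc)
    also have "\<dots> = qpoch s s (2 * Suc N)" by (simp add: qpoch_def mult_ac)
    finally show ?case .
  qed (simp add: qpoch_def)
  moreover have "(\<lambda>N. qpoch s q N * qpoch q q N) \<longlonglongrightarrow> qpoch_inf s q * qpoch_inf q q"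
    by (intro tendsto_mult qpoch_tendsto vge_q)
  moreover have "(\<lambda>N. qpoch s s (2 * N)) \<longlonglongrightarrow> qpoch_inf s s"
    using LIMSEQ_subseq_LIMSEQ[OF qpoch_tendsto[OF vge_s, of s], of "\<lambda>N. 2 * N"]
    by (simp add: strict_mono_def o_def)
  ultimately show ?thesis using LIMSEQ_unique by fastforce
qed

end

context nome_n
begin

definition zv :: "(nat \<Rightarrow> int) \<Rightarrow> nat \<Rightarrow> rat fls" where
  "zv r i = s powi gexp r i"

definition wv :: "rat fls \<Rightarrow> rat fls" where
  "wv z = z + 1 / z"

definition Delta :: "(nat \<Rightarrow> int) \<Rightarrow> rat fls" where
  "Delta r = (\<Prod>i<n. zv r i - 1 / zv r i) * (\<Prod>(a, b)\<in>{(a, b). a < b \<and> b < n}. wv (zv r b) - wv (zv r a))"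

text \<open>The exponent of s in the product of all flipped variables, by
  \<open>prod_flipset\<close>; through it the weight x_j^m enters the lattice sum.\<close>

definition Qf :: "(nat \<Rightarrow> int) \<Rightarrow> int" where
  "Qf r = (\<Sum>i<n. 2 * int n * r i ^ 2 - (2 * int i + 1) * r i)"

definition zero_shift :: "nat \<Rightarrow> int" where
  "zero_shift = (\<lambda>i. if i < n then 0 else undefined)"

lemma zv_nonzero: "zv r i \<noteq> 0"
  by (simp add: zv_def s_nonzero power_int_eq_0_iff)

lemma powi_add: "s powi (j + k) = s powi j * s powi k"
  by (rule power_int_add) (simp add: s_nonzero)

lemma inverse_powi: "1 / s powi k = s powi (- k)"
  by (simp add: power_int_minus divide_inverse)

lemma powi_diff: "s powi (j - k) = s powi j / s powi k"
  using powi_add[of j "- k"] by (simp add: power_int_minus divide_inverse)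

lemma gexp_update: "gexp (r(i := r i + 1)) j = (if j = i then gexp r i + 4 * int n else gexp r j)"
  by (simp add: gexp_def algebra_simps)

lemma zv_update: "zv (r(i := r i + 1)) j = (if j = i then zv r i * t else zv r j)"
proof -
  have "t = s powi (4 * int n)" using power_int_of_nat[of s "4 * n"] by simp
  then show ?thesis by (simp add: zv_def gexp_update powi_add del: fun_upd_apply)
qed

lemma Qf_update: "i < n \<Longrightarrow> Qf (r(i := r i + 1)) = Qf r + gexp r i + 2 * int n"
proof -
  assume i: "i < n"
  have "(\<Sum>j\<in>{..<n} - {i}. 2 * int n * (r(i := r i + 1)) j ^ 2 - (2 * int j + 1) * (r(i := r i + 1)) j)
     = (\<Sum>j\<in>{..<n} - {i}. 2 * int n * r j ^ 2 - (2 * int j + 1) * r j)"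
    by (intro sum.cong) auto
  then show ?thesis
    using i by (simp add: Qf_def sum.remove[of "{..<n}" i] gexp_def power2_eq_square algebra_simps)
qed

lemma Delta_update:
  fixes r :: "nat \<Rightarrow> int"
  assumes i: "i < n"
  defines "z \<equiv> zv r i"
  shows "Delta (r(i := r i + 1)) * ((z - 1 / z) * (\<Prod>j\<in>{..<n} - {i}. wv z - wv (zv r j)))
    = Delta r * ((z * t - 1 / (z * t)) * (\<Prod>j\<in>{..<n} - {i}. wv (z * t) - wv (zv r j)))"
proof -
  let ?r' = "r(i := r i + 1)"
  have w: "(\<lambda>j. wv (zv ?r' j)) = (\<lambda>j. wv (zv r j))(i := wv (z * t))"
    by (auto simp: zv_update z_def simp del: fun_upd_apply) (auto simp: z_def)
  have "(\<Prod>j\<in>{..<n} - {i}. zv ?r' j - 1 / zv ?r' j) = (\<Prod>j\<in>{..<n} - {i}. zv r j - 1 / zv r j)"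
    by (intro prod.cong refl) (auto simp: zv_update simp del: fun_upd_apply)
  then have 1: "(\<Prod>j<n. zv ?r' j - 1 / zv ?r' j) * (z - 1 / z) = (\<Prod>j<n. zv r j - 1 / zv r j) * (z * t - 1 / (z * t))"
    using i by (simp add: prod.remove[of "{..<n}" i] zv_update z_def del: fun_upd_apply)
  have 2: "(\<Prod>(a, b)\<in>{(a, b). a < b \<and> b < n}. wv (zv ?r' b) - wv (zv ?r' a)) * (\<Prod>j\<in>{..<n} - {i}. wv z - wv (zv r j))
    = (\<Prod>(a, b)\<in>{(a, b). a < b \<and> b < n}. wv (zv r b) - wv (zv r a)) * (\<Prod>j\<in>{..<n} - {i}. wv (z * t) - wv (zv r j))"
    using prod_pairs_update[OF i, of "\<lambda>j. wv (zv r j)" "wv (z * t)"]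
    unfolding w[symmetric] by (simp add: z_def)
  have "Delta ?r' * ((z - 1 / z) * (\<Prod>j\<in>{..<n} - {i}. wv z - wv (zv r j)))
    = ((\<Prod>j<n. zv ?r' j - 1 / zv ?r' j) * (z - 1 / z)) *
     ((\<Prod>(a, b)\<in>{(a, b). a < b \<and> b < n}. wv (zv ?r' b) - wv (zv ?r' a)) * (\<Prod>j\<in>{..<n} - {i}. wv z - wv (zv r j)))"
    by (simp only: Delta_def mult_ac)
  then show ?thesis unfolding 1 2 by (simp only: Delta_def mult_ac)
qed

lemma wv_factor:
  assumes "z \<noteq> 0" "w \<noteq> 0"
  shows "(1 - z * w) * (1 - z / w) = z * (wv z - wv w)"
  using assms by (simp add: wv_def field_simps)

text \<open>The proposed limit changes under r_i -> r_i + 1 by the same ratio as the products in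
  \<open>PhiL_update\<close>. \<open>Delta_update\<close> supplies the ratio of Weyl denominators,
  and \<open>wv_factor\<close> rewrites the limits in terms of z + 1 / z.\<close>

lemma step_ratio:
  fixes r :: "nat \<Rightarrow> int"
  assumes i: "i < n"
  defines "y0 \<equiv> s powi (M + gexp r i)"
  shows "s powi ((2 * int n + 1) * Qf (r(i := r i + 1))) * Delta (r(i := r i + 1)) * (1 - 1 / y0) *
      (1 / ((1 - t) * (1 - s powi (8 * int n + 2 * gexp r i)) *
           (\<Prod>j\<in>{..<n} - {i}. (1 - s powi (4 * int n + gexp r i + gexp r j)) * (1 - s powi (4 * int n + gexp r i - gexp r j)))))
    = s powi ((2 * int n + 1) * Qf r) * Delta r * (1 - y0) *
      (1 / ((1 - t) * (1 - s powi (- 2 * gexp r i)) *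
           (\<Prod>j\<in>{..<n} - {i}. (1 - s powi (gexp r j - gexp r i)) * (1 - s powi (- gexp r j - gexp r i)))))"
    (is "?L1 * (1 / ?A) = ?L2 * (1 / ?B)")
proof -
  define z where "z = zv r i"
  define z' where "z' = z * t"
  define Pa where "Pa = (\<Prod>j\<in>{..<n} - {i}. wv z - wv (zv r j))"
  define Pb where "Pb = (\<Prod>j\<in>{..<n} - {i}. wv z' - wv (zv r j))"
  have z0: "z \<noteq> 0" "z' \<noteq> 0" using zv_nonzero[of r i] s_nonzero by (auto simp: z_def z'_def)
  have t: "t = s powi (4 * int n)" using power_int_of_nat[of s "4 * n"] by simp
  have z'p: "z' = s powi (4 * int n + gexp r i)"
    unfolding z'_def z_def zv_def t powi_add by (rule mult.commute)
  have A1: "s powi (8 * int n + 2 * gexp r i) = z' * z'"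
    unfolding z'p powi_add[symmetric] by (simp add: algebra_simps)
  have B1: "s powi (- 2 * gexp r i) = 1 / z * (1 / z)"
    unfolding z_def zv_def inverse_powi powi_add[symmetric] by simp
  have card: "card ({..<n} - {i}) = n - 1" using i by simp
  have A2: "(\<Prod>j\<in>{..<n} - {i}. (1 - s powi (4 * int n + gexp r i + gexp r j)) * (1 - s powi (4 * int n + gexp r i - gexp r j)))
    = z' ^ (n - 1) * Pb"
  proof -
    have "(1 - s powi (4 * int n + gexp r i + gexp r j)) * (1 - s powi (4 * int n + gexp r i - gexp r j)) = z' * (wv z' - wv (zv r j))" for j
      using wv_factor[OF z0(2) zv_nonzero[of r j]] by (simp only: powi_add powi_diff z'p zv_def)
    then show ?thesis by (simp only: prod.distrib prod_constant card Pb_def)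
  qed
  have B2: "(\<Prod>j\<in>{..<n} - {i}. (1 - s powi (gexp r j - gexp r i)) * (1 - s powi (- gexp r j - gexp r i)))
    = (1 / z) ^ (n - 1) * Pa"
  proof -
    have "(1 - s powi (gexp r j - gexp r i)) * (1 - s powi (- gexp r j - gexp r i)) = 1 / z * (wv z - wv (zv r j))" for j
    proof -
      have "wv (1 / z) = wv z" using z0 by (simp add: wv_def)
      moreover have "s powi (gexp r j - gexp r i) = 1 / z * zv r j" by (simp add: powi_diff z_def zv_def)
      moreover have "s powi (- gexp r j - gexp r i) = 1 / z / zv r j"
        unfolding powi_diff inverse_powi[symmetric] by (simp add: z_def zv_def mult.commute)
      ultimately show ?thesis using wv_factor[of "1 / z" "zv r j"] z0 zv_nonzero[of r j] by simp
    qed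
    then show ?thesis by (simp only: prod.distrib prod_constant card Pa_def)
  qed
  have ne: "1 - s powi k \<noteq> 0" if "k \<noteq> 0" for k using that by simp
  have odd0: "gexp r i + 2 * k \<noteq> 0" for k
  proof
    assume "gexp r i + 2 * k = 0"
    moreover have "odd (gexp r i + 2 * k)" using odd_gexp by simp
    ultimately show False by simp
  qed
  have A0: "?A \<noteq> 0"
  proof -
    have "4 * int n + gexp r i + gexp r j \<noteq> 0" "4 * int n + gexp r i - gexp r j \<noteq> 0" if "j \<in> {..<n} - {i}" for j
      using gexp_neq[OF i, of j r r 1] that by auto
    then show ?thesis using odd0[of "4 * int n div 1"] odd0[of "2 * int n"] n_pos ne
      by (auto simp: t)
  qed
  have B0: "?B \<noteq> 0"
  proof -
    have "gexp r j - gexp r i \<noteq> 0" "- gexp r j - gexp r i \<noteq> 0" if "j \<in> {..<n} - {i}" for j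
      using gexp_neq[OF i, of j r r 0] that by auto
    then show ?thesis using odd0[of 0] n_pos ne by (auto simp: t)
  qed
  have y00: "y0 \<noteq> 0" by (simp add: y0_def s_nonzero power_int_eq_0_iff)
  \<comment> \<open>Here (2 n + 1) (gexp + 2 n) = (gexp + 2 n) + n (2 gexp + 4 n): the first part is
    \<open>y0\<close>, the second provides the powers of z and z' = z t left over by
    \<open>wv_factor\<close>.\<close>
  have Q: "s powi ((2 * int n + 1) * Qf (r(i := r i + 1))) = s powi ((2 * int n + 1) * Qf r) * y0 * (z * z') ^ n"
  proof -
    have "(z * z') ^ n = s powi (int n * (2 * gexp r i + 4 * int n))"
      unfolding z'p z_def zv_def powi_add[symmetric] by (simp add: power_int_power' algebra_simps)
    moreover have "(2 * int n + 1) * Qf (r(i := r i + 1)) = (2 * int n + 1) * Qf r + (M + gexp r i) + int n * (2 * gexp r i + 4 * int n)"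
      unfolding Qf_update[OF i] by (simp add: algebra_simps)
    ultimately show ?thesis by (simp only: powi_add y0_def)
  qed
  have D: "Delta (r(i := r i + 1)) * ((z - 1 / z) * Pa) = Delta r * ((z' - 1 / z') * Pb)"
    using Delta_update[OF i, of r] by (simp add: z_def z'_def Pa_def Pb_def)
  have "?L1 * ?B = ?L2 * ?A"
  proof -
    have n1: "z ^ n = z * z ^ (n - 1)" "z' ^ n = z' * z' ^ (n - 1)"
      using n_pos power_eq_if[of z n] power_eq_if[of z' n] by auto
    have b: "(1 - 1 / z * (1 / z)) = (z - 1 / z) * (1 / z)" using z0 by (simp add: field_simps)
    have a: "(1 - z' * z') = - z' * (z' - 1 / z')" using z0 by (simp add: field_simps)
    have y: "y0 * (1 - 1 / y0) = - (1 - y0)" using y00 by (simp add: field_simps)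
    have zc: "z ^ (n - 1) * (1 / z) ^ (n - 1) = 1" "z * (1 / z) = 1" using z0 by (simp_all add: power_divide)
    let ?q = "s powi ((2 * int n + 1) * Qf r)"
    have "?L1 * ?B = ?q * (y0 * (1 - 1 / y0)) * (z' ^ n) * (1 - t) * (Delta (r(i := r i + 1)) * ((z - 1 / z) * Pa))
        * (z * (1 / z)) * (z ^ (n - 1) * (1 / z) ^ (n - 1))"
      unfolding B1 B2 b Q power_mult_distrib n1 by (simp only: mult_ac)
    also have "\<dots> = ?q * (- (1 - y0)) * (z' ^ n) * (1 - t) * (Delta r * ((z' - 1 / z') * Pb))"
      unfolding y D zc by simp
    also have "\<dots> = ?L2 * ?A"
      unfolding A1 A2 a n1 by (simp only: mult_minus_left mult_minus_right mult_ac)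
    finally show ?thesis .
  qed
  then show ?thesis using A0 B0 by (simp only: mult_1_right times_divide_eq_right divide_eq_eq eq_divide_eq) (simp add: field_simps)
qed

text \<open>By \<open>PhiL_update\<close> the two sequences differ by the quotient of
  \<open>A\<close> and \<open>B\<close>, whose limits are nonzero; so convergence passes in both
  directions, as \<open>PiE_grid_induct\<close> requires.\<close>

lemma PhiL_step:
  fixes r :: "nat \<Rightarrow> int" and c :: "rat fls"
  assumes i: "i < n"
  defines "\<psi> \<equiv> \<lambda>r. c * (s powi ((2 * int n + 1) * Qf r) * Delta r)"
  shows "PhiL r \<longlonglongrightarrow> \<psi> r \<longleftrightarrow> PhiL (r(i := r i + 1)) \<longlonglongrightarrow> \<psi> (r(i := r i + 1))"
proof -
  let ?r' = "r(i := r i + 1)"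
  define y0 where "y0 = s powi (M + gexp r i)"
  define A where "A L = (1 - 1 / y0) * (\<Prod>a\<in>{..<2 * n * L} - {minpos r i}. hlB t (s powi (2 * (minz r i + expo r a + 1))))" for L
  define B where "B L = (1 - y0) * (\<Prod>a\<in>{..<2 * n * L} - {minpos r i}. hlB t (s powi (2 * (expo r a - minz r i))))" for L
  define a where "a = (1 - 1 / y0) * (1 / ((1 - t) * (1 - s powi (8 * int n + 2 * gexp r i)) *
           (\<Prod>j\<in>{..<n} - {i}. (1 - s powi (4 * int n + gexp r i + gexp r j)) * (1 - s powi (4 * int n + gexp r i - gexp r j)))))"
  define b where "b = (1 - y0) * (1 / ((1 - t) * (1 - s powi (- 2 * gexp r i)) *
           (\<Prod>j\<in>{..<n} - {i}. (1 - s powi (gexp r j - gexp r i)) * (1 - s powi (- gexp r j - gexp r i)))))"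
  have lim: "A \<longlonglongrightarrow> a" "B \<longlonglongrightarrow> b"
    unfolding A_def B_def a_def b_def by (intro tendsto_mult tendsto_const prod_hlB_limits[OF i])+
  have odd0: "gexp r i + 2 * k \<noteq> 0" for k
  proof
    assume "gexp r i + 2 * k = 0"
    moreover have "odd (gexp r i + 2 * k)" using odd_gexp by simp
    ultimately show False by simp
  qed
  have t: "t = s powi (4 * int n)" using power_int_of_nat[of s "4 * n"] by simp
  have y1: "y0 \<noteq> 0" "y0 \<noteq> 1" using odd0[of "int n"] by (auto simp: y0_def s_nonzero power_int_eq_0_iff add.commute)
  have "4 * int n + gexp r i + gexp r j \<noteq> 0" "4 * int n + gexp r i - gexp r j \<noteq> 0" if "j \<in> {..<n} - {i}" for j
    using gexp_neq[OF i, of j r r 1] that by auto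
  then have a0: "a \<noteq> 0"
    using odd0[of "2 * int n"] n_pos y1 by (auto simp: a_def t)
  have "gexp r j - gexp r i \<noteq> 0" "- gexp r j - gexp r i \<noteq> 0" if "j \<in> {..<n} - {i}" for j
    using gexp_neq[OF i, of j r r 0] that by auto
  then have b0: "b \<noteq> 0"
    using odd0[of 0] n_pos y1 by (auto simp: b_def t)
  have rel: "\<psi> ?r' * a = \<psi> r * b"
    by (simp only: \<psi>_def a_def b_def mult.assoc step_ratio[OF i, of r, folded y0_def, unfolded mult.assoc])
  obtain L0 where L0: "bounded r L0" using bounded_ex by blast
  have ev: "\<forall>\<^sub>F L in sequentially. PhiL ?r' L * A L = PhiL r L * B L"
    using eventually_ge_at_top[of "L0 + 1"]
  proof eventually_elim
    case (elim L)
    have "bounded r L" using bounded_mono[OF L0] elim by simp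
    moreover have "\<bar>r i\<bar> \<le> int L0" using L0 i by (simp add: bounded_def)
    then have "int L > \<bar>r i\<bar>" using elim by linarith
    ultimately show ?case using PhiL_update[OF i, of r L] by (simp add: A_def B_def y0_def mult_ac del: fun_upd_apply)
  qed
  have Ane: "\<forall>\<^sub>F L in sequentially. A L \<noteq> 0" using lim(1) a0 by (rule tendsto_imp_eventually_ne)
  have Bne: "\<forall>\<^sub>F L in sequentially. B L \<noteq> 0" using lim(2) b0 by (rule tendsto_imp_eventually_ne)
  show ?thesis
  proof
    assume "PhiL r \<longlonglongrightarrow> \<psi> r"
    then have "(\<lambda>L. PhiL r L * B L / A L) \<longlonglongrightarrow> \<psi> r * b / a"
      by (intro tendsto_divide_fls tendsto_mult lim a0)
    moreover have "\<psi> r * b / a = \<psi> ?r'" using rel a0 by (simp add: field_simps del: fun_upd_apply)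
    moreover have "\<forall>\<^sub>F L in sequentially. PhiL r L * B L / A L = PhiL ?r' L"
      using ev Ane by eventually_elim (simp add: field_simps del: fun_upd_apply)
    ultimately show "PhiL ?r' \<longlonglongrightarrow> \<psi> ?r'" by (auto intro: Lim_transform_eventually simp del: fun_upd_apply)
  next
    assume "PhiL ?r' \<longlonglongrightarrow> \<psi> ?r'"
    then have "(\<lambda>L. PhiL ?r' L * A L / B L) \<longlonglongrightarrow> \<psi> ?r' * a / b"
      by (intro tendsto_divide_fls tendsto_mult lim b0)
    moreover have "\<psi> ?r' * a / b = \<psi> r" using rel b0 by (simp add: field_simps del: fun_upd_apply)
    moreover have "\<forall>\<^sub>F L in sequentially. PhiL ?r' L * A L / B L = PhiL r L"
      using ev Bne by eventually_elim (simp add: field_simps del: fun_upd_apply)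
    ultimately show "PhiL r \<longlonglongrightarrow> \<psi> r" by (auto intro: Lim_transform_eventually)
  qed
qed

lemma flipset_zero_shift: "flipset zero_shift = {}"
proof -
  have "thr zero_shift \<rho> = 0" if "0 \<le> \<rho>" "\<rho> < M" for \<rho>
    using that by (auto simp: thr_def zero_shift_def)
  then show ?thesis
    using mod_range by (auto simp: flipset_def inT_def pos_imp_zdiv_nonneg_iff[OF M_pos])
qed

text \<open>A step multiplies both sides by s^(2 minz + 1): if \<open>minz\<close> is nonnegative
  this index joins the flipped set, otherwise the index - minz - 1 leaves it.\<close>

lemma prod_flipset: "r \<in> PiE {..<n} (\<lambda>_. UNIV) \<Longrightarrow> (\<Prod>a\<in>flipset r. xs a) = s powi Qf r"
proof (erule PiE_grid_induct[rotated 2])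
  show "(\<Prod>a\<in>flipset (\<lambda>i. if i < n then 0 else undefined). xs a) = s powi Qf (\<lambda>i. if i < n then 0 else undefined)"
    using flipset_zero_shift by (simp add: Qf_def zero_shift_def)
next
  fix r :: "nat \<Rightarrow> int" and i assume i: "i < n"
  let ?r' = "r(i := r i + 1)"
  have iT: "inT ?r' (int a) \<longleftrightarrow> int a = - minz r i - 1 \<or> (inT r (int a) \<and> int a \<noteq> minz r i)" for a
    by (rule inT_update[OF i])
  have e1: "(\<Prod>a\<in>flipset ?r'. xs a) = (\<Prod>a\<in>flipset r. xs a) * s powi (M + gexp r i)"
  proof (cases "minz r i \<ge> 0")
    case True
    define a0 where "a0 = nat (minz r i)"
    have a0: "int a0 = minz r i" using True by (simp add: a0_def)
    have notin: "a0 \<notin> flipset r" using inT_minz[OF i, of r] a0 by (simp add: flipset_def)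
    have "flipset ?r' = insert a0 (flipset r)"
      unfolding flipset_def iT using a0 by auto
    then have "(\<Prod>a\<in>flipset ?r'. xs a) = xs a0 * (\<Prod>a\<in>flipset r. xs a)"
      using finite_flipset notin by simp
    then show ?thesis by (simp add: xs_powi a0 two_minz mult.commute)
  next
    case False
    define a0 where "a0 = nat (- minz r i - 1)"
    have a0: "int a0 = - minz r i - 1" using False by (simp add: a0_def)
    have isin: "a0 \<in> flipset r" using inT_minz[OF i, of r] inT_neg[of r "minz r i"] a0 by (simp add: flipset_def)
    have "flipset ?r' = flipset r - {a0}"
      unfolding flipset_def iT using a0 by auto
    then have "(\<Prod>a\<in>flipset r. xs a) = xs a0 * (\<Prod>a\<in>flipset ?r'. xs a)"
      using finite_flipset isin by (simp add: prod.remove[of "flipset r" a0])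
    moreover have "xs a0 * s powi (M + gexp r i) = 1"
      unfolding xs_powi a0 two_minz[symmetric] powi_add[symmetric] by simp
    ultimately show ?thesis by (simp add: mult_ac del: fun_upd_apply)
  qed
  have e2: "s powi Qf ?r' = s powi Qf r * s powi (M + gexp r i)"
    unfolding Qf_update[OF i] powi_add[symmetric] by (simp add: algebra_simps)
  have "s powi (M + gexp r i) \<noteq> 0" by (simp add: s_nonzero power_int_eq_0_iff)
  then show "(\<Prod>a\<in>flipset r. xs a) = s powi Qf r \<longleftrightarrow> (\<Prod>a\<in>flipset ?r'. xs a) = s powi Qf ?r'"
    unfolding e1 e2 using s_nonzero by simp
qed

section \<open>The limit at r = 0\<close>

definition PhiInf :: "rat fls" where
  "PhiInf = (\<Prod>k<n. qpoch q q (2 * k + 1)) / (qpoch_inf q q ^ (n - 1) * qpoch_inf s s)"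

lemma qpoch_q_Suc: "qpoch q q (Suc k) = qpoch q q k * (1 - q ^ Suc k)"
  by (simp add: qpoch_def)

lemma prod_q_shift: "qpoch q q a * (\<Prod>j<N. 1 - q ^ (a + j + 1)) = qpoch q q (a + N)"
  by (induction N) (simp_all add: qpoch_q_Suc mult_ac)

lemma prod_q_ratio: "(\<Prod>j<N. 1 - q ^ (a + j + 1)) = qpoch q q (a + N) / qpoch q q a"
  using prod_q_shift[of a N] by (subst nonzero_eq_divide_eq[OF qpoch_q_nonzero]) (simp only: mult.commute)

text \<open>Since x_N x_j = q^(N + j + 1) and t = q^(2 n), a new variable contributes quotients of
  \<open>qpoch q q\<close>, which the products over k absorb by telescoping. The number of factors
  is independent of N, so the limit can be taken factor by factor.\<close>

lemma hlPhi_closed_form: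
  "hlPhi t {..<N} xs = (\<Prod>k<n. qpoch q q (2 * k + 1)) * (\<Prod>k<n. qpoch q q (2 * N + 2 * k))
     / ((\<Prod>k<2 * n. qpoch q q (N + k)) * qpoch s q N)"
proof (induction N)
  case 0
  have "(\<Prod>k<2 * n. qpoch q q k) = (\<Prod>k<n. qpoch q q (2 * k)) * (\<Prod>k<n. qpoch q q (2 * k + 1))" for n
    by (induction n) (simp_all add: mult_ac)
  moreover have "(\<Prod>k<n. qpoch q q (2 * k + 1)) \<noteq> 0" "(\<Prod>k<n. qpoch q q (2 * k)) \<noteq> 0"
    using qpoch_q_nonzero by auto
  ultimately show ?case by (simp add: qpoch_def[of s q 0])
next
  case (Suc N)
  let ?W = "qpoch q q"
  have tel1: "(\<Prod>k<n. ?W (2 * Suc N + 2 * k)) * ?W (2 * N) = (\<Prod>k<n. ?W (2 * N + 2 * k)) * ?W (2 * N + 2 * n)" for n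
    by (induction n) (simp_all add: mult_ac)
  have tel2: "(\<Prod>k<m. ?W (Suc N + k)) * ?W N = (\<Prod>k<m. ?W (N + k)) * ?W (N + m)" for m
    by (induction m) (simp_all add: mult_ac)
  have xN: "xs N = s * q ^ N" by (simp add: xs_def power_mult)
  have tq: "t = q ^ (2 * n)" by (simp add: power_mult[symmetric])
  have "xs N * xs j = q ^ (N + j + 1)" for j
    by (simp add: xs_def power_mult[symmetric] power_add[symmetric] algebra_simps)
  then have B: "hlB t (xs N * xs j) = (1 - q ^ (2 * n + N + j + 1)) / (1 - q ^ (N + j + 1))" for j
    unfolding hlB_def tq by (simp only: power_add[symmetric] add.assoc)
  have "(\<Prod>j<N. hlB t (xs N * xs j)) = (\<Prod>j<N. 1 - q ^ (2 * n + N + j + 1)) / (\<Prod>j<N. 1 - q ^ (N + j + 1))"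
    unfolding B by (rule prod_dividef)
  also have "\<dots> = (?W (2 * n + 2 * N) / ?W (2 * n + N)) / (?W (2 * N) / ?W N)"
    unfolding prod_q_ratio by (simp only: mult_2 add.assoc)
  finally have P: "(\<Prod>j<N. hlB t (xs N * xs j)) = (?W (2 * N + 2 * n) * ?W N) / (?W (N + 2 * n) * ?W (2 * N))"
    by (simp add: add.commute)
  have S: "qpoch s q (Suc N) = qpoch s q N * (1 - xs N)" by (simp add: qpoch_def xN)
  have "{..<Suc N} = insert N {..<N}" by auto
  then have "hlPhi t {..<Suc N} xs = hlPhi t {..<N} xs * (1 / (1 - xs N) * (\<Prod>j<N. hlB t (xs N * xs j)))"
    by (simp add: hlPhi_insert)
  also have "\<dots> = (\<Prod>k<n. ?W (2 * k + 1)) * ((\<Prod>k<n. ?W (2 * N + 2 * k)) * ?W (2 * N + 2 * n)) * ?W N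
     / (((\<Prod>k<2 * n. ?W (N + k)) * ?W (N + 2 * n)) * qpoch s q (Suc N) * ?W (2 * N))"
    unfolding Suc.IH P S by (simp add: mult_ac)
  also have "\<dots> = (\<Prod>k<n. ?W (2 * k + 1)) * (\<Prod>k<n. ?W (2 * Suc N + 2 * k))
     / ((\<Prod>k<2 * n. ?W (Suc N + k)) * qpoch s q (Suc N))"
    unfolding tel1[symmetric] tel2[symmetric] using qpoch_q_nonzero by simp
  finally show ?case .
qed

lemma hlPhi_tendsto: "(\<lambda>N. hlPhi t {..<N} xs) \<longlonglongrightarrow> PhiInf"
proof -
  let ?W = "qpoch q q" and ?w = "qpoch_inf q q"
  have W: "?W \<longlonglongrightarrow> ?w" by (rule qpoch_tendsto[OF vge_q])
  have w0: "?w \<noteq> 0" by (rule qpoch_inf_nonzero[OF vge_q vge_q])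
  have sq0: "qpoch_inf s q \<noteq> 0" by (rule qpoch_inf_nonzero[OF vge_q vge_s])
  have 1: "(\<lambda>N. ?W (2 * N + 2 * k)) \<longlonglongrightarrow> ?w" for k
    using LIMSEQ_subseq_LIMSEQ[OF W, of "\<lambda>N. 2 * N + 2 * k"] by (simp add: strict_mono_def o_def)
  have 2: "(\<lambda>N. ?W (N + k)) \<longlonglongrightarrow> ?w" for k
    using LIMSEQ_ignore_initial_segment[OF W] .
  have "(\<lambda>N. hlPhi t {..<N} xs) \<longlonglongrightarrow> (\<Prod>k<n. ?W (2 * k + 1)) * (\<Prod>k<n. ?w) / ((\<Prod>k<2 * n. ?w) * qpoch_inf s q)"
    unfolding hlPhi_closed_form
    by (intro tendsto_divide_fls tendsto_mult tendsto_const tendsto_prod_fls 1 2 qpoch_tendsto vge_q) (use w0 sq0 in auto)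
  also have "(\<Prod>k<n. ?W (2 * k + 1)) * (\<Prod>k<n. ?w) / ((\<Prod>k<2 * n. ?w) * qpoch_inf s q) = PhiInf"
  proof -
    have "?w ^ n = ?w * ?w ^ (n - 1)" "?w ^ (2 * n) = ?w ^ n * ?w ^ n"
      using n_pos power_eq_if[of ?w n] by (auto simp: mult_2 power_add)
    then show ?thesis
      using w0 by (simp add: PhiInf_def qpoch_inf_split[symmetric])
  qed
  finally show ?thesis .
qed

text \<open>At r = 0, row b of the Weyl denominator has the monomial s^(-(2 b + 1)) once from z - 1
  / z and once for each a < b. The same product appears in \<open>Hfun_powers\<close> and cancels in
  the end.\<close>

definition mu :: "rat fls" where
  "mu = (\<Prod>j<n. s powi (- ((2 * int j + 1) * (int j + 1))))"

lemma Delta_zero_shift: "Delta zero_shift = mu * (\<Prod>j<n. qpoch q q (2 * j + 1))"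
proof -
  have z: "zv zero_shift j = s powi (- (2 * int j + 1))" if "j < n" for j
    using that by (simp add: zv_def gexp_def zero_shift_def)
  let ?z = "\<lambda>j. s powi (- (2 * int j + 1))"
  have qp: "q ^ k = s powi (2 * int k)" for k
    using power_int_of_nat[of s "2 * k"] by (simp add: power_mult)
  have set: "{(a, b). a < b \<and> b < n} = prod.swap ` (SIGMA b:{..<n}. {..<b})" by (auto simp: image_iff)
  have "(\<Prod>(a, b)\<in>{(a, b). a < b \<and> b < n}. wv (zv zero_shift b) - wv (zv zero_shift a))
     = (\<Prod>b<n. \<Prod>a<b. wv (zv zero_shift b) - wv (zv zero_shift a))"
    unfolding set by (subst prod.reindex, simp, subst prod.Sigma) (auto simp: o_def case_prod_unfold)
  then have "Delta zero_shift = (\<Prod>b<n. (zv zero_shift b - 1 / zv zero_shift b) * (\<Prod>a<b. wv (zv zero_shift b) - wv (zv zero_shift a)))"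
    by (simp add: Delta_def prod.distrib)
  also have "\<dots> = (\<Prod>b<n. s powi (- ((2 * int b + 1) * (int b + 1))) * qpoch q q (2 * b + 1))"
  proof (intro prod.cong refl)
    fix b assume "b \<in> {..<n}"
    then have b: "b < n" by simp
    have 1: "?z b - 1 / ?z b = ?z b * (1 - q ^ (2 * b + 1))"
      unfolding inverse_powi qp right_diff_distrib powi_add[symmetric] by simp
    have 2: "wv (?z b) - wv (?z a) = ?z b * ((1 - q ^ (b - a)) * (1 - q ^ (b + a + 1)))" if "a < b" for a
    proof -
      have "wv (?z b) = wv (1 / ?z b)" using s_nonzero by (simp add: wv_def power_int_eq_0_iff)
      then have "1 / ?z b * (wv (?z b) - wv (?z a)) = (1 - 1 / ?z b * ?z a) * (1 - 1 / ?z b / ?z a)"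
        using wv_factor[of "1 / ?z b" "?z a"] s_nonzero by (simp add: power_int_eq_0_iff)
      also have "1 / ?z b * ?z a = q ^ (b - a)"
        unfolding qp inverse_powi powi_add[symmetric] using that by (simp add: of_nat_diff algebra_simps)
      also have "1 / ?z b / ?z a = q ^ (b + a + 1)"
      proof -
        have "1 / ?z b / ?z a = 1 / ?z b * (1 / ?z a)" by simp
        then show ?thesis unfolding qp inverse_powi powi_add[symmetric] by (simp add: algebra_simps)
      qed
      finally show ?thesis using s_nonzero by (simp add: field_simps power_int_eq_0_iff)
    qed
    have "(\<Prod>a<b. (1 - q ^ (b - a)) * (1 - q ^ (b + a + 1))) = (\<Prod>a<b. 1 - q ^ (b - a)) * (\<Prod>a<b. 1 - q ^ (b + a + 1))"
      by (rule prod.distrib)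
    also have "(\<Prod>a<b. 1 - q ^ (b - a)) = qpoch q q b"
      using prod.nat_diff_reindex[of "\<lambda>k. 1 - q ^ Suc k" b]
      by (simp add: qpoch_def Suc_diff_Suc)
    also have "qpoch q q b * (\<Prod>a<b. 1 - q ^ (b + a + 1)) = qpoch q q (2 * b)"
      using prod_q_shift[of b b] by (simp add: mult_2)
    finally have 3: "(\<Prod>a<b. (1 - q ^ (b - a)) * (1 - q ^ (b + a + 1))) = qpoch q q (2 * b)" .
    have 4: "(\<Prod>a<b. wv (?z b) - wv (?z a)) = ?z b ^ b * qpoch q q (2 * b)"
      using 2 by (simp add: prod.distrib 3[symmetric])
    have "(zv zero_shift b - 1 / zv zero_shift b) * (\<Prod>a<b. wv (zv zero_shift b) - wv (zv zero_shift a))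
      = (?z b - 1 / ?z b) * (\<Prod>a<b. wv (?z b) - wv (?z a))"
      using b z by simp
    also have "\<dots> = ?z b ^ (b + 1) * (qpoch q q (2 * b) * (1 - q ^ (2 * b + 1)))"
      unfolding 1 4 by simp
    also have "qpoch q q (2 * b) * (1 - q ^ (2 * b + 1)) = qpoch q q (2 * b + 1)"
      using qpoch_q_Suc[of "2 * b"] by simp
    also have "?z b ^ (b + 1) = s powi (- ((2 * int b + 1) * (int b + 1)))"
      by (subst power_int_power') (simp add: algebra_simps)
    finally show "(zv zero_shift b - 1 / zv zero_shift b) * (\<Prod>a<b. wv (zv zero_shift b) - wv (zv zero_shift a))
      = s powi (- ((2 * int b + 1) * (int b + 1))) * qpoch q q (2 * b + 1)" .
  qed
  finally show ?thesis by (simp add: mu_def prod.distrib)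
qed

lemma mu_nonzero: "mu \<noteq> 0"
  by (simp add: mu_def s_nonzero power_int_eq_0_iff)

text \<open>Chosen so that the limit formula reduces to \<open>PhiInf\<close> at r = 0.\<close>

definition cc :: "rat fls" where
  "cc = 1 / (mu * qpoch_inf q q ^ (n - 1) * qpoch_inf s s)"

lemma PhiL_tendsto:
  assumes "r \<in> PiE {..<n} (\<lambda>_. UNIV)"
  shows "PhiL r \<longlonglongrightarrow> cc * (s powi ((2 * int n + 1) * Qf r) * Delta r)"
  using assms
proof (rule PiE_grid_induct[rotated 2])
  have "(\<lambda>L. hlPhi t {..<2 * n * L} xs) \<longlonglongrightarrow> PhiInf"
    using LIMSEQ_subseq_LIMSEQ[OF hlPhi_tendsto, of "\<lambda>L. 2 * n * L"] n_pos by (simp add: strict_mono_def o_def)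
  moreover have "PhiL zero_shift = (\<lambda>L. hlPhi t {..<2 * n * L} xs)"
    unfolding PhiL_def flipset_zero_shift by (intro ext hlPhi_cong) (simp add: flip_def)
  moreover have "cc * (s powi ((2 * int n + 1) * Qf zero_shift) * Delta zero_shift) = PhiInf"
    using mu_nonzero by (simp add: Qf_def zero_shift_def[unfolded fun_eq_iff] Delta_zero_shift cc_def PhiInf_def)
  ultimately show "PhiL (\<lambda>i. if i < n then 0 else undefined) \<longlonglongrightarrow> cc * (s powi ((2 * int n + 1) * Qf (\<lambda>i. if i < n then 0 else undefined)) * Delta (\<lambda>i. if i < n then 0 else undefined))"
    unfolding zero_shift_def[symmetric] by (simp only:)
qed (rule PhiL_step)

end

section \<open>The sets J with nonzero contribution\<close>

lemma nat_set_downward_closed: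
  assumes "finite D" "\<And>d. Suc d \<in> D \<Longrightarrow> d \<in> D"
  shows "d \<in> D \<longleftrightarrow> d < card D"
proof -
  have down: "d' \<in> D" if "d \<in> D" "d' \<le> d" for d d'
    using that(2,1) by (induction rule: inc_induct) (auto intro: assms(2))
  have "D = {..<card D}"
  proof (cases "D = {}")
    case False
    have "D = {..Max D}"
      using Max_in[OF assms(1) False] Max_ge[OF assms(1)] down by auto
    then have "card D = Suc (Max D)" by (metis card_atMost)
    then show ?thesis using \<open>D = {..Max D}\<close> lessThan_Suc_atMost by simp
  qed simp
  then show ?thesis by auto
qed

lemma hlPhi_nonzero_pair:
  fixes y :: "nat \<Rightarrow> 'a::field"
  assumes "hlPhi t X y \<noteq> 0" "finite X" "i \<in> X" "j \<in> X" "i \<noteq> j"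
  shows "t * (y i * y j) \<noteq> 1"
proof -
  have *: "t * (y a * y b) \<noteq> 1" if "a \<in> X" "b \<in> X" "a < b" for a b
  proof
    assume "t * (y a * y b) = 1"
    then have "hlB t (y a * y b) = 0" by (simp add: hlB_def)
    moreover have "finite {(i, j). i \<in> X \<and> j \<in> X \<and> i < j}"
      by (rule finite_subset[of _ "X \<times> X"]) (use assms(2) in auto)
    ultimately have "(\<Prod>(i, j)\<in>{(i, j). i \<in> X \<and> j \<in> X \<and> i < j}. hlB t (y i * y j)) = 0"
      using that by (intro prod_zero bexI[of _ "(a, b)"]) auto
    then show False using assms(1) by (simp add: hlPhi_def)
  qed
  show ?thesis
  proof (cases "i < j")
    case True
    then show ?thesis using * assms by blast
  next
    case False
    then have "t * (y j * y i) \<noteq> 1" using * assms by simp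
    then show ?thesis by (simp add: mult.commute)
  qed
qed

context nome_n
begin

text \<open>No factor 1 - t y_a y_b may vanish. For a flipped a + 2 n and an unflipped a it would,
  so \<open>J\<close> meets each residue class modulo 2 n in an initial segment
  (\<open>closed\<close>); for two flipped indices with a + b + 1 = 2 n it would as well, so of two
  opposite classes at most one is met (\<open>excl\<close>). Thus n signed lengths describe
  \<open>J\<close>.\<close>

lemma flipset_if_hlPhi_nonzero:
  assumes J: "J \<subseteq> {..<2 * n * L}" and nz: "hlPhi t {..<2 * n * L} (flip xs J) \<noteq> 0"
  shows "\<exists>r\<in>PiE {..<n} (\<lambda>_. UNIV). bounded r L \<and> J = flipset r"
proof -
  have x: "flip xs J a = (if a \<in> J then s powi (- (2 * int a + 1)) else s powi (2 * int a + 1))" for a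
    unfolding flip_def xs_powi inverse_powi ..
  have t: "t = s powi (4 * int n)" using power_int_of_nat[of s "4 * n"] by simp
  have closed: "a \<in> J" if "a + 2 * n \<in> J" for a
  proof (rule ccontr)
    assume "a \<notin> J"
    then have "t * (flip xs J (a + 2 * n) * flip xs J a) = s powi (4 * int n + (- (2 * int (a + 2 * n) + 1) + (2 * int a + 1)))"
      using that by (simp only: x if_True if_False t powi_add)
    also have "\<dots> = 1" by simp
    finally show False
      using hlPhi_nonzero_pair[OF nz, of "a + 2 * n" a] that J n_pos by auto
  qed
  have excl: "\<not> (a \<in> J \<and> b \<in> J)" if "a + b + 1 = 2 * n" for a b
  proof
    assume ab: "a \<in> J \<and> b \<in> J"
    have "t * (flip xs J a * flip xs J b) = s powi (4 * int n + (- (2 * int a + 1) + - (2 * int b + 1)))"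
      using ab by (simp only: x if_True t powi_add)
    also have "4 * int n + (- (2 * int a + 1) + - (2 * int b + 1)) = 0" using that by linarith
    finally have "t * (flip xs J a * flip xs J b) = 1" by simp
    moreover have "a \<noteq> b" using that by presburger
    ultimately show False using hlPhi_nonzero_pair[OF nz, of a b] ab J by auto
  qed
  define D where "D \<rho> = {d. \<rho> + 2 * n * d \<in> J}" for \<rho>
  define kk where "kk \<rho> = card (D \<rho>)" for \<rho>
  have DL: "D \<rho> \<subseteq> {..<L}" for \<rho>
  proof
    fix d assume "d \<in> D \<rho>"
    then have "\<rho> + 2 * n * d < 2 * n * L" using J by (auto simp: D_def)
    then have "2 * n * d < 2 * n * L" by linarith
    then show "d \<in> {..<L}" by simp
  qed
  have kL: "kk \<rho> \<le> L" for \<rho>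
    using card_mono[OF _ DL] by (simp add: kk_def)
  have D: "d \<in> D \<rho> \<longleftrightarrow> d < kk \<rho>" for d \<rho>
    unfolding kk_def
  proof (rule nat_set_downward_closed)
    show "finite (D \<rho>)" using DL finite_subset by blast
    show "d \<in> D \<rho>" if "Suc d \<in> D \<rho>" for d
      using that closed[of "\<rho> + 2 * n * d"] by (simp add: D_def algebra_simps)
  qed
  have kk0: "kk \<rho> = 0 \<or> kk \<rho>' = 0" if "\<rho> + \<rho>' + 1 = 2 * n" for \<rho> \<rho>'
    using excl[OF that] D[of 0 \<rho>] D[of 0 \<rho>'] by (auto simp: D_def)
  \<comment> \<open>At most one of the two lengths is nonzero; the sign tells which of the opposite
    classes is flipped.\<close>
  define r where "r i = (if i < n then int (kk (n - 1 - i)) - int (kk (n + i)) else undefined)" for i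
  have thr: "thr r (int \<rho>) = int (kk \<rho>) - int (kk (2 * n - 1 - \<rho>))" if "\<rho> < 2 * n" for \<rho>
  proof (cases "\<rho> < n")
    case True
    have "nat (int n - 1 - int \<rho>) = n - 1 - \<rho>" using True by simp
    moreover have "n - 1 - (n - 1 - \<rho>) = \<rho>" "n + (n - 1 - \<rho>) = 2 * n - 1 - \<rho>" "n - 1 - \<rho> < n" using True by auto
    ultimately show ?thesis using True by (simp add: thr_def r_def)
  next
    case False
    have "nat (int \<rho> - int n) = \<rho> - n" by simp
    moreover have "n + (\<rho> - n) = \<rho>" "n - 1 - (\<rho> - n) = 2 * n - 1 - \<rho>" "\<rho> - n < n" using False that by auto
    ultimately show ?thesis using False by (simp add: thr_def r_def)
  qed
  have "J = flipset r"
  proof (rule Set.set_eqI)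
    fix a
    define \<rho> d where "\<rho> = a mod (2 * n)" and "d = a div (2 * n)"
    have a: "a = \<rho> + 2 * n * d" and \<rho>: "\<rho> < 2 * n" using n_pos by (auto simp: \<rho>_def d_def)
    have "a \<in> J \<longleftrightarrow> d < kk \<rho>" using D[of d \<rho>] by (simp add: D_def a)
    moreover have "inT r (int a) \<longleftrightarrow> thr r (int \<rho>) \<le> int d"
      using inT_repr[of "int \<rho>" r "int d"] \<rho> by (simp add: a)
    ultimately show "a \<in> J \<longleftrightarrow> a \<in> flipset r"
      using kk0[of \<rho> "2 * n - 1 - \<rho>"] \<rho> by (auto simp: flipset_def thr[OF \<rho>])
  qed
  moreover have "bounded r L"
    unfolding bounded_def
  proof (intro allI impI)
    fix i assume "i < n"
    then show "\<bar>r i\<bar> \<le> int L" using kL[of "n - 1 - i"] kL[of "n + i"] by (simp add: r_def)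
  qed
  moreover have "r \<in> PiE {..<n} (\<lambda>_. UNIV)" by (simp add: PiE_def extensional_def r_def)
  ultimately show ?thesis by blast
qed

text \<open>A flipped variable contributes 1 / (1 - 1 / x) = - x / (1 - x), which has the valuation
  of x, and the pair factors are integral. As \<open>flipset\<close> is injective, this bound is
  small for only finitely many r.\<close>

lemma vge_PhiL:
  assumes "bounded r L"
  shows "vge (int (\<Sum>a\<in>flipset r. 2 * a + 1)) (PhiL r L)"
proof -
  let ?X = "{..<2 * n * L}"
  let ?y = "flip xs (flipset r)"
  have "vge (\<Sum>a\<in>?X. if a \<in> flipset r then 2 * int a + 1 else 0) (\<Prod>a\<in>?X. 1 / (1 - ?y a))"
  proof (rule vge_prod)
    fix a
    show "vge (if a \<in> flipset r then 2 * int a + 1 else 0) (1 / (1 - ?y a))"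
    proof (cases "a \<in> flipset r")
      case True
      have i: "vge 0 (1 / (1 - xs a))" "1 - xs a \<noteq> 0"
        by (rule vge_inverse_one_minus[OF vge_mono[OF vge_xs]]; simp)+
      have "1 / (1 - ?y a) = - xs a * (1 / (1 - xs a))"
        using True i(2) by (simp add: flip_def field_simps)
      moreover have "vge (2 * int a + 1 + 0) (- xs a * (1 / (1 - xs a)))"
        using vge_xs[of a] i by (intro vge_mult) auto
      ultimately show ?thesis using True by simp
    next
      case False
      moreover have "vge 0 (1 / (1 - xs a))"
        by (rule vge_inverse_one_minus[OF vge_mono[OF vge_xs]]) simp
      ultimately show ?thesis by (simp add: flip_def)
    qed
  qed
  moreover have "(\<Sum>a\<in>?X. if a \<in> flipset r then 2 * int a + 1 else 0) = int (\<Sum>a\<in>flipset r. 2 * a + 1)"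
  proof -
    have "?X \<inter> flipset r = flipset r" using flipset_subset[OF assms] by auto
    then have "(\<Sum>a\<in>?X. if a \<in> flipset r then 2 * int a + 1 else 0) = (\<Sum>a\<in>flipset r. 2 * int a + 1)"
      by (simp only: sum.inter_restrict[OF finite_lessThan, symmetric])
    then show ?thesis by (simp add: algebra_simps)
  qed
  moreover have "vge 0 (\<Prod>(i, j)\<in>{(i, j). i \<in> ?X \<and> j \<in> ?X \<and> i < j}. hlB t (?y i * ?y j))"
  proof (rule vge_prod_0; clarify)
    fix i j :: nat assume "i < j"
    then have "2 * expo r i + 1 + (2 * expo r j + 1) \<noteq> 0"
      by (auto simp: expo_def)
    then show "vge 0 (hlB t (?y i * ?y j))"
      unfolding flip_flipset powi_add[symmetric] by (rule vge_hlB)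
  qed
  ultimately have "vge (int (\<Sum>a\<in>flipset r. 2 * a + 1) + 0) (PhiL r L)"
    unfolding PhiL_def hlPhi_def by (intro vge_mult) auto
  then show ?thesis by simp
qed

text \<open>Among 2 n L variables the nonzero terms belong to the \<open>r\<close> bounded by
  \<open>L\<close>; all other \<open>r\<close> count as 0, so that the index set is independent of
  \<open>L\<close>. The weight raises the factor 2 n + 1 of the quadratic form by m, which gives
  \<kappa>.\<close>

theorem PhiSum_tendsto:
  "\<exists>S. ((\<lambda>r. cc * (s powi ((int m + 2 * int n + 1) * Qf r) * Delta r)) has_sum S) (PiE {..<n} (\<lambda>_. UNIV))
    \<and> (\<lambda>L. PhiSum t xs (\<lambda>i. xs i ^ m) {..<2 * n * L}) \<longlonglongrightarrow> S"
proof (rule has_sum_dominated[where v = "\<lambda>r. int (\<Sum>a\<in>flipset r. 2 * a + 1)"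
      and a = "\<lambda>L r. if bounded r L then PhiL r L * (\<Prod>a\<in>flipset r. xs a) ^ m else 0"])
  let ?A = "PiE {..<n} (\<lambda>_. UNIV :: int set)"
  fix r assume r: "r \<in> ?A"
  obtain L0 where L0: "bounded r L0" using bounded_ex by blast
  have "(\<lambda>L. PhiL r L * (\<Prod>a\<in>flipset r. xs a) ^ m) \<longlonglongrightarrow> cc * (s powi ((2 * int n + 1) * Qf r) * Delta r) * (s powi Qf r) ^ m"
    unfolding prod_flipset[OF r] by (intro tendsto_mult tendsto_const PhiL_tendsto r)
  also have "cc * (s powi ((2 * int n + 1) * Qf r) * Delta r) * (s powi Qf r) ^ m = cc * (s powi ((int m + 2 * int n + 1) * Qf r) * Delta r)"
  proof -
    have "(s powi Qf r) ^ m = s powi (int m * Qf r)" by (simp add: power_int_power' mult.commute)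
    moreover have "(int m + 2 * int n + 1) * Qf r = (2 * int n + 1) * Qf r + int m * Qf r" by (simp add: algebra_simps)
    ultimately show ?thesis by (simp only: powi_add mult_ac)
  qed
  finally have "(\<lambda>L. PhiL r L * (\<Prod>a\<in>flipset r. xs a) ^ m) \<longlonglongrightarrow> cc * (s powi ((int m + 2 * int n + 1) * Qf r) * Delta r)" .
  moreover have "\<forall>\<^sub>F L in sequentially. PhiL r L * (\<Prod>a\<in>flipset r. xs a) ^ m = (if bounded r L then PhiL r L * (\<Prod>a\<in>flipset r. xs a) ^ m else 0)"
    using eventually_ge_at_top[of L0] by eventually_elim (simp add: bounded_mono[OF L0])
  ultimately show "(\<lambda>L. if bounded r L then PhiL r L * (\<Prod>a\<in>flipset r. xs a) ^ m else 0) \<longlonglongrightarrow> cc * (s powi ((int m + 2 * int n + 1) * Qf r) * Delta r)"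
    by (rule Lim_transform_eventually)
  fix L
  have "vge 0 (\<Prod>a\<in>flipset r. xs a)"
    by (rule vge_mono[OF vge_prod_xs[OF finite_flipset]], rule of_nat_0_le_iff)
  then have "vge 0 ((\<Prod>a\<in>flipset r. xs a) ^ m)"
    using vge_power[of 0 "\<Prod>a\<in>flipset r. xs a" m] by simp
  then show "vge (int (\<Sum>a\<in>flipset r. 2 * a + 1)) (if bounded r L then PhiL r L * (\<Prod>a\<in>flipset r. xs a) ^ m else 0)"
    using vge_mult[OF vge_PhiL, of r L 0] by simp
next
  let ?A = "PiE {..<n} (\<lambda>_. UNIV :: int set)"
  fix k
  show "finite {r \<in> ?A. int (\<Sum>a\<in>flipset r. 2 * a + 1) < k}"
  proof (rule finite_imageD)
    show "inj_on flipset {r \<in> ?A. int (\<Sum>a\<in>flipset r. 2 * a + 1) < k}"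
      by (rule inj_on_subset[OF inj_on_flipset]) auto
    show "finite (flipset ` {r \<in> ?A. int (\<Sum>a\<in>flipset r. 2 * a + 1) < k})"
    proof (rule finite_subset[OF _ finite_sum_less[of k]], rule image_subsetI)
      fix r assume "r \<in> {r \<in> ?A. int (\<Sum>a\<in>flipset r. 2 * a + 1) < k}"
      then show "flipset r \<in> {J. finite J \<and> int (\<Sum>a\<in>J. 2 * a + 1) < k}"
        using finite_flipset[of r] by (simp only: mem_Collect_eq)
    qed
  qed
next
  let ?A = "PiE {..<n} (\<lambda>_. UNIV :: int set)"
  fix L
  define R where "R = {r \<in> ?A. bounded r L}"
  let ?F = "\<lambda>J. hlPhi t {..<2 * n * L} (flip xs J) * (\<Prod>i\<in>J. xs i ^ m)"
  show "((\<lambda>r. if bounded r L then PhiL r L * (\<Prod>a\<in>flipset r. xs a) ^ m else 0) has_sum PhiSum t xs (\<lambda>i. xs i ^ m) {..<2 * n * L}) ?A"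
  proof (rule has_sum_finite_neutralI)
    have "R \<subseteq> PiE {..<n} (\<lambda>_. {- int L..int L})"
    proof
      fix r assume "r \<in> R"
      then have r: "r \<in> ?A" "bounded r L" by (simp_all add: R_def)
      show "r \<in> PiE {..<n} (\<lambda>_. {- int L..int L})"
      proof (rule PiE_I)
        fix i assume "i \<in> {..<n}"
        then have "\<bar>r i\<bar> \<le> int L" using r(2) by (simp add: bounded_def)
        then show "r i \<in> {- int L..int L}" by (simp add: abs_le_iff)
      next
        fix i assume "i \<notin> {..<n}"
        then show "r i = undefined" using r(1) by (metis PiE_arb)
      qed
    qed
    then show "finite R" by (rule finite_subset) (simp add: finite_PiE)
    show "R \<subseteq> ?A" by (auto simp: R_def)
    show "(if bounded r L then PhiL r L * (\<Prod>a\<in>flipset r. xs a) ^ m else 0) = 0" if "r \<in> ?A - R" for r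
      using that by (auto simp: R_def)
    have "PhiSum t xs (\<lambda>i. xs i ^ m) {..<2 * n * L} = (\<Sum>J\<in>flipset ` R. ?F J)"
      unfolding PhiSum_def
    proof (rule sum.mono_neutral_right)
      show "flipset ` R \<subseteq> Pow {..<2 * n * L}" using flipset_subset by (auto simp: R_def)
      show "\<forall>J\<in>Pow {..<2 * n * L} - flipset ` R. ?F J = 0"
      proof
        fix J assume J: "J \<in> Pow {..<2 * n * L} - flipset ` R"
        have "hlPhi t {..<2 * n * L} (flip xs J) = 0"
        proof (rule ccontr)
          assume "hlPhi t {..<2 * n * L} (flip xs J) \<noteq> 0"
          then obtain r where "r \<in> ?A" "bounded r L" "J = flipset r"
            using flipset_if_hlPhi_nonzero[of J L] J by auto
          then show False using J by (auto simp: R_def)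
        qed
        then show "?F J = 0" by simp
      qed
    qed simp
    also have "\<dots> = (\<Sum>r\<in>R. ?F (flipset r))"
    proof (subst sum.reindex)
      show "inj_on flipset R" by (rule inj_on_subset[OF inj_on_flipset]) (simp add: R_def)
    qed simp
    also have "\<dots> = (\<Sum>r\<in>R. if bounded r L then PhiL r L * (\<Prod>a\<in>flipset r. xs a) ^ m else 0)"
      by (intro sum.cong refl) (auto simp: R_def PhiL_def prod_power_distrib)
    finally show "PhiSum t xs (\<lambda>i. xs i ^ m) {..<2 * n * L} = (\<Sum>r\<in>R. if bounded r L then PhiL r L * (\<Prod>a\<in>flipset r. xs a) ^ m else 0)" .
  qed
qed simp

end

section \<open>Laurent expansions of theta functions\<close>

text \<open>Convergence of the Laurent expansion at every nonzero point.\<close>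

definition entire :: "(int \<Rightarrow> 'a::field fls) \<Rightarrow> bool" where
  "entire g \<longleftrightarrow> (\<forall>\<xi> N. \<xi> \<noteq> 0 \<longrightarrow> finite {k. \<not> vge N (g k * \<xi> powi k)})"

definition laurent :: "(int \<Rightarrow> 'a::field fls) \<Rightarrow> 'a fls \<Rightarrow> 'a fls" where
  "laurent g \<xi> = infsum (\<lambda>k. g k * \<xi> powi k) UNIV"

definition conv :: "(int \<Rightarrow> 'a::field fls) \<Rightarrow> (int \<Rightarrow> 'a fls) \<Rightarrow> int \<Rightarrow> 'a fls" where
  "conv g e k = infsum (\<lambda>j. g (k - j) * e j) UNIV"

text \<open>Coefficient form of the functional equation c f(P \<xi>) = \<xi>^(-2 L)
  f(\<xi>).\<close>

definition quasi :: "int \<Rightarrow> 'a::field fls \<Rightarrow> 'a fls \<Rightarrow> (int \<Rightarrow> 'a fls) \<Rightarrow> bool" where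
  "quasi L c P g \<longleftrightarrow> (\<forall>k. g (k + 2 * L) = c * P powi k * g k)"

lemma laurent_has_sum:
  assumes "entire g" "\<xi> \<noteq> 0"
  shows "((\<lambda>k. g k * \<xi> powi k) has_sum laurent g \<xi>) UNIV"
proof -
  have "\<exists>S. ((\<lambda>k. g k * \<xi> powi k) has_sum S) UNIV"
    using assms by (intro has_sum_fls_ex) (auto simp: entire_def)
  then show ?thesis unfolding laurent_def by (metis infsumI)
qed

text \<open>The terms form an antidiagonal of the product family at \<xi> = 1, whose summability
  leaves only finitely many of them above any bound.\<close>

lemma conv_has_sum:
  assumes "entire g" "entire e"
  shows "((\<lambda>j. g (k - j) * e j) has_sum conv g e k) UNIV"
proof -
  have 1: "((\<lambda>k. g k) has_sum laurent g 1) UNIV" "((\<lambda>k. e k) has_sum laurent e 1) UNIV"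
    using laurent_has_sum[OF assms(1), of 1] laurent_has_sum[OF assms(2), of 1] by simp_all
  have fin: "finite {x \<in> UNIV \<times> UNIV. \<not> vge N (case x of (i, j) \<Rightarrow> g i * e j)}" for N
    by (rule has_sum_fls_finite[OF has_sum_product_fls[OF 1]])
  have "\<exists>S. ((\<lambda>j. g (k - j) * e j) has_sum S) UNIV"
  proof (rule has_sum_fls_ex)
    fix N
    have "finite ((\<lambda>j. (k - j, j)) ` {j \<in> UNIV. \<not> vge N (g (k - j) * e j)})"
      by (rule finite_subset[OF _ fin[of N]]) auto
    then show "finite {j \<in> UNIV. \<not> vge N (g (k - j) * e j)}"
      by (rule finite_imageD) (auto simp: inj_on_def)
  qed
  then show ?thesis unfolding conv_def by (metis infsumI)
qed

lemma laurent_mult: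
  assumes "entire g" "entire e" "\<xi> \<noteq> 0"
  shows "((\<lambda>k. conv g e k * \<xi> powi k) has_sum laurent g \<xi> * laurent e \<xi>) UNIV"
proof -
  have "((\<lambda>(i, j). (g i * \<xi> powi i) * (e j * \<xi> powi j)) has_sum laurent g \<xi> * laurent e \<xi>) (UNIV \<times> UNIV)"
    by (intro has_sum_product_fls laurent_has_sum assms)
  also have "?this \<longleftrightarrow> ((\<lambda>(k, j). (g (k - j) * e j) * \<xi> powi k) has_sum laurent g \<xi> * laurent e \<xi>) (UNIV \<times> UNIV)"
  proof (rule has_sum_reindex_bij_witness[of _ "\<lambda>(k, j). (k - j, j)" "\<lambda>(i, j). (i + j, j)"])
    fix a :: "int \<times> int"
    show "(case (case a of (i, j) \<Rightarrow> (i + j, j)) of (k, j) \<Rightarrow> g (k - j) * e j * \<xi> powi k)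
      = (case a of (i, j) \<Rightarrow> g i * \<xi> powi i * (e j * \<xi> powi j))"
      using assms(3) by (cases a) (simp add: power_int_add mult_ac)
  qed auto
  finally have *: "((\<lambda>(k, j). (g (k - j) * e j) * \<xi> powi k) has_sum laurent g \<xi> * laurent e \<xi>) (UNIV \<times> UNIV)" .
  show ?thesis
    by (rule has_sum_SigmaD[OF *]) (simp add: has_sum_cmult_left conv_has_sum assms)
qed

lemma finite_vge_lower:
  fixes f :: "'b \<Rightarrow> 'a::field fls"
  assumes "finite A"
  shows "\<exists>m. \<forall>x\<in>A. vge m (f x)"
  using has_sum_fls_lower[OF has_sum_finite[OF assms, of f]] by metis

text \<open>A step by 2 L multiplies the term g_k \<xi>^k by c P^k \<xi>^(2 L), of valuation at
  least 1 from \<open>K\<close> on, so the valuations grow with every period. Negative indices are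
  reached through \<open>quasi_reflect\<close>.\<close>

lemma quasi_decay:
  fixes g :: "int \<Rightarrow> 'a::field fls"
  assumes P: "P \<noteq> 0" "vge 1 P" and c: "c \<noteq> 0" and L: "L > 0" and q: "quasi L c P g" and \<xi>: "\<xi> \<noteq> 0"
  shows "finite {k. k \<ge> 0 \<and> \<not> vge N (g k * \<xi> powi k)}"
proof -
  define T where "T k = g k * \<xi> powi k" for k
  define K where "K = max 0 (1 - fls_subdegree c - 2 * L * fls_subdegree \<xi>)"
  have dP: "fls_subdegree P \<ge> 1" using P by (simp add: vge_iff_subdegree)
  have step: "vge (m + 1) (T (k + 2 * L))" if "k \<ge> K" "vge m (T k)" for k m
  proof -
    have "T (k + 2 * L) = (c * P powi k * \<xi> powi (2 * L)) * T k"
      using q \<xi> by (simp add: T_def quasi_def power_int_add mult_ac)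
    moreover have "vge 1 (c * P powi k * \<xi> powi (2 * L))"
    proof -
      have "k * 1 \<le> k * fls_subdegree P" using dP that(1) by (intro mult_left_mono) (auto simp: K_def)
      then have "1 \<le> fls_subdegree c + k * fls_subdegree P + 2 * L * fls_subdegree \<xi>"
        using that(1) by (simp add: K_def)
      then show ?thesis
        using P c \<xi> by (simp add: vge_iff_subdegree fls_subdegree_power_int power_int_eq_0_iff)
    qed
    ultimately show ?thesis using vge_mult[of 1 _ m "T k"] that(2) by (simp add: add.commute)
  qed
  obtain m where "\<forall>k\<in>{K..<K + 2 * L}. vge m (T k)"
    using finite_vge_lower[OF finite_atLeastLessThan_int] by blast
  then have m: "vge m (T k)" if "k \<in> {K..<K + 2 * L}" for k using that by blast
  have claim: "vge (m + int j) (T k)" if "K + 2 * L * int j \<le> k" "k < K + 2 * L * int j + 2 * L" for j k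
    using that
  proof (induction j arbitrary: k)
    case 0
    then show ?case using m[of k] by simp
  next
    case (Suc j)
    have "vge (m + int j + 1) (T (k - 2 * L + 2 * L))"
    proof (rule step)
      have "0 \<le> 2 * L * int j" using L by simp
      moreover have "2 * L * int (Suc j) = 2 * L * int j + 2 * L" by (simp add: algebra_simps)
      ultimately show "K \<le> k - 2 * L" using Suc.prems(1) by linarith
      show "vge (m + int j) (T (k - 2 * L))" using Suc.prems by (intro Suc.IH) (auto simp: algebra_simps)
    qed
    then show ?case by (simp add: add_ac)
  qed
  have "{k. k \<ge> 0 \<and> \<not> vge N (g k * \<xi> powi k)} \<subseteq> {0..<K + 2 * L * int (nat (N - m))}"
  proof
    fix k assume k: "k \<in> {k. k \<ge> 0 \<and> \<not> vge N (g k * \<xi> powi k)}"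
    show "k \<in> {0..<K + 2 * L * int (nat (N - m))}"
    proof (rule ccontr)
      assume "k \<notin> {0..<K + 2 * L * int (nat (N - m))}"
      then have big: "K + 2 * L * int (nat (N - m)) \<le> k" using k by auto
      define j where "j = nat ((k - K) div (2 * L))"
      have "0 \<le> 2 * L * int (nat (N - m))" using L by simp
      then have kK: "0 \<le> k - K" using big by linarith
      have j: "int j = (k - K) div (2 * L)" using kK L by (simp add: j_def pos_imp_zdiv_nonneg_iff)
      have "int (nat (N - m)) = (2 * L * int (nat (N - m))) div (2 * L)" using L by simp
      also have "\<dots> \<le> (k - K) div (2 * L)" using big L by (intro zdiv_mono1) auto
      finally have jN: "int (nat (N - m)) \<le> int j" using j by simp
      have "2 * L * int j \<le> k - K" "k - K < 2 * L * int j + 2 * L"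
        unfolding j using L mult_div_mod_eq[of "2 * L" "k - K"] pos_mod_bound[of "2 * L" "k - K"] pos_mod_sign[of "2 * L" "k - K"]
        by linarith+
      then have "vge (m + int j) (T k)" by (intro claim) auto
      then have "vge N (T k)" by (rule vge_mono) (use jN in linarith)
      then show False using k by (simp add: T_def)
    qed
  qed
  then show ?thesis using finite_subset by blast
qed

lemma quasi_reflect:
  assumes P: "P \<noteq> 0" and c: "c \<noteq> 0" and q: "quasi L c P g"
  shows "quasi L (P powi (2 * L) / c) P (\<lambda>k. g (- k))"
  unfolding quasi_def
proof
  fix k
  have "g (- k) = c * P powi (- k - 2 * L) * g (- k - 2 * L)"
    using q[unfolded quasi_def, rule_format, of "- k - 2 * L"] by simp
  moreover have "P powi (- k - 2 * L) * (P powi (2 * L) * P powi k) = 1"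
    using P by (simp add: power_int_add[symmetric])
  ultimately show "g (- (k + 2 * L)) = P powi (2 * L) / c * P powi k * g (- k)"
    using c by (simp add: field_simps)
qed

lemma quasi_entire:
  assumes "P \<noteq> 0" "vge 1 P" "c \<noteq> 0" "L > 0" "quasi L c P g"
  shows "entire g"
  unfolding entire_def
proof (intro allI impI)
  fix \<xi> :: "'a fls" and N assume \<xi>: "\<xi> \<noteq> 0"
  have 1: "finite {k. k \<ge> 0 \<and> \<not> vge N (g k * \<xi> powi k)}"
    using assms \<xi> by (intro quasi_decay) auto
  have 2: "finite {k. k \<ge> 0 \<and> \<not> vge N (g (- k) * (1 / \<xi>) powi k)}"
    using assms \<xi> by (intro quasi_decay[OF assms(1,2) _ assms(4) quasi_reflect]) (auto simp: power_int_eq_0_iff)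
  have "{k. \<not> vge N (g k * \<xi> powi k)} \<subseteq> {k. k \<ge> 0 \<and> \<not> vge N (g k * \<xi> powi k)}
      \<union> uminus ` {k. k \<ge> 0 \<and> \<not> vge N (g (- k) * (1 / \<xi>) powi k)}"
  proof
    fix k assume k: "k \<in> {k. \<not> vge N (g k * \<xi> powi k)}"
    have "(1 / \<xi>) powi (- k) = \<xi> powi k"
      using \<xi> by (simp add: power_int_minus power_int_divide_distrib inverse_eq_divide)
    then have "k < 0 \<Longrightarrow> - k \<in> {k. k \<ge> 0 \<and> \<not> vge N (g (- k) * (1 / \<xi>) powi k)}"
      using k by simp
    then show "k \<in> {k. k \<ge> 0 \<and> \<not> vge N (g k * \<xi> powi k)}
      \<union> uminus ` {k. k \<ge> 0 \<and> \<not> vge N (g (- k) * (1 / \<xi>) powi k)}"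
      using k by (cases "k < 0") (auto intro!: image_eqI[of k uminus "- k"])
  qed
  then show "finite {k. \<not> vge N (g k * \<xi> powi k)}"
    using 1 2 finite_subset by blast
qed

text \<open>Moving the summation index by 2 L' distributes the shift 2 (L + L') over both factors,
  and P^(k - j) P^j no longer depends on j.\<close>

lemma quasi_conv:
  assumes P: "P \<noteq> 0" and e: "entire g" "entire e" and q: "quasi L c P g" "quasi L' c' P e"
  shows "quasi (L + L') (c * c') P (conv g e)"
  unfolding quasi_def
proof
  fix k
  have "((\<lambda>j. g (k + 2 * (L + L') - j) * e j) has_sum conv g e (k + 2 * (L + L'))) UNIV"
    by (rule conv_has_sum[OF e])
  also have "?this \<longleftrightarrow> ((\<lambda>j. g (k + 2 * (L + L') - (j + 2 * L')) * e (j + 2 * L')) has_sum conv g e (k + 2 * (L + L'))) UNIV"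
    by (rule has_sum_reindex_bij_witness[of _ "\<lambda>j. j + 2 * L'" "\<lambda>j. j - 2 * L'"]) auto
  also have "(\<lambda>j. g (k + 2 * (L + L') - (j + 2 * L')) * e (j + 2 * L')) = (\<lambda>j. (c * c' * P powi k) * (g (k - j) * e j))"
  proof
    fix j
    have "k + 2 * (L + L') - (j + 2 * L') = (k - j) + 2 * L" by simp
    then have "g (k + 2 * (L + L') - (j + 2 * L')) * e (j + 2 * L') = (c * P powi (k - j) * g (k - j)) * (c' * P powi j * e j)"
      using q by (simp only: quasi_def)
    also have "\<dots> = (c * c' * (P powi (k - j) * P powi j)) * (g (k - j) * e j)" by (simp only: mult_ac)
    also have "P powi (k - j) * P powi j = P powi k" using P by (simp add: power_int_add[symmetric])
    finally show "g (k + 2 * (L + L') - (j + 2 * L')) * e (j + 2 * L') = (c * c' * P powi k) * (g (k - j) * e j)" .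
  qed
  finally have "((\<lambda>j. (c * c' * P powi k) * (g (k - j) * e j)) has_sum conv g e (k + 2 * (L + L'))) UNIV" .
  moreover have "((\<lambda>j. (c * c' * P powi k) * (g (k - j) * e j)) has_sum (c * c' * P powi k) * conv g e k) UNIV"
    by (intro has_sum_cmult_right conv_has_sum e)
  ultimately show "conv g e (k + 2 * (L + L')) = c * c' * P powi k * conv g e k"
    by (rule has_sum_unique)
qed

lemma quasi_shift:
  assumes "P \<noteq> 0" "quasi L c P g"
  shows "quasi L (c * P powi a) P (\<lambda>k. g (k + a))"
  unfolding quasi_def
proof
  fix k
  have "g (k + a + 2 * L) = c * P powi (k + a) * g (k + a)" using assms(2) by (simp add: quasi_def)
  then show "g (k + 2 * L + a) = c * P powi a * P powi k * g (k + a)"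
    using assms(1) by (simp add: power_int_add algebra_simps)
qed

lemma laurent_shift:
  assumes "entire g" "\<xi> \<noteq> 0"
  shows "((\<lambda>k. g (k + a) * \<xi> powi k) has_sum \<xi> powi (- a) * laurent g \<xi>) UNIV"
proof -
  have "((\<lambda>k. \<xi> powi (- a) * (g k * \<xi> powi k)) has_sum \<xi> powi (- a) * laurent g \<xi>) UNIV"
    by (intro has_sum_cmult_right laurent_has_sum assms)
  also have "?this \<longleftrightarrow> ((\<lambda>k. \<xi> powi (- a) * (g (k + a) * \<xi> powi (k + a))) has_sum \<xi> powi (- a) * laurent g \<xi>) UNIV"
    by (rule has_sum_reindex_bij_witness[of _ "\<lambda>k. k + a" "\<lambda>k. k - a"]) auto
  also have "(\<lambda>k. \<xi> powi (- a) * (g (k + a) * \<xi> powi (k + a))) = (\<lambda>k. g (k + a) * \<xi> powi k)"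
  proof
    fix k
    have "\<xi> powi (- a) * \<xi> powi (k + a) = \<xi> powi k" using assms(2) by (simp add: power_int_add[symmetric])
    then show "\<xi> powi (- a) * (g (k + a) * \<xi> powi (k + a)) = g (k + a) * \<xi> powi k"
      by (metis mult.left_commute)
  qed
  finally show ?thesis .
qed

section \<open>Jacobi's triple product\<close>

definition jac :: "'a::field fls \<Rightarrow> int \<Rightarrow> 'a fls" where
  "jac p k = (- 1) powi k * p powi (k * (k - 1) div 2)"

lemma jac_Suc: "p \<noteq> 0 \<Longrightarrow> jac p (k + 1) = - (p powi k) * jac p k"
proof -
  assume p: "p \<noteq> 0"
  have "(k + 1) * (k + 1 - 1) = k * (k - 1) + k * 2" by (simp add: algebra_simps)
  then have "(k + 1) * (k + 1 - 1) div 2 = k * (k - 1) div 2 + k" by simp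
  then show ?thesis using p by (simp add: jac_def power_int_add)
qed

lemma jac_reflect: "jac p (1 - k) = - jac p k"
proof -
  have "(1 - k) * (1 - k - 1) = k * (k - 1)" by (simp add: algebra_simps)
  moreover have "(- 1 :: 'a fls) powi (1 - k) = - ((- 1) powi k)"
    by (simp add: power_int_diff power_int_minus_left)
  ultimately show ?thesis by (simp add: jac_def)
qed

lemma jac_nonzero: "p \<noteq> 0 \<Longrightarrow> jac p k \<noteq> 0"
  by (simp add: jac_def power_int_eq_0_iff)

lemma jac_0 [simp]: "jac p 0 = 1"
  by (simp add: jac_def)

lemma qpoch_unit:
  fixes p :: "'a::field fls"
  assumes "vge 1 p"
  shows "qpoch p p k \<noteq> 0" "fls_subdegree (qpoch p p k) = 0"
proof -
  have "qpoch p p k \<noteq> 0 \<and> fls_subdegree (qpoch p p k) = 0"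
  proof (induction k)
    case (Suc k)
    have "vge 1 (p * p ^ k)" using vge_mult_power[OF assms assms, of k] by (rule vge_mono) simp
    then have "fls_nth (1 - p * p ^ k) 0 \<noteq> 0" "\<forall>i<0. fls_nth (1 - p * p ^ k) i = 0"
      by (auto simp: vge_def)
    then have "1 - p * p ^ k \<noteq> 0" "fls_subdegree (1 - p * p ^ k) = 0"
      by (auto intro: fls_subdegree_eqI)
    then show ?case using Suc by (simp add: qpoch_def)
  qed (simp add: qpoch_def)
  then show "qpoch p p k \<noteq> 0" "fls_subdegree (qpoch p p k) = 0" by auto
qed

definition qbin :: "'a::field fls \<Rightarrow> nat \<Rightarrow> nat \<Rightarrow> 'a fls" where
  "qbin p N j = (if j \<le> N then qpoch p p N / (qpoch p p j * qpoch p p (N - j)) else 0)"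

lemma qbin_Suc:
  assumes "vge 1 p"
  shows "qbin p (Suc N) (Suc j) = qbin p N (Suc j) + p ^ (N - j) * qbin p N j"
proof -
  note nz = qpoch_unit(1)[OF assms]
  have S: "qpoch p p (Suc k) = qpoch p p k * (1 - p ^ Suc k)" for k by (simp add: qpoch_def)
  have nz': "1 - p ^ Suc k \<noteq> 0" for k using nz[of "Suc k"] unfolding S by auto
  consider "Suc j \<le> N" | "j = N" | "j > N" by linarith
  then show ?thesis
  proof cases
    case 1
    define m where "m = N - Suc j"
    have N: "N = Suc j + m" "N - j = Suc m" "Suc N - Suc j = Suc m" "N - Suc j = m" using 1 by (auto simp: m_def)
    have "qbin p (Suc N) (Suc j) = qpoch p p N * (1 - p ^ Suc N) / (qpoch p p (Suc j) * qpoch p p (Suc m))"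
    proof -
      have "Suc j \<le> Suc N" using 1 by simp
      then show ?thesis by (simp only: qbin_def N(3) S[of N] if_True)
    qed
    also have "\<dots> = qpoch p p N * ((1 - p ^ Suc m) + p ^ Suc m * (1 - p ^ Suc j)) / (qpoch p p (Suc j) * qpoch p p (Suc m))"
      unfolding N(1) by (simp add: power_add algebra_simps)
    also have "\<dots> = qpoch p p N * (1 - p ^ Suc m) / (qpoch p p (Suc j) * qpoch p p (Suc m))
        + p ^ Suc m * (qpoch p p N * (1 - p ^ Suc j) / (qpoch p p (Suc j) * qpoch p p (Suc m)))"
      by (simp add: add_divide_distrib[symmetric] algebra_simps)
    also have "qpoch p p N * (1 - p ^ Suc m) / (qpoch p p (Suc j) * qpoch p p (Suc m)) = qpoch p p N / (qpoch p p (Suc j) * qpoch p p m)"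
      unfolding S[of m] using nz' nz by simp
    also have "qpoch p p N * (1 - p ^ Suc j) / (qpoch p p (Suc j) * qpoch p p (Suc m)) = qpoch p p N / (qpoch p p j * qpoch p p (Suc m))"
      unfolding S[of j] using nz' nz by simp
    finally show ?thesis using 1 by (simp add: qbin_def N)
  next
    case 2
    then show ?thesis using nz by (simp add: qbin_def qpoch_def[of p p 0])
  next
    case 3
    then show ?thesis by (simp add: qbin_def)
  qed
qed

lemma qbinomial_theorem:
  assumes p: "vge 1 p" "p \<noteq> 0"
  shows "(\<Prod>j<N. 1 - z * p ^ j) = (\<Sum>j\<le>N. jac p (int j) * qbin p N j * z ^ j)"
proof (induction N)
  case 0
  then show ?case by (simp add: qbin_def qpoch_def)
next
  case (Suc N)
  let ?a = "\<lambda>N j. jac p (int j) * qbin p N j * z ^ j"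
  have "(\<Prod>j<Suc N. 1 - z * p ^ j) = (\<Sum>j\<le>N. ?a N j) - (\<Sum>j\<le>N. ?a N j) * (z * p ^ N)"
    using Suc by (simp add: algebra_simps)
  also have "\<dots> = (\<Sum>j\<le>Suc N. ?a N j) - (\<Sum>j\<le>N. ?a N j) * (z * p ^ N)"
    by (simp add: qbin_def)
  also have "(\<Sum>j\<le>Suc N. ?a N j) = ?a N 0 + (\<Sum>j\<le>N. ?a N (Suc j))"
    by (rule sum.atMost_Suc_shift)
  also have "(\<Sum>j\<le>N. ?a N j) * (z * p ^ N) = (\<Sum>j\<le>N. - (jac p (int (Suc j)) * (p ^ (N - j) * qbin p N j) * z ^ Suc j))"
    unfolding sum_distrib_right
  proof (intro sum.cong refl)
    fix j assume "j \<in> {..N}"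
    then have "p ^ N = p ^ j * p ^ (N - j)" by (simp add: power_add[symmetric])
    moreover have "jac p (int (Suc j)) = - (p ^ j) * jac p (int j)"
      using jac_Suc[OF p(2), of "int j"] by (simp add: add.commute)
    ultimately show "?a N j * (z * p ^ N) = - (jac p (int (Suc j)) * (p ^ (N - j) * qbin p N j) * z ^ Suc j)"
      by simp
  qed
  also have "?a N 0 + (\<Sum>j\<le>N. ?a N (Suc j)) - (\<Sum>j\<le>N. - (jac p (int (Suc j)) * (p ^ (N - j) * qbin p N j) * z ^ Suc j))
    = ?a N 0 + (\<Sum>j\<le>N. ?a (Suc N) (Suc j))"
    unfolding qbin_Suc[OF p(1)] by (simp add: sum_negf sum.distrib algebra_simps)
  also have "?a N 0 = ?a (Suc N) 0"
    using qpoch_unit(1)[OF p(1)] by (simp add: qbin_def qpoch_def[of p p 0])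
  also have "?a (Suc N) 0 + (\<Sum>j\<le>N. ?a (Suc N) (Suc j)) = (\<Sum>j\<le>Suc N. ?a (Suc N) j)"
    by (rule sum.atMost_Suc_shift[symmetric])
  finally show ?case .
qed

lemma prod_lessThan_add: "(\<Prod>j<a + b. f j) = (\<Prod>j<a. f j) * (\<Prod>j<b. f (a + j))" for a b :: nat
  by (induction b) (simp_all add: mult_ac)

text \<open>The q-binomial theorem with 2 N factors at z / p^N. The first N factors are those of
  \<open>qpoch (p / z) p N\<close> in reverse order, up to the monomial \<open>E N\<close>; the same
  monomial separates the j-th term from the one centred at j - N.\<close>

lemma finite_jacobi_triple:
  assumes p: "vge 1 p" "p \<noteq> 0" and z: "z \<noteq> 0"
  shows "qpoch z p N * qpoch (p / z) p N
    = (\<Sum>j\<le>2 * N. jac p (int j - int N) * z powi (int j - int N) * qbin p (2 * N) j)"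
proof -
  define E where "E N = (\<Prod>j<N. - (z / p ^ Suc j))" for N
  have E0: "E N \<noteq> 0" for N using p z by (simp add: E_def)
  have EN: "E N * (jac p (- int N) * z powi (- int N)) = 1" for N
  proof (induction N)
    case (Suc N)
    have "jac p (- int N) = - (p powi (- int (Suc N))) * jac p (- int (Suc N))"
      using jac_Suc[OF p(2), of "- int (Suc N)"] by simp
    then have j: "jac p (- int (Suc N)) = - (p ^ Suc N) * jac p (- int N)"
      using p(2) by (simp add: power_int_minus field_simps del: power_Suc of_nat_Suc)
    have zz: "z powi (- int (Suc N)) = z powi (- int N) / z"
    proof -
      have "- int (Suc N) = - int N - 1" by simp
      then show ?thesis using power_int_diff[OF disjI1[OF z], of "- int N" 1] by (simp only: power_int_1_right)
    qed
    have "E (Suc N) = E N * - (z / p ^ Suc N)" by (simp add: E_def)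
    then have "E (Suc N) * (jac p (- int (Suc N)) * z powi (- int (Suc N)))
        = E N * - (z / p ^ Suc N) * (- (p ^ Suc N) * jac p (- int N) * (z powi (- int N) / z))"
      by (simp only: j zz)
    also have "\<dots> = (E N * (jac p (- int N) * z powi (- int N))) * ((z / p ^ Suc N) * (p ^ Suc N) / z)"
      by (simp del: power_Suc)
    also have "\<dots> = 1" using Suc z p(2) by simp
    finally show ?case .
  qed (simp add: E_def)
  have trm: "jac p (int j) * (z / p ^ N) ^ j = E N * (jac p (int j - int N) * z powi (int j - int N))" for j
  proof (induction j)
    case 0
    then show ?case using EN[of N] by simp
  next
    case (Suc j)
    have j1: "jac p (int (Suc j)) = - (p ^ j) * jac p (int j)"
      using jac_Suc[OF p(2), of "int j"] by (simp add: add.commute)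
    have j2: "jac p (int (Suc j) - int N) = - (p ^ j / p ^ N) * jac p (int j - int N)"
    proof -
      have "int (Suc j) - int N = (int j - int N) + 1" by simp
      then have "jac p (int (Suc j) - int N) = - (p powi (int j - int N)) * jac p (int j - int N)"
        using jac_Suc[OF p(2), of "int j - int N"] by (simp only:)
      then show ?thesis using p(2) by (simp add: power_int_diff)
    qed
    have z2: "z powi (int (Suc j) - int N) = z * z powi (int j - int N)"
    proof -
      have "int (Suc j) - int N = 1 + (int j - int N)" by simp
      then show ?thesis using power_int_add[OF disjI1[OF z], of 1 "int j - int N"] by (simp only: power_int_1_right)
    qed
    have "jac p (int (Suc j)) * (z / p ^ N) ^ Suc j = - (p ^ j) * (z / p ^ N) * (jac p (int j) * (z / p ^ N) ^ j)"
      by (simp only: j1 power_Suc mult_ac)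
    also have "\<dots> = E N * (jac p (int (Suc j) - int N) * z powi (int (Suc j) - int N))"
      unfolding Suc j2 z2 by (simp add: mult_ac)
    finally show ?case .
  qed
  have "(\<Prod>j<2 * N. 1 - z / p ^ N * p ^ j) = (\<Prod>j<N. 1 - z / p ^ N * p ^ j) * (\<Prod>j<N. 1 - z / p ^ N * p ^ (N + j))"
    using prod_lessThan_add[of "\<lambda>j. 1 - z / p ^ N * p ^ j" N N] by (simp only: mult_2)
  also have "(\<Prod>j<N. 1 - z / p ^ N * p ^ (N + j)) = qpoch z p N"
    using p(2) by (simp add: qpoch_def power_add)
  also have "(\<Prod>j<N. 1 - z / p ^ N * p ^ j) = (\<Prod>j<N. 1 - z / p ^ Suc j)"
  proof -
    have "(\<Prod>j<N. 1 - z / p ^ N * p ^ j) = (\<Prod>j<N. 1 - z / p ^ N * p ^ (N - Suc j))"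
      by (rule prod.nat_diff_reindex[symmetric])
    also have "\<dots> = (\<Prod>j<N. 1 - z / p ^ Suc j)"
    proof (intro prod.cong refl)
      fix j assume "j \<in> {..<N}"
      then have "p ^ N = p ^ Suc j * p ^ (N - Suc j)" by (simp add: power_add[symmetric] del: power_Suc)
      then have "z / p ^ N * p ^ (N - Suc j) = z / p ^ Suc j" using p(2) by simp
      then show "1 - z / p ^ N * p ^ (N - Suc j) = 1 - z / p ^ Suc j" by simp
    qed
    finally show ?thesis .
  qed
  also have "\<dots> = E N * qpoch (p / z) p N"
    unfolding E_def qpoch_def prod.distrib[symmetric] using p(2) z
    by (intro prod.cong refl) (simp add: field_simps)
  finally have "E N * (qpoch z p N * qpoch (p / z) p N) = (\<Prod>j<2 * N. 1 - z / p ^ N * p ^ j)"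
    by (simp add: mult_ac)
  also have "\<dots> = (\<Sum>j\<le>2 * N. jac p (int j) * qbin p (2 * N) j * (z / p ^ N) ^ j)"
    by (rule qbinomial_theorem[OF p])
  also have "\<dots> = (\<Sum>j\<le>2 * N. E N * (jac p (int j - int N) * z powi (int j - int N) * qbin p (2 * N) j))"
  proof (intro sum.cong refl)
    fix j
    have "jac p (int j) * qbin p (2 * N) j * (z / p ^ N) ^ j = (jac p (int j) * (z / p ^ N) ^ j) * qbin p (2 * N) j"
      by (simp only: mult_ac)
    then show "jac p (int j) * qbin p (2 * N) j * (z / p ^ N) ^ j = E N * (jac p (int j - int N) * z powi (int j - int N) * qbin p (2 * N) j)"
      unfolding trm by (simp only: mult_ac)
  qed
  also have "\<dots> = E N * (\<Sum>j\<le>2 * N. jac p (int j - int N) * z powi (int j - int N) * qbin p (2 * N) j)"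
    by (rule sum_distrib_left[symmetric])
  finally show ?thesis using E0 by simp
qed

text \<open>Limit of the finite form. Gaussian binomials are integral, so the terms without them
  dominate. Their decay follows from \<open>quasi_entire\<close> with nome p^2, because two steps of
  \<open>jac\<close> make one period.\<close>

lemma jacobi_triple_product:
  assumes p: "vge 1 p" "p \<noteq> 0" and z: "z \<noteq> 0"
  shows "((\<lambda>k. jac p k / qpoch_inf p p * z powi k) has_sum theta z p) UNIV"
proof -
  define w where "w = qpoch_inf p p"
  have w0: "w \<noteq> 0" unfolding w_def by (rule qpoch_inf_nonzero[OF p(1) p(1)])
  have W: "qpoch p p \<longlonglongrightarrow> w" unfolding w_def by (rule qpoch_tendsto[OF p(1)])
  define a where "a N k = (if \<bar>k\<bar> \<le> int N then jac p k * z powi k * qbin p (2 * N) (nat (int N + k)) else 0)" for N :: nat and k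
  have "quasi 1 p (p ^ 2) (jac p)"
    unfolding quasi_def
  proof
    fix k
    have "jac p (k + 2 * 1) = - (p powi (k + 1)) * (- (p powi k) * jac p k)"
      using jac_Suc[OF p(2), of k] jac_Suc[OF p(2), of "k + 1"] by (simp add: add.assoc)
    also have "\<dots> = p * (p powi k * p powi k) * jac p k" using p(2) by (simp add: power_int_add)
    also have "p powi k * p powi k = (p ^ 2) powi k"
      by (simp add: power2_eq_square power_int_mult_distrib)
    finally show "jac p (k + 2 * 1) = p * (p ^ 2) powi k * jac p k" .
  qed
  moreover have "vge 1 (p ^ 2)" using vge_power[OF p(1), of 2] by (rule vge_mono) simp
  ultimately have ent: "entire (jac p)" using p(2) by (intro quasi_entire[of "p ^ 2" p 1]) auto
  have "\<exists>S. ((\<lambda>k. jac p k / w * z powi k) has_sum S) UNIV \<and> (\<lambda>N. qpoch z p N * qpoch (p / z) p N) \<longlonglongrightarrow> S"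
  proof (rule has_sum_dominated[where a = a and v = "\<lambda>k. fls_subdegree (jac p k * z powi k)"])
    fix k :: int
    have flim: "filterlim (\<lambda>N. nat (int N + l)) at_top sequentially" for l
      unfolding filterlim_at_top
    proof
      fix Z
      show "\<forall>\<^sub>F N in sequentially. Z \<le> nat (int N + l)"
        using eventually_ge_at_top[of "nat (int Z - l)"] by eventually_elim linarith
    qed
    have W1: "(\<lambda>N. qpoch p p (nat (int N + l))) \<longlonglongrightarrow> w" for l
      using W flim by (rule filterlim_compose)
    have W2: "(\<lambda>N. qpoch p p (2 * N)) \<longlonglongrightarrow> w"
      using LIMSEQ_subseq_LIMSEQ[OF W, of "\<lambda>N. 2 * N"] by (simp add: strict_mono_def o_def)
    have "(\<lambda>N. jac p k * z powi k * (qpoch p p (2 * N) / (qpoch p p (nat (int N + k)) * qpoch p p (nat (int N + (- k))))))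
      \<longlonglongrightarrow> jac p k * z powi k * (w / (w * w))"
      using w0 by (intro tendsto_mult tendsto_const tendsto_divide_fls W1 W2) auto
    also have "jac p k * z powi k * (w / (w * w)) = jac p k / w * z powi k" using w0 by simp
    finally show "(\<lambda>N. a N k) \<longlonglongrightarrow> jac p k / w * z powi k"
    proof (rule Lim_transform_eventually)
      show "\<forall>\<^sub>F N in sequentially. jac p k * z powi k * (qpoch p p (2 * N) / (qpoch p p (nat (int N + k)) * qpoch p p (nat (int N + (- k))))) = a N k"
        using eventually_ge_at_top[of "nat \<bar>k\<bar>"]
      proof eventually_elim
        case (elim N)
        then have "2 * N - nat (int N + k) = nat (int N + (- k))" "nat (int N + k) \<le> 2 * N" "\<bar>k\<bar> \<le> int N" by linarith+
        then show ?case by (simp add: a_def qbin_def)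
      qed
    qed
    fix N
    have "vge 0 (qbin p (2 * N) j)" for j
      using qpoch_unit[OF p(1)] by (auto simp: qbin_def vge_iff_subdegree divide_inverse fls_inverse_subdegree)
    then have "vge (fls_subdegree (jac p k * z powi k) + 0) (jac p k * z powi k * qbin p (2 * N) (nat (int N + k)))"
      by (intro vge_mult) (auto simp: vge_iff_subdegree)
    then show "vge (fls_subdegree (jac p k * z powi k)) (a N k)" by (simp add: a_def)
  next
    fix K
    have "{k \<in> UNIV. fls_subdegree (jac p k * z powi k) < K} \<subseteq> {k. \<not> vge K (jac p k * z powi k)}"
      using jac_nonzero[OF p(2)] z by (auto simp: vge_iff_subdegree power_int_eq_0_iff)
    then show "finite {k \<in> UNIV. fls_subdegree (jac p k * z powi k) < K}"
      using ent z finite_subset unfolding entire_def by blast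
  next
    fix N
    show "(a N has_sum qpoch z p N * qpoch (p / z) p N) UNIV"
    proof (rule has_sum_finite_neutralI[of "{- int N..int N}"])
      show "a N k = 0" if "k \<in> UNIV - {- int N..int N}" for k
        using that by (auto simp: a_def)
      have "(\<Sum>j\<le>2 * N. jac p (int j - int N) * z powi (int j - int N) * qbin p (2 * N) j) = (\<Sum>k\<in>{- int N..int N}. a N k)"
        by (rule sum.reindex_bij_witness[of _ "\<lambda>k. nat (int N + k)" "\<lambda>j. int j - int N"]) (auto simp: a_def)
      then show "qpoch z p N * qpoch (p / z) p N = (\<Sum>k\<in>{- int N..int N}. a N k)"
        unfolding finite_jacobi_triple[OF p z] .
    qed auto
  qed simp
  then obtain S where S: "((\<lambda>k. jac p k / w * z powi k) has_sum S) UNIV"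
    and lim: "(\<lambda>N. qpoch z p N * qpoch (p / z) p N) \<longlonglongrightarrow> S" by blast
  have "(\<lambda>N. qpoch z p N * qpoch (p / z) p N) \<longlonglongrightarrow> theta z p"
    unfolding theta_def by (intro tendsto_mult qpoch_tendsto p)
  with lim have "S = theta z p" by (rule LIMSEQ_unique)
  with S show ?thesis by (simp add: w_def)
qed

text \<open>Coefficients in \<xi> of theta(y \<xi>^2; p), hence supported on even exponents.\<close>

definition thetaC :: "'a::field fls \<Rightarrow> 'a fls \<Rightarrow> int \<Rightarrow> 'a fls" where
  "thetaC p y k = (if even k then jac p (k div 2) * y powi (k div 2) / qpoch_inf p p else 0)"

lemma thetaC_has_sum:
  assumes p: "vge 1 p" "p \<noteq> 0" and y: "y \<noteq> 0" and \<xi>: "\<xi> \<noteq> 0"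
  shows "((\<lambda>k. thetaC p y k * \<xi> powi k) has_sum theta (y * \<xi>\<^sup>2) p) UNIV"
proof -
  have "((\<lambda>j. jac p j / qpoch_inf p p * (y * \<xi>\<^sup>2) powi j) has_sum theta (y * \<xi>\<^sup>2) p) UNIV"
    using y \<xi> by (intro jacobi_triple_product p) auto
  also have "(\<lambda>j. jac p j / qpoch_inf p p * (y * \<xi>\<^sup>2) powi j) = (\<lambda>k. thetaC p y k * \<xi> powi k) \<circ> (\<lambda>j. 2 * j)"
    by (rule ext) (simp add: thetaC_def power_int_mult_distrib power_int_mult)
  also have "(\<dots> has_sum theta (y * \<xi>\<^sup>2) p) UNIV \<longleftrightarrow> ((\<lambda>k. thetaC p y k * \<xi> powi k) has_sum theta (y * \<xi>\<^sup>2) p) (range (\<lambda>j. 2 * j))"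
    by (rule has_sum_reindex[symmetric]) (simp add: inj_on_def)
  also have "\<dots> \<longleftrightarrow> ?thesis"
    by (rule has_sum_cong_neutral) (auto simp: thetaC_def elim!: evenE)
  finally show ?thesis .
qed

lemma laurent_thetaC:
  assumes "vge 1 p" "p \<noteq> 0" "y \<noteq> 0" "\<xi> \<noteq> 0"
  shows "laurent (thetaC p y) \<xi> = theta (y * \<xi>\<^sup>2) p"
  unfolding laurent_def by (rule infsumI[OF thetaC_has_sum[OF assms]])

lemma thetaC_Suc2:
  assumes "p \<noteq> 0" "y \<noteq> 0"
  shows "thetaC p y (2 * j + 2) = - y * p powi j * thetaC p y (2 * j)"
proof -
  have d: "(2 * j + 2) div 2 = j + 1" by simp
  show ?thesis unfolding thetaC_def d jac_Suc[OF assms(1)] using assms(2) by (simp add: power_int_add)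
qed

lemma thetaC_odd: "odd k \<Longrightarrow> thetaC p y k = 0"
  by (simp add: thetaC_def)

lemma thetaC_quasi:
  assumes "P \<noteq> 0" "y \<noteq> 0"
  shows "quasi 1 (- y) P (thetaC (P\<^sup>2) y)"
  unfolding quasi_def
proof
  fix k
  show "thetaC (P\<^sup>2) y (k + 2 * 1) = - y * P powi k * thetaC (P\<^sup>2) y k"
  proof (cases "even k")
    case True
    then obtain j where j: "k = 2 * j" by (elim evenE)
    have "(P\<^sup>2) powi j = P powi (2 * j)" by (simp add: power_int_mult)
    then show ?thesis using thetaC_Suc2[of "P\<^sup>2" y j] assms by (simp add: j)
  qed (simp add: thetaC_odd)
qed

text \<open>The shift \<xi> -> P \<xi> multiplies \<xi>^2 by P^2, which is one period for nome P^2
  but two for nome P; hence 2 here and 1 in \<open>thetaC_quasi\<close>.\<close>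

lemma thetaC_quasi2:
  assumes "P \<noteq> 0"
  shows "quasi 2 P P (thetaC P 1)"
  unfolding quasi_def
proof
  fix k
  show "thetaC P 1 (k + 2 * 2) = P * P powi k * thetaC P 1 k"
  proof (cases "even k")
    case True
    then obtain j where j: "k = 2 * j" by (elim evenE)
    have "thetaC P 1 (k + 2 * 2) = thetaC P 1 (2 * (j + 1) + 2)" by (simp add: j add.commute)
    also have "\<dots> = - 1 * P powi (j + 1) * thetaC P 1 (2 * (j + 1))" by (rule thetaC_Suc2[OF assms]) simp
    also have "2 * (j + 1) = 2 * j + 2" by simp
    also have "thetaC P 1 (2 * j + 2) = - 1 * P powi j * thetaC P 1 (2 * j)" by (rule thetaC_Suc2[OF assms]) simp
    also have "- 1 * P powi (j + 1) * (- 1 * P powi j * thetaC P 1 (2 * j)) = P * (P powi j * P powi j) * thetaC P 1 k"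
      using assms by (simp add: power_int_add j)
    also have "P powi j * P powi j = P powi k" unfolding j mult_2 by (rule power_int_add[symmetric]) (use assms in simp)
    finally show ?thesis .
  qed (simp add: thetaC_odd)
qed

lemma thetaC_reflect:
  assumes "y \<noteq> 0"
  shows "thetaC p y (2 - k) = - y * thetaC p (1 / y) k"
proof (cases "even k")
  case True
  then obtain j where j: "k = 2 * j" by (elim evenE)
  have d: "(2 - k) div 2 = 1 - j" "k div 2 = j" "even (2 - k)" using j by auto
  have "y powi (1 - j) = y * (1 / y) powi j" using assms by (simp add: power_int_diff power_int_divide_distrib)
  then show ?thesis using True by (simp add: thetaC_def d jac_reflect)
qed (simp add: thetaC_odd)

text \<open>Functions with f(1 / \<xi>) = - f(\<xi>) = f(- \<xi>) and a fixed functional equation.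
  Among 4 n consecutive coefficients the even ones vanish and the odd ones pair up with opposite
  signs, so the dimension is n.\<close>

definition thspace :: "nat \<Rightarrow> 'a::field fls \<Rightarrow> (int \<Rightarrow> 'a fls) \<Rightarrow> bool" where
  "thspace n P g \<longleftrightarrow> quasi (2 * int n) (P powi (2 * int n)) P g \<and> (\<forall>k. g (- k) = - g k) \<and> (\<forall>k. even k \<longrightarrow> g k = 0)"

lemma thspace_entire:
  assumes "P \<noteq> 0" "vge 1 P" "n \<ge> 1" "thspace n P g"
  shows "entire g"
  using assms by (intro quasi_entire[of P "P powi (2 * int n)" "2 * int n"]) (auto simp: thspace_def power_int_eq_0_iff)

lemma thspace_base:
  assumes P: "P \<noteq> 0" "vge 1 P"
  shows "\<exists>g. thspace 1 P g \<and> (\<forall>\<xi>. \<xi> \<noteq> 0 \<longrightarrow> laurent g \<xi> = \<xi> powi (- 1) * theta (\<xi>\<^sup>2) P)"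
proof (intro exI conjI allI impI)
  define g where "g = (\<lambda>k. thetaC P 1 (k + 1))"
  have e: "entire (thetaC P 1)"
    using P by (intro quasi_entire[OF P _ _ thetaC_quasi2]) auto
  have "quasi 2 (P * P powi 1) P g"
    unfolding g_def by (rule quasi_shift[OF P(1) thetaC_quasi2[OF P(1)]])
  moreover have "P * P powi 1 = P powi 2" using P by (simp add: power2_eq_square)
  moreover have "g (- k) = - g k" for k
    using thetaC_reflect[of 1 P "k + 1"] by (simp add: g_def)
  moreover have "g k = 0" if "even k" for k using that by (simp add: g_def thetaC_odd)
  ultimately show "thspace 1 P g" by (simp add: thspace_def)
  fix \<xi> :: "'a fls" assume \<xi>: "\<xi> \<noteq> 0"
  show "laurent g \<xi> = \<xi> powi (- 1) * theta (\<xi>\<^sup>2) P"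
    unfolding laurent_def g_def
    using infsumI[OF laurent_shift[OF e \<xi>, of 1]] P \<xi> by (simp add: laurent_thetaC)
qed

text \<open>As a function of \<xi> it vanishes at c and 1 / c, and \<xi>^(-2) makes it invariant
  under \<xi> -> 1 / \<xi>. Multiplication by it raises the parameter \<open>n\<close> of
  \<open>thspace\<close> by one.\<close>

definition pairf :: "'a::field fls \<Rightarrow> 'a fls \<Rightarrow> 'a fls \<Rightarrow> 'a fls" where
  "pairf p c \<xi> = \<xi> powi (- 2) * theta (c\<^sup>2 * \<xi>\<^sup>2) p * theta (\<xi>\<^sup>2 / c\<^sup>2) p"

lemma pairf_expansion:
  assumes P: "P \<noteq> 0" "vge 1 P" and c: "c \<noteq> 0"
  shows "\<exists>e. quasi 2 (P powi 2) P e \<and> (\<forall>k. e (- k) = e k) \<and> (\<forall>k. odd k \<longrightarrow> e k = 0) \<and>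
    (\<forall>\<xi>. \<xi> \<noteq> 0 \<longrightarrow> laurent e \<xi> = pairf (P\<^sup>2) c \<xi>)"
proof -
  define p where "p = P\<^sup>2"
  define y where "y = c\<^sup>2"
  define a where "a = conv (thetaC p y) (thetaC p (1 / y))"
  define e where "e = (\<lambda>k. a (k + 2))"
  have y: "y \<noteq> 0" using c by (simp add: y_def)
  have p: "vge 1 p" "p \<noteq> 0" unfolding p_def using vge_mono[OF vge_power[OF P(2), of 2]] P(1) by simp_all
  have q: "quasi 1 (- y) P (thetaC p y)" "quasi 1 (- (1 / y)) P (thetaC p (1 / y))"
    unfolding p_def using P y by (auto intro!: thetaC_quasi)
  have e1: "entire (thetaC p y)" "entire (thetaC p (1 / y))"
    using y by (auto intro!: quasi_entire[OF P _ _ q(1)] quasi_entire[OF P _ _ q(2)])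
  have "quasi (1 + 1) (- y * - (1 / y)) P a" unfolding a_def by (rule quasi_conv[OF P(1) e1 q])
  then have qa: "quasi 2 1 P a" using y by simp
  have ea: "entire a" by (rule quasi_entire[OF P _ _ qa]) auto
  have qe: "quasi 2 (P powi 2) P e" using quasi_shift[OF P(1) qa, of 2] by (simp add: e_def)
  \<comment> \<open>The reflection k -> 2 - k exchanges the two theta factors, whose constants - y
    and - 1 / y multiply to 1.\<close>
  have even_e: "e (- k) = e k" for k
  proof -
  have "((\<lambda>j. thetaC p y (- k + 2 - j) * thetaC p (1 / y) j) has_sum e (- k)) UNIV"
    unfolding e_def a_def by (rule conv_has_sum[OF e1])
  also have "?this \<longleftrightarrow> ((\<lambda>i. thetaC p y (- k + 2 - (i - k)) * thetaC p (1 / y) (i - k)) has_sum e (- k)) UNIV"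
    by (rule has_sum_reindex_bij_witness[of _ "\<lambda>j. j - k" "\<lambda>j. j + k"]) auto
  also have "(\<lambda>i. thetaC p y (- k + 2 - (i - k)) * thetaC p (1 / y) (i - k)) = (\<lambda>i. thetaC p y (k + 2 - i) * thetaC p (1 / y) i)"
  proof
    fix i
    have 1: "thetaC p y (- k + 2 - (i - k)) = - y * thetaC p (1 / y) i"
      using thetaC_reflect[OF y, of p i] by simp
    have "thetaC p (1 / y) (2 - (k + 2 - i)) = - (1 / y) * thetaC p (1 / (1 / y)) (k + 2 - i)"
      by (rule thetaC_reflect) (use y in simp)
    then have 2: "thetaC p (1 / y) (i - k) = - (1 / y) * thetaC p y (k + 2 - i)" by simp
    show "thetaC p y (- k + 2 - (i - k)) * thetaC p (1 / y) (i - k) = thetaC p y (k + 2 - i) * thetaC p (1 / y) i"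
      unfolding 1 2 using y by simp
  qed
  finally have "((\<lambda>i. thetaC p y (k + 2 - i) * thetaC p (1 / y) i) has_sum e (- k)) UNIV" .
  moreover have "((\<lambda>i. thetaC p y (k + 2 - i) * thetaC p (1 / y) i) has_sum e k) UNIV"
    unfolding e_def a_def by (rule conv_has_sum[OF e1])
  ultimately show ?thesis by (rule has_sum_unique)
  qed
  have odd_e: "e k = 0" if k: "odd k" for k
    unfolding e_def a_def conv_def
  proof (rule infsum_0)
    fix j
    show "thetaC p y (k + 2 - j) * thetaC p (1 / y) j = 0"
      using k by (cases "even j") (simp_all add: thetaC_odd)
  qed
  have le: "laurent e \<xi> = pairf (P\<^sup>2) c \<xi>" if \<xi>: "\<xi> \<noteq> 0" for \<xi>
  proof -
    have "laurent a \<xi> = laurent (thetaC p y) \<xi> * laurent (thetaC p (1 / y)) \<xi>"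
      using infsumI[OF laurent_mult[OF e1 \<xi>]] by (simp add: laurent_def a_def)
    also have "\<dots> = theta (y * \<xi>\<^sup>2) p * theta (\<xi>\<^sup>2 / y) p"
      using y \<xi> p by (simp add: laurent_thetaC)
    finally have a: "laurent a \<xi> = theta (y * \<xi>\<^sup>2) p * theta (\<xi>\<^sup>2 / y) p" .
    have "laurent e \<xi> = \<xi> powi (- 2) * laurent a \<xi>"
      unfolding e_def using infsumI[OF laurent_shift[OF ea \<xi>, of 2]] by (simp add: laurent_def)
    then show ?thesis by (simp add: a pairf_def y_def p_def mult.assoc)
  qed
  show ?thesis by (intro exI[of _ e] conjI allI impI qe even_e odd_e le)
qed

text \<open>An antisymmetric function times a symmetric one is antisymmetric, and the functional
  equations multiply.\<close>

lemma thspace_conv: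
  assumes P: "P \<noteq> 0" "vge 1 P" and n: "n \<ge> 1" and g: "thspace n P g"
    and e: "quasi 2 (P powi 2) P e" "\<And>k. e (- k) = e k" "\<And>k. odd k \<Longrightarrow> e k = 0"
  shows "thspace (Suc n) P (conv g e)" "\<xi> \<noteq> 0 \<Longrightarrow> laurent (conv g e) \<xi> = laurent g \<xi> * laurent e \<xi>"
proof -
  have ent: "entire g" "entire e"
    using thspace_entire[OF P n g] quasi_entire[OF P _ _ e(1)] P(1) by (auto simp: power_int_eq_0_iff)
  have qg: "quasi (2 * int n) (P powi (2 * int n)) P g" and godd: "g (- k) = - g k" and geven: "even k \<Longrightarrow> g k = 0" for k
    using g by (auto simp: thspace_def)
  have "quasi (2 * int n + 2) (P powi (2 * int n) * P powi 2) P (conv g e)"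
    by (rule quasi_conv[OF P(1) ent qg e(1)])
  moreover have "P powi (2 * int n) * P powi 2 = P powi (2 * int n + 2)"
    by (rule power_int_add[symmetric]) (use P in simp)
  moreover have "2 * int n + 2 = 2 * int (Suc n)" by simp
  ultimately have q: "quasi (2 * int (Suc n)) (P powi (2 * int (Suc n))) P (conv g e)" by simp
  have "conv g e (- k) = - conv g e k" for k
  proof -
    have "((\<lambda>j. g (- k - j) * e j) has_sum conv g e (- k)) UNIV" by (rule conv_has_sum[OF ent])
    also have "?this \<longleftrightarrow> ((\<lambda>j. g (- k - (- j)) * e (- j)) has_sum conv g e (- k)) UNIV"
      by (rule has_sum_reindex_bij_witness[of _ uminus uminus]) auto
    also have "(\<lambda>j. g (- k - (- j)) * e (- j)) = (\<lambda>j. - (g (k - j) * e j))"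
    proof
      fix j
      show "g (- k - (- j)) * e (- j) = - (g (k - j) * e j)"
        using godd[of "k - j"] e(2)[of j] by simp
    qed
    finally have "((\<lambda>j. - (g (k - j) * e j)) has_sum conv g e (- k)) UNIV" .
    moreover have "((\<lambda>j. - (g (k - j) * e j)) has_sum - conv g e k) UNIV"
      using has_sum_cmult_right[OF conv_has_sum[OF ent, of k], of "- 1"] by simp
    ultimately show ?thesis by (rule has_sum_unique)
  qed
  moreover have "conv g e k = 0" if "even k" for k
    unfolding conv_def
  proof (rule infsum_0)
    fix j
    show "g (k - j) * e j = 0"
      using that by (cases "even j") (simp_all add: geven e(3))
  qed
  ultimately show "thspace (Suc n) P (conv g e)" using q by (simp add: thspace_def)
  show "laurent (conv g e) \<xi> = laurent g \<xi> * laurent e \<xi>" if "\<xi> \<noteq> 0"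
    using infsumI[OF laurent_mult[OF ent that]] by (simp add: laurent_def)
qed

text \<open>An element of \<open>thspace\<close> with prescribed zeros c_j, used as an interpolating
  function in \<open>Dfun_update\<close>.\<close>

definition hfun :: "'a::field fls \<Rightarrow> (nat \<Rightarrow> 'a fls) \<Rightarrow> nat set \<Rightarrow> 'a fls \<Rightarrow> 'a fls" where
  "hfun P c J \<xi> = \<xi> powi (- 1) * theta (\<xi>\<^sup>2) P * (\<Prod>j\<in>J. pairf (P\<^sup>2) (c j) \<xi>)"

lemma hfun_expansion:
  assumes P: "P \<noteq> 0" "vge 1 P" and J: "finite J" "\<And>j. j \<in> J \<Longrightarrow> c j \<noteq> 0"
  shows "\<exists>g. thspace (Suc (card J)) P g \<and> (\<forall>\<xi>. \<xi> \<noteq> 0 \<longrightarrow> laurent g \<xi> = hfun P c J \<xi>)"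
  using J
proof (induction J)
  case empty
  show ?case using thspace_base[OF P] by (simp add: hfun_def)
next
  case (insert j J)
  then obtain g where g: "thspace (Suc (card J)) P g" "\<And>\<xi>. \<xi> \<noteq> 0 \<Longrightarrow> laurent g \<xi> = hfun P c J \<xi>" by auto
  obtain e where e: "quasi 2 (P powi 2) P e" "\<And>k. e (- k) = e k" "\<And>k. odd k \<Longrightarrow> e k = 0"
    "\<And>\<xi>. \<xi> \<noteq> 0 \<Longrightarrow> laurent e \<xi> = pairf (P\<^sup>2) (c j) \<xi>"
    using pairf_expansion[OF P, of "c j"] insert.prems by auto
  note thspace_conv[OF P _ g(1) e(1-3)]
  moreover have "hfun P c (insert j J) \<xi> = hfun P c J \<xi> * pairf (P\<^sup>2) (c j) \<xi>" for \<xi>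
    using insert.hyps by (simp add: hfun_def)
  ultimately show ?case using insert.hyps g(2) e(4) by (intro exI[of _ "conv g e"]) simp
qed

text \<open>The solution of the functional equation that is supported on b + 4 n \<int> and equals 1
  at b. For r \<ge> 0 the exponent is the sum of b + 4 n l + 2 n over 0 \<le> l < r.\<close>

definition thbase1 :: "nat \<Rightarrow> 'a::field fls \<Rightarrow> int \<Rightarrow> int \<Rightarrow> 'a fls" where
  "thbase1 n P b k = (let r = (k - b) div (4 * int n) in
    if 4 * int n dvd k - b then P powi (2 * int n * r\<^sup>2 + b * r) else 0)"

definition thbase :: "nat \<Rightarrow> 'a::field fls \<Rightarrow> int \<Rightarrow> int \<Rightarrow> 'a fls" where
  "thbase n P b k = thbase1 n P b k - thbase1 n P b (- k)"

lemma thbase1_at: "n \<ge> 1 \<Longrightarrow> thbase1 n P b (b + 4 * int n * r) = P powi (2 * int n * r\<^sup>2 + b * r)"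
  by (simp add: thbase1_def)

lemma thbase1_quasi:
  assumes P: "P \<noteq> 0" and n: "n \<ge> 1"
  shows "quasi (2 * int n) (P powi (2 * int n)) P (thbase1 n P b)"
  unfolding quasi_def
proof
  fix k
  have N: "k + 2 * (2 * int n) - b = (k - b) + 4 * int n" by simp
  show "thbase1 n P b (k + 2 * (2 * int n)) = P powi (2 * int n) * P powi k * thbase1 n P b k"
  proof (cases "4 * int n dvd k - b")
    case True
    then obtain r where r: "k - b = 4 * int n * r" by (elim dvdE)
    have k: "k = 4 * int n * r + b" using r by simp
    have "thbase1 n P b (k + 2 * (2 * int n)) = thbase1 n P b (b + 4 * int n * (r + 1))"
      unfolding k by (simp add: algebra_simps)
    also have "\<dots> = P powi (2 * int n * (r + 1)\<^sup>2 + b * (r + 1))" by (rule thbase1_at[OF n])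
    also have "2 * int n * (r + 1)\<^sup>2 + b * (r + 1) = 2 * int n + k + (2 * int n * r\<^sup>2 + b * r)"
      unfolding k by (simp add: power2_eq_square algebra_simps)
    also have "P powi \<dots> = P powi (2 * int n) * P powi k * P powi (2 * int n * r\<^sup>2 + b * r)"
      using P by (simp add: power_int_add)
    also have "P powi (2 * int n * r\<^sup>2 + b * r) = thbase1 n P b k"
      using thbase1_at[OF n, of P b r] by (simp add: k add.commute)
    finally show ?thesis .
  next
    case False
    then have "\<not> 4 * int n dvd (k - b) + 4 * int n" by simp
    then have "thbase1 n P b (k + 2 * (2 * int n)) = 0"
      unfolding thbase1_def N Let_def by (rule if_not_P)
    moreover have "thbase1 n P b k = 0" using False by (simp add: thbase1_def)
    ultimately show ?thesis by simp
  qed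
qed

lemma thbase_quasi:
  assumes P: "P \<noteq> 0" and n: "n \<ge> 1"
  shows "quasi (2 * int n) (P powi (2 * int n)) P (thbase n P b)"
proof -
  have "quasi (2 * int n) (P powi (2 * (2 * int n)) / P powi (2 * int n)) P (\<lambda>k. thbase1 n P b (- k))"
    by (rule quasi_reflect[OF P _ thbase1_quasi[OF P n]]) (use P in \<open>simp add: power_int_eq_0_iff\<close>)
  moreover have "P powi (2 * (2 * int n)) / P powi (2 * int n) = P powi (2 * int n)"
    using P by (simp add: power_int_diff[symmetric])
  ultimately have "quasi (2 * int n) (P powi (2 * int n)) P (\<lambda>k. thbase1 n P b (- k))" by simp
  with thbase1_quasi[OF P n, of b] show ?thesis
    by (simp add: quasi_def thbase_def algebra_simps)
qed

lemma thbase_has_sum: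
  assumes P: "P \<noteq> 0" "vge 1 P" and n: "n \<ge> 1" and \<xi>: "\<xi> \<noteq> 0"
  shows "((\<lambda>r. P powi (2 * int n * r\<^sup>2 + b * r) * (\<xi> powi (b + 4 * int n * r) - \<xi> powi (- (b + 4 * int n * r))))
    has_sum laurent (thbase n P b) \<xi>) UNIV"
proof -
  define c where "c r = P powi (2 * int n * r\<^sup>2 + b * r)" for r
  have inj: "inj (\<lambda>r. b + 4 * int n * r)" using n by (auto simp: inj_on_def)
  have c: "thbase1 n P b (b + 4 * int n * r) = c r" for r
    using thbase1_at[OF n] by (simp add: c_def)
  have z: "thbase1 n P b k = 0" if "k \<notin> range (\<lambda>r. b + 4 * int n * r)" for k
  proof -
    have "\<not> 4 * int n dvd k - b"
    proof
      assume "4 * int n dvd k - b"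
      then obtain r where "k - b = 4 * int n * r" by (elim dvdE)
      then have "k = b + 4 * int n * r" by simp
      with that show False by blast
    qed
    then show ?thesis by (simp add: thbase1_def)
  qed
  have e1: "entire (thbase1 n P b)"
    using P n by (intro quasi_entire[OF P _ _ thbase1_quasi]) (auto simp: power_int_eq_0_iff)
  have sum: "((\<lambda>r. c r * \<xi> powi (b + 4 * int n * r)) has_sum laurent (thbase1 n P b) \<xi>) UNIV" if "\<xi> \<noteq> 0" for \<xi>
  proof -
    have "((\<lambda>k. thbase1 n P b k * \<xi> powi k) has_sum laurent (thbase1 n P b) \<xi>) UNIV"
      by (rule laurent_has_sum[OF e1 that])
    also have "?this \<longleftrightarrow> ((\<lambda>k. thbase1 n P b k * \<xi> powi k) has_sum laurent (thbase1 n P b) \<xi>) (range (\<lambda>r. b + 4 * int n * r))"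
      by (rule has_sum_cong_neutral) (auto simp: z)
    also have "\<dots> \<longleftrightarrow> ((\<lambda>r. c r * \<xi> powi (b + 4 * int n * r)) has_sum laurent (thbase1 n P b) \<xi>) UNIV"
      unfolding has_sum_reindex[OF inj] o_def c ..
    finally show ?thesis .
  qed
  have p: "(1 / \<xi>) powi k = \<xi> powi (- k)" for k
    by (simp add: power_int_minus power_int_divide_distrib inverse_eq_divide)
  have S: "((\<lambda>r. c r * \<xi> powi (b + 4 * int n * r) - c r * (1 / \<xi>) powi (b + 4 * int n * r))
    has_sum laurent (thbase1 n P b) \<xi> - laurent (thbase1 n P b) (1 / \<xi>)) UNIV"
    using has_sum_add[OF sum[OF \<xi>] has_sum_cmult_right[OF sum, of "1 / \<xi>" "- 1"]] \<xi> by simp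
  have "laurent (thbase n P b) \<xi> = laurent (thbase1 n P b) \<xi> - laurent (thbase1 n P b) (1 / \<xi>)"
  proof -
    have 1: "((\<lambda>k. thbase1 n P b k * \<xi> powi k) has_sum laurent (thbase1 n P b) \<xi>) UNIV"
      by (rule laurent_has_sum[OF e1 \<xi>])
    have "((\<lambda>k. thbase1 n P b k * (1 / \<xi>) powi k) has_sum laurent (thbase1 n P b) (1 / \<xi>)) UNIV"
      by (rule laurent_has_sum[OF e1]) (use \<xi> in simp)
    also have "?this \<longleftrightarrow> ((\<lambda>k. thbase1 n P b (- k) * (1 / \<xi>) powi (- k)) has_sum laurent (thbase1 n P b) (1 / \<xi>)) UNIV"
      by (rule has_sum_reindex_bij_witness[of _ uminus uminus]) auto
    finally have 2: "((\<lambda>k. thbase1 n P b (- k) * \<xi> powi k) has_sum laurent (thbase1 n P b) (1 / \<xi>)) UNIV"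
      by (simp add: p)
    show ?thesis
      unfolding laurent_def[of "thbase n P b"]
      using infsumI[OF has_sum_add[OF 1 has_sum_cmult_right[OF 2, of "- 1"]]] by (simp add: thbase_def left_diff_distrib)
  qed
  with S show ?thesis by (simp add: p c_def right_diff_distrib)
qed

lemma quasi_eqI:
  assumes P: "P \<noteq> 0" and c: "c \<noteq> 0" and L: "L > 0" and q: "quasi L c P g" "quasi L c P h"
    and eq: "\<And>k. - L \<le> k \<Longrightarrow> k < L \<Longrightarrow> g k = h k"
  shows "g = h"
proof
  fix k
  have S: "g (k + 2 * L) = h (k + 2 * L) \<longleftrightarrow> g k = h k" for k
    using P c q by (simp add: quasi_def power_int_eq_0_iff)
  have "g (k0 + 2 * L * r) = h (k0 + 2 * L * r) \<longleftrightarrow> g k0 = h k0" for k0 r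
  proof (induction r rule: int_induct[of _ 0])
    case (step1 i)
    then show ?case using S[of "k0 + 2 * L * i"] by (simp add: algebra_simps)
  next
    case (step2 i)
    then show ?case using S[of "k0 + 2 * L * (i - 1)"] by (simp add: algebra_simps)
  qed simp
  moreover define r where "r = (k + L) div (2 * L)"
  moreover define k0 where "k0 = (k + L) mod (2 * L) - L"
  moreover have "k = k0 + 2 * L * r" unfolding r_def k0_def using mult_div_mod_eq[of "2 * L" "k + L"] by linarith
  moreover have "g k0 = h k0"
    using L pos_mod_bound[of "2 * L" "k + L"] pos_mod_sign[of "2 * L" "k + L"] by (intro eq) (auto simp: k0_def)
  ultimately show "g k = h k" by metis
qed

text \<open>Sums and differences of the odd numbers 2 i + 1 and 2 j + 1 are below 4 n in absolute
  value, so modulo 4 n only i = j can coincide. The basis is thus dual to the coefficients at - 1, -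
  3, and so on.\<close>

lemma thbase_at:
  assumes n: "n \<ge> 1" and i: "i < n" "j < n"
  shows "thbase n P (- (2 * int i + 1)) (- (2 * int j + 1)) = (if i = j then 1 else 0)"
proof -
  have small: "d = 0" if "4 * int n dvd d" "\<bar>d\<bar> < 4 * int n" for d
    using that zdvd_not_zless[of "\<bar>d\<bar>" "4 * int n"] by (cases "d = 0") auto
  have "\<not> 4 * int n dvd (2 * int j + 1) - (- (2 * int i + 1))"
    using small[of "(2 * int j + 1) - (- (2 * int i + 1))"] i by auto
  moreover have "4 * int n dvd - (2 * int j + 1) - (- (2 * int i + 1)) \<longleftrightarrow> i = j"
    using small[of "- (2 * int j + 1) - (- (2 * int i + 1))"] i by auto
  ultimately show ?thesis by (auto simp: thbase_def thbase1_def Let_def)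
qed

definition thfun :: "nat \<Rightarrow> 'a::field fls \<Rightarrow> nat \<Rightarrow> 'a fls \<Rightarrow> 'a fls" where
  "thfun n P i \<xi> = laurent (thbase n P (- (2 * int i + 1))) \<xi>"

lemma has_sum_sum_fls:
  fixes f :: "'b \<Rightarrow> 'c \<Rightarrow> 'a::field fls"
  assumes "finite I" "\<And>i. i \<in> I \<Longrightarrow> (f i has_sum S i) A"
  shows "((\<lambda>x. \<Sum>i\<in>I. f i x) has_sum (\<Sum>i\<in>I. S i)) A"
  using assms
proof (induction I)
  case (insert i I)
  have 1: "(f i has_sum S i) A" using insert.prems by simp
  have 2: "((\<lambda>x. \<Sum>i\<in>I. f i x) has_sum (\<Sum>i\<in>I. S i)) A" using insert.IH insert.prems by simp
  show ?case using has_sum_add[OF 1 2] insert.hyps by simp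
qed simp

text \<open>Both sides have the same functional equation and symmetries, so only the n odd
  coefficients from -(2 n - 1) to - 1 have to be compared.\<close>

lemma thspace_expand:
  assumes P: "P \<noteq> 0" "vge 1 P" and n: "n \<ge> 1" and g: "thspace n P g" and \<xi>: "\<xi> \<noteq> 0"
  shows "laurent g \<xi> = (\<Sum>i<n. g (- (2 * int i + 1)) * thfun n P i \<xi>)"
proof -
  let ?b = "\<lambda>i. - (2 * int i + 1)"
  define h where "h k = (\<Sum>i<n. g (?b i) * thbase n P (?b i) k)" for k
  have qg: "quasi (2 * int n) (P powi (2 * int n)) P g" and godd: "g (- k) = - g k" and geven: "even k \<Longrightarrow> g k = 0" for k
    using g by (auto simp: thspace_def)
  have "g = h"
  proof (rule quasi_eqI[OF P(1) _ _ qg])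
    show "P powi (2 * int n) \<noteq> 0" using P by (simp add: power_int_eq_0_iff)
    show "0 < 2 * int n" using n by simp
    show "quasi (2 * int n) (P powi (2 * int n)) P h"
      using thbase_quasi[OF P(1) n] by (simp add: quasi_def h_def sum_distrib_left mult_ac)
    fix k assume k: "- (2 * int n) \<le> k" "k < 2 * int n"
    have hodd: "h (- k) = - h k" for k by (simp add: h_def thbase_def sum_negf[symmetric] algebra_simps)
    have hb: "h (?b j) = g (?b j)" if "j < n" for j
    proof -
      have "h (?b j) = (\<Sum>i<n. if i = j then g (?b j) else 0)"
        unfolding h_def
      proof (intro sum.cong refl)
        fix i assume "i \<in> {..<n}"
        then have "thbase n P (?b i) (?b j) = (if i = j then 1 else 0)" using that by (intro thbase_at[OF n]) auto
        then show "g (?b i) * thbase n P (?b i) (?b j) = (if i = j then g (?b j) else 0)" by (cases "i = j") auto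
      qed
      then show ?thesis using that by simp
    qed
    show "g k = h k"
    proof (cases "even k")
      case True
      have "thbase n P (?b i) k = 0" for i
      proof -
        have "\<not> 4 * int n dvd k - ?b i" "\<not> 4 * int n dvd - k - ?b i"
        proof -
          have "odd (k - ?b i)" "odd (- k - ?b i)" using True by auto
          moreover have "even (4 * int n)" by simp
          ultimately show "\<not> 4 * int n dvd k - ?b i" "\<not> 4 * int n dvd - k - ?b i" by (meson dvd_trans)+
        qed
        then show ?thesis by (simp add: thbase_def thbase1_def Let_def)
      qed
      then show ?thesis using True by (simp add: h_def geven)
    next
      case False
      then obtain l where l: "k = 2 * l + 1" by (elim oddE)
      show ?thesis
      proof (cases "l < 0")
        case True
        then have "k = ?b (nat (- l - 1))" "nat (- l - 1) < n" using l k by auto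
        then show ?thesis using hb by metis
      next
        case False
        then have "- k = ?b (nat l)" "nat l < n" using l k by auto
        then have "h (- k) = g (- k)" using hb by metis
        then show ?thesis by (simp add: godd hodd)
      qed
    qed
  qed
  have ent: "entire (thbase n P b)" for b
    using P n by (intro quasi_entire[OF P _ _ thbase_quasi]) (auto simp: power_int_eq_0_iff)
  have "((\<lambda>k. \<Sum>i<n. g (?b i) * (thbase n P (?b i) k * \<xi> powi k)) has_sum (\<Sum>i<n. g (?b i) * thfun n P i \<xi>)) UNIV"
    unfolding thfun_def by (intro has_sum_sum_fls has_sum_cmult_right laurent_has_sum ent \<xi> finite_lessThan)
  also have "(\<lambda>k. \<Sum>i<n. g (?b i) * (thbase n P (?b i) k * \<xi> powi k)) = (\<lambda>k. h k * \<xi> powi k)"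
    by (simp add: h_def sum_distrib_right mult.assoc)
  finally show ?thesis unfolding laurent_def[of g] \<open>g = h\<close>[symmetric] by (rule infsumI)
qed

section \<open>The theta function determinant\<close>

text \<open>Coefficients of (z - 1 / z) times the product of z + 1 / z - w_k over k < j, with
  respect to S_(m + 1) where S_m = z^m - z^(-m). The recursion is (z + 1 / z) S_m = S_(m + 1) + S_(m
  - 1).\<close>

primrec newton_coeff :: "(nat \<Rightarrow> 'a::field) \<Rightarrow> nat \<Rightarrow> nat \<Rightarrow> 'a" where
  "newton_coeff w 0 = (\<lambda>m. if m = 0 then 1 else 0)"
| "newton_coeff w (Suc j) = (\<lambda>m. (if m = 0 then 0 else newton_coeff w j (m - 1)) + newton_coeff w j (m + 1) - w j * newton_coeff w j m)"

lemma newton_coeff_eq_0: "m > j \<Longrightarrow> newton_coeff w j m = 0"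
  by (induction j arbitrary: m) auto

lemma newton_coeff_diag: "newton_coeff w j j = 1"
  by (induction j) (auto simp: newton_coeff_eq_0)

lemma newton_expansion:
  fixes z :: "'a::field"
  assumes z: "z \<noteq> 0" and N: "N > j"
  shows "(\<Sum>m<N. newton_coeff w j m * (z ^ Suc m - (1 / z) ^ Suc m)) = (z - 1 / z) * (\<Prod>k<j. z + 1 / z - w k)"
  using N
proof (induction j arbitrary: N)
  case 0
  then obtain N' where N': "N = Suc N'" by (cases N) auto
  show ?case unfolding N' by (simp add: sum.lessThan_Suc_shift del: sum.lessThan_Suc)
next
  case (Suc j)
  define S where "S m = z ^ m - (1 / z) ^ m" for m
  define T where "T = newton_coeff w j"
  obtain N' where N': "N = Suc N'" using Suc.prems by (cases N) auto
  have T0: "T m = 0" if "m > j" for m using that by (simp add: T_def newton_coeff_eq_0)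
  have S0: "S 0 = 0" by (simp add: S_def)
  have SS: "(z + 1 / z) * S (Suc m) = S (Suc (Suc m)) + S m" for m
    using z by (simp add: S_def field_simps)
  have 1: "(\<Sum>m<N. T m * S (Suc (Suc m))) = (\<Sum>m<N. (if m = 0 then 0 else T (m - 1)) * S (Suc m))"
  proof -
    have "(\<Sum>m<N. T m * S (Suc (Suc m))) = (\<Sum>m<N'. T m * S (Suc (Suc m)))"
      using T0[of N'] Suc.prems by (simp add: N')
    also have "\<dots> = (\<Sum>m<N. (if m = 0 then 0 else T (m - 1)) * S (Suc m))"
      unfolding N' by (simp add: sum.lessThan_Suc_shift del: sum.lessThan_Suc)
    finally show ?thesis .
  qed
  have 2: "(\<Sum>m<N. T m * S m) = (\<Sum>m<N. T (m + 1) * S (Suc m))"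
  proof -
    have "(\<Sum>m<N. T m * S m) = (\<Sum>m<N'. T (m + 1) * S (Suc m))"
      unfolding N' by (simp add: sum.lessThan_Suc_shift S0 del: sum.lessThan_Suc)
    also have "\<dots> = (\<Sum>m<N. T (m + 1) * S (Suc m))"
      using T0[of "N' + 1"] Suc.prems by (simp add: N')
    finally show ?thesis .
  qed
  have "(\<Sum>m<N. newton_coeff w (Suc j) m * S (Suc m))
      = (\<Sum>m<N. (if m = 0 then 0 else T (m - 1)) * S (Suc m)) + (\<Sum>m<N. T (m + 1) * S (Suc m)) - w j * (\<Sum>m<N. T m * S (Suc m))"
    unfolding sum_distrib_left sum.distrib[symmetric] sum_subtractf[symmetric]
    by (intro sum.cong refl) (simp add: T_def algebra_simps)
  also have "\<dots> = (\<Sum>m<N. T m * (S (Suc (Suc m)) + S m)) - w j * (\<Sum>m<N. T m * S (Suc m))"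
    unfolding 1[symmetric] 2[symmetric] by (simp add: sum.distrib algebra_simps)
  also have "\<dots> = (z + 1 / z - w j) * (\<Sum>m<N. T m * S (Suc m))"
    unfolding SS[symmetric] sum_distrib_left sum_subtractf[symmetric] by (intro sum.cong refl) (simp add: algebra_simps)
  also have "(\<Sum>m<N. T m * S (Suc m)) = (z - 1 / z) * (\<Prod>k<j. z + 1 / z - w k)"
    unfolding T_def S_def using Suc.prems by (intro Suc.IH) simp
  finally show ?case by (simp add: S_def mult_ac)
qed

lemma prod_less_pairs:
  "(\<Prod>(a, b)\<in>{(a, b). a < b \<and> b < n}. f a b) = (\<Prod>b<n. \<Prod>a<b. f a b)" for n :: nat
proof -
  have "(\<Prod>b<n. \<Prod>a<b. f a b) = (\<Prod>(b, a)\<in>Sigma {..<n} (\<lambda>b. {..<b}). f a b)"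
    by (rule prod.Sigma) auto
  also have "\<dots> = (\<Prod>(a, b)\<in>{(a, b). a < b \<and> b < n}. f a b)"
    by (rule prod.reindex_bij_witness[of _ "\<lambda>(a, b). (b, a)" "\<lambda>(b, a). (a, b)"]) auto
  finally show ?thesis by simp
qed

text \<open>Newton interpolation in z + 1 / z: a unitriangular change of columns makes the matrix
  lower triangular, since for i < j the product over k < j contains w_i - w_i.\<close>

lemma det_weyl_C:
  fixes z :: "nat \<Rightarrow> 'a::field"
  assumes z: "\<And>i. i < n \<Longrightarrow> z i \<noteq> 0"
  shows "det (mat n n (\<lambda>(i, j). z i ^ Suc j - (1 / z i) ^ Suc j))
    = (\<Prod>i<n. z i - 1 / z i) * (\<Prod>(a, b)\<in>{(a, b). a < b \<and> b < n}. (z b + 1 / z b) - (z a + 1 / z a))"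
proof -
  define w where "w i = z i + 1 / z i" for i
  define A where "A = mat n n (\<lambda>(i, j). z i ^ Suc j - (1 / z i) ^ Suc j)"
  define T where "T = mat n n (\<lambda>(m, j). newton_coeff w j m)"
  define B where "B = mat n n (\<lambda>(i, j). (z i - 1 / z i) * (\<Prod>k<j. w i - w k))"
  have c: "A \<in> carrier_mat n n" "T \<in> carrier_mat n n" "B \<in> carrier_mat n n" by (simp_all add: A_def T_def B_def)
  have "A * T = B"
  proof (rule eq_matI)
    fix i j assume ij: "i < dim_row B" "j < dim_col B"
    then have ij': "i < n" "j < n" by (auto simp: B_def)
    have "(A * T) $$ (i, j) = (\<Sum>m<n. newton_coeff w j m * (z i ^ Suc m - (1 / z i) ^ Suc m))"
      using ij' by (simp add: A_def T_def scalar_prod_def atLeast0LessThan mult.commute)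
    also have "\<dots> = (z i - 1 / z i) * (\<Prod>k<j. z i + 1 / z i - w k)"
      using ij' by (intro newton_expansion z)
    finally show "(A * T) $$ (i, j) = B $$ (i, j)" using ij' by (simp add: B_def w_def)
  qed (auto simp: A_def T_def B_def)
  then have "det A * det T = det B" using det_mult[OF c(1,2)] by simp
  moreover have "det T = 1"
  proof -
    have "upper_triangular T" by (auto simp: T_def newton_coeff_eq_0)
    then have "det T = prod_list (diag_mat T)" using c(2) by (rule det_upper_triangular)
    also have "\<dots> = 1" unfolding prod_list_diag_prod by (rule prod.neutral) (simp add: T_def newton_coeff_diag)
    finally show ?thesis .
  qed
  moreover have "det B = (\<Prod>i<n. (z i - 1 / z i) * (\<Prod>k<i. w i - w k))"
  proof -
    have "det B = prod_list (diag_mat B)"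
    proof (rule det_lower_triangular[OF _ c(3)])
      fix i j assume "i < j" "j < n"
      then show "B $$ (i, j) = 0" by (auto simp: B_def)
    qed
    also have "\<dots> = (\<Prod>i<n. (z i - 1 / z i) * (\<Prod>k<i. w i - w k))"
      unfolding prod_list_diag_prod by (simp add: B_def atLeast0LessThan)
    finally show ?thesis .
  qed
  ultimately show ?thesis by (simp add: A_def prod.distrib prod_less_pairs w_def)
qed

text \<open>A permutation that avoids the zero entries sends every index to itself or to
  \<open>k\<close>; by injectivity it is the identity.\<close>

lemma det_diagonal_up_to_column:
  fixes M :: "'a::idom mat"
  assumes M: "M \<in> carrier_mat n n" and z: "\<And>i j. i < n \<Longrightarrow> j < n \<Longrightarrow> i \<noteq> j \<Longrightarrow> j \<noteq> k \<Longrightarrow> M $$ (i, j) = 0"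
  shows "det M = (\<Prod>i<n. M $$ (i, i))"
proof -
  let ?f = "\<lambda>p. signof p * (\<Prod>i = 0..<n. M $$ (i, p i))"
  have "det M = (\<Sum>p\<in>{p. p permutes {0..<n}}. ?f p)" by (rule det_def'[OF M])
  also have "\<dots> = (\<Sum>p\<in>{id}. ?f p)"
  proof (rule sum.mono_neutral_right)
    show "finite {p. p permutes {0..<n}}" by (simp add: finite_permutations)
    show "{id} \<subseteq> {p. p permutes {0..<n}}" by (simp add: permutes_id)
    show "\<forall>p\<in>{p. p permutes {0..<n}} - {id}. ?f p = 0"
    proof
      fix p assume p: "p \<in> {p. p permutes {0..<n}} - {id}"
      then have perm: "p permutes {0..<n}" by simp
      have "\<exists>i<n. p i \<noteq> i \<and> p i \<noteq> k"
      proof (rule ccontr)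
        assume "\<not> ?thesis"
        then have *: "p i = i \<or> p i = k" if "i < n" for i using that by blast
        have "p i = i" for i
        proof (cases "i < n")
          case False
          then show ?thesis using permutes_not_in[OF perm] by simp
        next
          case True
          show ?thesis
          proof (rule ccontr)
            assume "p i \<noteq> i"
            then have "p i = k" "i \<noteq> k" using *[OF True] by auto
            moreover have "k < n" using permutes_in_image[OF perm, of i] True \<open>p i = k\<close> by simp
            ultimately have "p k = k" using * by blast
            then show False using permutes_inj[OF perm] \<open>p i = k\<close> \<open>i \<noteq> k\<close> by (metis injD)
          qed
        qed
        then show False using p by (auto simp: fun_eq_iff)
      qed
      then obtain i where i: "i < n" "p i \<noteq> i" "p i \<noteq> k" by blast
      moreover have "p i < n" using permutes_in_image[OF perm, of i] i by simp
      ultimately have "M $$ (i, p i) = 0" using z[of i "p i"] by auto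
      then have "(\<Prod>i = 0..<n. M $$ (i, p i)) = 0" using i(1) by (intro prod_zero) auto
      then show "?f p = 0" by simp
    qed
  qed
  also have "\<dots> = (\<Prod>i<n. M $$ (i, i))" by (simp add: atLeast0LessThan)
  finally show ?thesis .
qed

section \<open>Proportionality of the determinant and the theta product\<close>

definition Dfun :: "nat \<Rightarrow> 'a::field fls \<Rightarrow> (nat \<Rightarrow> 'a fls) \<Rightarrow> 'a fls" where
  "Dfun n P \<xi> = det (mat n n (\<lambda>(i, j). thfun n P i (\<xi> j)))"

definition Hfun :: "nat \<Rightarrow> 'a::field fls \<Rightarrow> (nat \<Rightarrow> 'a fls) \<Rightarrow> 'a fls" where
  "Hfun n P \<xi> = (\<Prod>j<n. \<xi> j powi (- 1) * theta ((\<xi> j)\<^sup>2) P) *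
    (\<Prod>(a, b)\<in>{(a, b). a < b \<and> b < n}. pairf (P\<^sup>2) (\<xi> a) (\<xi> b))"

text \<open>Nonvanishing of all factors of \<open>Hfun\<close>, so that the interpolating functions
  do not vanish at their own points.\<close>

definition admissible :: "nat \<Rightarrow> 'a::field fls \<Rightarrow> (nat \<Rightarrow> 'a fls) \<Rightarrow> bool" where
  "admissible n P \<xi> \<longleftrightarrow> (\<forall>j<n. \<xi> j \<noteq> 0 \<and> theta ((\<xi> j)\<^sup>2) P \<noteq> 0 \<and>
    (\<forall>i<n. i \<noteq> j \<longrightarrow> pairf (P\<^sup>2) (\<xi> i) (\<xi> j) \<noteq> 0))"

lemma theta_1:
  assumes "vge 1 p" shows "theta (1 :: 'a::field fls) p = 0"
proof -
  have "qpoch_inf 1 p = 0" unfolding qpoch_inf_eq_0_iff[OF assms] by (intro exI[of _ 0]) simp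
  then show ?thesis by (simp add: theta_def)
qed

lemma vge_sq: "vge 1 P \<Longrightarrow> vge 1 (P\<^sup>2 :: 'a::field fls)"
  using vge_mono[OF vge_power[of 1 P 2]] by simp

lemma theta_inverse:
  fixes p :: "'a::field fls"
  assumes p: "vge 1 p" and z: "z \<noteq> 0" and p0: "p \<noteq> 0"
  shows "theta (1 / z) p = - (1 / z) * theta z p"
proof -
  have step: "qpoch_inf z p = (1 - z) * qpoch_inf (z * p) p" for z
  proof (rule LIMSEQ_unique)
    show "(\<lambda>N. qpoch z p (Suc N)) \<longlonglongrightarrow> qpoch_inf z p" by (rule LIMSEQ_Suc[OF qpoch_tendsto[OF p]])
    have "qpoch z p (Suc N) = (1 - z) * qpoch (z * p) p N" for N
      by (simp add: qpoch_def prod.lessThan_Suc_shift mult_ac del: prod.lessThan_Suc)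
    then show "(\<lambda>N. qpoch z p (Suc N)) \<longlonglongrightarrow> (1 - z) * qpoch_inf (z * p) p"
      by (simp add: tendsto_mult qpoch_tendsto[OF p])
  qed
  have "theta (1 / z) p = (1 - 1 / z) * qpoch_inf (p / z) p * qpoch_inf (z * p) p"
    using step[of "1 / z"] by (simp add: theta_def mult.commute)
  also have "\<dots> = - (1 / z) * (((1 - z) * qpoch_inf (z * p) p) * qpoch_inf (p / z) p)"
    using z by (simp add: field_simps)
  also have "\<dots> = - (1 / z) * theta z p" unfolding theta_def step[of z, symmetric] ..
  finally show ?thesis .
qed

lemma pairf_antisym:
  fixes p :: "'a::field fls"
  assumes p: "vge 1 p" "p \<noteq> 0" and a: "a \<noteq> 0" and b: "b \<noteq> 0"
  shows "pairf p b a = - pairf p a b"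
proof -
  have t: "theta (a\<^sup>2 / b\<^sup>2) p = - (a\<^sup>2 / b\<^sup>2) * theta (b\<^sup>2 / a\<^sup>2) p"
    using theta_inverse[OF p(1) _ p(2), of "b\<^sup>2 / a\<^sup>2"] a b by simp
  have "a powi (- 2) * - (a\<^sup>2 / b\<^sup>2) = - (b powi (- 2))"
    using a b by (simp add: power_int_minus field_simps)
  moreover have "pairf p b a = (a powi (- 2) * - (a\<^sup>2 / b\<^sup>2)) * (theta (a\<^sup>2 * b\<^sup>2) p * theta (b\<^sup>2 / a\<^sup>2) p)"
    unfolding pairf_def t by (simp only: mult_ac)
  ultimately show ?thesis by (simp add: pairf_def mult.assoc)
qed

lemma pairf_self: "vge 1 p \<Longrightarrow> c \<noteq> 0 \<Longrightarrow> pairf p c c = 0"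
  by (simp add: pairf_def theta_1)

text \<open>The functions \<open>hfun\<close> with zeros at all points except c_l lie in the
  n-dimensional space; \<open>A\<close> holds their coefficients. Multiplying by \<open>A\<close>
  turns the determinant into that of their values, a matrix which is diagonal apart from column
  \<open>k\<close>. So in the k-th point the determinant is a multiple of the function that vanishes
  at the other points, and det A is nonzero because at \<open>c\<close> the diagonal is.\<close>

lemma Dfun_update:
  fixes P :: "'a::field fls"
  assumes P: "P \<noteq> 0" "vge 1 P" and c: "admissible n P c" and k: "k < n" and \<xi>: "\<xi> \<noteq> 0"
  shows "Dfun n P (c(k := \<xi>)) * hfun P c ({..<n} - {k}) (c k) = Dfun n P c * hfun P c ({..<n} - {k}) \<xi>"
proof -
  have n: "n \<ge> 1" using k by simp
  define J where "J l = {..<n} - {l}" for l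
  have c0: "c j \<noteq> 0" if "j < n" for j using c that by (simp add: admissible_def)
  have "\<exists>g. thspace n P g \<and> (\<forall>\<xi>. \<xi> \<noteq> 0 \<longrightarrow> laurent g \<xi> = hfun P c (J l) \<xi>)" if "l < n" for l
  proof -
    have "Suc (card (J l)) = n" using that by (simp add: J_def)
    then show ?thesis using hfun_expansion[OF P, of "J l" c] c0 by (simp add: J_def)
  qed
  then obtain g where g: "\<And>l. l < n \<Longrightarrow> thspace n P (g l)"
    and gl: "\<And>l \<xi>. l < n \<Longrightarrow> \<xi> \<noteq> 0 \<Longrightarrow> laurent (g l) \<xi> = hfun P c (J l) \<xi>" by metis
  define A where "A = mat n n (\<lambda>(l, i). g l (- (2 * int i + 1)))"
  have hnz: "hfun P c (J l) (c l) \<noteq> 0" if "l < n" for l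
    using c that by (auto simp: hfun_def admissible_def J_def power_int_eq_0_iff)
  have hz: "hfun P c (J l) (c j) = 0" if "l < n" "j < n" "j \<noteq> l" for l j
  proof -
    have "(\<Prod>j'\<in>J l. pairf (P\<^sup>2) (c j') (c j)) = 0"
      using that c0[OF that(2)] by (intro prod_zero) (auto simp: J_def intro!: bexI[of _ j] pairf_self vge_sq P)
    then show ?thesis by (simp add: hfun_def)
  qed
  have key: "det A * Dfun n P (c(k := x)) = (\<Prod>i\<in>J k. hfun P c (J i) (c i)) * hfun P c (J k) x" if x: "x \<noteq> 0" for x
  proof -
    define F where "F = mat n n (\<lambda>(i, j). thfun n P i ((c(k := x)) j))"
    have carr: "A \<in> carrier_mat n n" "F \<in> carrier_mat n n" by (simp_all add: A_def F_def)
    have AF: "(A * F) $$ (l, j) = hfun P c (J l) ((c(k := x)) j)" if "l < n" "j < n" for l j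
    proof -
      have nz: "(c(k := x)) j \<noteq> 0" using c0 x that by simp
      have "(A * F) $$ (l, j) = (\<Sum>i<n. g l (- (2 * int i + 1)) * thfun n P i ((c(k := x)) j))"
        using that by (simp add: A_def F_def scalar_prod_def atLeast0LessThan)
      also have "\<dots> = laurent (g l) ((c(k := x)) j)"
        by (rule thspace_expand[OF P n g[OF that(1)] nz, symmetric])
      also have "\<dots> = hfun P c (J l) ((c(k := x)) j)" by (rule gl[OF that(1) nz])
      finally show ?thesis .
    qed
    have "det A * Dfun n P (c(k := x)) = det (A * F)" using det_mult[OF carr] by (simp add: Dfun_def F_def)
    also have "\<dots> = (\<Prod>i<n. (A * F) $$ (i, i))"
    proof (rule det_diagonal_up_to_column[of _ _ k])
      show "A * F \<in> carrier_mat n n" using carr by simp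
      show "(A * F) $$ (i, j) = 0" if "i < n" "j < n" "i \<noteq> j" "j \<noteq> k" for i j
        using that hz[of i j] by (simp add: AF)
    qed
    also have "\<dots> = (\<Prod>i<n. hfun P c (J i) ((c(k := x)) i))" by (intro prod.cong refl AF) auto
    also have "\<dots> = hfun P c (J k) x * (\<Prod>i\<in>J k. hfun P c (J i) ((c(k := x)) i))"
      using k by (subst prod.remove[of _ k]) (auto simp: J_def)
    also have "(\<Prod>i\<in>J k. hfun P c (J i) ((c(k := x)) i)) = (\<Prod>i\<in>J k. hfun P c (J i) (c i))"
      by (intro prod.cong refl) (auto simp: J_def)
    finally show ?thesis by (simp only: mult.commute)
  qed
  define K where "K = (\<Prod>i\<in>J k. hfun P c (J i) (c i))"
  have Knz: "K \<noteq> 0" unfolding K_def using hnz by (auto simp: J_def)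
  have 1: "det A * Dfun n P (c(k := \<xi>)) = K * hfun P c (J k) \<xi>" unfolding K_def by (rule key[OF \<xi>])
  have "det A * Dfun n P (c(k := c k)) = K * hfun P c (J k) (c k)" unfolding K_def by (rule key[OF c0[OF k]])
  then have 2: "det A * Dfun n P c = K * hfun P c (J k) (c k)" by simp
  have "det A \<noteq> 0" using 2 Knz hnz[OF k] by auto
  moreover have "det A * (Dfun n P (c(k := \<xi>)) * hfun P c (J k) (c k)) = det A * (Dfun n P c * hfun P c (J k) \<xi>)"
    unfolding mult.assoc[symmetric] 1 2 by (simp only: mult_ac)
  ultimately show ?thesis by (simp add: J_def)
qed

text \<open>The factors containing the k-th point form \<open>hfun\<close>, up to sign: the pairs
  (k, b) with b > k have to be reversed by \<open>pairf_antisym\<close>.\<close>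

lemma Hfun_update:
  fixes P :: "'a::field fls"
  assumes P: "P \<noteq> 0" "vge 1 P" and c: "\<And>j. j < n \<Longrightarrow> c j \<noteq> 0" and k: "k < n" and \<xi>: "\<xi> \<noteq> 0"
  shows "Hfun n P (c(k := \<xi>)) * hfun P c ({..<n} - {k}) (c k) = Hfun n P c * hfun P c ({..<n} - {k}) \<xi>"
proof -
  define p where "p = P\<^sup>2"
  have p: "vge 1 p" "p \<noteq> 0" using P vge_sq[OF P(2)] by (simp_all add: p_def)
  define Z where "Z = {(a, b). a < b \<and> b < n \<and> a \<noteq> k \<and> b \<noteq> k}"
  define K where "K = (\<Prod>j\<in>{..<n} - {k}. c j powi (- 1) * theta ((c j)\<^sup>2) P) * (\<Prod>(a, b)\<in>Z. pairf p (c a) (c b)) * (- 1) ^ card {k<..<n}"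
  have H: "Hfun n P (c(k := x)) = K * hfun P c ({..<n} - {k}) x" if x: "x \<noteq> 0" for x
  proof -
    let ?c = "c(k := x)"
    have fin: "finite Z" by (rule finite_subset[of _ "{..<n} \<times> {..<n}"]) (auto simp: Z_def)
    have "{(a, b). a < b \<and> b < n} = Z \<union> ((\<lambda>a. (a, k)) ` {..<k} \<union> (\<lambda>b. (k, b)) ` {k<..<n})"
      using k by (auto simp: Z_def)
    then have "(\<Prod>(a, b)\<in>{(a, b). a < b \<and> b < n}. pairf p (?c a) (?c b))
      = (\<Prod>(a, b)\<in>Z \<union> ((\<lambda>a. (a, k)) ` {..<k} \<union> (\<lambda>b. (k, b)) ` {k<..<n}). pairf p (?c a) (?c b))" by simp
    also have "\<dots> = (\<Prod>(a, b)\<in>Z. pairf p (?c a) (?c b)) * ((\<Prod>(a, b)\<in>(\<lambda>a. (a, k)) ` {..<k}. pairf p (?c a) (?c b))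
       * (\<Prod>(a, b)\<in>(\<lambda>b. (k, b)) ` {k<..<n}. pairf p (?c a) (?c b)))"
      using fin by (subst prod.union_disjoint, simp, simp, force simp: Z_def, subst prod.union_disjoint) auto
    also have "(\<Prod>(a, b)\<in>Z. pairf p (?c a) (?c b)) = (\<Prod>(a, b)\<in>Z. pairf p (c a) (c b))"
      by (intro prod.cong refl) (auto simp: Z_def)
    also have "(\<Prod>(a, b)\<in>(\<lambda>a. (a, k)) ` {..<k}. pairf p (?c a) (?c b)) = (\<Prod>a<k. pairf p (c a) x)"
      by (subst prod.reindex) (auto simp: inj_on_def intro!: prod.cong)
    also have "(\<Prod>(a, b)\<in>(\<lambda>b. (k, b)) ` {k<..<n}. pairf p (?c a) (?c b)) = (\<Prod>b\<in>{k<..<n}. - pairf p (c b) x)"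
      using c x p by (subst prod.reindex) (auto simp: inj_on_def intro!: prod.cong pairf_antisym)
    also have "\<dots> = (- 1) ^ card {k<..<n} * (\<Prod>b\<in>{k<..<n}. pairf p (c b) x)"
      by (simp add: prod_uminus)
    finally have A: "(\<Prod>(a, b)\<in>{(a, b). a < b \<and> b < n}. pairf p (?c a) (?c b))
      = (\<Prod>(a, b)\<in>Z. pairf p (c a) (c b)) * (- 1) ^ card {k<..<n} * ((\<Prod>a<k. pairf p (c a) x) * (\<Prod>b\<in>{k<..<n}. pairf p (c b) x))"
      by (simp only: mult_ac)
    have E: "{..<n} - {k} = {..<k} \<union> {k<..<n}" using k by auto
    have B: "(\<Prod>j\<in>{..<n} - {k}. pairf p (c j) x) = (\<Prod>a<k. pairf p (c a) x) * (\<Prod>b\<in>{k<..<n}. pairf p (c b) x)"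
      unfolding E by (rule prod.union_disjoint) auto
    have C: "(\<Prod>j<n. ?c j powi (- 1) * theta ((?c j)\<^sup>2) P)
      = (x powi (- 1) * theta (x\<^sup>2) P) * (\<Prod>j\<in>{..<n} - {k}. c j powi (- 1) * theta ((c j)\<^sup>2) P)"
    proof -
      have "(\<Prod>j<n. ?c j powi (- 1) * theta ((?c j)\<^sup>2) P)
        = (?c k powi (- 1) * theta ((?c k)\<^sup>2) P) * (\<Prod>j\<in>{..<n} - {k}. ?c j powi (- 1) * theta ((?c j)\<^sup>2) P)"
        by (rule prod.remove) (use k in auto)
      also have "(\<Prod>j\<in>{..<n} - {k}. ?c j powi (- 1) * theta ((?c j)\<^sup>2) P) = (\<Prod>j\<in>{..<n} - {k}. c j powi (- 1) * theta ((c j)\<^sup>2) P)"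
        by (intro prod.cong) auto
      finally show ?thesis by simp
    qed
    show ?thesis
      unfolding Hfun_def hfun_def p_def[symmetric] A C B K_def by (simp only: mult_ac)
  qed
  have "Hfun n P c = K * hfun P c ({..<n} - {k}) (c k)" using H[OF c[OF k]] by simp
  with H[OF \<xi>] show ?thesis by (simp only: mult_ac)
qed

lemma Hfun_nonzero: "admissible n P c \<Longrightarrow> Hfun n P c \<noteq> 0"
proof -
  assume a: "admissible n P c"
  have "finite {(a, b). a < b \<and> b < n}"
    by (rule finite_subset[of _ "{..<n} \<times> {..<n}"]) auto
  with a show ?thesis by (auto simp: Hfun_def admissible_def power_int_eq_0_iff)
qed

text \<open>The points are exchanged one coordinate at a time, so every mixed point on the way has
  to be admissible.\<close>

lemma Dfun_Hfun_ratio: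
  fixes P :: "'a::field fls"
  assumes P: "P \<noteq> 0" "vge 1 P" and ad: "\<And>k. k \<le> n \<Longrightarrow> admissible n P (\<lambda>j. if j < k then d j else c j)"
  shows "Dfun n P d * Hfun n P c = Dfun n P c * Hfun n P d"
proof -
  define m where "m k = (\<lambda>j. if j < k then d j else c j)" for k
  have adm: "admissible n P (m k)" if "k \<le> n" for k using ad[OF that] by (simp add: m_def)
  have m0: "m 0 = c" by (simp add: m_def)
  have "Dfun n P (m k) * Hfun n P c = Dfun n P c * Hfun n P (m k)" if "k \<le> n" for k
    using that
  proof (induction k)
    case (Suc k)
    have k: "k < n" "k \<le> n" using Suc.prems by auto
    have mS: "m (Suc k) = (m k)(k := d k)" by (auto simp: m_def less_Suc_eq)
    have dk: "d k \<noteq> 0" using adm[OF Suc.prems] k(1) by (auto simp: admissible_def m_def)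
    have nz: "m k j \<noteq> 0" if "j < n" for j using adm[OF k(2)] that by (simp add: admissible_def)
    let ?h = "hfun P (m k) ({..<n} - {k})"
    have h0: "?h (m k k) \<noteq> 0"
      using adm[OF k(2)] k(1) by (auto simp: hfun_def admissible_def power_int_eq_0_iff)
    have D: "Dfun n P (m (Suc k)) * ?h (m k k) = Dfun n P (m k) * ?h (d k)"
      unfolding mS by (rule Dfun_update[OF P adm[OF k(2)] k(1) dk])
    have H: "Hfun n P (m (Suc k)) * ?h (m k k) = Hfun n P (m k) * ?h (d k)"
      unfolding mS by (rule Hfun_update[OF P nz k(1) dk])
    have "?h (m k k) * (Dfun n P (m (Suc k)) * Hfun n P c) = (Dfun n P (m (Suc k)) * ?h (m k k)) * Hfun n P c"
      by (simp only: mult_ac)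
    also have "\<dots> = (Dfun n P (m k) * Hfun n P c) * ?h (d k)" unfolding D by (simp only: mult_ac)
    also have "\<dots> = Dfun n P c * (Hfun n P (m k) * ?h (d k))" unfolding Suc.IH[OF k(2)] by (simp only: mult_ac)
    also have "\<dots> = ?h (m k k) * (Dfun n P c * Hfun n P (m (Suc k)))" unfolding H[symmetric] by (simp only: mult_ac)
    finally show ?case using h0 by simp
  qed (simp add: m0)
  from this[of n] have *: "Dfun n P (m n) * Hfun n P c = Dfun n P c * Hfun n P (m n)" by simp
  have "Dfun n P (m n) = Dfun n P d"
    unfolding Dfun_def by (intro arg_cong[where f = det] cong_mat) (auto simp: m_def)
  moreover have "Hfun n P (m n) = Hfun n P d"
    unfolding Hfun_def by (intro arg_cong2[where f = "(*)"] prod.cong refl) (auto simp: m_def)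
  ultimately show ?thesis using * by simp
qed

context nome_n begin

lemma Delta_det: "Delta r = det (mat n n (\<lambda>(i, j). zv r i ^ Suc j - (1 / zv r i) ^ Suc j))"
  unfolding Delta_def wv_def by (rule det_weyl_C[symmetric]) (rule zv_nonzero)

text \<open>By Leibniz's formula for \<open>Delta\<close>, each permutation gives a summand that
  factors over the coordinates of \<open>r\<close>. The lattice sum is then a product of n
  one-dimensional sums, each a value of some \<open>thfun\<close> at a power of s.\<close>

lemma Dfun_has_sum:
  assumes \<kappa>: "\<kappa> \<ge> 1"
  shows "((\<lambda>r. s powi (int \<kappa> * Qf r) * Delta r) has_sum Dfun n (s ^ \<kappa>) (\<lambda>j. s ^ Suc j)) (PiE {..<n} (\<lambda>_. UNIV))"
proof -
  define P where "P = s ^ \<kappa>"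
  have P: "P \<noteq> 0" "vge 1 P" using s_nonzero vge_spow[of 1 \<kappa>] \<kappa> by (simp_all add: P_def)
  define b where "b i = - (2 * int i + 1)" for i :: nat
  define e where "e i k = 2 * int n * k\<^sup>2 + b i * k" for i :: nat and k :: int
  define x where "x i k = s powi (b i + 4 * int n * k)" for i k
  have xz: "x i (r i) = zv r i" for r i
    by (simp add: x_def zv_def gexp_def b_def)
  have term1: "((\<lambda>k. P powi e i k * (x i k ^ Suc j - (1 / x i k) ^ Suc j)) has_sum thfun n P i (s ^ Suc j)) UNIV" for i j
  proof -
    have "((\<lambda>k. P powi (2 * int n * k\<^sup>2 + b i * k) * ((s ^ Suc j) powi (b i + 4 * int n * k) - (s ^ Suc j) powi (- (b i + 4 * int n * k))))
      has_sum laurent (thbase n P (b i)) (s ^ Suc j)) UNIV"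
      by (rule thbase_has_sum[OF P n_pos]) (use s_nonzero in simp)
    also have "(\<lambda>k. P powi (2 * int n * k\<^sup>2 + b i * k) * ((s ^ Suc j) powi (b i + 4 * int n * k) - (s ^ Suc j) powi (- (b i + 4 * int n * k))))
      = (\<lambda>k. P powi e i k * (x i k ^ Suc j - (1 / x i k) ^ Suc j))"
    proof
      fix k
      have c: "(s ^ Suc j) powi l = (s powi l) ^ Suc j" for l
        by (metis power_int_mult power_int_of_nat mult.commute)
      have "1 / x i k = s powi (- (b i + 4 * int n * k))"
        by (simp only: x_def power_int_minus inverse_eq_divide)
      then show "P powi (2 * int n * k\<^sup>2 + b i * k) * ((s ^ Suc j) powi (b i + 4 * int n * k) - (s ^ Suc j) powi (- (b i + 4 * int n * k)))
        = P powi e i k * (x i k ^ Suc j - (1 / x i k) ^ Suc j)"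
        by (simp only: c e_def x_def)
    qed
    finally show ?thesis by (simp only: thfun_def b_def)
  qed
  let ?S = "{p. p permutes {0..<n}}"
  have fin: "finite ?S" by (simp add: finite_permutations)
  have "((\<lambda>r. \<Sum>p\<in>?S. signof p * (\<Prod>i<n. P powi e i (r i) * (x i (r i) ^ Suc (p i) - (1 / x i (r i)) ^ Suc (p i))))
    has_sum (\<Sum>p\<in>?S. signof p * (\<Prod>i<n. thfun n P i (s ^ Suc (p i))))) (PiE {..<n} (\<lambda>_. UNIV))"
    by (intro has_sum_sum_fls fin has_sum_cmult_right has_sum_prod_PiE_fls term1) simp
  also have "(\<Sum>p\<in>?S. signof p * (\<Prod>i<n. thfun n P i (s ^ Suc (p i)))) = Dfun n P (\<lambda>j. s ^ Suc j)"
  proof -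
    have "Dfun n P (\<lambda>j. s ^ Suc j) = (\<Sum>p\<in>?S. signof p * (\<Prod>i = 0..<n. mat n n (\<lambda>(i, j). thfun n P i (s ^ Suc j)) $$ (i, p i)))"
      unfolding Dfun_def by (rule det_def') simp
    also have "\<dots> = (\<Sum>p\<in>?S. signof p * (\<Prod>i<n. thfun n P i (s ^ Suc (p i))))"
    proof (intro sum.cong refl arg_cong2[where f = "(*)"] prod.cong)
      fix p i assume "p \<in> ?S" "i \<in> {..<n}"
      then have "i < n" "p i < n" using permutes_in_image[of p "{0..<n}" i] by auto
      then show "mat n n (\<lambda>(i, j). thfun n P i (s ^ Suc j)) $$ (i, p i) = thfun n P i (s ^ Suc (p i))" by simp
    qed auto
    finally show ?thesis by simp
  qed
  also have "(\<lambda>r. \<Sum>p\<in>?S. signof p * (\<Prod>i<n. P powi e i (r i) * (x i (r i) ^ Suc (p i) - (1 / x i (r i)) ^ Suc (p i))))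
    = (\<lambda>r. s powi (int \<kappa> * Qf r) * Delta r)"
  proof
    fix r
    have "(\<Prod>i<n. P powi e i (r i)) = P powi (\<Sum>i<n. e i (r i))"
      using P by (induction n) (simp_all add: power_int_add)
    also have "(\<Sum>i<n. e i (r i)) = Qf r"
      by (simp add: Qf_def e_def b_def algebra_simps)
    also have "P powi Qf r = s powi (int \<kappa> * Qf r)"
      by (simp add: P_def power_int_mult)
    finally have pr: "(\<Prod>i<n. P powi e i (r i)) = s powi (int \<kappa> * Qf r)" .
    have "Delta r = (\<Sum>p\<in>?S. signof p * (\<Prod>i = 0..<n. mat n n (\<lambda>(i, j). zv r i ^ Suc j - (1 / zv r i) ^ Suc j) $$ (i, p i)))"
      unfolding Delta_det by (rule det_def') simp
    also have "\<dots> = (\<Sum>p\<in>?S. signof p * (\<Prod>i<n. zv r i ^ Suc (p i) - (1 / zv r i) ^ Suc (p i)))"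
    proof (intro sum.cong refl arg_cong2[where f = "(*)"] prod.cong)
      fix p i assume "p \<in> ?S" "i \<in> {..<n}"
      then have "i < n" "p i < n" using permutes_in_image[of p "{0..<n}" i] by auto
      then show "mat n n (\<lambda>(i, j). zv r i ^ Suc j - (1 / zv r i) ^ Suc j) $$ (i, p i) = zv r i ^ Suc (p i) - (1 / zv r i) ^ Suc (p i)" by simp
    qed auto
    finally show "(\<Sum>p\<in>?S. signof p * (\<Prod>i<n. P powi e i (r i) * (x i (r i) ^ Suc (p i) - (1 / x i (r i)) ^ Suc (p i))))
      = s powi (int \<kappa> * Qf r) * Delta r"
      by (simp only: prod.distrib pr xz sum_distrib_left mult_ac)
  qed
  finally show ?thesis unfolding P_def .
qed

end

section \<open>Evaluation of the product at the nome of the case m = 0\<close>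

lemma qpoch_add: "qpoch z q (a + b) = qpoch z q a * (\<Prod>k<b. 1 - z * q ^ (a + k))"
  by (simp add: qpoch_def prod_lessThan_add)

text \<open>The exponents of s are sorted by their residue modulo \<open>M\<close>.\<close>

lemma qpoch_inf_dissection:
  fixes s :: "'a::field fls"
  assumes s: "vge 1 s" and M: "M \<ge> 1"
  shows "(\<Prod>a<M. qpoch_inf (s ^ Suc a) (s ^ M)) = qpoch_inf s s"
proof (rule LIMSEQ_unique)
  have sM: "vge 1 (s ^ M)" using vge_power[OF s, of M] by (rule vge_mono) (use M in simp)
  show "(\<lambda>N. \<Prod>a<M. qpoch (s ^ Suc a) (s ^ M) N) \<longlonglongrightarrow> (\<Prod>a<M. qpoch_inf (s ^ Suc a) (s ^ M))"
    by (intro tendsto_prod_fls qpoch_tendsto sM)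
  have "(\<Prod>a<M. qpoch (s ^ Suc a) (s ^ M) N) = qpoch s s (M * N)" for N
  proof (induction N)
    case (Suc N)
    have "(\<Prod>a<M. qpoch (s ^ Suc a) (s ^ M) (Suc N)) = (\<Prod>a<M. qpoch (s ^ Suc a) (s ^ M) N) * (\<Prod>a<M. 1 - s ^ Suc a * (s ^ M) ^ N)"
      by (simp add: qpoch_def prod.distrib)
    also have "(\<Prod>a<M. 1 - s ^ Suc a * (s ^ M) ^ N) = (\<Prod>a<M. 1 - s * s ^ (M * N + a))"
      by (simp add: power_mult power_add mult_ac)
    also have "(\<Prod>a<M. qpoch (s ^ Suc a) (s ^ M) N) * \<dots> = qpoch s s (M * N + M)"
      unfolding Suc qpoch_add ..
    finally show ?case by (simp add: add.commute)
  qed (simp add: qpoch_def)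
  moreover have "(\<lambda>N. qpoch s s (M * N)) \<longlonglongrightarrow> qpoch_inf s s"
    using LIMSEQ_subseq_LIMSEQ[OF qpoch_tendsto[OF s], of "\<lambda>N. M * N"] M by (simp add: strict_mono_def o_def)
  ultimately show "(\<lambda>N. \<Prod>a<M. qpoch (s ^ Suc a) (s ^ M) N) \<longlonglongrightarrow> qpoch_inf s s" by simp
qed

text \<open>The factors at 2 j + 1 and 2 n - (2 j + 1) multiply to c^2; for odd n the middle one is
  \<open>V n\<close>. The induction removes the outermost pair.\<close>

lemma prod_odd_reflect:
  fixes V :: "nat \<Rightarrow> 'a::comm_monoid_mult"
  assumes "V n = c" "\<And>k. k \<le> 2 * n \<Longrightarrow> V k * V (2 * n - k) = c * c"
  shows "(\<Prod>j<n. V (2 * j + 1)) = c ^ n"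
  using assms
proof (induction n arbitrary: V rule: induct_nat_012)
  case (ge2 n)
  have "(\<Prod>j<Suc (Suc n). V (2 * j + 1)) = V 1 * ((\<Prod>j<n. V (2 * j + 1 + 2)) * V (2 * n + 3))"
    unfolding prod.lessThan_Suc_shift[of _ "Suc n"] by (simp add: mult_ac eval_nat_numeral)
  also have "(\<Prod>j<n. V (2 * j + 1 + 2)) = c ^ n"
  proof (rule ge2.IH(1))
    show "V (n + 2) = c" using ge2.prems(1) by simp
    fix k assume k: "k \<le> 2 * n"
    have "2 * Suc (Suc n) - (k + 2) = 2 * n - k + 2" using k by simp
    then show "V (k + 2) * V (2 * n - k + 2) = c * c"
      using ge2.prems(2)[of "k + 2"] k by simp
  qed
  also have "V 1 * (c ^ n * V (2 * n + 3)) = c ^ n * (V 1 * V (2 * Suc (Suc n) - 1))"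
    by (simp add: mult_ac eval_nat_numeral)
  also have "V 1 * V (2 * Suc (Suc n) - 1) = c * c" by (rule ge2.prems(2)) simp
  finally show ?case by (simp add: mult_ac)
qed simp_all

text \<open>Row \<open>b\<close> together with the factor \<open>G (b + 1)\<close> runs through \<open>G 1, \<dots>, G (2 * b + 1)\<close>.\<close>

lemma prod_pairs_symmetric:
  fixes G :: "nat \<Rightarrow> 'a::field"
  assumes sym: "\<And>a. 1 \<le> a \<Longrightarrow> a \<le> 2 * n \<Longrightarrow> G (2 * n + 1 - a) = G a" and nz: "\<And>a. 1 \<le> a \<Longrightarrow> a \<le> n \<Longrightarrow> G a \<noteq> 0"
  shows "(\<Prod>b<n. \<Prod>a<b. G (b - a) * G (a + b + 2)) = (\<Prod>c<n. G (c + 1)) ^ (n - 1)"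
proof (cases n)
  case (Suc n')
  define V where "V k = (\<Prod>c<k. G (c + 1))" for k
  have refl: "V (2 * n) = V (2 * n - k) * V k" if k: "k \<le> 2 * n" for k
  proof -
    have "V (2 * n) = V (2 * n - k + k)" using k by simp
    also have "\<dots> = V (2 * n - k) * (\<Prod>c<k. G (2 * n - k + c + 1))"
      unfolding V_def by (rule prod_lessThan_add)
    also have "(\<Prod>c<k. G (2 * n - k + c + 1)) = (\<Prod>c<k. G (k - c))"
    proof (intro prod.cong refl)
      fix c assume "c \<in> {..<k}"
      then have "2 * n + 1 - (k - c) = 2 * n - k + c + 1" "1 \<le> k - c" "k - c \<le> 2 * n" using k by auto
      then show "G (2 * n - k + c + 1) = G (k - c)" using sym[of "k - c"] by simp
    qed
    also have "\<dots> = V k"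
      using prod.nat_diff_reindex[of "\<lambda>c. G (Suc c)" k] by (simp add: V_def Suc_diff_Suc)
    finally show ?thesis .
  qed
  have Vodd: "V (2 * b + 1) = (\<Prod>a<b. G (b - a) * G (a + b + 2)) * G (b + 1)" for b
  proof -
    have "2 * b + 1 = Suc b + b" by simp
    then have "V (2 * b + 1) = V (Suc b) * (\<Prod>a<b. G (Suc b + a + 1))"
      unfolding V_def by (simp only: prod_lessThan_add)
    also have "V (Suc b) = (\<Prod>a<b. G (b - a)) * G (b + 1)"
      using prod.nat_diff_reindex[of "\<lambda>c. G (Suc c)" b] by (simp add: V_def Suc_diff_Suc)
    also have "(\<Prod>a<b. G (Suc b + a + 1)) = (\<Prod>a<b. G (a + b + 2))"
      by (simp add: add_ac)
    finally show ?thesis by (simp add: prod.distrib mult_ac)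
  qed
  have "(\<Prod>b<n. V (2 * b + 1)) = V n ^ n"
  proof (rule prod_odd_reflect)
    fix k assume "k \<le> 2 * n"
    then show "V k * V (2 * n - k) = V n * V n"
      using refl[of k] refl[of n] by (simp add: mult.commute)
  qed simp
  moreover have "(\<Prod>b<n. V (2 * b + 1)) = (\<Prod>b<n. \<Prod>a<b. G (b - a) * G (a + b + 2)) * V n"
    unfolding Vodd V_def[of n] by (rule prod.distrib)
  moreover have "V n ^ n = V n ^ (n - 1) * V n" using Suc by simp
  ultimately have "(\<Prod>b<n. \<Prod>a<b. G (b - a) * G (a + b + 2)) * V n = V n ^ (n - 1) * V n" by metis
  moreover have "V n \<noteq> 0" using nz by (auto simp: V_def)
  ultimately show ?thesis by (simp add: V_def)
qed simp

definition Theta :: "nat \<Rightarrow> 'a::field fls \<Rightarrow> 'a fls \<Rightarrow> 'a fls" where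
  "Theta n s P = (\<Prod>i<n. theta (s ^ (2 * (i + 1))) P) *
    (\<Prod>b<n. \<Prod>a<b. theta (s ^ (2 * (b - a))) (P\<^sup>2) * theta (s ^ (2 * (a + b + 2))) (P\<^sup>2))"

text \<open>The factor of proportionality between \<open>Dfun\<close> and \<open>Hfun\<close> as a
  function of the nome.\<close>

definition Cst :: "nat \<Rightarrow> 'a::field fls \<Rightarrow> 'a fls" where
  "Cst n P = qpoch_inf (P\<^sup>2) (P\<^sup>2) ^ (n - 1) * qpoch_inf P P"

context nome_n begin

text \<open>The point s^(b + 1) brings s^(-(b + 1)) from its own factor and s^(-2 (b + 1)) from each
  of the b pairs with a < b; together these monomials are \<open>mu\<close>.\<close>

lemma Hfun_powers: "Hfun n P (\<lambda>j. s ^ Suc j) = mu * Theta n s P"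
proof -
  have e: "(s ^ Suc a)\<^sup>2 * (s ^ Suc b)\<^sup>2 = s ^ (2 * (a + b + 2))" for a b
    by (simp add: power_mult[symmetric] power_add[symmetric] del: power_Suc)
  have e2: "(s ^ Suc b)\<^sup>2 / (s ^ Suc a)\<^sup>2 = s ^ (2 * (b - a))" if "a < b" for a b
  proof -
    have "(s ^ Suc b)\<^sup>2 = s ^ (2 * (b - a)) * (s ^ Suc a)\<^sup>2"
      using that by (simp add: power_mult[symmetric] power_add[symmetric] del: power_Suc)
    then show ?thesis using s_nonzero by simp
  qed
  have "Hfun n P (\<lambda>j. s ^ Suc j) = (\<Prod>j<n. (s ^ Suc j) powi (- 1) * theta ((s ^ Suc j)\<^sup>2) P) *
    (\<Prod>b<n. \<Prod>a<b. (s ^ Suc b) powi (- 2) * (theta (s ^ (2 * (b - a))) (P\<^sup>2) * theta (s ^ (2 * (a + b + 2))) (P\<^sup>2)))"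
    unfolding Hfun_def prod_less_pairs
  proof (intro arg_cong2[where f = "(*)"] refl prod.cong)
    fix a b assume "b \<in> {..<n}" "a \<in> {..<b}"
    then have "a < b" by simp
    show "pairf (P\<^sup>2) (s ^ Suc a) (s ^ Suc b) = (s ^ Suc b) powi (- 2) * (theta (s ^ (2 * (b - a))) (P\<^sup>2) * theta (s ^ (2 * (a + b + 2))) (P\<^sup>2))"
      unfolding pairf_def e e2[OF \<open>a < b\<close>] by (simp only: mult_ac)
  qed
  also have "\<dots> = (\<Prod>b<n. (s ^ Suc b) powi (- 1) * ((s ^ Suc b) powi (- 2)) ^ b) * Theta n s P"
    by (simp add: Theta_def prod.distrib mult_ac power_mult[symmetric] del: power_Suc)
  also have "(\<Prod>b<n. (s ^ Suc b) powi (- 1) * ((s ^ Suc b) powi (- 2)) ^ b) = mu"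
    unfolding mu_def
  proof (intro prod.cong refl)
    fix b
    have "(s ^ Suc b) powi k = s powi (int (Suc b) * k)" for k
      by (simp only: power_int_mult power_int_of_nat)
    moreover have "(s powi k) ^ b = s powi (k * int b)" for k
      by (simp only: power_int_mult power_int_of_nat)
    moreover have "int (Suc b) * (- 1) + int (Suc b) * (- 2) * int b = - ((2 * int b + 1) * (int b + 1))"
      by (simp add: algebra_simps)
    ultimately show "(s ^ Suc b) powi (- 1) * ((s ^ Suc b) powi (- 2)) ^ b = s powi (- ((2 * int b + 1) * (int b + 1)))"
      by (simp only: powi_add[symmetric])
  qed
  finally show ?thesis .
qed

text \<open>For nome s^(2 n + 1) the exponents 2 (i + 1) and their complements run through 1, ..., 2
  n once, so \<open>qpoch_inf_dissection\<close> yields (s; s). The pair factors give (q; q) in the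
  same way, n - 1 times by \<open>prod_pairs_symmetric\<close>.\<close>

lemma Theta_base: "Cst n (s ^ (2 * n + 1)) * Theta n s (s ^ (2 * n + 1)) = qpoch_inf q q ^ (n - 1) * qpoch_inf s s"
proof -
  define M where "M = 2 * n + 1"
  define P where "P = s ^ M"
  have sM: "vge 1 P" unfolding P_def by (rule vge_spow) (simp add: M_def)
  have P2: "P\<^sup>2 = q ^ M" by (simp add: P_def power_mult[symmetric] mult.commute)
  have th: "theta (z ^ a) (z ^ M) = qpoch_inf (z ^ a) (z ^ M) * qpoch_inf (z ^ (M - a)) (z ^ M)"
    if "z \<noteq> 0" "a \<le> M" for z :: "rat fls" and a
    using that by (simp add: theta_def power_diff)
  have A: "(\<Prod>i<n. theta (s ^ (2 * (i + 1))) P) * qpoch_inf P P = qpoch_inf s s"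
  proof -
    define F where "F a = qpoch_inf (s ^ a) (s ^ M)" for a
    have odd: "(\<Prod>i<n. F (M - 2 * (i + 1))) = (\<Prod>i<n. F (2 * i + 1))"
    proof -
      have "(\<Prod>i<n. F (M - 2 * (i + 1))) = (\<Prod>i<n. F (2 * (n - Suc i) + 1))"
        by (intro prod.cong refl arg_cong[where f = F]) (auto simp: M_def)
      also have "\<dots> = (\<Prod>i<n. F (2 * i + 1))" by (rule prod.nat_diff_reindex[where g = "\<lambda>i. F (2 * i + 1)"])
      finally show ?thesis .
    qed
    have all: "(\<Prod>a<2 * k. F (Suc a)) = (\<Prod>i<k. F (2 * i + 1) * F (2 * (i + 1)))" for k
      by (induction k) (simp_all add: mult_ac)
    have "(\<Prod>i<n. theta (s ^ (2 * (i + 1))) P) = (\<Prod>i<n. F (2 * (i + 1)) * F (M - 2 * (i + 1)))"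
      unfolding P_def F_def using s_nonzero by (intro prod.cong refl th) (auto simp: M_def)
    also have "\<dots> = (\<Prod>a<2 * n. F (Suc a))"
      unfolding all prod.distrib odd by (rule mult.commute)
    finally have "(\<Prod>i<n. theta (s ^ (2 * (i + 1))) P) * qpoch_inf P P = (\<Prod>a<M. F (Suc a))"
      by (simp add: M_def F_def P_def)
    also have "\<dots> = qpoch_inf s s" unfolding F_def by (rule qpoch_inf_dissection[OF vge_s]) (simp add: M_def)
    finally show ?thesis .
  qed
  have B: "(\<Prod>b<n. \<Prod>a<b. theta (s ^ (2 * (b - a))) (P\<^sup>2) * theta (s ^ (2 * (a + b + 2))) (P\<^sup>2)) * qpoch_inf (P\<^sup>2) (P\<^sup>2) ^ (n - 1)
    = qpoch_inf q q ^ (n - 1)"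
  proof -
    define F where "F a = qpoch_inf (q ^ a) (q ^ M)" for a
    define G where "G a = F a * F (M - a)" for a
    have tG: "theta (s ^ (2 * a)) (P\<^sup>2) = G a" if "a \<le> M" for a
      using th[of q a] that s_nonzero by (simp add: G_def F_def P2 power_mult)
    have qM: "vge 1 (q ^ M)" using sM vge_sq[OF sM] P2 by simp
    have Fnz: "F a \<noteq> 0" if "a \<ge> 1" for a
      unfolding F_def by (rule qpoch_inf_nonzero[OF qM]) (use vge_power[OF vge_q, of a] that in \<open>auto elim: vge_mono\<close>)
    have "(\<Prod>b<n. \<Prod>a<b. theta (s ^ (2 * (b - a))) (P\<^sup>2) * theta (s ^ (2 * (a + b + 2))) (P\<^sup>2)) = (\<Prod>b<n. \<Prod>a<b. G (b - a) * G (a + b + 2))"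
      by (intro prod.cong refl arg_cong2[where f = "(*)"] tG) (auto simp: M_def)
    also have "\<dots> = (\<Prod>c<n. G (c + 1)) ^ (n - 1)"
    proof (rule prod_pairs_symmetric)
      show "G (2 * n + 1 - a) = G a" if "1 \<le> a" "a \<le> 2 * n" for a
        using that by (simp add: G_def M_def mult.commute)
      show "G a \<noteq> 0" if "1 \<le> a" "a \<le> n" for a
        using that Fnz by (simp add: G_def M_def)
    qed
    also have "(\<Prod>c<n. G (c + 1)) = (\<Prod>c<2 * n. F (Suc c))"
    proof -
      have "(\<Prod>c<n. F (M - (c + 1))) = (\<Prod>c<n. F (n + Suc c))"
      proof -
        have "(\<Prod>c<n. F (M - (c + 1))) = (\<Prod>c<n. F (n + Suc (n - Suc c)))"
          by (intro prod.cong refl arg_cong[where f = F]) (auto simp: M_def)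
        also have "\<dots> = (\<Prod>c<n. F (n + Suc c))" by (rule prod.nat_diff_reindex[where g = "\<lambda>c. F (n + Suc c)"])
        finally show ?thesis .
      qed
      then have "(\<Prod>c<n. G (c + 1)) = (\<Prod>c<n. F (Suc c)) * (\<Prod>c<n. F (Suc (n + c)))"
        by (simp add: G_def prod.distrib)
      also have "\<dots> = (\<Prod>c<n + n. F (Suc c))" by (rule prod_lessThan_add[symmetric])
      finally show ?thesis by (simp only: mult_2)
    qed
    finally have "(\<Prod>b<n. \<Prod>a<b. theta (s ^ (2 * (b - a))) (P\<^sup>2) * theta (s ^ (2 * (a + b + 2))) (P\<^sup>2)) * qpoch_inf (P\<^sup>2) (P\<^sup>2) ^ (n - 1)
      = (\<Prod>a<M. F (Suc a)) ^ (n - 1)"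
      by (simp add: M_def F_def P2 power_mult_distrib[symmetric])
    also have "(\<Prod>a<M. F (Suc a)) = qpoch_inf q q" unfolding F_def by (rule qpoch_inf_dissection[OF vge_q]) (simp add: M_def)
    finally show ?thesis .
  qed
  show ?thesis
    unfolding M_def[symmetric] P_def[symmetric] Cst_def Theta_def A[symmetric] B[symmetric] by (simp only: mult_ac)
qed

text \<open>\<open>PhiSum\<close> converges along all N to the sum over partitions and along the
  multiples of 2 n to the lattice sum, so the two agree.\<close>

lemma has_sum_cc_Dfun:
  "((\<lambda>\<mu>. s ^ sum_list \<mu> * hall_littlewood_inf \<mu> (\<lambda>k. (s ^ 2) ^ k) ((s ^ 2) ^ (2 * n)))
     has_sum (cc * Dfun n (s ^ (m + 2 * n + 1)) (\<lambda>j. s ^ Suc j))) {\<mu>. is_partition \<mu> \<and> part \<mu> 0 \<le> m}"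
  and PhiSum_limit: "(\<lambda>L. PhiSum t xs (\<lambda>i. xs i ^ m) {..<2 * n * L}) \<longlonglongrightarrow> cc * Dfun n (s ^ (m + 2 * n + 1)) (\<lambda>j. s ^ Suc j)"
proof -
  let ?D = "Dfun n (s ^ (m + 2 * n + 1)) (\<lambda>j. s ^ Suc j)"
  obtain S where S: "((\<lambda>r. cc * (s powi ((int m + 2 * int n + 1) * Qf r) * Delta r)) has_sum S) (PiE {..<n} (\<lambda>_. UNIV))"
    "(\<lambda>L. PhiSum t xs (\<lambda>i. xs i ^ m) {..<2 * n * L}) \<longlonglongrightarrow> S"
    using PhiSum_tendsto by blast
  have e: "int (m + 2 * n + 1) = int m + 2 * int n + 1" by simp
  have "((\<lambda>r. s powi (int (m + 2 * n + 1) * Qf r) * Delta r) has_sum ?D) (PiE {..<n} (\<lambda>_. UNIV))"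
    by (rule Dfun_has_sum) simp
  then have "((\<lambda>r. s powi ((int m + 2 * int n + 1) * Qf r) * Delta r) has_sum ?D) (PiE {..<n} (\<lambda>_. UNIV))"
    unfolding e .
  then have "S = cc * ?D" using S(1) by (intro has_sum_unique[OF S(1)] has_sum_cmult_right)
  with S(2) show lim: "(\<lambda>L. PhiSum t xs (\<lambda>i. xs i ^ m) {..<2 * n * L}) \<longlonglongrightarrow> cc * ?D" by simp
  obtain T where T: "((\<lambda>\<mu>. s ^ sum_list \<mu> * hall_littlewood_inf \<mu> (\<lambda>k. (s ^ 2) ^ k) ((s ^ 2) ^ (2 * n))) has_sum T) {\<mu>. is_partition \<mu> \<and> part \<mu> 0 \<le> m}"
    "(\<lambda>N. PhiSum t xs (\<lambda>i. xs i ^ m) {..<N}) \<longlonglongrightarrow> T"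
    using sum_hall_littlewood_eq_limit[OF n_pos] by blast
  have "(\<lambda>L. PhiSum t xs (\<lambda>i. xs i ^ m) {..<2 * n * L}) \<longlonglongrightarrow> T"
    using LIMSEQ_subseq_LIMSEQ[OF T(2), of "\<lambda>L. 2 * n * L"] n_pos by (simp add: strict_mono_def o_def)
  with lim have "T = cc * ?D" by (metis LIMSEQ_unique)
  with T(1) show "((\<lambda>\<mu>. s ^ sum_list \<mu> * hall_littlewood_inf \<mu> (\<lambda>k. (s ^ 2) ^ k) ((s ^ 2) ^ (2 * n)))
     has_sum (cc * ?D)) {\<mu>. is_partition \<mu> \<and> part \<mu> 0 \<le> m}" by simp
qed

text \<open>For \<open>m = 0\<close> the bounded sum is \<open>1\<close>, which fixes the constant of proportionality.\<close>

lemma Dfun_base: "Dfun n (s ^ (2 * n + 1)) (\<lambda>j. s ^ Suc j) = Cst n (s ^ (2 * n + 1)) * Hfun n (s ^ (2 * n + 1)) (\<lambda>j. s ^ Suc j)"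
proof -
  have "PhiSum t xs (\<lambda>i. xs i ^ 0) {..<N} = 1" for N
    using PhiSum_one[of "{..<N}" xs t] generic_xs by simp
  then have "(\<lambda>L. 1) \<longlonglongrightarrow> cc * Dfun n (s ^ (0 + 2 * n + 1)) (\<lambda>j. s ^ Suc j)"
    using PhiSum_limit[of 0] by (simp only:)
  then have 1: "cc * Dfun n (s ^ (2 * n + 1)) (\<lambda>j. s ^ Suc j) = 1"
    using LIMSEQ_unique[OF tendsto_const[of 1]] unfolding add_0 by metis
  then have "cc \<noteq> 0" by auto
  with 1 have "Dfun n (s ^ (2 * n + 1)) (\<lambda>j. s ^ Suc j) = 1 / cc"
    by (metis mult.commute nonzero_eq_divide_eq)
  also have "\<dots> = mu * (qpoch_inf q q ^ (n - 1) * qpoch_inf s s)" by (simp add: cc_def mult.assoc)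
  finally show ?thesis unfolding Theta_base[symmetric] Hfun_powers by (simp only: mult_ac)
qed

end

section \<open>The constant of proportionality\<close>

lemma theta_nonzero:
  fixes p :: "'a::field fls"
  assumes p: "vge 1 p" "p \<noteq> 0" and z: "z \<noteq> 0" "\<And>k. z \<noteq> p powi k"
  shows "theta z p \<noteq> 0"
proof
  assume "theta z p = 0"
  then consider "qpoch_inf z p = 0" | "qpoch_inf (p / z) p = 0" by (auto simp: theta_def)
  then show False
  proof cases
    case 1
    then obtain k where "z * p ^ k = 1" unfolding qpoch_inf_eq_0_iff[OF p(1)] by blast
    then have "z = p powi (- int k)" using p(2) by (simp add: power_int_minus field_simps)
    then show False using z(2) by blast
  next
    case 2
    then obtain k where "p / z * p ^ k = 1" unfolding qpoch_inf_eq_0_iff[OF p(1)] by blast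
    then have "z = p ^ Suc k" using z(1) by (simp add: field_simps)
    then have "z = p powi int (Suc k)" by (simp only: power_int_of_nat)
    then show False using z(2) by blast
  qed
qed

lemma fls_monomial_eq_iff:
  fixes r :: "'a::field"
  assumes "r \<noteq> 0" "fls_const r * fls_X powi e = fls_X powi e'"
  shows "r = 1 \<and> e = e'"
proof -
  have X: "fls_X powi k \<noteq> (0 :: 'a fls)" for k by (simp add: power_int_eq_0_iff)
  have r: "fls_const r \<noteq> 0" using assms(1) by simp
  have "fls_subdegree (fls_const r * fls_X powi e) = e"
    using r X by (simp add: fls_subdegree_power_int)
  moreover have "fls_subdegree (fls_X powi e' :: 'a fls) = e'" by (simp add: fls_subdegree_power_int)
  ultimately have e: "e = e'" using assms(2) by simp
  with assms(2) have "fls_const r = 1" using X[of e'] by simp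
  then have "fls_nth (fls_const r) 0 = fls_nth 1 0" by simp
  then show ?thesis using e by simp
qed

lemma theta_monomial_nonzero:
  fixes r :: "'a::field"
  assumes N: "N \<ge> 1" and r: "r \<noteq> 0" and ne: "r \<noteq> 1 \<or> \<not> int N dvd e"
  shows "theta (fls_const r * fls_X powi e) (fls_X ^ N) \<noteq> 0"
proof (rule theta_nonzero)
  show "vge 1 (fls_X ^ N :: 'a fls)" using N by (simp add: vge_iff_subdegree)
  show "fls_const r * fls_X powi e \<noteq> 0" using r by (simp add: power_int_eq_0_iff)
  fix k
  show "fls_const r * fls_X powi e \<noteq> (fls_X ^ N) powi k"
  proof
    assume "fls_const r * fls_X powi e = (fls_X ^ N) powi k"
    also have "(fls_X ^ N) powi k = (fls_X powi (int N * k) :: 'a fls)" by (simp add: power_int_mult)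
    finally have "r = 1 \<and> e = int N * k" using r by (intro fls_monomial_eq_iff)
    then show False using ne by auto
  qed
qed simp

text \<open>A monomial r X^e is a power of the nome only if r = 1 and the exponent fits; each
  hypothesis rules out one of the two.\<close>

lemma admissible_monomials:
  fixes r :: "nat \<Rightarrow> 'a::field"
  assumes N: "N \<ge> 1" and r: "\<And>j. j < n \<Longrightarrow> r j \<noteq> 0"
    and 1: "\<And>j. j < n \<Longrightarrow> (r j)\<^sup>2 \<noteq> 1 \<or> \<not> int N dvd 2 * e j"
    and 2: "\<And>i j. i < n \<Longrightarrow> j < n \<Longrightarrow> i \<noteq> j \<Longrightarrow> (r i)\<^sup>2 * (r j)\<^sup>2 \<noteq> 1 \<or> \<not> int N dvd e i + e j"
    and 3: "\<And>i j. i < n \<Longrightarrow> j < n \<Longrightarrow> i \<noteq> j \<Longrightarrow> (r j)\<^sup>2 \<noteq> (r i)\<^sup>2 \<or> \<not> int N dvd e j - e i"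
  shows "admissible n (fls_X ^ N) (\<lambda>j. fls_const (r j) * fls_X powi e j)"
  unfolding admissible_def
proof (intro allI impI conjI)
  let ?x = "\<lambda>j. fls_const (r j) * fls_X powi e j :: 'a fls"
  have X: "fls_X powi k \<noteq> (0 :: 'a fls)" for k by (simp add: power_int_eq_0_iff)
  have nz: "?x j \<noteq> 0" if "j < n" for j using r that X by simp
  have sq: "(?x j)\<^sup>2 = fls_const ((r j)\<^sup>2) * fls_X powi (2 * e j)" for j
  proof -
    have "fls_X powi (2 * e j) = (fls_X powi e j * fls_X powi e j :: 'a fls)"
      unfolding mult_2 by (rule power_int_add) simp
    moreover have "fls_const ((r j)\<^sup>2) = fls_const (r j) * fls_const (r j)" by (simp add: power2_eq_square)
    ultimately show ?thesis by (simp only: power2_eq_square[of "?x j"] mult_ac)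
  qed
  fix j assume j: "j < n"
  show "?x j \<noteq> 0" by (rule nz[OF j])
  show "theta ((?x j)\<^sup>2) (fls_X ^ N) \<noteq> 0"
    unfolding sq using r 1 j by (intro theta_monomial_nonzero N) auto
  fix i assume i: "i < n" "i \<noteq> j"
  have dv: "int (2 * N) dvd 2 * a \<longleftrightarrow> int N dvd a" for a by simp
  have p: "(fls_X ^ N)\<^sup>2 = (fls_X :: 'a fls) ^ (2 * N)" by (simp add: power_mult[symmetric] mult.commute)
  have m: "(?x i)\<^sup>2 * (?x j)\<^sup>2 = fls_const ((r i)\<^sup>2 * (r j)\<^sup>2) * fls_X powi (2 * (e i + e j))"
  proof -
    have "fls_X powi (2 * (e i + e j)) = (fls_X powi (2 * e i) * fls_X powi (2 * e j) :: 'a fls)"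
      unfolding distrib_left by (rule power_int_add) simp
    then show ?thesis unfolding sq by (simp only: fls_const_mult_const[symmetric] mult_ac)
  qed
  have d: "(?x j)\<^sup>2 / (?x i)\<^sup>2 = fls_const ((r j)\<^sup>2 / (r i)\<^sup>2) * fls_X powi (2 * (e j - e i))"
  proof -
    have "fls_const ((r j)\<^sup>2 / (r i)\<^sup>2) * fls_X powi (2 * (e j - e i)) * (?x i)\<^sup>2
      = (fls_const ((r j)\<^sup>2 / (r i)\<^sup>2) * fls_const ((r i)\<^sup>2)) * (fls_X powi (2 * (e j - e i)) * fls_X powi (2 * e i))"
      unfolding sq by (simp only: mult_ac)
    also have "fls_const ((r j)\<^sup>2 / (r i)\<^sup>2) * fls_const ((r i)\<^sup>2) = fls_const ((r j)\<^sup>2)"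
      using r[OF i(1)] by (simp add: fls_const_mult_const)
    also have "fls_X powi (2 * (e j - e i)) * fls_X powi (2 * e i) = (fls_X powi (2 * (e j - e i) + 2 * e i) :: 'a fls)"
      by (rule power_int_add[symmetric]) simp
    also have "2 * (e j - e i) + 2 * e i = 2 * e j" by simp
    also have "fls_const ((r j)\<^sup>2) * fls_X powi (2 * e j) = (?x j)\<^sup>2" unfolding sq ..
    finally have e: "fls_const ((r j)\<^sup>2 / (r i)\<^sup>2) * fls_X powi (2 * (e j - e i)) * (?x i)\<^sup>2 = (?x j)\<^sup>2" .
    have "(?x i)\<^sup>2 \<noteq> 0" using nz[OF i(1)] by (rule power_not_zero)
    then show ?thesis using e by (metis nonzero_mult_div_cancel_right)
  qed
  have "theta ((?x i)\<^sup>2 * (?x j)\<^sup>2) ((fls_X ^ N)\<^sup>2) \<noteq> 0"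
    unfolding m p
  proof (rule theta_monomial_nonzero)
    show "(r i)\<^sup>2 * (r j)\<^sup>2 \<noteq> 1 \<or> \<not> int (2 * N) dvd 2 * (e i + e j)"
      unfolding dv by (rule 2[OF i(1) j i(2)])
  qed (use N r[OF i(1)] r[OF j] in simp_all)
  moreover have "theta ((?x j)\<^sup>2 / (?x i)\<^sup>2) ((fls_X ^ N)\<^sup>2) \<noteq> 0"
    unfolding d p
  proof (rule theta_monomial_nonzero)
    show "(r j)\<^sup>2 / (r i)\<^sup>2 \<noteq> 1 \<or> \<not> int (2 * N) dvd 2 * (e j - e i)"
      unfolding dv using 3[OF i(1) j i(2)] r[OF i(1)] by simp
  qed (use N r[OF i(1)] r[OF j] in simp_all)
  ultimately show "pairf ((fls_X ^ N)\<^sup>2) (?x i) (?x j) \<noteq> 0"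
    using nz[OF j] by (simp add: pairf_def power_int_eq_0_iff)
qed

text \<open>The point with constant coordinates \<open>j + 2\<close> is an intermediate stop between \<open>X\<^sup>a\<close> and \<open>X\<^sup>b\<close>: mixing
  powers of \<open>X\<^sup>a\<close> and \<open>X\<^sup>b\<close> directly may hit a zero of a theta function.\<close>

lemma admissible_mixed:
  fixes n N a :: nat
  assumes N: "N > 2 * a * n" and a: "a \<ge> 1" and n: "n \<ge> 1"
  shows "admissible n (fls_X ^ N) (\<lambda>j. if j < k then (fls_X ^ a) ^ Suc j else fls_const (of_nat (j + 2) :: rat))"
proof -
  define r :: "nat \<Rightarrow> rat" where "r j = (if j < k then 1 else of_nat (j + 2))" for j
  define e where "e j = (if j < k then int (a * Suc j) else 0)" for j
  \<comment> \<open>All exponents to be tested are at most 2 a n in absolute value, hence below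
    N.\<close>
  have small: "\<not> int N dvd x" if "x \<noteq> 0" "\<bar>x\<bar> \<le> 2 * int a * int n" for x
  proof
    assume "int N dvd x"
    then have "int N \<le> \<bar>x\<bar>" using that(1) by (simp add: zdvd_imp_le)
    moreover have "int (2 * a * n) < int N" using N by (simp only: of_nat_less_iff)
    ultimately show False using that(2) by simp
  qed
  have eb: "0 \<le> e j" "e j \<le> int a * int n" if "j < n" for j
  proof -
    have "a * Suc j \<le> a * n" using that by (intro mult_left_mono) auto
    then show "0 \<le> e j" "e j \<le> int a * int n" unfolding e_def of_nat_mult[symmetric] by (auto simp del: of_nat_mult)
  qed
  have r1: "(r j)\<^sup>2 = 1 \<longleftrightarrow> j < k" and rsq: "1 \<le> (r j)\<^sup>2" for j
  proof -
    have "1 < (2 + of_nat j :: rat)\<^sup>2" by (rule one_less_power) auto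
    then have "\<not> j < k \<Longrightarrow> 1 < (r j)\<^sup>2" unfolding r_def by (simp only: if_False of_nat_add of_nat_numeral add.commute)
    moreover have "j < k \<Longrightarrow> (r j)\<^sup>2 = 1" by (simp add: r_def)
    ultimately show "(r j)\<^sup>2 = 1 \<longleftrightarrow> j < k" "1 \<le> (r j)\<^sup>2" by fastforce+
  qed
  have epos: "e j > 0" if "j < k" for j using that a by (simp add: e_def del: of_nat_mult)
  have "admissible n (fls_X ^ N) (\<lambda>j. fls_const (r j) * fls_X powi e j)"
  proof (rule admissible_monomials)
    show "1 \<le> N" using N by simp
    show "r j \<noteq> 0" for j by (simp add: r_def del: of_nat_add)
    show "(r j)\<^sup>2 \<noteq> 1 \<or> \<not> int N dvd 2 * e j" if "j < n" for j
      using r1[of j] epos[of j] small[of "2 * e j"] eb[OF that] by (cases "j < k") auto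
    fix i j assume ij: "i < n" "j < n" "i \<noteq> j"
    show "(r i)\<^sup>2 * (r j)\<^sup>2 \<noteq> 1 \<or> \<not> int N dvd e i + e j"
    proof (cases "i < k \<and> j < k")
      case True
      then show ?thesis using epos[of i] epos[of j] small[of "e i + e j"] eb[OF ij(1)] eb[OF ij(2)] by simp
    next
      case False
      then have "1 < (r i)\<^sup>2 \<or> 1 < (r j)\<^sup>2" using r1 rsq by (metis order_le_imp_less_or_eq)
      then have "1 < (r i)\<^sup>2 * (r j)\<^sup>2" using rsq[of i] rsq[of j] by (metis less_1_mult mult_1 mult_1_right order_le_less)
      then show ?thesis by simp
    qed
    show "(r j)\<^sup>2 \<noteq> (r i)\<^sup>2 \<or> \<not> int N dvd e j - e i"
    proof (cases "i < k \<and> j < k")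
      case True
      then have "e j - e i = int a * (int j - int i)" by (simp add: e_def algebra_simps)
      then have "e j - e i \<noteq> 0" using ij(3) a by simp
      then show ?thesis using small[of "e j - e i"] eb[OF ij(1)] eb[OF ij(2)] by simp
    next
      case False
      show ?thesis
      proof (cases "i < k \<or> j < k")
        case True
        with False have "((r j)\<^sup>2 = 1) \<noteq> ((r i)\<^sup>2 = 1)" using r1 by blast
        then show ?thesis by auto
      next
        case F: False
        then have "r j \<noteq> r i" "0 \<le> r j" "0 \<le> r i" using ij(3) by (auto simp: r_def)
        then have "(r j)\<^sup>2 \<noteq> (r i)\<^sup>2" using power2_eq_iff_nonneg by blast
        then show ?thesis by simp
      qed
    qed
  qed
  also have "(\<lambda>j. fls_const (r j) * fls_X powi e j) = (\<lambda>j. if j < k then (fls_X ^ a) ^ Suc j else fls_const (of_nat (j + 2)))"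
  proof
    fix j
    have x: "fls_X powi int (a * Suc j) = ((fls_X ^ a) ^ Suc j :: rat fls)" by (simp only: power_int_of_nat power_mult)
    have c: "fls_const (1 :: rat) = 1" by simp
    show "fls_const (r j) * fls_X powi e j = (if j < k then (fls_X ^ a) ^ Suc j else fls_const (of_nat (j + 2)))"
    proof (cases "j < k")
      case True
      then show ?thesis by (simp only: r_def e_def if_True x c mult_1_left)
    next
      case False
      then show ?thesis by (simp only: r_def e_def if_False power_int_0_right mult_1_right)
    qed
  qed
  finally show ?thesis .
qed

lemma Dfun_Hfun_powers:
  fixes n N a b :: nat
  assumes "N > 2 * a * n" "a \<ge> 1" "N > 2 * b * n" "b \<ge> 1" and n: "n \<ge> 1"
  defines "P \<equiv> (fls_X :: rat fls) ^ N"
  shows "Dfun n P (\<lambda>j. (fls_X ^ a) ^ Suc j) * Hfun n P (\<lambda>j. (fls_X ^ b) ^ Suc j)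
    = Dfun n P (\<lambda>j. (fls_X ^ b) ^ Suc j) * Hfun n P (\<lambda>j. (fls_X ^ a) ^ Suc j)"
    and "Hfun n P (\<lambda>j. (fls_X ^ a) ^ Suc j) \<noteq> 0"
proof -
  have P: "P \<noteq> 0" "vge 1 P" using assms(1) by (simp_all add: P_def vge_iff_subdegree)
  let ?c = "\<lambda>j. fls_const (of_nat (j + 2) :: rat)"
  have ad: "admissible n P (\<lambda>j. if j < k then (fls_X ^ a') ^ Suc j else ?c j)" if "a' \<in> {a, b}" for a' k
    unfolding P_def using assms that by (intro admissible_mixed) auto
  have A: "Dfun n P (\<lambda>j. (fls_X ^ a) ^ Suc j) * Hfun n P ?c = Dfun n P ?c * Hfun n P (\<lambda>j. (fls_X ^ a) ^ Suc j)"
    by (rule Dfun_Hfun_ratio[OF P ad]) simp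
  have B: "Dfun n P (\<lambda>j. (fls_X ^ b) ^ Suc j) * Hfun n P ?c = Dfun n P ?c * Hfun n P (\<lambda>j. (fls_X ^ b) ^ Suc j)"
    by (rule Dfun_Hfun_ratio[OF P ad]) simp
  have nz: "Hfun n P ?c \<noteq> 0" using Hfun_nonzero[OF ad[of a 0]] by simp
  have "Hfun n P ?c * (Dfun n P (\<lambda>j. (fls_X ^ a) ^ Suc j) * Hfun n P (\<lambda>j. (fls_X ^ b) ^ Suc j))
    = (Dfun n P (\<lambda>j. (fls_X ^ a) ^ Suc j) * Hfun n P ?c) * Hfun n P (\<lambda>j. (fls_X ^ b) ^ Suc j)" by (simp only: mult_ac)
  also have "\<dots> = (Dfun n P ?c * Hfun n P (\<lambda>j. (fls_X ^ b) ^ Suc j)) * Hfun n P (\<lambda>j. (fls_X ^ a) ^ Suc j)"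
    unfolding A by (simp only: mult_ac)
  also have "\<dots> = Hfun n P ?c * (Dfun n P (\<lambda>j. (fls_X ^ b) ^ Suc j) * Hfun n P (\<lambda>j. (fls_X ^ a) ^ Suc j))"
    unfolding B[symmetric] by (simp only: mult_ac)
  finally show "Dfun n P (\<lambda>j. (fls_X ^ a) ^ Suc j) * Hfun n P (\<lambda>j. (fls_X ^ b) ^ Suc j)
    = Dfun n P (\<lambda>j. (fls_X ^ b) ^ Suc j) * Hfun n P (\<lambda>j. (fls_X ^ a) ^ Suc j)" using nz by simp
  have "admissible n P (\<lambda>j. if j < n then (fls_X ^ a) ^ Suc j else ?c j)" by (rule ad) simp
  then have "admissible n P (\<lambda>j. (fls_X ^ a) ^ Suc j)" by (simp add: admissible_def)
  then show "Hfun n P (\<lambda>j. (fls_X ^ a) ^ Suc j) \<noteq> 0" by (rule Hfun_nonzero)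
qed

lemma nome_X_power: "a \<ge> 1 \<Longrightarrow> n \<ge> 1 \<Longrightarrow> nome_n ((fls_X :: rat fls) ^ a) n"
  by unfold_locales (simp_all add: vge_iff_subdegree)

text \<open>The nome s^\<kappa> is also the (2 n + 1)-st power of X^\<kappa>, where
  \<open>Dfun_base\<close> applies. \<open>Dfun_Hfun_powers\<close> carries the factor from the
  powers of X^\<kappa> to those of s; here \<kappa> > 2 n keeps the points s^(j + 1) small against
  the nome.\<close>

lemma Dfun_eq_Cst_Hfun_power:
  fixes n \<kappa> :: nat
  assumes n: "n \<ge> 1" and \<kappa>: "\<kappa> > 2 * n"
  defines "s \<equiv> (fls_X :: rat fls) ^ (2 * n + 1)"
  shows "Dfun n (s ^ \<kappa>) (\<lambda>j. s ^ Suc j) = Cst n (s ^ \<kappa>) * Hfun n (s ^ \<kappa>) (\<lambda>j. s ^ Suc j)"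
proof -
  define N where "N = \<kappa> * (2 * n + 1)"
  let ?P = "(fls_X :: rat fls) ^ N"
  let ?s' = "(fls_X :: rat fls) ^ \<kappa>"
  have P: "s ^ \<kappa> = ?P" "?s' ^ (2 * n + 1) = ?P" by (simp_all only: s_def N_def power_mult[symmetric] mult.commute)
  interpret nome_n ?s' n by (rule nome_X_power) (use n \<kappa> in auto)
  have base: "Dfun n ?P (\<lambda>j. ?s' ^ Suc j) = Cst n ?P * Hfun n ?P (\<lambda>j. ?s' ^ Suc j)"
    using Dfun_base unfolding P .
  have 1: "2 * (2 * n + 1) * n < N" "2 * \<kappa> * n < N"
  proof -
    have "2 * (2 * n + 1) * n = (2 * n) * (2 * n + 1)" by simp
    also have "\<dots> < \<kappa> * (2 * n + 1)" using \<kappa> by (intro mult_strict_right_mono) auto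
    finally show "2 * (2 * n + 1) * n < N" by (simp only: N_def)
    have "2 * \<kappa> * n = \<kappa> * (2 * n)" by simp
    also have "\<dots> < \<kappa> * (2 * n + 1)" using \<kappa> by (intro mult_strict_left_mono) auto
    finally show "2 * \<kappa> * n < N" by (simp only: N_def)
  qed
  have "Dfun n ?P (\<lambda>j. s ^ Suc j) * Hfun n ?P (\<lambda>j. ?s' ^ Suc j) = Dfun n ?P (\<lambda>j. ?s' ^ Suc j) * Hfun n ?P (\<lambda>j. s ^ Suc j)"
    unfolding s_def by (rule Dfun_Hfun_powers(1)) (use 1 n \<kappa> in auto)
  also have "\<dots> = (Cst n ?P * Hfun n ?P (\<lambda>j. s ^ Suc j)) * Hfun n ?P (\<lambda>j. ?s' ^ Suc j)"
    unfolding base by (simp only: mult_ac)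
  finally have eq: "Dfun n ?P (\<lambda>j. s ^ Suc j) * Hfun n ?P (\<lambda>j. ?s' ^ Suc j) = (Cst n ?P * Hfun n ?P (\<lambda>j. s ^ Suc j)) * Hfun n ?P (\<lambda>j. ?s' ^ Suc j)" .
  have "Hfun n ?P (\<lambda>j. ?s' ^ Suc j) \<noteq> 0"
    by (rule Dfun_Hfun_powers(2)[of \<kappa> n N \<kappa>]) (use 1 n \<kappa> in auto)
  with eq show ?thesis unfolding P by simp
qed

section \<open>The substitution of X^d for X\<close>

lemma vge_compose_power:
  assumes "d \<ge> 1" "vge k f" "K \<le> int d * k"
  shows "vge K (fls_compose_power f d)"
  unfolding vge_def
proof (intro allI impI)
  fix i assume i: "i < K"
  show "fls_nth (fls_compose_power f d) i = 0"
  proof (cases "int d dvd i")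
    case True
    then obtain l where l: "i = int d * l" by (elim dvdE)
    then have "int d * l < int d * k" using i assms(3) by simp
    then have "l < k" using assms(1) by simp
    then show ?thesis using assms(1,2) l by (simp add: fls_nth_compose_power vge_def)
  qed (use assms(1) in \<open>simp add: fls_nth_compose_power\<close>)
qed

lemma tendsto_compose_power:
  fixes f :: "'b \<Rightarrow> 'a::field fls"
  assumes d: "d \<ge> 1" and f: "(f \<longlongrightarrow> l) F"
  shows "((\<lambda>x. fls_compose_power (f x) d) \<longlongrightarrow> fls_compose_power l d) F"
  unfolding tendsto_fls_iff
proof
  fix K
  have "eventually (\<lambda>x. vge (max 0 K) (f x - l)) F" using f unfolding tendsto_fls_iff by blast
  then show "eventually (\<lambda>x. vge K (fls_compose_power (f x) d - fls_compose_power l d)) F"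
  proof eventually_elim
    case (elim x)
    have "1 * max 0 K \<le> int d * max 0 K" using d by (intro mult_right_mono) auto
    then have "vge K (fls_compose_power (f x - l) d)"
      by (intro vge_compose_power[OF d elim]) simp
    then show ?case by simp
  qed
qed

lemma compose_power_sum: "fls_compose_power (\<Sum>x\<in>A. f x) d = (\<Sum>x\<in>A. fls_compose_power (f x) d)"
  by (induction A rule: infinite_finite_induct) auto

lemma has_sum_compose_power:
  fixes f :: "'b \<Rightarrow> 'a::field fls"
  assumes d: "d \<ge> 1" and f: "(f has_sum S) A"
  shows "((\<lambda>x. fls_compose_power (f x) d) has_sum fls_compose_power S d) A"
  using tendsto_compose_power[OF d f[unfolded has_sum_def]] by (simp add: has_sum_def compose_power_sum)

lemma compose_power_prod: "d \<ge> 1 \<Longrightarrow> fls_compose_power (\<Prod>x\<in>A. f x :: 'a::field fls) d = (\<Prod>x\<in>A. fls_compose_power (f x) d)"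
  by (induction A rule: infinite_finite_induct) auto

lemma compose_power_inj:
  assumes "d \<ge> 1" "fls_compose_power f d = fls_compose_power g d"
  shows "f = g"
proof (rule fls_eqI)
  fix i
  have "fls_nth (fls_compose_power f d) (int d * i) = fls_nth (fls_compose_power g d) (int d * i)" using assms(2) by simp
  then show "fls_nth f i = fls_nth g i" using assms(1) by (simp add: fls_nth_compose_power)
qed

lemma compose_power_divide:
  assumes d: "d \<ge> 1"
  shows "fls_compose_power (f / g :: 'a::field fls) d = fls_compose_power f d / fls_compose_power g d"
proof (cases "g = 0")
  case False
  then have "fls_compose_power g d \<noteq> 0" using compose_power_inj[OF d, of g 0] by auto
  moreover have "fls_compose_power (f / g) d * fls_compose_power g d = fls_compose_power f d"
    using False by (simp add: fls_compose_power_mult[symmetric])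
  ultimately show ?thesis by (simp add: nonzero_eq_divide_eq)
qed simp

lemma compose_power_powi:
  assumes d: "d \<ge> 1"
  shows "fls_compose_power ((f :: 'a::field fls) powi k) d = fls_compose_power f d powi k"
proof (cases "k \<ge> 0")
  case True
  then show ?thesis using d by (simp add: power_int_def fls_compose_power_power)
next
  case False
  then show ?thesis
    using compose_power_divide[OF d, of 1 "f ^ nat (- k)"] d by (simp add: power_int_def inverse_eq_divide power_one_over)
qed

lemma compose_power_qpoch_inf:
  fixes q z :: "'a::field fls"
  assumes d: "d \<ge> 1" and q: "vge 1 q"
  shows "fls_compose_power (qpoch_inf z q) d = qpoch_inf (fls_compose_power z d) (fls_compose_power q d)"
proof (rule LIMSEQ_unique)
  show "(\<lambda>N. fls_compose_power (qpoch z q N) d) \<longlonglongrightarrow> fls_compose_power (qpoch_inf z q) d"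
    by (intro tendsto_compose_power d qpoch_tendsto q)
  have "vge 1 (fls_compose_power q d)" using d by (intro vge_compose_power[OF d q]) simp
  then have "(\<lambda>N. qpoch (fls_compose_power z d) (fls_compose_power q d) N) \<longlonglongrightarrow> qpoch_inf (fls_compose_power z d) (fls_compose_power q d)"
    by (rule qpoch_tendsto)
  then show "(\<lambda>N. fls_compose_power (qpoch z q N) d) \<longlonglongrightarrow> qpoch_inf (fls_compose_power z d) (fls_compose_power q d)"
    using d by (simp add: qpoch_def compose_power_prod)
qed

lemma compose_power_theta:
  fixes q z :: "'a::field fls"
  assumes d: "d \<ge> 1" and q: "vge 1 q"
  shows "fls_compose_power (theta z q) d = theta (fls_compose_power z d) (fls_compose_power q d)"
  unfolding theta_def using d by (simp add: compose_power_qpoch_inf[OF d q] compose_power_divide[OF d])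

text \<open>The substitution X -> X^(2 n + 1) maps both sides to those of
  \<open>Dfun_eq_Cst_Hfun_power\<close>, and it is injective.\<close>

lemma Dfun_eq_Cst_Hfun:
  fixes n \<kappa> :: nat
  assumes n: "n \<ge> 1" and \<kappa>: "\<kappa> > 2 * n"
  defines "s \<equiv> (fls_X :: rat fls)"
  shows "Dfun n (s ^ \<kappa>) (\<lambda>j. s ^ Suc j) = Cst n (s ^ \<kappa>) * Hfun n (s ^ \<kappa>) (\<lambda>j. s ^ Suc j)"
proof -
  define d where "d = 2 * n + 1"
  have d: "d \<ge> 1" by (simp add: d_def)
  define \<sigma> where "\<sigma> f = fls_compose_power f d" for f :: "rat fls"
  define s' where "s' = s ^ d"
  interpret A: nome_n s n using nome_X_power[of 1 n] n by (simp add: s_def)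
  interpret B: nome_n s' n unfolding s'_def s_def by (rule nome_X_power) (use n d in auto)
  have \<sigma>s: "\<sigma> s = s'"
    using d by (simp add: \<sigma>_def s_def s'_def fls_X_power_conv_shift_1)
  have \<sigma>_simps: "\<sigma> (f * g) = \<sigma> f * \<sigma> g" "\<sigma> (f - g) = \<sigma> f - \<sigma> g" "\<sigma> (f + g) = \<sigma> f + \<sigma> g" "\<sigma> 1 = 1" "\<sigma> (f / g) = \<sigma> f / \<sigma> g"
    "\<sigma> (f ^ k) = \<sigma> f ^ k" "\<sigma> (f powi i) = \<sigma> f powi i" "\<sigma> (prod h A) = (\<Prod>x\<in>A. \<sigma> (h x))" for f g k i and h :: "'b \<Rightarrow> rat fls" and A
    using d by (simp_all add: \<sigma>_def compose_power_divide compose_power_powi compose_power_prod)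
  have vP: "vge 1 (s ^ \<kappa>)" "vge 1 ((s ^ \<kappa>)\<^sup>2)" using \<kappa> by (simp_all add: s_def vge_iff_subdegree fls_subdegree_pow)
  have \<sigma>_theta: "\<sigma> (theta z (s ^ \<kappa>)) = theta (\<sigma> z) (s' ^ \<kappa>)" "\<sigma> (theta z ((s ^ \<kappa>)\<^sup>2)) = theta (\<sigma> z) ((s' ^ \<kappa>)\<^sup>2)" for z
    using compose_power_theta[OF d vP(1), of z] compose_power_theta[OF d vP(2), of z] \<sigma>s \<sigma>_simps(6)
    unfolding \<sigma>_def[symmetric] by simp_all
  have \<sigma>_q: "\<sigma> (qpoch_inf z (s ^ \<kappa>)) = qpoch_inf (\<sigma> z) (s' ^ \<kappa>)" "\<sigma> (qpoch_inf z ((s ^ \<kappa>)\<^sup>2)) = qpoch_inf (\<sigma> z) ((s' ^ \<kappa>)\<^sup>2)" for z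
    using compose_power_qpoch_inf[OF d vP(1), of z] compose_power_qpoch_inf[OF d vP(2), of z] \<sigma>s \<sigma>_simps(6)
    unfolding \<sigma>_def[symmetric] by simp_all
  have C: "\<sigma> (Cst n (s ^ \<kappa>)) = Cst n (s' ^ \<kappa>)"
    by (simp add: Cst_def \<sigma>_simps \<sigma>_q \<sigma>s)
  have H: "\<sigma> (Hfun n (s ^ \<kappa>) (\<lambda>j. s ^ Suc j)) = Hfun n (s' ^ \<kappa>) (\<lambda>j. s' ^ Suc j)"
    unfolding Hfun_def pairf_def prod_less_pairs \<sigma>_simps \<sigma>_theta \<sigma>s ..
  have z: "\<sigma> (A.zv r i) = B.zv r i" for r i
    by (simp add: A.zv_def B.zv_def A.gexp_def B.gexp_def \<sigma>_simps \<sigma>s)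
  have D: "\<sigma> (A.Delta r) = B.Delta r" for r
    unfolding A.Delta_def B.Delta_def A.wv_def B.wv_def prod_less_pairs \<sigma>_simps z ..
  have \<kappa>1: "\<kappa> \<ge> 1" using \<kappa> by simp
  \<comment> \<open>The substitution commutes with infinite sums, so the determinant is transported
    through its lattice sum, whose terms are explicit.\<close>
  have "((\<lambda>r. \<sigma> (s powi (int \<kappa> * A.Qf r) * A.Delta r)) has_sum \<sigma> (Dfun n (s ^ \<kappa>) (\<lambda>j. s ^ Suc j))) (PiE {..<n} (\<lambda>_. UNIV))"
    unfolding \<sigma>_def by (rule has_sum_compose_power[OF d A.Dfun_has_sum[OF \<kappa>1]])
  then have "((\<lambda>r. s' powi (int \<kappa> * B.Qf r) * B.Delta r) has_sum \<sigma> (Dfun n (s ^ \<kappa>) (\<lambda>j. s ^ Suc j))) (PiE {..<n} (\<lambda>_. UNIV))"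
    by (simp only: \<sigma>_simps \<sigma>s D)
  then have "\<sigma> (Dfun n (s ^ \<kappa>) (\<lambda>j. s ^ Suc j)) = Dfun n (s' ^ \<kappa>) (\<lambda>j. s' ^ Suc j)"
    by (rule has_sum_unique[OF _ B.Dfun_has_sum[OF \<kappa>1]])
  also have "\<dots> = Cst n (s' ^ \<kappa>) * Hfun n (s' ^ \<kappa>) (\<lambda>j. s' ^ Suc j)"
    unfolding s'_def s_def d_def by (rule Dfun_eq_Cst_Hfun_power[OF n \<kappa>])
  also have "\<dots> = \<sigma> (Cst n (s ^ \<kappa>) * Hfun n (s ^ \<kappa>) (\<lambda>j. s ^ Suc j))" by (simp only: \<sigma>_simps C H)
  finally show ?thesis unfolding \<sigma>_def by (rule compose_power_inj[OF d])
qed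

theorem theorem1p3:
  fixes m n \<kappa> :: nat and s q :: "rat fls"
  assumes "m \<ge> 1" and "n \<ge> 1" and "\<kappa> = m + 2 * n + 1"
    and s: "s = fls_X" and q: "q = s ^ 2"
  shows "((\<lambda>\<mu>. s ^ sum_list \<mu> * hall_littlewood_inf \<mu> (\<lambda>k. q ^ k) (q ^ (2 * n)))
     has_sum
       (qpoch_inf (q ^ \<kappa>) (q ^ \<kappa>) ^ (n - 1) * qpoch_inf (s ^ \<kappa>) (s ^ \<kappa>)
         / (qpoch_inf q q ^ (n - 1) * qpoch_inf s s)
        * (\<Prod>i = 1..n. theta (q ^ i) (s ^ \<kappa>))
        * (\<Prod>(i, j)\<in>{(i, j). 1 \<le> i \<and> i < j \<and> j \<le> n}.
             theta (q ^ (j - i)) (q ^ \<kappa>) * theta (q ^ (i + j)) (q ^ \<kappa>))))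
     {\<mu>. is_partition \<mu> \<and> part \<mu> 0 \<le> m}"
proof -
  interpret nome_n s n using nome_X_power[of 1 n] assms by simp
  let ?P = "s ^ \<kappa>"
  have qk: "q ^ \<kappa> = ?P\<^sup>2" by (simp add: q power_mult[symmetric] mult.commute)
  have D: "Dfun n ?P (\<lambda>j. s ^ Suc j) = Cst n ?P * (mu * Theta n s ?P)"
  proof -
    have "Dfun n ?P (\<lambda>j. s ^ Suc j) = Cst n ?P * Hfun n ?P (\<lambda>j. s ^ Suc j)"
      unfolding s by (rule Dfun_eq_Cst_Hfun) (use assms in auto)
    then show ?thesis unfolding Hfun_powers .
  qed
  have p1: "(\<Prod>i = 1..n. theta (q ^ i) ?P) = (\<Prod>i<n. theta (s ^ (2 * (i + 1))) ?P)"
    by (rule prod.reindex_bij_witness[of _ "\<lambda>i. i + 1" "\<lambda>i. i - 1"]) (auto simp: q power_mult[symmetric])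
  have p2: "(\<Prod>(i, j)\<in>{(i, j). 1 \<le> i \<and> i < j \<and> j \<le> n}. theta (q ^ (j - i)) (q ^ \<kappa>) * theta (q ^ (i + j)) (q ^ \<kappa>))
    = (\<Prod>b<n. \<Prod>a<b. theta (s ^ (2 * (b - a))) (?P\<^sup>2) * theta (s ^ (2 * (a + b + 2))) (?P\<^sup>2))"
    unfolding qk prod_less_pairs[symmetric] q
    by (rule sym, rule prod.reindex_bij_witness[of _ "\<lambda>(i, j). (i - 1, j - 1)" "\<lambda>(a, b). (a + 1, b + 1)"])
      (auto simp: power_mult[symmetric] mult.commute[of \<kappa> 2])
  \<comment> \<open>The monomial \<open>mu\<close> from the Weyl denominator at r = 0 cancels
    against the one from \<open>Hfun_powers\<close>.\<close>
  have "cc * Dfun n (s ^ (m + 2 * n + 1)) (\<lambda>j. s ^ Suc j) = Cst n ?P * Theta n s ?P / (qpoch_inf q q ^ (n - 1) * qpoch_inf s s)"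
    using mu_nonzero unfolding assms(3)[symmetric] D cc_def by (simp add: q)
  also have "\<dots> = qpoch_inf (q ^ \<kappa>) (q ^ \<kappa>) ^ (n - 1) * qpoch_inf (s ^ \<kappa>) (s ^ \<kappa>)
         / (qpoch_inf q q ^ (n - 1) * qpoch_inf s s)
        * (\<Prod>i = 1..n. theta (q ^ i) (s ^ \<kappa>))
        * (\<Prod>(i, j)\<in>{(i, j). 1 \<le> i \<and> i < j \<and> j \<le> n}.
             theta (q ^ (j - i)) (q ^ \<kappa>) * theta (q ^ (i + j)) (q ^ \<kappa>))"
    unfolding p1 p2 unfolding qk Cst_def Theta_def by simp
  finally show ?thesis using has_sum_cc_Dfun[of m] by (simp only: q)
qed

end
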